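(* Let $t<T$, and let $\{\phi_j\}_{j=0}^{\infty}$ be either the complete orthonormal system of Legendre polynomials or the complete orthonormal trigonometric system in $L_2([t,T])$. Let $i_1,i_2,i_3,i_4\in\{0,1,\ldots,m\}$. Then for the iterated Stratonovich stochastic integral $$I^{*(i_1i_2i_3i_4)}_{T,t}=\int_t^{*T}\int_t^{*t_4}\int_t^{*t_3}\int_t^{*t_2}d\mathbf{w}^{(i_1)}_{t_1}\,d\mathbf{w}^{(i_2)}_{t_2}\,d\mathbf{w}^{(i_3)}_{t_3}\,d\mathbf{w}^{(i_4)}_{t_4}$$ the following expansion converging in the mean-square sense holds: $$I^{*(i_1i_2i_3i_4)}_{T,t}=\operatorname*{l.i.m.}_{p\to\infty}\sum_{j_1,j_2,j_3,j_4=0}^{p}C_{j_4j_3j_2j_1}\,\zeta^{(i_1)}_{j_1}\zeta^{(i_2)}_{j_2}\zeta^{(i_3)}_{j_3}\zeta^{(i_4)}_{j_4},$$ where $$C_{j_4j_3j_2j_1}=\int_t^T\phi_{j_4}(s_4)\int_t^{s_4}\phi_{j_3}(s_3)\int_t^{s_3}\phi_{j_2}(s_2)\int_t^{s_2}\phi_{j_1}(s_1)\,ds_1\,ds_2\,ds_3\,ds_4,\qquad \zeta^{(i)}_j=\int_t^T\phi_j(s)\,d\mathbf{w}^{(i)}_s .$$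
   Context: $(\Omega,\mathrm{F},\mathsf{P})$ is a complete probability space with a nondecreasing right-continuous filtration $\{\mathrm{F}_s\}$, and $\mathbf{f}_s=(\mathbf{f}^{(1)}_s,\ldots,\mathbf{f}^{(m)}_s)$ is a standard $m$-dimensional Wiener process adapted to it with independent components. Set $\mathbf{w}^{(i)}_s=\mathbf{f}^{(i)}_s$ for $i=1,\ldots,m$ and $\mathbf{w}^{(0)}_s=s$ (so integration against $d\mathbf{w}^{(0)}$ is ordinary Lebesgue integration). $\int^{*}$ denotes the Stratonovich stochastic integral, and $\operatorname{l.i.m.}$ denotes the limit in the mean-square sense. For $i\neq0$, the $\zeta^{(i)}_j$ are independent standard Gaussian random variables for distinct $i$ or $j$. The Legendre system on $[t,T]$ is $\phi_j(x)=\sqrt{\frac{2j+1}{T-t}}\,P_j\!\left(\left(x-\frac{T+t}{2}\right)\frac{2}{T-t}\right)$, $j\ge0$, with $P_j$ the Legendre polynomial of degree $j$; the trigonometric system is $\phi_0(x)=\frac{1}{\sqrt{T-t}}$, $\phi_{2r-1}(x)=\sqrt{\frac{2}{T-t}}\sin\frac{2\pi r(x-t)}{T-t}$, $\phi_{2r}(x)=\sqrt{\frac{2}{T-t}}\cos\frac{2\pi r(x-t)}{T-t}$, $r\ge1$. *)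

theory Defs
  imports "HOL-Probability.Probability"
begin

fun legendreP :: "nat \<Rightarrow> real \<Rightarrow> real" where
  "legendreP 0 x = 1"
| "legendreP (Suc 0) x = x"
| "legendreP (Suc (Suc n)) x =
     ((2 * real n + 3) * x * legendreP (Suc n) x - (real n + 1) * legendreP n x) / (real n + 2)"

definition legendre_sys :: "real \<Rightarrow> real \<Rightarrow> nat \<Rightarrow> real \<Rightarrow> real" where
  "legendre_sys t T j x =
     sqrt ((2 * real j + 1) / (T - t)) * legendreP j ((x - (T + t) / 2) * (2 / (T - t)))"

definition trig_sys :: "real \<Rightarrow> real \<Rightarrow> nat \<Rightarrow> real \<Rightarrow> real" where
  "trig_sys t T j x =
     (if j = 0 then 1 / sqrt (T - t)
      else if odd j then sqrt (2 / (T - t)) * sin (2 * pi * real ((j + 1) div 2) * (x - t) / (T - t))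
      else sqrt (2 / (T - t)) * cos (2 * pi * real (j div 2) * (x - t) / (T - t)))"

definition std_wiener ::
  "'a measure \<Rightarrow> (real \<Rightarrow> 'a measure) \<Rightarrow> nat \<Rightarrow> (nat \<Rightarrow> real \<Rightarrow> 'a \<Rightarrow> real) \<Rightarrow> bool" where
  "std_wiener M F m W \<longleftrightarrow>
     prob_space M
   \<and> (\<forall>A \<in> null_sets M. \<forall>B. B \<subseteq> A \<longrightarrow> B \<in> sets M)
   \<and> (\<forall>s. subalgebra M (F s))
   \<and> (\<forall>s u. s \<le> u \<longrightarrow> sets (F s) \<subseteq> sets (F u))
   \<and> (\<forall>s. sets (F s) = (\<Inter>u\<in>{s<..}. sets (F u)))
   \<and> (\<forall>i\<in>{1..m}. \<forall>s\<ge>0. W i s \<in> borel_measurable (F s))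
   \<and> (\<forall>i\<in>{1..m}. \<forall>\<omega>\<in>space M. W i 0 \<omega> = 0 \<and> continuous_on {0..} (\<lambda>s. W i s \<omega>))
   \<and> (\<forall>s u. 0 \<le> s \<longrightarrow> s < u \<longrightarrow>
        (\<forall>i\<in>{1..m}. distributed M lborel (\<lambda>\<omega>. W i u \<omega> - W i s \<omega>)
                                       (\<lambda>x. ennreal (normal_density 0 (sqrt (u - s)) x)))
      \<and> (\<forall>A\<in>sets (F s). prob_space.indep_vars M (\<lambda>_. borel)
            (\<lambda>k \<omega>. if k = 0 then indicator A \<omega> else W k u \<omega> - W k s \<omega>) {0..m}))"

definition wproc :: "(nat \<Rightarrow> real \<Rightarrow> 'a \<Rightarrow> real) \<Rightarrow> nat \<Rightarrow> real \<Rightarrow> 'a \<Rightarrow> real" where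
  "wproc W i = (if i = 0 then (\<lambda>s \<omega>. s) else W i)"

definition ms_lim :: "'a measure \<Rightarrow> (nat \<Rightarrow> 'a \<Rightarrow> real) \<Rightarrow> ('a \<Rightarrow> real) \<Rightarrow> bool" where
  "ms_lim M X Y \<longleftrightarrow> Y \<in> borel_measurable M
     \<and> (\<forall>p. integrable M (\<lambda>\<omega>. (X p \<omega> - Y \<omega>)\<^sup>2))
     \<and> ((\<lambda>p. LINT \<omega>|M. (X p \<omega> - Y \<omega>)\<^sup>2) \<longlonglongrightarrow> 0)"

definition partition_seq :: "real \<Rightarrow> real \<Rightarrow> (nat \<Rightarrow> nat) \<Rightarrow> (nat \<Rightarrow> nat \<Rightarrow> real) \<Rightarrow> bool" where
  "partition_seq a b N \<tau> \<longleftrightarrow>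
     (\<forall>k. 0 < N k \<and> \<tau> k 0 = a \<and> \<tau> k (N k) = b \<and> (\<forall>n < N k. \<tau> k n < \<tau> k (Suc n)))
   \<and> ((\<lambda>k. Max ((\<lambda>n. \<tau> k (Suc n) - \<tau> k n) ` {..<N k})) \<longlonglongrightarrow> 0)"

definition strat_int ::
  "'a measure \<Rightarrow> (real \<Rightarrow> 'a \<Rightarrow> real) \<Rightarrow> (real \<Rightarrow> 'a \<Rightarrow> real) \<Rightarrow> real \<Rightarrow> real \<Rightarrow> ('a \<Rightarrow> real) \<Rightarrow> bool" where
  "strat_int M X w a b Y \<longleftrightarrow>
     (a = b \<and> Y \<in> borel_measurable M \<and> (AE \<omega> in M. Y \<omega> = 0))
   \<or> (a < b \<and> (\<forall>N \<tau>. partition_seq a b N \<tau> \<longrightarrow>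
        ms_lim M (\<lambda>k \<omega>. \<Sum>n<N k. (X (\<tau> k n) \<omega> + X (\<tau> k (Suc n)) \<omega>) / 2
                                * (w (\<tau> k (Suc n)) \<omega> - w (\<tau> k n) \<omega>)) Y))"

definition ito_int ::
  "'a measure \<Rightarrow> (real \<Rightarrow> 'a \<Rightarrow> real) \<Rightarrow> (real \<Rightarrow> 'a \<Rightarrow> real) \<Rightarrow> real \<Rightarrow> real \<Rightarrow> ('a \<Rightarrow> real) \<Rightarrow> bool" where
  "ito_int M X w a b Y \<longleftrightarrow> a < b \<and> (\<forall>N \<tau>. partition_seq a b N \<tau> \<longrightarrow>
        ms_lim M (\<lambda>k \<omega>. \<Sum>n<N k. X (\<tau> k n) \<omega> * (w (\<tau> k (Suc n)) \<omega> - w (\<tau> k n) \<omega>)) Y)"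

definition coefC :: "(nat \<Rightarrow> real \<Rightarrow> real) \<Rightarrow> real \<Rightarrow> real \<Rightarrow> nat \<Rightarrow> nat \<Rightarrow> nat \<Rightarrow> nat \<Rightarrow> real" where
  "coefC \<phi> t T j4 j3 j2 j1 =
     integral {t..T} (\<lambda>s4. \<phi> j4 s4 *
       integral {t..s4} (\<lambda>s3. \<phi> j3 s3 *
         integral {t..s3} (\<lambda>s2. \<phi> j2 s2 *
           integral {t..s2} (\<lambda>s1. \<phi> j1 s1))))"

end

theory Submission
  imports Defs "HOL-Combinatorics.Multiset_Permutations"
begin

text \<open>Replacing the Stratonovich integrals by trapezoidal sums on nested uniform grids turns the iterated
  integral into a quadruple form in the increments of the \<open>w\<close>'s whose kernel is the indicator of
  the simplex, with the value \<open>1/2\<close> on ties. The partial sum of the expansion is the form with kernel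
  \<open>\<Sum> C \<psi> \<psi> \<psi> \<psi>\<close>, the truncated Fourier series of the same indicator. Expanding a quadruple form
  in Hermite polynomials bounds its second moment, uniformly in the mesh, by the squared norms of the kernel
  and of all its contractions along one or two pairs of arguments. It remains to see that these vanish
  asymptotically for the remainder of the Fourier series. For the kernel itself and for single contractions
  this is Parseval's identity. The three double contractions are sums of coefficients
  \<open>C\<close> with two pairs of equal indices; shuffle relations between iterated integrals express three independent
  linear combinations of them through quantities that are explicit or whose limits Parseval's identity gives,
  and there the fact that \<open>\<psi> 0\<close> is constant is used. The only other properties of the basis that enter are orthonormality
  and completeness.\<close>

section \<open>Hermite polynomials and Gaussian increments\<close>

text \<open>A contraction integrates a kernel over a diagonal, a null set, and is therefore not
  controlled by the L2 norm: a Fourier series may converge in L2 while its contractions converge to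
  something else. So completeness of the basis does not settle the theorem by itself. What has to be
  seen is that the contracted series reproduces the value 1/2 on ties, which is the difference
  between trapezoidal and Ito sums. For a single contraction this is checked with the two free
  arguments held fixed; a double contraction leaves no argument to fix, and the algebraic relations
  take over.

  The second obstacle is that the integrals are given only by their defining mean-square limits, and
  an outer sum contains values of an inner integral that is itself such a limit. Hence
  \<open>p\<close> stays fixed while the meshes tend to zero, the innermost first. Products do not
  behave well under mean-square limits; each passage uses an almost surely convergent subsequence,
  and Fatou's lemma preserves the second moment bound. Only then does \<open>p\<close> tend to
  infinity.\<close>

fun hermite :: "nat \<Rightarrow> real \<Rightarrow> real" where
  "hermite 0 x = 1"
| "hermite (Suc 0) x = x"
| "hermite (Suc (Suc n)) x = x * hermite (Suc n) x - real (Suc n) * hermite n x"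

lemma hermite_measurable [measurable]: "hermite n \<in> borel_measurable borel"
  by (induction n rule: induct_nat_012) (auto simp: hermite.simps[abs_def])

text \<open>Lets a product of increments be expanded one factor at a time. At \<open>n = 0\<close>
  the truncated predecessor comes with the factor 0.\<close>

lemma mult_hermite: "x * hermite n x = hermite (Suc n) x + real n * hermite (n - 1) x"
  by (cases n) auto

text \<open>Degree 8 covers products of two Hermite polynomials of degree at most 4. Odd moments
  vanish, the even ones are 1, 1, 3, 15, 105.\<close>

lemma std_normal_polynomial:
  "has_bochner_integral lborel (\<lambda>x. std_normal_density x *
      (c0 + c1 * x + c2 * x^2 + c3 * x^3 + c4 * x^4 + c5 * x^5 + c6 * x^6 + c7 * x^7 + c8 * x^8))
    (c0 + c2 + 3 * c4 + 15 * c6 + 105 * c8)"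
proof -
  have e: "has_bochner_integral lborel (\<lambda>x. c * (std_normal_density x * x ^ (2 * k))) (c * (fact (2 * k) / (2^k * fact k)))" for c k
    by (intro has_bochner_integral_mult_right std_normal_moment_even)
  have o: "has_bochner_integral lborel (\<lambda>x. c * (std_normal_density x * x ^ (2 * k + 1))) (c * 0)" for c k
    by (intro has_bochner_integral_mult_right std_normal_moment_odd)
  note * = has_bochner_integral_add[OF e[of c0 0] has_bochner_integral_add[OF o[of c1 0]
    has_bochner_integral_add[OF e[of c2 1] has_bochner_integral_add[OF o[of c3 1]
    has_bochner_integral_add[OF e[of c4 2] has_bochner_integral_add[OF o[of c5 2]
    has_bochner_integral_add[OF e[of c6 3] has_bochner_integral_add[OF o[of c7 3] e[of c8 4]]]]]]]]]
  have "fact 2 = (2::real)" "fact 4 = (24::real)" "fact 6 = (720::real)" "fact 8 = (40320::real)" "fact 3 = (6::real)"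
    by (simp_all add: fact_numeral)
  then have v: "c0 * (fact (2 * 0) / (2^0 * fact 0)) + (c1 * 0 + (c2 * (fact (2 * 1) / (2^1 * fact 1)) + (c3 * 0 +
      (c4 * (fact (2 * 2) / (2^2 * fact 2)) + (c5 * 0 + (c6 * (fact (2 * 3) / (2^3 * fact 3)) + (c7 * 0 +
      c8 * (fact (2 * 4) / (2^4 * fact 4))))))))) = c0 + c2 + 3 * c4 + 15 * c6 + 105 * c8"
    by simp
  have f: "std_normal_density x * (c0 + c1 * x + c2 * x^2 + c3 * x^3 + c4 * x^4 + c5 * x^5 + c6 * x^6 + c7 * x^7 + c8 * x^8) =
    c0 * (std_normal_density x * x ^ (2 * 0)) + (c1 * (std_normal_density x * x ^ (2 * 0 + 1)) +
    (c2 * (std_normal_density x * x ^ (2 * 1)) + (c3 * (std_normal_density x * x ^ (2 * 1 + 1)) +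
    (c4 * (std_normal_density x * x ^ (2 * 2)) + (c5 * (std_normal_density x * x ^ (2 * 2 + 1)) +
    (c6 * (std_normal_density x * x ^ (2 * 3)) + (c7 * (std_normal_density x * x ^ (2 * 3 + 1)) +
    c8 * (std_normal_density x * x ^ (2 * 4)))))))))" for x
    by (simp add: distrib_left mult.left_commute)
  show ?thesis
    using * unfolding v f .
qed

text \<open>Probabilists' normalisation, with squared norm \<open>fact n\<close> for the standard
  normal density. The cap 4 is the number of factors in the iterated integral; up to symmetry it
  leaves fifteen moment computations.\<close>

lemma hermite_orthogonal:
  assumes "n \<le> 4" "k \<le> 4"
  shows "has_bochner_integral lborel (\<lambda>x. std_normal_density x * (hermite n x * hermite k x))
    (if n = k then fact n else 0)"
proof -
  have hermite: "hermite 0 x = 1" "hermite 1 x = x" "hermite 2 x = x^2 - 1" "hermite 3 x = x^3 - 3 * x" "hermite 4 x = x^4 - 6 * x^2 + 3" for x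
    by (simp_all add: eval_nat_numeral algebra_simps)
  have f: "fact 0 = (1::real)" "fact 1 = (1::real)" "fact 2 = (2::real)" "fact 3 = (6::real)" "fact 4 = (24::real)"
    by (simp_all add: fact_numeral)
  \<comment> \<open>\<open>ca\<close> to \<open>ci\<close> are the coefficients of the product
    polynomial in ascending powers, so each case below is one polynomial identity and one numerical
    check.\<close>
  have key: "has_bochner_integral lborel (\<lambda>x. std_normal_density x * (p x * q x)) v"
    if "\<And>x. p x * q x = ca + cb * x + cc * x^2 + cd * x^3 + ce * x^4 + cf * x^5 + cg * x^6 + ch * x^7 + ci * x^8"
      "v = ca + cc + 3 * ce + 15 * cg + 105 * ci" for p q :: "real \<Rightarrow> real" and v ca cb cc cd ce cf cg ch ci
    using std_normal_polynomial[of ca cb cc cd ce cf cg ch ci] that by simp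
  have b00: "has_bochner_integral lborel (\<lambda>x. std_normal_density x * (hermite 0 x * hermite 0 x)) 1"
    by (rule key[where ca = "1" and cb = "0" and cc = "0" and cd = "0" and ce = "0" and cf = "0" and cg = "0" and ch = "0" and ci = "0"]) (unfold hermite, algebra, simp)
  have b01: "has_bochner_integral lborel (\<lambda>x. std_normal_density x * (hermite 0 x * hermite 1 x)) 0"
    by (rule key[where ca = "0" and cb = "1" and cc = "0" and cd = "0" and ce = "0" and cf = "0" and cg = "0" and ch = "0" and ci = "0"]) (unfold hermite, algebra, simp)
  have b02: "has_bochner_integral lborel (\<lambda>x. std_normal_density x * (hermite 0 x * hermite 2 x)) 0"
    by (rule key[where ca = "-1" and cb = "0" and cc = "1" and cd = "0" and ce = "0" and cf = "0" and cg = "0" and ch = "0" and ci = "0"]) (unfold hermite, algebra, simp)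
  have b03: "has_bochner_integral lborel (\<lambda>x. std_normal_density x * (hermite 0 x * hermite 3 x)) 0"
    by (rule key[where ca = "0" and cb = "-3" and cc = "0" and cd = "1" and ce = "0" and cf = "0" and cg = "0" and ch = "0" and ci = "0"]) (unfold hermite, algebra, simp)
  have b04: "has_bochner_integral lborel (\<lambda>x. std_normal_density x * (hermite 0 x * hermite 4 x)) 0"
    by (rule key[where ca = "3" and cb = "0" and cc = "-6" and cd = "0" and ce = "1" and cf = "0" and cg = "0" and ch = "0" and ci = "0"]) (unfold hermite, algebra, simp)
  have b11: "has_bochner_integral lborel (\<lambda>x. std_normal_density x * (hermite 1 x * hermite 1 x)) 1"
    by (rule key[where ca = "0" and cb = "0" and cc = "1" and cd = "0" and ce = "0" and cf = "0" and cg = "0" and ch = "0" and ci = "0"]) (unfold hermite, algebra, simp)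
  have b12: "has_bochner_integral lborel (\<lambda>x. std_normal_density x * (hermite 1 x * hermite 2 x)) 0"
    by (rule key[where ca = "0" and cb = "-1" and cc = "0" and cd = "1" and ce = "0" and cf = "0" and cg = "0" and ch = "0" and ci = "0"]) (unfold hermite, algebra, simp)
  have b13: "has_bochner_integral lborel (\<lambda>x. std_normal_density x * (hermite 1 x * hermite 3 x)) 0"
    by (rule key[where ca = "0" and cb = "0" and cc = "-3" and cd = "0" and ce = "1" and cf = "0" and cg = "0" and ch = "0" and ci = "0"]) (unfold hermite, algebra, simp)
  have b14: "has_bochner_integral lborel (\<lambda>x. std_normal_density x * (hermite 1 x * hermite 4 x)) 0"
    by (rule key[where ca = "0" and cb = "3" and cc = "0" and cd = "-6" and ce = "0" and cf = "1" and cg = "0" and ch = "0" and ci = "0"]) (unfold hermite, algebra, simp)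
  have b22: "has_bochner_integral lborel (\<lambda>x. std_normal_density x * (hermite 2 x * hermite 2 x)) 2"
    by (rule key[where ca = "1" and cb = "0" and cc = "-2" and cd = "0" and ce = "1" and cf = "0" and cg = "0" and ch = "0" and ci = "0"]) (unfold hermite, algebra, simp)
  have b23: "has_bochner_integral lborel (\<lambda>x. std_normal_density x * (hermite 2 x * hermite 3 x)) 0"
    by (rule key[where ca = "0" and cb = "3" and cc = "0" and cd = "-4" and ce = "0" and cf = "1" and cg = "0" and ch = "0" and ci = "0"]) (unfold hermite, algebra, simp)
  have b24: "has_bochner_integral lborel (\<lambda>x. std_normal_density x * (hermite 2 x * hermite 4 x)) 0"
    by (rule key[where ca = "-3" and cb = "0" and cc = "9" and cd = "0" and ce = "-7" and cf = "0" and cg = "1" and ch = "0" and ci = "0"]) (unfold hermite, algebra, simp)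
  have b33: "has_bochner_integral lborel (\<lambda>x. std_normal_density x * (hermite 3 x * hermite 3 x)) 6"
    by (rule key[where ca = "0" and cb = "0" and cc = "9" and cd = "0" and ce = "-6" and cf = "0" and cg = "1" and ch = "0" and ci = "0"]) (unfold hermite, algebra, simp)
  have b34: "has_bochner_integral lborel (\<lambda>x. std_normal_density x * (hermite 3 x * hermite 4 x)) 0"
    by (rule key[where ca = "0" and cb = "-9" and cc = "0" and cd = "21" and ce = "0" and cf = "-9" and cg = "0" and ch = "1" and ci = "0"]) (unfold hermite, algebra, simp)
  have b44: "has_bochner_integral lborel (\<lambda>x. std_normal_density x * (hermite 4 x * hermite 4 x)) 24"
    by (rule key[where ca = "9" and cb = "0" and cc = "-36" and cd = "0" and ce = "42" and cf = "0" and cg = "-12" and ch = "0" and ci = "1"]) (unfold hermite, algebra, simp)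
  note b = b00 b01 b02 b03 b04 b11 b12 b13 b14 b22 b23 b24 b33 b34 b44
  have b': "has_bochner_integral lborel (\<lambda>x. std_normal_density x * (hermite i x * hermite j x)) (if i = j then fact i else 0)"
    if "i \<le> j" "j \<le> 4" for i j
  proof -
    from that have "j \<in> {0,1,2,3,4}" "i \<in> {0,1,2,3,4}" by auto
    then show ?thesis
      using \<open>i \<le> j\<close>
      by (elim insertE emptyE; hypsubst; simp only: f zero_neq_numeral numeral_eq_iff one_eq_numeral_iff
          if_False if_True refl b zero_neq_one num.inject num.distinct simp_thms; simp)
  qed
  show ?thesis
  proof (cases "n \<le> k")
    case True
    then show ?thesis using b'[of n k] assms by simp
  next
    case False
    have eq: "(\<lambda>x. std_normal_density x * (hermite n x * hermite k x)) = (\<lambda>x. std_normal_density x * (hermite k x * hermite n x))"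
      by (simp add: mult.commute mult.left_commute)
    from False show ?thesis using b'[of k n] assms unfolding eq by simp
  qed
qed

section \<open>Independence of normalised increments on a uniform grid\<close>

locale wiener_grid = prob_space M for M :: "'a measure" +
  fixes F :: "real \<Rightarrow> 'a measure" and m :: nat and W :: "nat \<Rightarrow> real \<Rightarrow> 'a \<Rightarrow> real"
    and t \<delta> :: real
  assumes wiener: "std_wiener M F m W" and t: "0 \<le> t" and \<delta>: "0 < \<delta>"
begin

definition \<xi> :: "nat \<Rightarrow> nat \<Rightarrow> 'a \<Rightarrow> real" where
  "\<xi> i a \<omega> = (W i (t + real (Suc a) * \<delta>) \<omega> - W i (t + real a * \<delta>) \<omega>) / sqrt \<delta>"

lemma subalgebra_F: "subalgebra M (F s)"
  using wiener unfolding std_wiener_def by blast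

lemma filtration_mono: "s \<le> u \<Longrightarrow> subalgebra (F u) (F s)"
proof -
  assume "s \<le> u"
  then have "sets (F s) \<subseteq> sets (F u)"
    using wiener unfolding std_wiener_def by blast
  with subalgebra_F[of s] subalgebra_F[of u] show ?thesis
    by (simp add: subalgebra_def)
qed

lemma W_adapted: "i \<in> {1..m} \<Longrightarrow> 0 \<le> s \<Longrightarrow> W i s \<in> borel_measurable (F s)"
  using wiener unfolding std_wiener_def by blast

lemma W_increment_distributed:
  "i \<in> {1..m} \<Longrightarrow> 0 \<le> s \<Longrightarrow> s < u \<Longrightarrow>
    distributed M lborel (\<lambda>\<omega>. W i u \<omega> - W i s \<omega>) (normal_density 0 (sqrt (u - s)))"
  using wiener unfolding std_wiener_def by blast

text \<open>The definition of a Wiener process tests the past only through indicators of events of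
  \<open>F s\<close>. Independence concerns preimages, and every preimage under an adapted
  \<open>Y\<close> is such an event, so the indicator may be replaced by \<open>Y\<close>.\<close>

lemma indep_adapted_increments:
  assumes s: "0 \<le> s" "s < u" and Y: "Y \<in> borel_measurable (F s)"
  shows "indep_vars (\<lambda>_. borel) (\<lambda>k \<omega>. if k = 0 then Y \<omega> else W k u \<omega> - W k s \<omega>) {0..m}"
proof -
  let ?X = "\<lambda>A k \<omega>. if k = (0::nat) then indicator A \<omega> else W k u \<omega> - W k s \<omega>"
  let ?Y = "\<lambda>k \<omega>. if k = (0::nat) then Y \<omega> else W k u \<omega> - W k s \<omega>"
  note sub = subalgebra_F[of s]
  have ind: "indep_vars (\<lambda>_. borel) (?X A) {0..m}" if "A \<in> sets (F s)" for A
    using wiener s that unfolding std_wiener_def by blast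
  have sp: "space (F s) = space M" using sub by (simp add: subalgebra_def)
  have Ym: "Y \<in> borel_measurable M"
    using measurable_from_subalg[OF sub Y] .
  have rv: "random_variable borel (?Y k)" if "k \<in> {0..m}" for k
  proof -
    have *: "random_variable borel (?X {} k)"
      using ind[OF sets.empty_sets] that unfolding indep_vars_def2 by blast
    show ?thesis
    proof (cases "k = 0")
      case True
      then show ?thesis using Ym by simp
    next
      case False
      then show ?thesis using * by simp
    qed
  qed
  have "indep_sets (\<lambda>i. {?Y i -` A \<inter> space M |A. A \<in> sets borel}) {0..m}"
  proof (rule indep_setsI)
    show "{?Y i -` A \<inter> space M |A. A \<in> sets borel} \<subseteq> events" if "i \<in> {0..m}" for i
      using measurable_sets[OF rv[OF that]] by blast
  next
    fix A J assume J: "J \<noteq> {}" "J \<subseteq> {0..m}" "finite J"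
      and A: "\<forall>j\<in>J. A j \<in> {?Y j -` A \<inter> space M |A. A \<in> sets borel}"
    then have "\<forall>j\<in>J. \<exists>B. B \<in> sets borel \<and> A j = ?Y j -` B \<inter> space M" by blast
    then obtain B where B: "\<And>j. j \<in> J \<Longrightarrow> B j \<in> sets borel"
      "\<And>j. j \<in> J \<Longrightarrow> A j = ?Y j -` B j \<inter> space M"
      by metis
    \<comment> \<open>The event that \<open>Y\<close> lies in \<open>B 0\<close> is itself fed to
      the hypothesis; testing its indicator against the set of 1 gives this event back. If 0 is not
      in \<open>J\<close> any event will do.\<close>
    define A0 where "A0 = (if 0 \<in> J then Y -` B 0 \<inter> space M else {})"
    have A0: "A0 \<in> sets (F s)"
      using measurable_sets[OF Y, of "B 0"] B(1) sp by (auto simp: A0_def)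
    define B' where "B' j = (if j = 0 then {1::real} else B j)" for j
    have eq: "A j = ?X A0 j -` B' j \<inter> space M" if "j \<in> J" for j
    proof (cases "j = 0")
      case True
      with that B(2)[OF that] show ?thesis by (auto simp: B'_def A0_def indicator_def)
    next
      case False
      with B(2)[OF that] show ?thesis by (simp add: B'_def)
    qed
    have "prob (\<Inter>j\<in>J. ?X A0 j -` B' j \<inter> space M) = (\<Prod>j\<in>J. prob (?X A0 j -` B' j \<inter> space M))"
      by (rule indep_varsD[OF ind[OF A0]]) (use J B(1) in \<open>simp_all add: B'_def\<close>)
    then show "prob (\<Inter>j\<in>J. A j) = (\<Prod>j\<in>J. prob (A j))"
    proof -
      have "(\<Inter>j\<in>J. A j) = (\<Inter>j\<in>J. ?X A0 j -` B' j \<inter> space M)"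
        using eq by (rule INF_cong[OF refl])
      moreover have "(\<Prod>j\<in>J. prob (A j)) = (\<Prod>j\<in>J. prob (?X A0 j -` B' j \<inter> space M))"
        using eq by (intro prod.cong refl) (rule arg_cong[of _ _ prob])
      ultimately show ?thesis using \<open>prob (\<Inter>j\<in>J. ?X A0 j -` B' j \<inter> space M) = _\<close> by (simp only:)
    qed
  qed
  with rv show ?thesis unfolding indep_vars_def2 by blast
qed

lemma \<xi>_measurable:
  assumes i: "i \<in> {1..m}" and a: "a < n"
  shows "\<xi> i a \<in> borel_measurable (F (t + real n * \<delta>))"
proof -
  have "W i (t + real b * \<delta>) \<in> borel_measurable (F (t + real n * \<delta>))" if "b \<le> n" for b
  proof (rule measurable_from_subalg)
    show "subalgebra (F (t + real n * \<delta>)) (F (t + real b * \<delta>))"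
      using that \<delta> by (intro filtration_mono) simp
    show "W i (t + real b * \<delta>) \<in> borel_measurable (F (t + real b * \<delta>))"
      using i t \<delta> by (intro W_adapted) simp_all
  qed
  from this[of a] this[of "Suc a"] a show ?thesis
    unfolding \<xi>_def[abs_def] by (intro borel_measurable_divide borel_measurable_diff) simp_all
qed

lemma \<xi>_rv: "i \<in> {1..m} \<Longrightarrow> \<xi> i a \<in> borel_measurable M"
  by (rule measurable_from_subalg[OF subalgebra_F \<xi>_measurable[of i a "Suc a"]]) auto

lemma \<xi>_distributed:
  assumes "i \<in> {1..m}"
  shows "distributed M lborel (\<xi> i a) std_normal_density"
proof -
  have *: "t + real a * \<delta> < t + real (Suc a) * \<delta>" "0 \<le> t + real a * \<delta>" using \<delta> t by auto
  note W_increment_distributed[OF assms *(2,1)]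
  also have "(t + real (Suc a) * \<delta>) - (t + real a * \<delta>) = \<delta>" by (simp add: algebra_simps)
  finally show ?thesis
    using \<delta> by (subst (asm) normal_standard_normal_convert) (auto simp: \<xi>_def[abs_def])
qed

text \<open>Induction over the cells: the product over the first \<open>n\<close> cells is
  measurable at the left end of the next cell, so it can play the past variable in
  \<open>indep_adapted_increments\<close>, while the components of the new cell are the other
  independent variables.\<close>

lemma prod_\<xi>:
  assumes h: "\<And>i a. i \<in> {1..m} \<Longrightarrow> h i a \<in> borel_measurable borel"
    and int: "\<And>i a. i \<in> {1..m} \<Longrightarrow> integrable M (\<lambda>\<omega>. h i a (\<xi> i a \<omega>) :: real)"
  shows "integrable M (\<lambda>\<omega>. \<Prod>a<n. \<Prod>i\<in>{1..m}. h i a (\<xi> i a \<omega>)) \<and>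
    expectation (\<lambda>\<omega>. \<Prod>a<n. \<Prod>i\<in>{1..m}. h i a (\<xi> i a \<omega>)) =
      (\<Prod>a<n. \<Prod>i\<in>{1..m}. expectation (\<lambda>\<omega>. h i a (\<xi> i a \<omega>)))"
proof (induction n)
  case 0
  then show ?case by (simp add: prob_space)
next
  case (Suc n)
  let ?s = "t + real n * \<delta>" and ?u = "t + real (Suc n) * \<delta>"
  let ?Y = "\<lambda>\<omega>. \<Prod>a<n. \<Prod>i\<in>{1..m}. h i a (\<xi> i a \<omega>)"
  let ?g = "\<lambda>k x. if k = (0::nat) then x else h k n (x / sqrt \<delta>)"
  let ?Z = "\<lambda>k \<omega>. if k = (0::nat) then ?Y \<omega> else W k ?u \<omega> - W k ?s \<omega>"
  have Y: "?Y \<in> borel_measurable (F ?s)"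
    by (intro borel_measurable_prod measurable_compose[OF \<xi>_measurable h]) auto
  have "indep_vars (\<lambda>_. borel) ?Z {0..m}"
    by (rule indep_adapted_increments[OF _ _ Y]) (use t \<delta> in auto)
  then have ind: "indep_vars (\<lambda>_. borel) (\<lambda>k \<omega>. ?g k (?Z k \<omega>)) {0..m}"
    proof (rule indep_vars_compose2)
    show "?g k \<in> borel_measurable borel" if "k \<in> {0..m}" for k
      using that by (cases "k = 0") (auto intro!: measurable_compose[OF _ h])
  qed
  have gZ: "?g k (?Z k \<omega>) = (if k = 0 then ?Y \<omega> else h k n (\<xi> k n \<omega>))" for k \<omega>
    by (simp add: \<xi>_def)
  have ind: "indep_vars (\<lambda>_. borel) (\<lambda>k \<omega>. if k = 0 then ?Y \<omega> else h k n (\<xi> k n \<omega>)) {0..m}"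
    using ind unfolding gZ .
  have int': "integrable M (\<lambda>\<omega>. if k = 0 then ?Y \<omega> else h k n (\<xi> k n \<omega>))" if "k \<in> {0..m}" for k
    using that Suc.IH int[of k n] by (cases "k = 0") auto
  have split: "{0..m} = insert 0 {1..m}" by auto
  have pr: "(\<Prod>k\<in>{0..m}. if k = 0 then c else f k) = c * (\<Prod>k\<in>{1..m}. f k)" for c :: real and f
    unfolding split by (subst prod.insert) (auto intro!: prod.cong)
  have "integrable M (\<lambda>\<omega>. \<Prod>k\<in>{0..m}. if k = 0 then ?Y \<omega> else h k n (\<xi> k n \<omega>))"
    using indep_vars_integrable[OF _ ind int'] by simp
  moreover have "expectation (\<lambda>\<omega>. \<Prod>k\<in>{0..m}. if k = 0 then ?Y \<omega> else h k n (\<xi> k n \<omega>)) =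
      (\<Prod>k\<in>{0..m}. expectation (\<lambda>\<omega>. if k = 0 then ?Y \<omega> else h k n (\<xi> k n \<omega>)))"
    using indep_vars_lebesgue_integral[OF _ ind int'] by simp
  moreover have "\<dots> = (\<Prod>k\<in>{0..m}. if k = 0 then expectation ?Y else expectation (\<lambda>\<omega>. h k n (\<xi> k n \<omega>)))"
    by (intro prod.cong) auto
  moreover have "\<dots> = (\<Prod>a<Suc n. \<Prod>i\<in>{1..m}. expectation (\<lambda>\<omega>. h i a (\<xi> i a \<omega>)))"
    unfolding pr using Suc.IH by (simp add: mult.commute)
  moreover have "(\<lambda>\<omega>. \<Prod>k\<in>{0..m}. if k = 0 then ?Y \<omega> else h k n (\<xi> k n \<omega>)) =
      (\<lambda>\<omega>. \<Prod>a<Suc n. \<Prod>i\<in>{1..m}. h i a (\<xi> i a \<omega>))"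
    unfolding pr by (simp add: mult.commute)
  ultimately show ?case by (simp only: simp_thms)
qed

end

section \<open>Second moments of multilinear forms\<close>

lemma fact_mult_le_fact_add: "fact a * fact b \<le> (fact (a + b) :: nat)"
  using fact_fact_dvd_fact[of a b, where 'a = nat] by (intro dvd_imp_le) auto

lemma prod_fact_le_fact_sum: "finite S \<Longrightarrow> (\<Prod>x\<in>S. fact (c x)) \<le> (fact (\<Sum>x\<in>S. c x) :: nat)"
proof (induction S rule: finite_induct)
  case (insert x S)
  have "fact (c x) * (\<Prod>x\<in>S. fact (c x)) \<le> (fact (c x) * fact (sum c S) :: nat)"
    using insert.IH by simp
  also have "\<dots> \<le> fact (c x + sum c S)" by (rule fact_mult_le_fact_add)
  finally show ?case using insert by simp
qed auto

lemma count_list_remove1: "count_list (remove1 x xs) y = (if x = y then count_list xs y - 1 else count_list xs y)"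
  by (induction xs) (auto dest: count_notin simp: count_list_0_iff)

text \<open>Words with equal letter counts are rearrangements of one another; the count bounds the
  number of words that are not orthogonal to a given one.\<close>

lemma card_same_mset_le: "finite {B. mset B = mset A} \<and> card {B. mset B = mset A} \<le> fact (length A)"
proof -
  have "{B. mset B = mset A} = permutations_of_multiset (mset A)"
    by (auto simp: permutations_of_multiset_def)
  then show ?thesis
    by (simp add: card_permutations_of_multiset)
qed

section \<open>Products of Hermite polynomials in the increments, indexed by words\<close>

context wiener_grid
begin

definition letters :: "nat \<Rightarrow> (nat \<times> nat) set" where "letters n = {1..m} \<times> {..<n}"

text \<open>A word \<open>A\<close> lists pairs (component, cell); the multiplicity of a pair is the degree of its Hermite factor.\<close>

definition wick :: "nat \<Rightarrow> (nat \<times> nat) list \<Rightarrow> 'a \<Rightarrow> real" where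
  "wick n A \<omega> = (\<Prod>x\<in>letters n. hermite (count_list A x) (\<xi> (fst x) (snd x) \<omega>))"

lemma finite_letters [simp]: "finite (letters n)" by (simp add: letters_def)

lemma wick_Nil [simp]: "wick n [] \<omega> = 1" by (simp add: wick_def)

lemma wick_measurable: "wick n A \<in> borel_measurable M"
  unfolding wick_def[abs_def]
  by (intro borel_measurable_prod measurable_compose[OF \<xi>_rv hermite_measurable]) (auto simp: letters_def)

text \<open>Only the factor at the letter \<open>x\<close> changes, and there
  \<open>mult_hermite\<close> applies. The second term collects the contractions of \<open>x\<close>
  with each of its occurrences in \<open>A\<close>.\<close>

lemma \<xi>_mult_wick:
  assumes "x \<in> letters n"
  shows "\<xi> (fst x) (snd x) \<omega> * wick n A \<omega> = wick n (x # A) \<omega> + real (count_list A x) * wick n (remove1 x A) \<omega>"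
proof -
  let ?r = "\<Prod>y\<in>letters n - {x}. hermite (count_list A y) (\<xi> (fst y) (snd y) \<omega>)"
  have split: "wick n B \<omega> = hermite (count_list B x) (\<xi> (fst x) (snd x) \<omega>) *
    (\<Prod>y\<in>letters n - {x}. hermite (count_list B y) (\<xi> (fst y) (snd y) \<omega>))" for B
    unfolding wick_def using assms by (subst prod.remove[of _ x]) auto
  have "(\<Prod>y\<in>letters n - {x}. hermite (count_list (x # A) y) (\<xi> (fst y) (snd y) \<omega>)) = ?r"
  proof (rule prod.cong[OF refl])
    fix y assume "y \<in> letters n - {x}"
    then have "x \<noteq> y" by auto
    then show "hermite (count_list (x # A) y) (\<xi> (fst y) (snd y) \<omega>) = hermite (count_list A y) (\<xi> (fst y) (snd y) \<omega>)"
      by (simp add: count_list_remove1)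
  qed
  moreover have "(\<Prod>y\<in>letters n - {x}. hermite (count_list (remove1 x A) y) (\<xi> (fst y) (snd y) \<omega>)) = ?r"
  proof (rule prod.cong[OF refl])
    fix y assume "y \<in> letters n - {x}"
    then have "x \<noteq> y" by auto
    then show "hermite (count_list (remove1 x A) y) (\<xi> (fst y) (snd y) \<omega>) = hermite (count_list A y) (\<xi> (fst y) (snd y) \<omega>)"
      by (simp add: count_list_remove1)
  qed
  moreover have "\<xi> (fst x) (snd x) \<omega> * (hermite (count_list A x) (\<xi> (fst x) (snd x) \<omega>) * ?r) =
      hermite (Suc (count_list A x)) (\<xi> (fst x) (snd x) \<omega>) * ?r +
      real (count_list A x) * (hermite (count_list A x - 1) (\<xi> (fst x) (snd x) \<omega>) * ?r)"
    by (simp only: mult.assoc[symmetric] mult_hermite distrib_right)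
  ultimately show ?thesis
    unfolding split by (simp only: count_list_remove1 count_list.simps if_True refl Suc_eq_plus1)
qed

lemma expectation_hermite:
  assumes "i \<in> {1..m}" "p \<le> 4" "q \<le> 4"
  shows "has_bochner_integral M (\<lambda>\<omega>. hermite p (\<xi> i a \<omega>) * hermite q (\<xi> i a \<omega>)) (if p = q then fact p else 0)"
proof -
  note D = \<xi>_distributed[OF assms(1), of a]
  note h = hermite_orthogonal[OF assms(2,3)]
  have "integrable M (\<lambda>\<omega>. hermite p (\<xi> i a \<omega>) * hermite q (\<xi> i a \<omega>))"
    using distributed_integrable[OF D, of "\<lambda>x. hermite p x * hermite q x"] h
    by (auto simp: has_bochner_integral_iff)
  moreover have "expectation (\<lambda>\<omega>. hermite p (\<xi> i a \<omega>) * hermite q (\<xi> i a \<omega>)) = (if p = q then fact p else 0)"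
    using distributed_integral[OF D, of "\<lambda>x. hermite p x * hermite q x"] h
    by (auto simp: has_bochner_integral_iff)
  ultimately show ?thesis by (simp add: has_bochner_integral_iff)
qed

text \<open>The expectation factorises over letters by \<open>prod_\<xi>\<close>. A letter with
  different multiplicities in the two words contributes the factor 0; otherwise the factors are
  factorials of the multiplicities, whose product is at most the factorial of their sum.\<close>

lemma wick_inner:
  assumes "length A \<le> 4" "length B \<le> 4" "set A \<subseteq> letters n" "set B \<subseteq> letters n"
  shows "integrable M (\<lambda>\<omega>. wick n A \<omega> * wick n B \<omega>)"
    and "\<bar>expectation (\<lambda>\<omega>. wick n A \<omega> * wick n B \<omega>)\<bar> \<le> (if mset A = mset B then fact (length A) else 0)"
proof -
  let ?h = "\<lambda>i a x. hermite (count_list A (i, a)) x * hermite (count_list B (i, a)) x"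
  have cA: "count_list A x \<le> 4" and cB: "count_list B x \<le> 4" for x
    using count_le_length[of A x] count_le_length[of B x] assms by linarith+
  have int: "integrable M (\<lambda>\<omega>. ?h i a (\<xi> i a \<omega>))" if "i \<in> {1..m}" for i a
    using expectation_hermite[OF that cA cB] by (rule integrable.intros)
  have e: "wick n A \<omega> * wick n B \<omega> = (\<Prod>a<n. \<Prod>i\<in>{1..m}. ?h i a (\<xi> i a \<omega>))" for \<omega>
    unfolding wick_def letters_def prod.distrib[symmetric]
    by (subst prod.swap) (simp add: prod.cartesian_product split_def)
  have P: "integrable M (\<lambda>\<omega>. \<Prod>a<n. \<Prod>i\<in>{1..m}. ?h i a (\<xi> i a \<omega>)) \<and>
    expectation (\<lambda>\<omega>. \<Prod>a<n. \<Prod>i\<in>{1..m}. ?h i a (\<xi> i a \<omega>)) =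
      (\<Prod>a<n. \<Prod>i\<in>{1..m}. expectation (\<lambda>\<omega>. ?h i a (\<xi> i a \<omega>)))"
    by (rule prod_\<xi>[OF _ int]) auto
  then show "integrable M (\<lambda>\<omega>. wick n A \<omega> * wick n B \<omega>)" unfolding e by blast
  have "expectation (\<lambda>\<omega>. wick n A \<omega> * wick n B \<omega>) = (\<Prod>a<n. \<Prod>i\<in>{1..m}. expectation (\<lambda>\<omega>. ?h i a (\<xi> i a \<omega>)))"
    using P unfolding e by blast
  also have "\<dots> = (\<Prod>a<n. \<Prod>i\<in>{1..m}. if count_list A (i, a) = count_list B (i, a) then fact (count_list A (i, a)) else 0)"
    by (intro prod.cong refl has_bochner_integral_integral_eq expectation_hermite cA cB)
  also have "\<dots> = (\<Prod>x\<in>letters n. if count_list A x = count_list B x then fact (count_list A x) else 0)"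
    unfolding letters_def by (subst prod.swap) (auto simp: prod.cartesian_product split_def intro!: prod.cong)
  finally have E: "expectation (\<lambda>\<omega>. wick n A \<omega> * wick n B \<omega>) =
    (\<Prod>x\<in>letters n. if count_list A x = count_list B x then fact (count_list A x) else 0)" .
  show "\<bar>expectation (\<lambda>\<omega>. wick n A \<omega> * wick n B \<omega>)\<bar> \<le> (if mset A = mset B then fact (length A) else 0)"
  proof (cases "mset A = mset B")
    case True
    then have c: "count_list A x = count_list B x" for x
      by (metis count_mset)
    have "(\<Prod>x\<in>letters n. fact (count_list A x)) \<le> (fact (\<Sum>x\<in>letters n. count_list A x) :: nat)"
      by (rule prod_fact_le_fact_sum) simp
    also have "(\<Sum>x\<in>letters n. count_list A x) = length A"
      using assms(3) sum_count_set[of A "letters n"] by simp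
    finally have "real (\<Prod>x\<in>letters n. fact (count_list A x)) \<le> real (fact (length A))"
      by (rule of_nat_mono)
    then show ?thesis using True unfolding E by (simp add: c prod_nonneg of_nat_prod)
  next
    case False
    then obtain x where x: "count_list A x \<noteq> count_list B x"
      by (metis count_mset multiset_eqI)
    then have "x \<in> letters n"
      using assms(3,4) by (metis count_notin subsetD)
    with x have "(\<Prod>x\<in>letters n. if count_list A x = count_list B x then fact (count_list A x) else (0::real)) = 0"
      by (intro prod_zero) auto
    with False show ?thesis unfolding E by simp
  qed
qed

text \<open>Schur's test for the Gram matrix: entries are at most \<open>fact k\<close>, and since
  \<open>f\<close> is injective each row has at most \<open>fact k\<close> nonzero ones, coming from
  rearrangements of one word. Together with \<open>D s * D r\<close> being at most the mean of the
  squares this gives the factor \<open>(fact k)\<^sup>2\<close>.\<close>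

lemma wick_sum_second_moment:
  assumes S: "finite S" "inj_on f S" and k: "k \<le> 4"
    and f: "\<And>s. s \<in> S \<Longrightarrow> length (f s) = k" "\<And>s. s \<in> S \<Longrightarrow> set (f s) \<subseteq> letters n"
  shows "integrable M (\<lambda>\<omega>. (\<Sum>s\<in>S. D s * wick n (f s) \<omega>)\<^sup>2)"
    and "expectation (\<lambda>\<omega>. (\<Sum>s\<in>S. D s * wick n (f s) \<omega>)\<^sup>2) \<le> (fact k)\<^sup>2 * (\<Sum>s\<in>S. (D s)\<^sup>2)"
proof -
  let ?E = "\<lambda>s r. expectation (\<lambda>\<omega>. wick n (f s) \<omega> * wick n (f r) \<omega>)"
  have e: "(\<Sum>s\<in>S. D s * wick n (f s) \<omega>)\<^sup>2 = (\<Sum>s\<in>S. \<Sum>r\<in>S. D s * D r * (wick n (f s) \<omega> * wick n (f r) \<omega>))" for \<omega>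
    by (simp add: power2_eq_square sum_product mult_ac)
  have int: "integrable M (\<lambda>\<omega>. wick n (f s) \<omega> * wick n (f r) \<omega>)" if "s \<in> S" "r \<in> S" for s r
    using wick_inner(1)[of "f s" "f r" n] f that k by simp
  show "integrable M (\<lambda>\<omega>. (\<Sum>s\<in>S. D s * wick n (f s) \<omega>)\<^sup>2)"
    unfolding e by (intro Bochner_Integration.integrable_sum integrable_mult_right int)
  let ?c = "\<lambda>s r. if mset (f s) = mset (f r) then fact k else (0::real)"
  have Eb: "\<bar>?E s r\<bar> \<le> ?c s r" if "s \<in> S" "r \<in> S" for s r
    using wick_inner(2)[of "f s" "f r" n] f[OF that(1)] f[OF that(2)] k by (auto split: if_splits)
  have cb: "(\<Sum>r\<in>S. ?c s r) \<le> (fact k)\<^sup>2" if "s \<in> S" for s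
  proof -
    have "(\<Sum>r\<in>S. ?c s r) = fact k * real (card {r \<in> S. mset (f s) = mset (f r)})"
      using S by (simp add: sum.If_cases Int_def)
    also have "card {r \<in> S. mset (f s) = mset (f r)} = card (f ` {r \<in> S. mset (f s) = mset (f r)})"
      using S by (intro card_image[symmetric] inj_on_subset[OF S(2)]) auto
    also have "\<dots> \<le> card {B. mset B = mset (f s)}"
      using card_same_mset_le[of "f s"] by (intro card_mono) auto
    also have "\<dots> \<le> fact k"
      using card_same_mset_le[of "f s"] f(1)[OF that] by simp
    finally show ?thesis by (simp add: power2_eq_square)
  qed
  have "expectation (\<lambda>\<omega>. (\<Sum>s\<in>S. D s * wick n (f s) \<omega>)\<^sup>2) = (\<Sum>s\<in>S. \<Sum>r\<in>S. D s * D r * ?E s r)"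
    unfolding e by (subst Bochner_Integration.integral_sum, intro Bochner_Integration.integrable_sum integrable_mult_right int, assumption+,
      intro sum.cong refl, subst Bochner_Integration.integral_sum, intro integrable_mult_right int, assumption+,
      intro sum.cong refl integral_mult_right, simp add: int)
  also have "\<dots> \<le> (\<Sum>s\<in>S. \<Sum>r\<in>S. ((D s)\<^sup>2 / 2 + (D r)\<^sup>2 / 2) * ?c s r)"
  proof (intro sum_mono)
    fix s r assume sr: "s \<in> S" "r \<in> S"
    have "D s * D r * ?E s r \<le> \<bar>D s * D r\<bar> * \<bar>?E s r\<bar>"
      by (metis abs_ge_self abs_mult)
    also have "\<bar>D s * D r\<bar> \<le> (D s)\<^sup>2 / 2 + (D r)\<^sup>2 / 2"
      using sum_squares_bound[of "\<bar>D s\<bar>" "\<bar>D r\<bar>"] by (simp add: abs_mult)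
    also have "((D s)\<^sup>2 / 2 + (D r)\<^sup>2 / 2) * \<bar>?E s r\<bar> \<le> ((D s)\<^sup>2 / 2 + (D r)\<^sup>2 / 2) * ?c s r"
      using Eb[OF sr] by (intro mult_left_mono) auto
    finally show "D s * D r * ?E s r \<le> ((D s)\<^sup>2 / 2 + (D r)\<^sup>2 / 2) * ?c s r"
      by (simp add: mult_right_mono)
  qed
  also have "\<dots> = (\<Sum>s\<in>S. \<Sum>r\<in>S. (D s)\<^sup>2 / 2 * ?c s r) + (\<Sum>s\<in>S. \<Sum>r\<in>S. (D r)\<^sup>2 / 2 * ?c s r)"
    by (simp add: sum.distrib distrib_right)
  also have "(\<Sum>s\<in>S. \<Sum>r\<in>S. (D r)\<^sup>2 / 2 * ?c s r) = (\<Sum>s\<in>S. \<Sum>r\<in>S. (D s)\<^sup>2 / 2 * ?c s r)"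
    by (subst sum.swap) (intro sum.cong refl, auto)
  also have "(\<Sum>s\<in>S. \<Sum>r\<in>S. (D s)\<^sup>2 / 2 * ?c s r) + (\<Sum>s\<in>S. \<Sum>r\<in>S. (D s)\<^sup>2 / 2 * ?c s r) =
      (\<Sum>s\<in>S. (D s)\<^sup>2 * (\<Sum>r\<in>S. ?c s r))"
    by (simp add: sum_distrib_left flip: sum.distrib)
  also have "\<dots> \<le> (\<Sum>s\<in>S. (D s)\<^sup>2 * (fact k)\<^sup>2)"
    using cb by (intro sum_mono mult_left_mono) auto
  also have "\<dots> = (fact k)\<^sup>2 * (\<Sum>s\<in>S. (D s)\<^sup>2)"
    by (simp add: sum_distrib_left mult.commute)
  finally show "expectation (\<lambda>\<omega>. (\<Sum>s\<in>S. D s * wick n (f s) \<omega>)\<^sup>2) \<le> (fact k)\<^sup>2 * (\<Sum>s\<in>S. (D s)\<^sup>2)" .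
qed

end

text \<open>Only the first two arguments are contracted; other pairs are first moved to the front by
  \<open>sum_perm4\<close>.\<close>

lemma sum_delta_contract:
  fixes D :: "nat \<Rightarrow> nat \<Rightarrow> nat \<Rightarrow> nat \<Rightarrow> real"
  shows "(\<Sum>x<n. \<Sum>y<n. \<Sum>z<n. \<Sum>w<n. D x y z w * ((if x = y then e else 0) * X z w)) =
    e * (\<Sum>z<n. \<Sum>w<n. (\<Sum>x<n. D x x z w) * X z w)"
proof -
  have "(\<Sum>y<n. \<Sum>z<n. \<Sum>w<n. D x y z w * ((if x = y then e else 0) * X z w)) =
      (\<Sum>z<n. \<Sum>w<n. D x x z w * (e * X z w))" if "x < n" for x
  proof -
    have "(\<Sum>y<n. \<Sum>z<n. \<Sum>w<n. D x y z w * ((if x = y then e else 0) * X z w)) =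
        (\<Sum>y<n. if x = y then \<Sum>z<n. \<Sum>w<n. D x y z w * (e * X z w) else 0)"
      by (intro sum.cong) auto
    then show ?thesis using that by simp
  qed
  then have "(\<Sum>x<n. \<Sum>y<n. \<Sum>z<n. \<Sum>w<n. D x y z w * ((if x = y then e else 0) * X z w)) =
      (\<Sum>x<n. \<Sum>z<n. \<Sum>w<n. D x x z w * (e * X z w))"
    by simp
  also have "\<dots> = (\<Sum>z<n. \<Sum>w<n. \<Sum>x<n. D x x z w * (e * X z w))"
    by (subst sum.swap) (intro sum.cong refl sum.swap)
  finally show ?thesis by (simp add: sum_distrib_left sum_distrib_right mult_ac)
qed

lemma sum_delta_contract3:
  fixes D :: "nat \<Rightarrow> nat \<Rightarrow> nat \<Rightarrow> real"
  shows "(\<Sum>x<n. \<Sum>y<n. \<Sum>z<n. D x y z * ((if x = y then e else 0) * X z)) =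
    e * (\<Sum>z<n. (\<Sum>x<n. D x x z) * X z)"
proof -
  have "(\<Sum>y<n. \<Sum>z<n. D x y z * ((if x = y then e else 0) * X z)) =
      (\<Sum>z<n. D x x z * (e * X z))" if "x < n" for x
  proof -
    have "(\<Sum>y<n. \<Sum>z<n. D x y z * ((if x = y then e else 0) * X z)) =
        (\<Sum>y<n. if x = y then \<Sum>z<n. D x y z * (e * X z) else 0)"
      by (intro sum.cong) auto
    then show ?thesis using that by simp
  qed
  then have "(\<Sum>x<n. \<Sum>y<n. \<Sum>z<n. D x y z * ((if x = y then e else 0) * X z)) =
      (\<Sum>x<n. \<Sum>z<n. D x x z * (e * X z))"
    by simp
  also have "\<dots> = (\<Sum>z<n. \<Sum>x<n. D x x z * (e * X z))" by (rule sum.swap)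
  finally show ?thesis by (simp add: sum_distrib_left sum_distrib_right mult_ac)
qed

lemma sum_delta_contract2:
  fixes D :: "nat \<Rightarrow> nat \<Rightarrow> real"
  shows "(\<Sum>x<n. \<Sum>y<n. D x y * (if x = y then e else 0)) = e * (\<Sum>x<n. D x x)"
proof -
  have "(\<Sum>x<n. \<Sum>y<n. D x y * (if x = y then e else 0)) = (\<Sum>x<n. \<Sum>y<n. if x = y then D x y * e else 0)"
    by (intro sum.cong) auto
  also have "\<dots> = (\<Sum>x<n. D x x * e)" by (intro sum.cong) auto
  finally show ?thesis by (simp add: sum_distrib_left mult_ac)
qed

section \<open>Bounds on second moments\<close>

context prob_space
begin

text \<open>Stated with the nonnegative integral, so that the bound includes square integrability
  and passes through Fatou's lemma without side conditions.\<close>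

definition ms_le :: "('a \<Rightarrow> real) \<Rightarrow> real \<Rightarrow> bool" where
  "ms_le X c \<longleftrightarrow> X \<in> borel_measurable M \<and> (\<integral>\<^sup>+\<omega>. ennreal ((X \<omega>)\<^sup>2) \<partial>M) \<le> ennreal c"

lemma ms_le_mono: "ms_le X c \<Longrightarrow> c \<le> d \<Longrightarrow> ms_le X d"
  unfolding ms_le_def by (auto intro: order_trans ennreal_leI)

lemma ms_le_const: "ms_le (\<lambda>_. c) (c\<^sup>2)"
  by (simp add: ms_le_def emeasure_space_1)

text \<open>Cauchy-Schwarz pointwise in the sample. No orthogonality of the summands is required,
  which suits a time component, where \<open>v a\<close> is \<open>sqrt \<delta>\<close> and the
  squares add up to the length of the interval.\<close>

lemma ms_le_sum:
  assumes A: "finite A" and X: "\<And>a. a \<in> A \<Longrightarrow> ms_le (X a) (c a)" and c: "\<And>a. a \<in> A \<Longrightarrow> 0 \<le> c a"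
  shows "ms_le (\<lambda>\<omega>. \<Sum>a\<in>A. v a * X a \<omega>) ((\<Sum>a\<in>A. (v a)\<^sup>2) * (\<Sum>a\<in>A. c a))"
  unfolding ms_le_def
proof
  have [measurable]: "X a \<in> borel_measurable M" if "a \<in> A" for a
    using X[OF that] by (simp add: ms_le_def)
  show "(\<lambda>\<omega>. \<Sum>a\<in>A. v a * X a \<omega>) \<in> borel_measurable M" by measurable
  have "(\<integral>\<^sup>+\<omega>. ennreal ((\<Sum>a\<in>A. v a * X a \<omega>)\<^sup>2) \<partial>M) \<le>
      (\<integral>\<^sup>+\<omega>. ennreal (\<Sum>a\<in>A. (v a)\<^sup>2) * (\<Sum>a\<in>A. ennreal ((X a \<omega>)\<^sup>2)) \<partial>M)"
  proof (intro nn_integral_mono)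
    fix \<omega>
    have "(\<Sum>a\<in>A. v a * X a \<omega>)\<^sup>2 \<le> (\<Sum>a\<in>A. (v a)\<^sup>2) * (\<Sum>a\<in>A. (X a \<omega>)\<^sup>2)"
      by (rule Cauchy_Schwarz_ineq_sum)
    then show "ennreal ((\<Sum>a\<in>A. v a * X a \<omega>)\<^sup>2) \<le> ennreal (\<Sum>a\<in>A. (v a)\<^sup>2) * (\<Sum>a\<in>A. ennreal ((X a \<omega>)\<^sup>2))"
      by (subst sum_ennreal, simp, subst ennreal_mult[symmetric]) (auto intro: sum_nonneg ennreal_leI)
  qed
  also have "\<dots> = ennreal (\<Sum>a\<in>A. (v a)\<^sup>2) * (\<Sum>a\<in>A. \<integral>\<^sup>+\<omega>. ennreal ((X a \<omega>)\<^sup>2) \<partial>M)"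
    by (subst nn_integral_cmult, measurable, subst nn_integral_sum, measurable)
  also have "\<dots> \<le> ennreal (\<Sum>a\<in>A. (v a)\<^sup>2) * (\<Sum>a\<in>A. ennreal (c a))"
    using X by (intro mult_left_mono sum_mono) (auto simp: ms_le_def)
  also have "\<dots> = ennreal ((\<Sum>a\<in>A. (v a)\<^sup>2) * (\<Sum>a\<in>A. c a))"
    by (subst sum_ennreal, simp add: c, subst ennreal_mult[symmetric]) (auto intro: sum_nonneg c)
  finally show "(\<integral>\<^sup>+\<omega>. ennreal ((\<Sum>a\<in>A. v a * X a \<omega>)\<^sup>2) \<partial>M) \<le> ennreal ((\<Sum>a\<in>A. (v a)\<^sup>2) * (\<Sum>a\<in>A. c a))" .
qed

lemma ms_le_add:
  assumes "ms_le X c" "ms_le Y d" "0 \<le> c" "0 \<le> d"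
  shows "ms_le (\<lambda>\<omega>. X \<omega> + Y \<omega>) (2 * c + 2 * d)"
  using ms_le_sum[of UNIV "\<lambda>b. if b then X else Y" "\<lambda>b. if b then c else d" "\<lambda>_. 1"] assms
  by (simp add: UNIV_bool add.commute)

lemma ms_le_indicator_cmult:
  assumes "ms_le X c" "0 \<le> c"
  shows "ms_le (\<lambda>\<omega>. (if P then 1 else 0) * X \<omega>) c"
proof (cases P)
  case True
  then show ?thesis using assms(1) by simp
next
  case False
  then show ?thesis using ms_le_mono[OF ms_le_const[of 0], of c] assms(2) by simp
qed

end

context wiener_grid
begin

lemma wick_mset_cong:
  assumes "mset A = mset B"
  shows "wick n A = wick n B"
proof -
  have "count_list A x = count_list B x" for x
    using arg_cong[OF assms, of "\<lambda>S. count S x"] by (simp only: count_mset)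
  then show ?thesis by (simp add: wick_def fun_eq_iff)
qed

lemma wick_singleton: "x \<in> letters n \<Longrightarrow> wick n [x] \<omega> = \<xi> (fst x) (snd x) \<omega>"
  using \<xi>_mult_wick[of x n \<omega> "[]"] by simp

definition kdelta :: "nat \<times> nat \<Rightarrow> nat \<times> nat \<Rightarrow> real" where "kdelta x y = (if x = y then 1 else 0)"

lemma \<xi>_mult_wick1: "x \<in> letters n \<Longrightarrow> \<xi> (fst x) (snd x) \<omega> * wick n [y] \<omega> = wick n [x, y] \<omega> + kdelta x y"
  by (subst \<xi>_mult_wick) (auto simp: kdelta_def)

lemma \<xi>_mult_wick2: "x \<in> letters n \<Longrightarrow> \<xi> (fst x) (snd x) \<omega> * wick n [y, z] \<omega> =
    wick n [x, y, z] \<omega> + kdelta x y * wick n [z] \<omega> + kdelta x z * wick n [y] \<omega>"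
  by (subst \<xi>_mult_wick) (auto simp: kdelta_def)

lemma \<xi>_mult_wick3: "x \<in> letters n \<Longrightarrow> \<xi> (fst x) (snd x) \<omega> * wick n [y, z, w] \<omega> =
    wick n [x, y, z, w] \<omega> + kdelta x y * wick n [z, w] \<omega> + kdelta x z * wick n [y, w] \<omega> + kdelta x w * wick n [y, z] \<omega>"
  using wick_mset_cong[of "[y, z]" "[z, y]" n] by (subst \<xi>_mult_wick) (auto simp: kdelta_def)

lemma \<xi>_prod2:
  assumes "x \<in> letters n" "y \<in> letters n"
  shows "\<xi> (fst x) (snd x) \<omega> * \<xi> (fst y) (snd y) \<omega> = wick n [x, y] \<omega> + kdelta x y"
  using \<xi>_mult_wick1[OF assms(1), of \<omega> y] by (simp add: wick_singleton[OF assms(2)])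

lemma \<xi>_prod3:
  assumes "x \<in> letters n" "y \<in> letters n" "z \<in> letters n"
  shows "\<xi> (fst x) (snd x) \<omega> * \<xi> (fst y) (snd y) \<omega> * \<xi> (fst z) (snd z) \<omega> =
    wick n [x, y, z] \<omega> + kdelta x y * wick n [z] \<omega> + kdelta x z * wick n [y] \<omega> + kdelta y z * wick n [x] \<omega>"
proof -
  have "\<xi> (fst x) (snd x) \<omega> * (\<xi> (fst y) (snd y) \<omega> * \<xi> (fst z) (snd z) \<omega>) =
    \<xi> (fst x) (snd x) \<omega> * wick n [y, z] \<omega> + \<xi> (fst x) (snd x) \<omega> * kdelta y z"
    by (simp only: \<xi>_prod2[OF assms(2,3)] distrib_left)
  then show ?thesis
    unfolding \<xi>_mult_wick2[OF assms(1)] wick_singleton[OF assms(1)] by (simp add: mult_ac)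
qed

text \<open>Wick's formula: one uncontracted term, six single contractions, three double ones. The
  right nesting fixes the shape to which \<open>ms_le_add\<close> is applied in
  \<open>ms_le_form4\<close>.\<close>

lemma \<xi>_prod4:
  assumes "x \<in> letters n" "y \<in> letters n" "z \<in> letters n" "w \<in> letters n"
  shows "\<xi> (fst x) (snd x) \<omega> * \<xi> (fst y) (snd y) \<omega> * \<xi> (fst z) (snd z) \<omega> * \<xi> (fst w) (snd w) \<omega> =
    wick n [x, y, z, w] \<omega> + (kdelta x y * wick n [z, w] \<omega> + (kdelta x z * wick n [y, w] \<omega> + (kdelta x w * wick n [y, z] \<omega> +
    (kdelta y z * wick n [x, w] \<omega> + (kdelta y w * wick n [x, z] \<omega> + (kdelta z w * wick n [x, y] \<omega> +
    (kdelta x y * kdelta z w + (kdelta x z * kdelta y w + kdelta x w * kdelta y z))))))))"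
proof -
  have "\<xi> (fst x) (snd x) \<omega> * (\<xi> (fst y) (snd y) \<omega> * \<xi> (fst z) (snd z) \<omega> * \<xi> (fst w) (snd w) \<omega>) =
    \<xi> (fst x) (snd x) \<omega> * wick n [y, z, w] \<omega> + kdelta y z * (\<xi> (fst x) (snd x) \<omega> * wick n [w] \<omega>) +
      kdelta y w * (\<xi> (fst x) (snd x) \<omega> * wick n [z] \<omega>) + kdelta z w * (\<xi> (fst x) (snd x) \<omega> * wick n [y] \<omega>)"
    unfolding \<xi>_prod3[OF assms(2-4)] by (simp add: distrib_left)
  then show ?thesis
    unfolding \<xi>_mult_wick3[OF assms(1)] \<xi>_mult_wick1[OF assms(1)]
    by (simp add: algebra_simps)
qed

lemma ms_le_wick_sum:
  assumes "finite S" "inj_on f S" "k \<le> 4" "\<And>s. s \<in> S \<Longrightarrow> length (f s) = k" "\<And>s. s \<in> S \<Longrightarrow> set (f s) \<subseteq> letters n"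
  shows "ms_le (\<lambda>\<omega>. \<Sum>s\<in>S. D s * wick n (f s) \<omega>) ((fact k)\<^sup>2 * (\<Sum>s\<in>S. (D s)\<^sup>2))"
  unfolding ms_le_def
proof
  show "(\<lambda>\<omega>. \<Sum>s\<in>S. D s * wick n (f s) \<omega>) \<in> borel_measurable M"
    by (intro borel_measurable_sum borel_measurable_times wick_measurable) auto
  note * = wick_sum_second_moment[OF assms, where D = D]
  show "(\<integral>\<^sup>+ \<omega>. ennreal ((\<Sum>s\<in>S. D s * wick n (f s) \<omega>)\<^sup>2) \<partial>M) \<le> ennreal ((fact k)\<^sup>2 * (\<Sum>s\<in>S. (D s)\<^sup>2))"
    using *(2) by (subst nn_integral_eq_integral[OF *(1)]) (auto intro: ennreal_leI)
qed

text \<open>Here and in the next three lemmas the constants 1, 4, 36, 576 are the squares of the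
  factorials of the word length.\<close>

lemma ms_le_wick1:
  assumes "i \<in> {1..m}"
  shows "ms_le (\<lambda>\<omega>. \<Sum>a<n. D a * wick n [(i, a)] \<omega>) (\<Sum>a<n. (D a)\<^sup>2)"
  using ms_le_wick_sum[of "{..<n}" "\<lambda>a. [(i, a)]" 1 n D] assms
  by (auto simp: inj_on_def letters_def)

lemma ms_le_wick2:
  assumes "i \<in> {1..m}" "j \<in> {1..m}"
  shows "ms_le (\<lambda>\<omega>. \<Sum>a<n. \<Sum>b<n. D a b * wick n [(i, a), (j, b)] \<omega>) (4 * (\<Sum>a<n. \<Sum>b<n. (D a b)\<^sup>2))"
  using ms_le_wick_sum[of "{..<n} \<times> {..<n}" "\<lambda>(a, b). [(i, a), (j, b)]" 2 n "\<lambda>(a, b). D a b"] assms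
  by (auto simp: inj_on_def letters_def sum.cartesian_product split_def)

lemma ms_le_wick3:
  assumes "i \<in> {1..m}" "j \<in> {1..m}" "k \<in> {1..m}"
  shows "ms_le (\<lambda>\<omega>. \<Sum>a<n. \<Sum>b<n. \<Sum>c<n. D a b c * wick n [(i, a), (j, b), (k, c)] \<omega>)
    (36 * (\<Sum>a<n. \<Sum>b<n. \<Sum>c<n. (D a b c)\<^sup>2))"
  using ms_le_wick_sum[of "{..<n} \<times> {..<n} \<times> {..<n}" "\<lambda>(a, b, c). [(i, a), (j, b), (k, c)]" 3 n "\<lambda>(a, b, c). D a b c"] assms
  by (auto simp: inj_on_def letters_def sum.cartesian_product split_def fact_numeral)

lemma ms_le_wick4:
  assumes "i \<in> {1..m}" "j \<in> {1..m}" "k \<in> {1..m}" "l \<in> {1..m}"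
  shows "ms_le (\<lambda>\<omega>. \<Sum>a<n. \<Sum>b<n. \<Sum>c<n. \<Sum>d<n. D a b c d * wick n [(i, a), (j, b), (k, c), (l, d)] \<omega>)
    (576 * (\<Sum>a<n. \<Sum>b<n. \<Sum>c<n. \<Sum>d<n. (D a b c d)\<^sup>2))"
  using ms_le_wick_sum[of "{..<n} \<times> {..<n} \<times> {..<n} \<times> {..<n}" "\<lambda>(a, b, c, d). [(i, a), (j, b), (k, c), (l, d)]" 4 n
      "\<lambda>(a, b, c, d). D a b c d"] assms
  by (auto simp: inj_on_def letters_def sum.cartesian_product split_def fact_numeral)

end

section \<open>Discrete forms and their contractions\<close>

lemma sum_perm3:
  fixes f :: "nat \<Rightarrow> nat \<Rightarrow> nat \<Rightarrow> real"
  shows "(\<Sum>a<n. \<Sum>b<n. \<Sum>c<n. f a b c) = (\<Sum>a<n. \<Sum>c<n. \<Sum>b<n. f a b c)"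
    and "(\<Sum>a<n. \<Sum>b<n. \<Sum>c<n. f a b c) = (\<Sum>b<n. \<Sum>c<n. \<Sum>a<n. f a b c)"
    and "(\<Sum>a<n. \<Sum>b<n. \<Sum>c<n. f a b c) = (\<Sum>c<n. \<Sum>a<n. \<Sum>b<n. f a b c)"
proof -
  show 1: "(\<Sum>a<n. \<Sum>b<n. \<Sum>c<n. f a b c) = (\<Sum>a<n. \<Sum>c<n. \<Sum>b<n. f a b c)" for f :: "nat \<Rightarrow> nat \<Rightarrow> nat \<Rightarrow> real"
    by (intro sum.cong refl sum.swap)
  have 2: "(\<Sum>a<n. \<Sum>b<n. \<Sum>c<n. f a b c) = (\<Sum>b<n. \<Sum>a<n. \<Sum>c<n. f a b c)" for f :: "nat \<Rightarrow> nat \<Rightarrow> nat \<Rightarrow> real"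
    by (rule sum.swap)
  show "(\<Sum>a<n. \<Sum>b<n. \<Sum>c<n. f a b c) = (\<Sum>b<n. \<Sum>c<n. \<Sum>a<n. f a b c)"
    by (subst 2, subst 1) (rule refl)
  show "(\<Sum>a<n. \<Sum>b<n. \<Sum>c<n. f a b c) = (\<Sum>c<n. \<Sum>a<n. \<Sum>b<n. f a b c)"
    by (subst 1, subst 2) (rule refl)
qed

text \<open>The five rearrangements bring each pair of summation variables other than the first pair
  to the front and keep the order of the rest. \<open>LI_perm4\<close>, \<open>coef4_perm\<close>
  and \<open>remainder_perm\<close> list the same five in the same order.\<close>

lemma sum_perm4:
  fixes f :: "nat \<Rightarrow> nat \<Rightarrow> nat \<Rightarrow> nat \<Rightarrow> real"
  shows "(\<Sum>a<n. \<Sum>b<n. \<Sum>c<n. \<Sum>d<n. f a b c d) = (\<Sum>a<n. \<Sum>c<n. \<Sum>b<n. \<Sum>d<n. f a b c d)"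
    and "(\<Sum>a<n. \<Sum>b<n. \<Sum>c<n. \<Sum>d<n. f a b c d) = (\<Sum>a<n. \<Sum>d<n. \<Sum>b<n. \<Sum>c<n. f a b c d)"
    and "(\<Sum>a<n. \<Sum>b<n. \<Sum>c<n. \<Sum>d<n. f a b c d) = (\<Sum>b<n. \<Sum>c<n. \<Sum>a<n. \<Sum>d<n. f a b c d)"
    and "(\<Sum>a<n. \<Sum>b<n. \<Sum>c<n. \<Sum>d<n. f a b c d) = (\<Sum>b<n. \<Sum>d<n. \<Sum>a<n. \<Sum>c<n. f a b c d)"
    and "(\<Sum>a<n. \<Sum>b<n. \<Sum>c<n. \<Sum>d<n. f a b c d) = (\<Sum>c<n. \<Sum>d<n. \<Sum>a<n. \<Sum>b<n. f a b c d)"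
proof -
  have i: "(\<Sum>b<n. \<Sum>c<n. \<Sum>d<n. f a b c d) = (\<Sum>d<n. \<Sum>b<n. \<Sum>c<n. f a b c d)"
    "(\<Sum>b<n. \<Sum>c<n. \<Sum>d<n. f a b c d) = (\<Sum>c<n. \<Sum>b<n. \<Sum>d<n. f a b c d)" for a
     by (rule sum_perm3) (rule sum.swap)
  show "(\<Sum>a<n. \<Sum>b<n. \<Sum>c<n. \<Sum>d<n. f a b c d) = (\<Sum>a<n. \<Sum>c<n. \<Sum>b<n. \<Sum>d<n. f a b c d)"
    by (simp only: i(2))
  show "(\<Sum>a<n. \<Sum>b<n. \<Sum>c<n. \<Sum>d<n. f a b c d) = (\<Sum>a<n. \<Sum>d<n. \<Sum>b<n. \<Sum>c<n. f a b c d)"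
    by (simp only: i(1))
  have s: "(\<Sum>a<n. \<Sum>b<n. \<Sum>c<n. \<Sum>d<n. f a b c d) = (\<Sum>b<n. \<Sum>a<n. \<Sum>c<n. \<Sum>d<n. f a b c d)"
    by (rule sum.swap)
  have j: "(\<Sum>a<n. \<Sum>c<n. \<Sum>d<n. f a b c d) = (\<Sum>d<n. \<Sum>a<n. \<Sum>c<n. f a b c d)"
    "(\<Sum>a<n. \<Sum>c<n. \<Sum>d<n. f a b c d) = (\<Sum>c<n. \<Sum>a<n. \<Sum>d<n. f a b c d)"
    "(\<Sum>a<n. \<Sum>c<n. \<Sum>d<n. f a b c d) = (\<Sum>c<n. \<Sum>d<n. \<Sum>a<n. f a b c d)" for b
     by (rule sum_perm3) (rule sum.swap, rule sum_perm3)
  show "(\<Sum>a<n. \<Sum>b<n. \<Sum>c<n. \<Sum>d<n. f a b c d) = (\<Sum>b<n. \<Sum>c<n. \<Sum>a<n. \<Sum>d<n. f a b c d)"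
    unfolding s by (simp only: j(2))
  show "(\<Sum>a<n. \<Sum>b<n. \<Sum>c<n. \<Sum>d<n. f a b c d) = (\<Sum>b<n. \<Sum>d<n. \<Sum>a<n. \<Sum>c<n. f a b c d)"
    unfolding s by (simp only: j(1))
  show "(\<Sum>a<n. \<Sum>b<n. \<Sum>c<n. \<Sum>d<n. f a b c d) = (\<Sum>c<n. \<Sum>d<n. \<Sum>a<n. \<Sum>b<n. f a b c d)"
    unfolding s j(3)
    by (subst sum.swap, rule sum.cong[OF refl], subst sum.swap, rule sum.cong[OF refl], rule sum.swap)
qed

text \<open>The contractions along pairs of arguments are the coefficients of the lower order terms in the
  Hermite expansion of a form.\<close>

definition trace_norm2 :: "nat \<Rightarrow> (nat \<Rightarrow> nat \<Rightarrow> real) \<Rightarrow> real" where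
  "trace_norm2 n D = (\<Sum>a<n. \<Sum>b<n. (D a b)\<^sup>2) + (\<Sum>a<n. D a a)\<^sup>2"

definition trace_norm3 :: "nat \<Rightarrow> (nat \<Rightarrow> nat \<Rightarrow> nat \<Rightarrow> real) \<Rightarrow> real" where
  "trace_norm3 n D = (\<Sum>a<n. \<Sum>b<n. \<Sum>c<n. (D a b c)\<^sup>2)
    + (\<Sum>z<n. (\<Sum>x<n. D x x z)\<^sup>2) + (\<Sum>z<n. (\<Sum>x<n. D x z x)\<^sup>2) + (\<Sum>z<n. (\<Sum>x<n. D z x x)\<^sup>2)"

definition trace_norm4 :: "nat \<Rightarrow> (nat \<Rightarrow> nat \<Rightarrow> nat \<Rightarrow> nat \<Rightarrow> real) \<Rightarrow> real" where
  "trace_norm4 n D = (\<Sum>a<n. \<Sum>b<n. \<Sum>c<n. \<Sum>d<n. (D a b c d)\<^sup>2)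
    + (\<Sum>z<n. \<Sum>w<n. (\<Sum>x<n. D x x z w)\<^sup>2) + (\<Sum>z<n. \<Sum>w<n. (\<Sum>x<n. D x z x w)\<^sup>2)
    + (\<Sum>z<n. \<Sum>w<n. (\<Sum>x<n. D x z w x)\<^sup>2) + (\<Sum>z<n. \<Sum>w<n. (\<Sum>x<n. D z x x w)\<^sup>2)
    + (\<Sum>z<n. \<Sum>w<n. (\<Sum>x<n. D z x w x)\<^sup>2) + (\<Sum>z<n. \<Sum>w<n. (\<Sum>x<n. D z w x x)\<^sup>2)
    + (\<Sum>z<n. \<Sum>x<n. D x x z z)\<^sup>2 + (\<Sum>z<n. \<Sum>x<n. D x z x z)\<^sup>2 + (\<Sum>z<n. \<Sum>x<n. D x z z x)\<^sup>2"

lemma trace_norm2_nonneg: "0 \<le> trace_norm2 n D"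
  unfolding trace_norm2_def by (intro add_nonneg_nonneg sum_nonneg zero_le_power2)

lemma trace_norm3_nonneg: "0 \<le> trace_norm3 n D"
  unfolding trace_norm3_def by (intro add_nonneg_nonneg sum_nonneg zero_le_power2)

lemma trace_norm4_nonneg: "0 \<le> trace_norm4 n D"
  unfolding trace_norm4_def by (intro add_nonneg_nonneg sum_nonneg zero_le_power2)

text \<open>Used when one component is time. The squared slices add up to the full square sum, and
  the squared traces of the slices add up to one of the single contractions of
  \<open>D\<close>.\<close>

lemma sum_trace_norm2_le:
  "(\<Sum>z<n. trace_norm2 n (D z)) \<le> trace_norm3 n D"
  "(\<Sum>z<n. trace_norm2 n (\<lambda>a b. D a z b)) \<le> trace_norm3 n D"
  "(\<Sum>z<n. trace_norm2 n (\<lambda>a b. D a b z)) \<le> trace_norm3 n D"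
proof -
  note q = sum_perm3[of "\<lambda>a b c. (D a b c)\<^sup>2" n]
  have r: "(\<Sum>b<n. \<Sum>a<n. \<Sum>c<n. (D a b c)\<^sup>2) = (\<Sum>a<n. \<Sum>b<n. \<Sum>c<n. (D a b c)\<^sup>2)"
    by (rule sum.swap)
  note nn = sum_nonneg[of "{..<n}" "\<lambda>z. (\<Sum>x<n. D x x z)\<^sup>2"] sum_nonneg[of "{..<n}" "\<lambda>z. (\<Sum>x<n. D x z x)\<^sup>2"]
    sum_nonneg[of "{..<n}" "\<lambda>z. (\<Sum>x<n. D z x x)\<^sup>2"]
  show "(\<Sum>z<n. trace_norm2 n (D z)) \<le> trace_norm3 n D"
    unfolding trace_norm2_def trace_norm3_def using nn by (simp add: sum.distrib)
  show "(\<Sum>z<n. trace_norm2 n (\<lambda>a b. D a z b)) \<le> trace_norm3 n D"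
    unfolding trace_norm2_def trace_norm3_def using nn r by (simp add: sum.distrib)
  show "(\<Sum>z<n. trace_norm2 n (\<lambda>a b. D a b z)) \<le> trace_norm3 n D"
    unfolding trace_norm2_def trace_norm3_def using nn q(3) by (simp add: sum.distrib)
qed

text \<open>As for three arguments: each contraction of a slice becomes, after summing over the
  fixed argument, one of the single contractions of \<open>D\<close>, possibly with the two free
  arguments exchanged.\<close>

lemma sum_trace_norm3_le:
  "(\<Sum>z<n. trace_norm3 n (D z)) \<le> trace_norm4 n D"
  "(\<Sum>z<n. trace_norm3 n (\<lambda>a b c. D a z b c)) \<le> trace_norm4 n D"
  "(\<Sum>z<n. trace_norm3 n (\<lambda>a b c. D a b z c)) \<le> trace_norm4 n D"
  "(\<Sum>z<n. trace_norm3 n (\<lambda>a b c. D a b c z)) \<le> trace_norm4 n D"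
proof -
  let ?f = "\<lambda>a b c d. (D a b c d)\<^sup>2"
  have q: "(\<Sum>b<n. \<Sum>a<n. \<Sum>c<n. \<Sum>d<n. ?f a b c d) = (\<Sum>a<n. \<Sum>b<n. \<Sum>c<n. \<Sum>d<n. ?f a b c d)"
    "(\<Sum>c<n. \<Sum>a<n. \<Sum>b<n. \<Sum>d<n. ?f a b c d) = (\<Sum>a<n. \<Sum>b<n. \<Sum>c<n. \<Sum>d<n. ?f a b c d)"
    "(\<Sum>d<n. \<Sum>a<n. \<Sum>b<n. \<Sum>c<n. ?f a b c d) = (\<Sum>a<n. \<Sum>b<n. \<Sum>c<n. \<Sum>d<n. ?f a b c d)"
      apply (rule sum.swap)
     apply (subst sum_perm4(1), subst sum.swap, rule refl)
    apply (subst sum_perm4(2), subst sum.swap, rule refl)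
    done
  have sw: "(\<Sum>z<n. \<Sum>w<n. (\<Sum>x<n. g x w z)\<^sup>2) = (\<Sum>z<n. \<Sum>w<n. (\<Sum>x<n. g x z w)\<^sup>2)" for g :: "nat \<Rightarrow> nat \<Rightarrow> nat \<Rightarrow> real"
    by (rule sum.swap)
  have nn: "0 \<le> (\<Sum>z<n. \<Sum>w<n. (\<Sum>x<n. g x z w)\<^sup>2)" for g :: "nat \<Rightarrow> nat \<Rightarrow> nat \<Rightarrow> real"
    by (intro sum_nonneg zero_le_power2)
  note n6 = nn[of "\<lambda>x z w. D x x z w"] nn[of "\<lambda>x z w. D x z x w"] nn[of "\<lambda>x z w. D x z w x"] nn[of "\<lambda>x z w. D z x x w"]
    nn[of "\<lambda>x z w. D z x w x"] nn[of "\<lambda>x z w. D z w x x"]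
  note s6 = sw[of "\<lambda>x z w. D x x z w"] sw[of "\<lambda>x z w. D x z x w"] sw[of "\<lambda>x z w. D x z w x"] sw[of "\<lambda>x z w. D z x x w"]
    sw[of "\<lambda>x z w. D z x w x"] sw[of "\<lambda>x z w. D z w x x"]
  note p3 = zero_le_power2[of "\<Sum>z<n. \<Sum>x<n. D x x z z"] zero_le_power2[of "\<Sum>z<n. \<Sum>x<n. D x z x z"]
    zero_le_power2[of "\<Sum>z<n. \<Sum>x<n. D x z z x"]
  show "(\<Sum>z<n. trace_norm3 n (D z)) \<le> trace_norm4 n D"
    unfolding trace_norm3_def trace_norm4_def sum.distrib using n6 p3 s6 by linarith
  show "(\<Sum>z<n. trace_norm3 n (\<lambda>a b c. D a z b c)) \<le> trace_norm4 n D"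
    unfolding trace_norm3_def trace_norm4_def sum.distrib using n6 p3 s6 q by linarith
  show "(\<Sum>z<n. trace_norm3 n (\<lambda>a b c. D a b z c)) \<le> trace_norm4 n D"
    unfolding trace_norm3_def trace_norm4_def sum.distrib using n6 p3 s6 q by linarith
  show "(\<Sum>z<n. trace_norm3 n (\<lambda>a b c. D a b c z)) \<le> trace_norm4 n D"
    unfolding trace_norm3_def trace_norm4_def sum.distrib using n6 p3 s6 q by linarith
qed

context wiener_grid
begin

text \<open>Component \<open>0\<close> is time, whose increment \<open>\<delta>\<close> is \<open>sqrt \<delta>\<close> times the constant used here.\<close>

definition std_inc :: "nat \<Rightarrow> nat \<Rightarrow> 'a \<Rightarrow> real" where
  "std_inc i a \<omega> = (if i = 0 then sqrt \<delta> else \<xi> i a \<omega>)"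

lemma std_inc_0: "std_inc 0 a \<omega> = sqrt \<delta>" by (simp add: std_inc_def)

lemma kdelta_pair: "kdelta (i, a) (j, b) = (if a = b then (if i = j then 1 else 0) else 0)"
  by (simp add: kdelta_def)

text \<open>The squares of \<open>sqrt \<delta>\<close> over \<open>n\<close> cells sum to at most
  \<open>K\<close>. A time component therefore costs one factor \<open>K\<close>, produces no
  contraction, and leaves forms with one argument fewer.\<close>

lemma ms_le_time_slot:
  assumes "real n * \<delta> \<le> K" "0 \<le> B" "\<And>a. a < n \<Longrightarrow> ms_le (X a) (c a)" "\<And>a. a < n \<Longrightarrow> 0 \<le> c a" "(\<Sum>a<n. c a) \<le> B"
  shows "ms_le (\<lambda>\<omega>. \<Sum>a<n. sqrt \<delta> * X a \<omega>) (K * B)"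
proof (rule ms_le_mono)
  show "ms_le (\<lambda>\<omega>. \<Sum>a<n. sqrt \<delta> * X a \<omega>) ((\<Sum>a<n. (sqrt \<delta>)\<^sup>2) * (\<Sum>a<n. c a))"
    using assms by (intro ms_le_sum) auto
  show "(\<Sum>a<n. (sqrt \<delta>)\<^sup>2) * (\<Sum>a<n. c a) \<le> K * B"
    using assms \<delta> by (simp del: sum_constant add: sum_constant) (intro mult_mono, auto intro: order_trans[OF _ assms(1)] sum_nonneg)
qed

lemma ms_le_form1:
  assumes K: "1 \<le> K" "real n * \<delta> \<le> K" and i: "i \<le> m"
  shows "ms_le (\<lambda>\<omega>. \<Sum>a<n. D a * std_inc i a \<omega>) (K * (\<Sum>a<n. (D a)\<^sup>2))"
proof (cases "i = 0")
  case True
  have "ms_le (\<lambda>\<omega>. \<Sum>a<n. sqrt \<delta> * (\<lambda>_. D a) \<omega>) (K * (\<Sum>a<n. (D a)\<^sup>2))"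
    using K by (intro ms_le_time_slot[where c = "\<lambda>a. (D a)\<^sup>2"] ms_le_const) (auto intro: sum_nonneg)
  then show ?thesis using True by (simp add: std_inc_0 mult.commute)
next
  case False
  with i have i: "i \<in> {1..m}" by simp
  then have "ms_le (\<lambda>\<omega>. \<Sum>a<n. D a * std_inc i a \<omega>) (\<Sum>a<n. (D a)\<^sup>2)"
    using ms_le_wick1[OF i, of D n] False by (simp add: wick_singleton letters_def std_inc_def)
  moreover have "(\<Sum>a<n. (D a)\<^sup>2) \<le> K * (\<Sum>a<n. (D a)\<^sup>2)"
    using mult_right_mono[OF K(1), of "\<Sum>a<n. (D a)\<^sup>2"] by (simp add: sum_nonneg)
  ultimately show ?thesis by (rule ms_le_mono)
qed

text \<open>Pattern for all the forms: a time component reduces to slices of lower degree; if all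
  components are Wiener, the Hermite expansion gives the contractions. \<open>1 \<le> K\<close> lets
  the power of \<open>K\<close> absorb the second case.\<close>

lemma ms_le_form2:
  assumes K: "1 \<le> K" "real n * \<delta> \<le> K" and ij: "i \<le> m" "j \<le> m"
  shows "ms_le (\<lambda>\<omega>. \<Sum>a<n. \<Sum>b<n. D a b * std_inc i a \<omega> * std_inc j b \<omega>) (8 * K^2 * trace_norm2 n D)"
proof -
  have n1: "(\<Sum>a<n. \<Sum>b<n. (D a b)\<^sup>2) \<le> trace_norm2 n D"
    by (simp add: trace_norm2_def)
  have n1': "(\<Sum>b<n. \<Sum>a<n. (D a b)\<^sup>2) \<le> trace_norm2 n D"
    using n1 by (subst sum.swap)
  have nn: "0 \<le> K * (\<Sum>a<n. (f a)\<^sup>2)" for f :: "nat \<Rightarrow> real" using K by (intro mult_nonneg_nonneg sum_nonneg) auto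
  have T: "ms_le X (8 * K^2 * trace_norm2 n D)" if "ms_le X (K * (K * trace_norm2 n D))" for X
    using that
  proof (rule ms_le_mono)
    have "1 * (K * (K * trace_norm2 n D)) \<le> 8 * (K * (K * trace_norm2 n D))"
      using K trace_norm2_nonneg[of n D] by (intro mult_right_mono mult_nonneg_nonneg) auto
    then show "K * (K * trace_norm2 n D) \<le> 8 * K\<^sup>2 * trace_norm2 n D"
      by (simp add: power2_eq_square mult_ac)
  qed
  consider "i = 0" | "j = 0" | "i \<in> {1..m}" "j \<in> {1..m}" using ij by force
  then show ?thesis
  proof cases
    case 1
    have "ms_le (\<lambda>\<omega>. \<Sum>a<n. sqrt \<delta> * (\<Sum>b<n. D a b * std_inc j b \<omega>)) (K * (K * trace_norm2 n D))"
      using K n1 trace_norm2_nonneg[of n D] ij nn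
      by (intro ms_le_time_slot[where c = "\<lambda>a. K * (\<Sum>b<n. (D a b)\<^sup>2)"] ms_le_form1)
        (auto simp flip: sum_distrib_left)
    from T[OF this] 1 show ?thesis by (simp add: std_inc_0 sum_distrib_left mult_ac)
  next
    case 2
    have "ms_le (\<lambda>\<omega>. \<Sum>b<n. sqrt \<delta> * (\<Sum>a<n. D a b * std_inc i a \<omega>)) (K * (K * trace_norm2 n D))"
      using K n1' trace_norm2_nonneg[of n D] ij nn
      by (intro ms_le_time_slot[where c = "\<lambda>b. K * (\<Sum>a<n. (D a b)\<^sup>2)"] ms_le_form1)
        (auto simp flip: sum_distrib_left)
    from T[OF this] 2 show ?thesis by (subst sum.swap) (simp add: std_inc_0 sum_distrib_left mult_ac)
  next
    case 3
    let ?e = "if i = j then 1 else 0 :: real"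
    have eq: "(\<Sum>a<n. \<Sum>b<n. D a b * std_inc i a \<omega> * std_inc j b \<omega>) =
      (\<Sum>a<n. \<Sum>b<n. D a b * wick n [(i, a), (j, b)] \<omega>) + ?e * (\<Sum>x<n. D x x)" for \<omega>
    proof -
      have "(\<Sum>a<n. \<Sum>b<n. D a b * std_inc i a \<omega> * std_inc j b \<omega>) =
          (\<Sum>a<n. \<Sum>b<n. D a b * wick n [(i, a), (j, b)] \<omega> + D a b * (if a = b then ?e else 0))"
        using 3 \<xi>_prod2[of "(i, _)" n "(j, _)" \<omega>]
        by (intro sum.cong refl) (simp add: std_inc_def letters_def mult.assoc distrib_left kdelta_pair)
      then show ?thesis
        by (simp only: sum.distrib sum_delta_contract2)
    qed
    have "ms_le (\<lambda>\<omega>. (\<Sum>a<n. \<Sum>b<n. D a b * wick n [(i, a), (j, b)] \<omega>) + ?e * (\<Sum>x<n. D x x))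
      (2 * (4 * (\<Sum>a<n. \<Sum>b<n. (D a b)\<^sup>2)) + 2 * (\<Sum>x<n. D x x)\<^sup>2)"
      by (intro ms_le_add ms_le_wick2 3 ms_le_indicator_cmult ms_le_const mult_nonneg_nonneg sum_nonneg) auto
    then show ?thesis unfolding eq
    proof (rule ms_le_mono)
      have "2 * (4 * (\<Sum>a<n. \<Sum>b<n. (D a b)\<^sup>2)) + 2 * (\<Sum>x<n. D x x)\<^sup>2 \<le> 8 * 1 * trace_norm2 n D"
        by (simp add: trace_norm2_def)
      also have "\<dots> \<le> 8 * K\<^sup>2 * trace_norm2 n D"
        using K by (intro mult_right_mono mult_left_mono trace_norm2_nonneg) (auto simp: one_le_power)
      finally show "2 * (4 * (\<Sum>a<n. \<Sum>b<n. (D a b)\<^sup>2)) + 2 * (\<Sum>x<n. D x x)\<^sup>2 \<le> 8 * K\<^sup>2 * trace_norm2 n D" .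
    qed
  qed
qed

lemma ms_le_form3:
  assumes K: "1 \<le> K" "real n * \<delta> \<le> K" and ijk: "i \<le> m" "j \<le> m" "k \<le> m"
  shows "ms_le (\<lambda>\<omega>. \<Sum>a<n. \<Sum>b<n. \<Sum>c<n. D a b c * std_inc i a \<omega> * std_inc j b \<omega> * std_inc k c \<omega>) (300 * K^3 * trace_norm3 n D)"
proof -
  have T: "ms_le X (300 * K^3 * trace_norm3 n D)" if "ms_le X (K * (8 * K^2 * trace_norm3 n D))" for X
    using that
  proof (rule ms_le_mono)
    have "8 * (K^3 * trace_norm3 n D) \<le> 300 * (K^3 * trace_norm3 n D)"
      using K trace_norm3_nonneg[of n D] by (intro mult_right_mono mult_nonneg_nonneg) auto
    then show "K * (8 * K^2 * trace_norm3 n D) \<le> 300 * K^3 * trace_norm3 n D"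
      by (simp add: power2_eq_square power3_eq_cube mult_ac)
  qed
  have nn: "0 \<le> 8 * K^2 * trace_norm2 n E" for E
    using K by (intro mult_nonneg_nonneg trace_norm2_nonneg) auto
  have B: "0 \<le> 8 * K^2 * trace_norm3 n D"
    using K by (intro mult_nonneg_nonneg trace_norm3_nonneg) auto
  have S: "(\<Sum>a<n. 8 * K^2 * trace_norm2 n (E a)) \<le> 8 * K^2 * trace_norm3 n D"
    if "(\<Sum>a<n. trace_norm2 n (E a)) \<le> trace_norm3 n D" for E
    using that K by (subst sum_distrib_left[symmetric]) (intro mult_left_mono, auto)
  note st = ms_le_time_slot[OF K(2) B _ nn S]
  consider "i = 0" | "j = 0" | "k = 0" | "i \<in> {1..m}" "j \<in> {1..m}" "k \<in> {1..m}" using ijk by force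
  then show ?thesis
  proof cases
    case 1
    have "ms_le (\<lambda>\<omega>. \<Sum>a<n. sqrt \<delta> * (\<Sum>b<n. \<Sum>c<n. D a b c * std_inc j b \<omega> * std_inc k c \<omega>)) (K * (8 * K^2 * trace_norm3 n D))"
      by (rule st[of _ D]) (intro ms_le_form2 K ijk sum_trace_norm2_le)+
    from T[OF this] 1 show ?thesis by (simp add: std_inc_0 sum_distrib_left mult_ac)
  next
    case 2
    have "ms_le (\<lambda>\<omega>. \<Sum>b<n. sqrt \<delta> * (\<Sum>a<n. \<Sum>c<n. D a b c * std_inc i a \<omega> * std_inc k c \<omega>)) (K * (8 * K^2 * trace_norm3 n D))"
      by (rule st[of _ "\<lambda>z a b. D a z b"]) (intro ms_le_form2 K ijk sum_trace_norm2_le)+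
    from T[OF this] 2 show ?thesis by (subst sum.swap) (simp add: std_inc_0 sum_distrib_left mult_ac)
  next
    case 3
    have "ms_le (\<lambda>\<omega>. \<Sum>c<n. sqrt \<delta> * (\<Sum>a<n. \<Sum>b<n. D a b c * std_inc i a \<omega> * std_inc j b \<omega>)) (K * (8 * K^2 * trace_norm3 n D))"
      by (rule st[of _ "\<lambda>z a b. D a b z"]) (intro ms_le_form2 K ijk sum_trace_norm2_le)+
    from T[OF this] 3 show ?thesis by (subst sum_perm3(3)) (simp add: std_inc_0 sum_distrib_left mult_ac)
  next
    case 4
    define e where "e i j = (if i = j then 1 else 0 :: real)" for i j :: nat
    have dle: "kdelta (i, a) (j, b) = (if a = b then e i j else 0)" for i a j b
      by (simp add: kdelta_pair e_def)
    have eq: "(\<Sum>a<n. \<Sum>b<n. \<Sum>c<n. D a b c * std_inc i a \<omega> * std_inc j b \<omega> * std_inc k c \<omega>) =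
      (\<Sum>a<n. \<Sum>b<n. \<Sum>c<n. D a b c * wick n [(i, a), (j, b), (k, c)] \<omega>)
      + (e i j * (\<Sum>z<n. (\<Sum>x<n. D x x z) * wick n [(k, z)] \<omega>)
      + (e i k * (\<Sum>z<n. (\<Sum>x<n. D x z x) * wick n [(j, z)] \<omega>)
      + e j k * (\<Sum>z<n. (\<Sum>x<n. D z x x) * wick n [(i, z)] \<omega>)))" for \<omega>
    proof -
      have "(\<Sum>a<n. \<Sum>b<n. \<Sum>c<n. D a b c * std_inc i a \<omega> * std_inc j b \<omega> * std_inc k c \<omega>) =
          (\<Sum>a<n. \<Sum>b<n. \<Sum>c<n. D a b c * wick n [(i, a), (j, b), (k, c)] \<omega>
           + (D a b c * ((if a = b then e i j else 0) * wick n [(k, c)] \<omega>)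
           + (D a b c * ((if a = c then e i k else 0) * wick n [(j, b)] \<omega>)
           + D a b c * ((if b = c then e j k else 0) * wick n [(i, a)] \<omega>))))"
      proof (intro sum.cong refl)
        fix a b c assume "a \<in> {..<n}" "b \<in> {..<n}" "c \<in> {..<n}"
        then have l: "(i, a) \<in> letters n" "(j, b) \<in> letters n" "(k, c) \<in> letters n"
          using 4 by (auto simp: letters_def)
        have "D a b c * std_inc i a \<omega> * std_inc j b \<omega> * std_inc k c \<omega> = D a b c * (\<xi> i a \<omega> * \<xi> j b \<omega> * \<xi> k c \<omega>)"
          using 4 by (simp add: std_inc_def mult.assoc)
        then show "D a b c * std_inc i a \<omega> * std_inc j b \<omega> * std_inc k c \<omega> =
           D a b c * wick n [(i, a), (j, b), (k, c)] \<omega>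
           + (D a b c * ((if a = b then e i j else 0) * wick n [(k, c)] \<omega>)
           + (D a b c * ((if a = c then e i k else 0) * wick n [(j, b)] \<omega>)
           + D a b c * ((if b = c then e j k else 0) * wick n [(i, a)] \<omega>)))"
          using \<xi>_prod3[OF l, of \<omega>] unfolding fst_conv snd_conv dle
          by (simp only: distrib_left add.assoc)
      qed
      moreover have "(\<Sum>a<n. \<Sum>b<n. \<Sum>c<n. D a b c * ((if a = c then e i k else 0) * wick n [(j, b)] \<omega>)) =
          e i k * (\<Sum>z<n. (\<Sum>x<n. D x z x) * wick n [(j, z)] \<omega>)"
        by (subst sum_perm3(1)) (rule sum_delta_contract3)
      moreover have "(\<Sum>a<n. \<Sum>b<n. \<Sum>c<n. D a b c * ((if b = c then e j k else 0) * wick n [(i, a)] \<omega>)) =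
          e j k * (\<Sum>z<n. (\<Sum>x<n. D z x x) * wick n [(i, z)] \<omega>)"
        by (subst sum_perm3(2)) (rule sum_delta_contract3)
      ultimately show ?thesis
        by (simp only: sum.distrib sum_delta_contract3)
    qed
    let ?q = "\<lambda>f. \<Sum>z<n. (\<Sum>x<n. f x z)\<^sup>2 :: real"
    let ?B = "2 * (36 * (\<Sum>a<n. \<Sum>b<n. \<Sum>c<n. (D a b c)\<^sup>2)) + 2 * (2 * ?q (\<lambda>x z. D x x z) +
      2 * (2 * ?q (\<lambda>x z. D x z x) + 2 * ?q (\<lambda>x z. D z x x)))"
    have "ms_le (\<lambda>\<omega>. (\<Sum>a<n. \<Sum>b<n. \<Sum>c<n. D a b c * wick n [(i, a), (j, b), (k, c)] \<omega>)
      + (e i j * (\<Sum>z<n. (\<Sum>x<n. D x x z) * wick n [(k, z)] \<omega>)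
      + (e i k * (\<Sum>z<n. (\<Sum>x<n. D x z x) * wick n [(j, z)] \<omega>)
      + e j k * (\<Sum>z<n. (\<Sum>x<n. D z x x) * wick n [(i, z)] \<omega>)))) ?B"
      unfolding e_def
      by (intro ms_le_add ms_le_wick3 ms_le_wick1 4 ms_le_indicator_cmult mult_nonneg_nonneg add_nonneg_nonneg sum_nonneg) auto
    then show ?thesis unfolding eq
    proof (rule ms_le_mono)
      have arith: "2 * (36 * s) + 2 * (2 * a + 2 * (2 * b + 2 * c)) \<le> 300 * 1 * (s + a + b + c)"
        if "0 \<le> s" "0 \<le> a" "0 \<le> b" "0 \<le> c" for s a b c :: real
        using that by simp
      have "?B \<le> 300 * 1 * trace_norm3 n D"
        unfolding trace_norm3_def by (rule arith) (intro sum_nonneg zero_le_power2)+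
      also have "\<dots> \<le> 300 * K^3 * trace_norm3 n D"
        using K by (intro mult_right_mono mult_left_mono trace_norm3_nonneg) (auto simp: one_le_power)
      finally show "?B \<le> 300 * K^3 * trace_norm3 n D" .
    qed
  qed
qed

text \<open>The constant is generous: every nested use of \<open>ms_le_add\<close> doubles, and the
  largest coefficient so obtained is 2 * 576. Coefficients for contractions between different
  components vanish through \<open>e\<close>.\<close>

lemma ms_le_form4:
  assumes K: "1 \<le> K" "real n * \<delta> \<le> K" and ijkl: "i \<le> m" "j \<le> m" "k \<le> m" "l \<le> m"
  shows "ms_le (\<lambda>\<omega>. \<Sum>a<n. \<Sum>b<n. \<Sum>c<n. \<Sum>d<n. D a b c d * std_inc i a \<omega> * std_inc j b \<omega> * std_inc k c \<omega> * std_inc l d \<omega>)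
    (10000 * K^4 * trace_norm4 n D)"
proof -
  have T: "ms_le X (10000 * K^4 * trace_norm4 n D)" if "ms_le X (K * (300 * K^3 * trace_norm4 n D))" for X
    using that
  proof (rule ms_le_mono)
    have "300 * (K^4 * trace_norm4 n D) \<le> 10000 * (K^4 * trace_norm4 n D)"
      using K trace_norm4_nonneg[of n D] by (intro mult_right_mono mult_nonneg_nonneg) auto
    then show "K * (300 * K^3 * trace_norm4 n D) \<le> 10000 * K^4 * trace_norm4 n D"
      by (simp add: power4_eq_xxxx power3_eq_cube mult_ac)
  qed
  have nn: "0 \<le> 300 * K^3 * trace_norm3 n E" for E
    using K by (intro mult_nonneg_nonneg trace_norm3_nonneg) auto
  have B: "0 \<le> 300 * K^3 * trace_norm4 n D"
    using K by (intro mult_nonneg_nonneg trace_norm4_nonneg) auto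
  have S: "(\<Sum>a<n. 300 * K^3 * trace_norm3 n (E a)) \<le> 300 * K^3 * trace_norm4 n D"
    if "(\<Sum>a<n. trace_norm3 n (E a)) \<le> trace_norm4 n D" for E
    using that K by (subst sum_distrib_left[symmetric]) (intro mult_left_mono, auto)
  note st = ms_le_time_slot[OF K(2) B _ nn S]
  consider "i = 0" | "j = 0" | "k = 0" | "l = 0" | "i \<in> {1..m}" "j \<in> {1..m}" "k \<in> {1..m}" "l \<in> {1..m}" using ijkl by force
  then show ?thesis
  proof cases
    case 1
    have "ms_le (\<lambda>\<omega>. \<Sum>a<n. sqrt \<delta> * (\<Sum>b<n. \<Sum>c<n. \<Sum>d<n. D a b c d * std_inc j b \<omega> * std_inc k c \<omega> * std_inc l d \<omega>)) (K * (300 * K^3 * trace_norm4 n D))"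
      by (rule st[of _ D]) (intro ms_le_form3 K ijkl sum_trace_norm3_le)+
    from T[OF this] 1 show ?thesis by (simp add: std_inc_0 sum_distrib_left mult_ac)
  next
    case 2
    have "ms_le (\<lambda>\<omega>. \<Sum>b<n. sqrt \<delta> * (\<Sum>a<n. \<Sum>c<n. \<Sum>d<n. D a b c d * std_inc i a \<omega> * std_inc k c \<omega> * std_inc l d \<omega>)) (K * (300 * K^3 * trace_norm4 n D))"
      by (rule st[of _ "\<lambda>z a b c. D a z b c"]) (intro ms_le_form3 K ijkl sum_trace_norm3_le)+
    from T[OF this] 2 show ?thesis by (subst sum.swap) (simp add: std_inc_0 sum_distrib_left mult_ac)
  next
    case 3
    have "ms_le (\<lambda>\<omega>. \<Sum>c<n. sqrt \<delta> * (\<Sum>a<n. \<Sum>b<n. \<Sum>d<n. D a b c d * std_inc i a \<omega> * std_inc j b \<omega> * std_inc l d \<omega>)) (K * (300 * K^3 * trace_norm4 n D))"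
      by (rule st[of _ "\<lambda>z a b c. D a b z c"]) (intro ms_le_form3 K ijkl sum_trace_norm3_le)+
    from T[OF this] 3 show ?thesis
      by (subst sum_perm4(1), subst sum.swap) (simp add: std_inc_0 sum_distrib_left mult_ac)
  next
    case 4
    have "ms_le (\<lambda>\<omega>. \<Sum>d<n. sqrt \<delta> * (\<Sum>a<n. \<Sum>b<n. \<Sum>c<n. D a b c d * std_inc i a \<omega> * std_inc j b \<omega> * std_inc k c \<omega>)) (K * (300 * K^3 * trace_norm4 n D))"
      by (rule st[of _ "\<lambda>z a b c. D a b c z"]) (intro ms_le_form3 K ijkl sum_trace_norm3_le)+
    from T[OF this] 4 show ?thesis
      by (subst sum_perm4(2), subst sum.swap) (simp add: std_inc_0 sum_distrib_left mult_ac)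
  next
    case 5
    define e where "e i j = (if i = j then 1 else 0 :: real)" for i j :: nat
    have dle: "kdelta (i, a) (j, b) = (if a = b then e i j else 0)" for i a j b
      by (simp add: kdelta_pair e_def)
    let ?G = "\<lambda>\<omega>. (\<Sum>a<n. \<Sum>b<n. \<Sum>c<n. \<Sum>d<n. D a b c d * wick n [(i, a), (j, b), (k, c), (l, d)] \<omega>)
      + (e i j * (\<Sum>z<n. \<Sum>w<n. (\<Sum>x<n. D x x z w) * wick n [(k, z), (l, w)] \<omega>)
      + (e i k * (\<Sum>z<n. \<Sum>w<n. (\<Sum>x<n. D x z x w) * wick n [(j, z), (l, w)] \<omega>)
      + (e i l * (\<Sum>z<n. \<Sum>w<n. (\<Sum>x<n. D x z w x) * wick n [(j, z), (k, w)] \<omega>)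
      + (e j k * (\<Sum>z<n. \<Sum>w<n. (\<Sum>x<n. D z x x w) * wick n [(i, z), (l, w)] \<omega>)
      + (e j l * (\<Sum>z<n. \<Sum>w<n. (\<Sum>x<n. D z x w x) * wick n [(i, z), (k, w)] \<omega>)
      + (e k l * (\<Sum>z<n. \<Sum>w<n. (\<Sum>x<n. D z w x x) * wick n [(i, z), (j, w)] \<omega>)
      + (e i j * (e k l * (\<Sum>z<n. \<Sum>x<n. D x x z z))
      + (e i k * (e j l * (\<Sum>z<n. \<Sum>x<n. D x z x z))
      + e i l * (e j k * (\<Sum>z<n. \<Sum>x<n. D x z z x))))))))))"
    have eq: "(\<Sum>a<n. \<Sum>b<n. \<Sum>c<n. \<Sum>d<n. D a b c d * std_inc i a \<omega> * std_inc j b \<omega> * std_inc k c \<omega> * std_inc l d \<omega>) = ?G \<omega>" for \<omega>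
    proof -
      let ?d = "\<lambda>a b x. if a = b then x else (0::real)"
      have "(\<Sum>a<n. \<Sum>b<n. \<Sum>c<n. \<Sum>d<n. D a b c d * std_inc i a \<omega> * std_inc j b \<omega> * std_inc k c \<omega> * std_inc l d \<omega>) =
          (\<Sum>a<n. \<Sum>b<n. \<Sum>c<n. \<Sum>d<n. D a b c d * wick n [(i, a), (j, b), (k, c), (l, d)] \<omega>
           + (D a b c d * (?d a b (e i j) * wick n [(k, c), (l, d)] \<omega>)
           + (D a b c d * (?d a c (e i k) * wick n [(j, b), (l, d)] \<omega>)
           + (D a b c d * (?d a d (e i l) * wick n [(j, b), (k, c)] \<omega>)
           + (D a b c d * (?d b c (e j k) * wick n [(i, a), (l, d)] \<omega>)
           + (D a b c d * (?d b d (e j l) * wick n [(i, a), (k, c)] \<omega>)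
           + (D a b c d * (?d c d (e k l) * wick n [(i, a), (j, b)] \<omega>)
           + (D a b c d * (?d a b (e i j) * ?d c d (e k l))
           + (D a b c d * (?d a c (e i k) * ?d b d (e j l))
           + D a b c d * (?d a d (e i l) * ?d b c (e j k)))))))))))"
      proof (intro sum.cong refl)
        fix a b c d assume "a \<in> {..<n}" "b \<in> {..<n}" "c \<in> {..<n}" "d \<in> {..<n}"
        then have l: "(i, a) \<in> letters n" "(j, b) \<in> letters n" "(k, c) \<in> letters n" "(l, d) \<in> letters n"
          using 5 by (auto simp: letters_def)
        have "D a b c d * std_inc i a \<omega> * std_inc j b \<omega> * std_inc k c \<omega> * std_inc l d \<omega> = D a b c d * (\<xi> i a \<omega> * \<xi> j b \<omega> * \<xi> k c \<omega> * \<xi> l d \<omega>)"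
          using 5 by (simp add: std_inc_def mult.assoc)
        also have "\<dots> = D a b c d * wick n [(i, a), (j, b), (k, c), (l, d)] \<omega>
           + (D a b c d * (?d a b (e i j) * wick n [(k, c), (l, d)] \<omega>)
           + (D a b c d * (?d a c (e i k) * wick n [(j, b), (l, d)] \<omega>)
           + (D a b c d * (?d a d (e i l) * wick n [(j, b), (k, c)] \<omega>)
           + (D a b c d * (?d b c (e j k) * wick n [(i, a), (l, d)] \<omega>)
           + (D a b c d * (?d b d (e j l) * wick n [(i, a), (k, c)] \<omega>)
           + (D a b c d * (?d c d (e k l) * wick n [(i, a), (j, b)] \<omega>)
           + (D a b c d * (?d a b (e i j) * ?d c d (e k l))
           + (D a b c d * (?d a c (e i k) * ?d b d (e j l))
           + D a b c d * (?d a d (e i l) * ?d b c (e j k))))))))))"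
          using \<xi>_prod4[OF l, of \<omega>] unfolding fst_conv snd_conv dle
          by (simp only: distrib_left)
        finally show "D a b c d * std_inc i a \<omega> * std_inc j b \<omega> * std_inc k c \<omega> * std_inc l d \<omega> = \<dots>" .
      qed
      moreover have "(\<Sum>a<n. \<Sum>b<n. \<Sum>c<n. \<Sum>d<n. D a b c d * (?d a c (e i k) * X b d)) =
          e i k * (\<Sum>z<n. \<Sum>w<n. (\<Sum>x<n. D x z x w) * X z w)" for X
        by (subst sum_perm4(1)) (rule sum_delta_contract)
      moreover have "(\<Sum>a<n. \<Sum>b<n. \<Sum>c<n. \<Sum>d<n. D a b c d * (?d a d (e i l) * X b c)) =
          e i l * (\<Sum>z<n. \<Sum>w<n. (\<Sum>x<n. D x z w x) * X z w)" for X
        by (subst sum_perm4(2)) (rule sum_delta_contract)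
      moreover have "(\<Sum>a<n. \<Sum>b<n. \<Sum>c<n. \<Sum>d<n. D a b c d * (?d b c (e j k) * X a d)) =
          e j k * (\<Sum>z<n. \<Sum>w<n. (\<Sum>x<n. D z x x w) * X z w)" for X
        by (subst sum_perm4(3)) (rule sum_delta_contract)
      moreover have "(\<Sum>a<n. \<Sum>b<n. \<Sum>c<n. \<Sum>d<n. D a b c d * (?d b d (e j l) * X a c)) =
          e j l * (\<Sum>z<n. \<Sum>w<n. (\<Sum>x<n. D z x w x) * X z w)" for X
        by (subst sum_perm4(4)) (rule sum_delta_contract)
      moreover have "(\<Sum>a<n. \<Sum>b<n. \<Sum>c<n. \<Sum>d<n. D a b c d * (?d c d (e k l) * X a b)) =
          e k l * (\<Sum>z<n. \<Sum>w<n. (\<Sum>x<n. D z w x x) * X z w)" for X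
        by (subst sum_perm4(5)) (rule sum_delta_contract)
      ultimately show ?thesis
        by (simp only: sum.distrib sum_delta_contract sum_delta_contract2)
    qed
    let ?q = "\<lambda>f. \<Sum>z<n. \<Sum>w<n. (\<Sum>x<n. f x z w)\<^sup>2 :: real"
    let ?B = "2 * (576 * (\<Sum>a<n. \<Sum>b<n. \<Sum>c<n. \<Sum>d<n. (D a b c d)\<^sup>2)) + 2 * (2 * (4 * ?q (\<lambda>x z w. D x x z w)) +
      2 * (2 * (4 * ?q (\<lambda>x z w. D x z x w)) + 2 * (2 * (4 * ?q (\<lambda>x z w. D x z w x)) +
      2 * (2 * (4 * ?q (\<lambda>x z w. D z x x w)) + 2 * (2 * (4 * ?q (\<lambda>x z w. D z x w x)) +
      2 * (2 * (4 * ?q (\<lambda>x z w. D z w x x)) + 2 * (2 * (\<Sum>z<n. \<Sum>x<n. D x x z z)\<^sup>2 +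
      2 * (2 * (\<Sum>z<n. \<Sum>x<n. D x z x z)\<^sup>2 + 2 * (\<Sum>z<n. \<Sum>x<n. D x z z x)\<^sup>2))))))))"
    have "ms_le ?G ?B"
      unfolding e_def
      by (intro ms_le_add ms_le_wick4 ms_le_wick2 5 ms_le_indicator_cmult ms_le_const mult_nonneg_nonneg add_nonneg_nonneg sum_nonneg) auto
    then show ?thesis unfolding eq
    proof (rule ms_le_mono)
      have arith: "2 * (576 * s) + 2 * (2 * (4 * q1) + 2 * (2 * (4 * q2) + 2 * (2 * (4 * q3) + 2 * (2 * (4 * q4) +
          2 * (2 * (4 * q5) + 2 * (2 * (4 * q6) + 2 * (2 * p1 + 2 * (2 * p2 + 2 * p3)))))))) \<le>
          10000 * 1 * (s + q1 + q2 + q3 + q4 + q5 + q6 + p1 + p2 + p3)"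
        if "0 \<le> s" "0 \<le> q1" "0 \<le> q2" "0 \<le> q3" "0 \<le> q4" "0 \<le> q5" "0 \<le> q6" "0 \<le> p1" "0 \<le> p2" "0 \<le> p3"
        for s q1 q2 q3 q4 q5 q6 p1 p2 p3 :: real
        using that by simp
      have "?B \<le> 10000 * 1 * trace_norm4 n D"
        unfolding trace_norm4_def by (rule arith) (intro sum_nonneg zero_le_power2)+
      also have "\<dots> \<le> 10000 * K^4 * trace_norm4 n D"
        using K by (intro mult_right_mono mult_left_mono trace_norm4_nonneg) (auto simp: one_le_power)
      finally show "?B \<le> 10000 * K^4 * trace_norm4 n D" .
    qed
  qed
qed

end

section \<open>Orthonormal expansions on an interval\<close>

text \<open>Bounded Borel functions form an algebra whose members are integrable for every finite
  Borel measure, so integrability and Fubini conditions reduce to applying closure rules.\<close>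

definition bm :: "('b::topological_space \<Rightarrow> real) \<Rightarrow> bool" where
  "bm f \<longleftrightarrow> f \<in> borel_measurable borel \<and> (\<exists>B. \<forall>x. \<bar>f x\<bar> \<le> B)"

lemma bmI: "f \<in> borel_measurable borel \<Longrightarrow> (\<And>x. \<bar>f x\<bar> \<le> B) \<Longrightarrow> bm f"
  unfolding bm_def by blast

lemma bm_measurable: "bm f \<Longrightarrow> f \<in> borel_measurable borel"
  unfolding bm_def by blast

lemma bm_bounded: "bm f \<Longrightarrow> \<exists>B\<ge>0. \<forall>x. \<bar>f x\<bar> \<le> B"
  unfolding bm_def by (meson abs_ge_zero order_trans)

lemma bm_const: "bm (\<lambda>_. c)"
  by (rule bmI[of _ "\<bar>c\<bar>"]) auto

lemma bm_add: "bm f \<Longrightarrow> bm g \<Longrightarrow> bm (\<lambda>x. f x + g x)"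
proof -
  assume f: "bm f" and g: "bm g"
  obtain B C where "\<forall>x. \<bar>f x\<bar> \<le> B" "\<forall>x. \<bar>g x\<bar> \<le> C" using f g unfolding bm_def by blast
  then show ?thesis
    using f g by (intro bmI[of _ "B + C"]) (auto simp: bm_def intro!: order_trans[OF abs_triangle_ineq] add_mono)
qed

lemma bm_mult: "bm f \<Longrightarrow> bm g \<Longrightarrow> bm (\<lambda>x. f x * g x)"
proof -
  assume f: "bm f" and g: "bm g"
  obtain B C where "B \<ge> 0" "\<forall>x. \<bar>f x\<bar> \<le> B" "\<forall>x. \<bar>g x\<bar> \<le> C" using bm_bounded[OF f] bm_bounded[OF g] by blast
  then show ?thesis
    using f g by (intro bmI[of _ "B * C"]) (auto simp: bm_def abs_mult intro!: mult_mono)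
qed

lemma bm_uminus: "bm f \<Longrightarrow> bm (\<lambda>x. - f x)"
  using bm_mult[OF bm_const[of "-1"]] by simp

lemma bm_diff: "bm f \<Longrightarrow> bm g \<Longrightarrow> bm (\<lambda>x. f x - g x)"
  using bm_add[OF _ bm_uminus] by fastforce

lemma bm_power: "bm f \<Longrightarrow> bm (\<lambda>x. f x ^ k)"
  by (induction k) (auto intro: bm_const bm_mult)

lemma bm_sum: "(\<And>i. i \<in> I \<Longrightarrow> bm (f i)) \<Longrightarrow> bm (\<lambda>x. \<Sum>i\<in>I. f i x)"
  by (induction I rule: infinite_finite_induct) (auto intro: bm_const bm_add)

lemma bm_compose: "bm f \<Longrightarrow> g \<in> borel_measurable borel \<Longrightarrow> bm (\<lambda>x. f (g x))"
  unfolding bm_def by (auto intro: measurable_compose)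

lemma bm_indicator: "A \<in> sets borel \<Longrightarrow> bm (indicator A)"
  by (rule bmI[of _ 1]) (auto simp: indicator_def)

lemma borel_measurable_fst_raw:
  fixes f :: "'a \<Rightarrow> 'b::topological_space \<times> 'c::topological_space"
  shows "f \<in> borel_measurable M \<Longrightarrow> (\<lambda>x. fst (f x)) \<in> borel_measurable M"
  by (rule measurable_compose[OF _ borel_measurable_continuous_onI]) (auto intro: continuous_on_fst continuous_on_id)

lemma borel_measurable_snd_raw:
  fixes f :: "'a \<Rightarrow> 'b::topological_space \<times> 'c::topological_space"
  shows "f \<in> borel_measurable M \<Longrightarrow> (\<lambda>x. snd (f x)) \<in> borel_measurable M"
  by (rule measurable_compose[OF _ borel_measurable_continuous_onI]) (auto intro: continuous_on_snd continuous_on_id)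

lemmas bm_intros = bm_const bm_add bm_mult bm_uminus bm_diff bm_power bm_sum

lemma integral_bm:
  assumes "finite_measure M" "sets M = sets borel" "bm f"
  shows "integrable M f"
proof -
  interpret finite_measure M by fact
  obtain B where "\<forall>x. \<bar>f x\<bar> \<le> B" using assms(3) unfolding bm_def by blast
  then show ?thesis
    using bm_measurable[OF assms(3)] measurable_cong_sets[OF assms(2) refl, of borel]
    by (intro integrable_const_bound[of _ B]) auto
qed

lemma orthonormal_distance:
  fixes e :: "'s \<Rightarrow> 'b::topological_space \<Rightarrow> real"
  assumes M: "finite_measure M" "sets M = sets borel" and S: "finite S"
    and f: "bm f" and e: "\<And>s. s \<in> S \<Longrightarrow> bm (e s)"
    and ort: "\<And>s r. s \<in> S \<Longrightarrow> r \<in> S \<Longrightarrow> (LINT x|M. e s x * e r x) = (if s = r then 1 else 0)"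
  shows "(LINT x|M. (f x - (\<Sum>s\<in>S. c s * e s x))\<^sup>2) =
    (LINT x|M. (f x)\<^sup>2) - 2 * (\<Sum>s\<in>S. c s * (LINT x|M. f x * e s x)) + (\<Sum>s\<in>S. (c s)\<^sup>2)"
proof -
  note i = integral_bm[OF M]
  have 1: "(f x - (\<Sum>s\<in>S. c s * e s x))\<^sup>2 = (f x)\<^sup>2 - 2 * (\<Sum>s\<in>S. c s * (f x * e s x)) +
      (\<Sum>s\<in>S. \<Sum>r\<in>S. c s * c r * (e s x * e r x))" for x
    by (simp add: power2_eq_square algebra_simps sum_product sum_distrib_left sum_distrib_right)
  have 2: "(LINT x|M. (\<Sum>s\<in>S. \<Sum>r\<in>S. c s * c r * (e s x * e r x))) = (\<Sum>s\<in>S. (c s)\<^sup>2)"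
  proof -
    have "(LINT x|M. (\<Sum>s\<in>S. \<Sum>r\<in>S. c s * c r * (e s x * e r x))) =
        (\<Sum>s\<in>S. LINT x|M. (\<Sum>r\<in>S. c s * c r * (e s x * e r x)))"
      by (intro Bochner_Integration.integral_sum i bm_intros e)
    also have "\<dots> = (\<Sum>s\<in>S. \<Sum>r\<in>S. LINT x|M. c s * c r * (e s x * e r x))"
      by (intro sum.cong refl Bochner_Integration.integral_sum i bm_intros e)
    also have "\<dots> = (\<Sum>s\<in>S. \<Sum>r\<in>S. if s = r then (c s)\<^sup>2 else 0)"
      by (intro sum.cong refl) (simp add: ort power2_eq_square)
    also have "\<dots> = (\<Sum>s\<in>S. (c s)\<^sup>2)" using S by simp
    finally show ?thesis .
  qed
  have 3: "(LINT x|M. (\<Sum>s\<in>S. c s * (f x * e s x))) = (\<Sum>s\<in>S. c s * (LINT x|M. f x * e s x))"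
    by (subst Bochner_Integration.integral_sum) (auto intro!: i bm_intros e f)
  have "(LINT x|M. (f x - (\<Sum>s\<in>S. c s * e s x))\<^sup>2) =
     (LINT x|M. (f x)\<^sup>2 - 2 * (\<Sum>s\<in>S. c s * (f x * e s x))) +
      (LINT x|M. (\<Sum>s\<in>S. \<Sum>r\<in>S. c s * c r * (e s x * e r x)))"
    unfolding 1 by (rule Bochner_Integration.integral_add) (auto intro!: i bm_intros e f)
  also have "(LINT x|M. (f x)\<^sup>2 - 2 * (\<Sum>s\<in>S. c s * (f x * e s x))) =
      (LINT x|M. (f x)\<^sup>2) - (LINT x|M. 2 * (\<Sum>s\<in>S. c s * (f x * e s x)))"
    by (rule Bochner_Integration.integral_diff) (auto intro!: i bm_intros e f)
  also have "(LINT x|M. 2 * (\<Sum>s\<in>S. c s * (f x * e s x))) = 2 * (LINT x|M. (\<Sum>s\<in>S. c s * (f x * e s x)))"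
    by (rule integral_mult_right_zero)
  finally show ?thesis unfolding 2 3 .
qed

text \<open>The third part is the best approximation property: by
  \<open>orthonormal_distance\<close> any other choice of coefficients adds the sum of the squared
  deviations \<open>c s\<close> minus Fourier coefficient.\<close>

lemma bessel:
  fixes e :: "'s \<Rightarrow> 'b::topological_space \<Rightarrow> real"
  assumes M: "finite_measure M" "sets M = sets borel" and S: "finite S"
    and f: "bm f" and e: "\<And>s. s \<in> S \<Longrightarrow> bm (e s)"
    and ort: "\<And>s r. s \<in> S \<Longrightarrow> r \<in> S \<Longrightarrow> (LINT x|M. e s x * e r x) = (if s = r then 1 else 0)"
  shows "(LINT x|M. (f x - (\<Sum>s\<in>S. (LINT x|M. f x * e s x) * e s x))\<^sup>2) =
    (LINT x|M. (f x)\<^sup>2) - (\<Sum>s\<in>S. (LINT x|M. f x * e s x)\<^sup>2)"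
    and "(\<Sum>s\<in>S. (LINT x|M. f x * e s x)\<^sup>2) \<le> (LINT x|M. (f x)\<^sup>2)"
    and "(LINT x|M. (f x)\<^sup>2) - (\<Sum>s\<in>S. (LINT x|M. f x * e s x)\<^sup>2) \<le> (LINT x|M. (f x - (\<Sum>s\<in>S. c s * e s x))\<^sup>2)"
proof -
  note D = orthonormal_distance[OF assms]
  show 1: "(LINT x|M. (f x - (\<Sum>s\<in>S. (LINT x|M. f x * e s x) * e s x))\<^sup>2) =
    (LINT x|M. (f x)\<^sup>2) - (\<Sum>s\<in>S. (LINT x|M. f x * e s x)\<^sup>2)"
    using D[where c = "\<lambda>s. LINT x|M. f x * e s x"] by (simp add: power2_eq_square)
  have "0 \<le> (LINT x|M. (f x - (\<Sum>s\<in>S. (LINT x|M. f x * e s x) * e s x))\<^sup>2)"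
    by (intro Bochner_Integration.integral_nonneg) auto
  then show "(\<Sum>s\<in>S. (LINT x|M. f x * e s x)\<^sup>2) \<le> (LINT x|M. (f x)\<^sup>2)" unfolding 1 by simp
  have "0 \<le> (\<Sum>s\<in>S. (c s - (LINT x|M. f x * e s x))\<^sup>2)" by (intro sum_nonneg) auto
  also have "\<dots> = (\<Sum>s\<in>S. (c s)\<^sup>2) - 2 * (\<Sum>s\<in>S. c s * (LINT x|M. f x * e s x)) + (\<Sum>s\<in>S. (LINT x|M. f x * e s x)\<^sup>2)"
    by (simp add: power2_diff sum.distrib sum_subtractf sum_distrib_left mult.assoc)
  finally have n: "0 \<le> (\<Sum>s\<in>S. (c s)\<^sup>2) - 2 * (\<Sum>s\<in>S. c s * (LINT x|M. f x * e s x)) + (\<Sum>s\<in>S. (LINT x|M. f x * e s x)\<^sup>2)" .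
  have arith: "A - E \<le> X" if "0 \<le> C - 2 * B + E" "X = A - 2 * B + C" for A B C E X :: real
    using that by simp
  show "(LINT x|M. (f x)\<^sup>2) - (\<Sum>s\<in>S. (LINT x|M. f x * e s x)\<^sup>2) \<le> (LINT x|M. (f x - (\<Sum>s\<in>S. c s * e s x))\<^sup>2)"
    by (rule arith[OF n D])
qed

section \<open>Lebesgue measure on the interval\<close>

locale interval =
  fixes t T :: real
  assumes t_less_T: "t < T"
begin

text \<open>A density instead of a subspace keeps functions on the whole line with the Borel
  sigma-algebra. The half-open interval is tiled exactly by the cells of a grid.\<close>

definition \<mu> :: "real measure" where "\<mu> = density lborel (\<lambda>x. ennreal (indicator {t..<T} x))"

abbreviation LI :: "(real \<Rightarrow> real) \<Rightarrow> real" where "LI f \<equiv> integral\<^sup>L \<mu> f"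

lemma sets_\<mu> [simp, measurable_cong]: "sets \<mu> = sets borel" by (simp add: \<mu>_def)
lemma space_\<mu> [simp]: "space \<mu> = UNIV" by (simp add: \<mu>_def)

lemma emeasure_\<mu>: "A \<in> sets borel \<Longrightarrow> emeasure \<mu> A = emeasure lborel (A \<inter> {t..<T})"
  unfolding \<mu>_def by (subst emeasure_density) (auto simp: nn_integral_indicator[symmetric] ennreal_indicator
      indicator_inter_arith[symmetric] mult.commute simp del: nn_integral_indicator intro!: nn_integral_cong)

lemma measure_\<mu>_UNIV: "measure \<mu> UNIV = T - t"
  using t_less_T by (simp add: measure_def emeasure_\<mu>)

sublocale finite_measure \<mu>
  using t_less_T by (intro finite_measureI) (simp add: emeasure_\<mu>)

lemma AE_\<mu>: "AE x in \<mu>. x \<in> {t..<T}"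
  unfolding \<mu>_def by (subst AE_density) (auto simp: indicator_def)

text \<open>Allows ties with a fixed point to be ignored inside an integral; see
  \<open>LI_neq_cong\<close>.\<close>

lemma AE_\<mu>_neq: "AE x in \<mu>. x \<noteq> c"
proof (rule AE_I')
  show "{c} \<in> null_sets \<mu>"
    using emeasure_\<mu>[of "{c}"] by (auto simp: null_sets_def intro: order.antisym[OF order_trans[OF emeasure_mono[of _ "{c}"]]])
qed auto

lemma LI_eq: "f \<in> borel_measurable borel \<Longrightarrow> LI f = (LINT x|lborel. indicator {t..<T} x * f x)"
  unfolding \<mu>_def by (subst integral_density) auto

lemma integrable_\<mu>: "bm f \<Longrightarrow> integrable \<mu> f"
  by (rule integral_bm) (auto intro: finite_measure_axioms)

lemma LI_cong: "(\<And>x. x \<in> {t..<T} \<Longrightarrow> f x = g x) \<Longrightarrow> f \<in> borel_measurable borel \<Longrightarrow> g \<in> borel_measurable borel \<Longrightarrow> LI f = LI g"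
  using AE_\<mu> by (intro integral_cong_AE) auto

lemma LI_tendsto:
  assumes "\<And>n. f n \<in> borel_measurable borel" "g \<in> borel_measurable borel" "\<And>n x. \<bar>f n x\<bar> \<le> B"
    and "\<And>x. x \<in> {t..<T} \<Longrightarrow> (\<lambda>n. f n x) \<longlonglongrightarrow> g x"
  shows "(\<lambda>n. LI (f n)) \<longlonglongrightarrow> LI g"
proof (rule integral_dominated_convergence[where w = "\<lambda>_. B"])
  show "AE x in \<mu>. (\<lambda>n. f n x) \<longlonglongrightarrow> g x"
    using AE_\<mu> by (rule eventually_mono) (rule assms(4))
qed (use assms in auto)

lemma bm_LI:
  fixes f :: "'b::second_countable_topology \<Rightarrow> real \<Rightarrow> real"
  assumes "bm (\<lambda>p. f (fst p) (snd p))"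
  shows "bm (\<lambda>x. LI (f x))"
proof -
  from bm_bounded[OF assms] obtain B where B: "B \<ge> 0" "\<And>x y. \<bar>f x y\<bar> \<le> B" by auto
  have m: "(\<lambda>p. f (fst p) (snd p)) \<in> borel_measurable (borel \<Otimes>\<^sub>M \<mu>)"
    using bm_measurable[OF assms]
    by (subst measurable_cong_sets[OF sets_pair_measure_cong[OF refl sets_\<mu>] refl]) (simp add: borel_prod)
  show ?thesis
  proof (rule bmI)
    show "(\<lambda>x. LI (f x)) \<in> borel_measurable borel"
      using m by (intro borel_measurable_lebesgue_integral) (simp add: split_def)
    fix x
    have "\<bar>LI (f x)\<bar> \<le> LI (\<lambda>y. \<bar>f x y\<bar>)" by (rule integral_abs_bound)
    also have "\<dots> \<le> LI (\<lambda>y. B)"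
      using B by (intro integral_mono') auto
    finally show "\<bar>LI (f x)\<bar> \<le> B * (T - t)" by (simp add: measure_\<mu>_UNIV mult.commute)
  qed
qed

sublocale pair: pair_sigma_finite \<mu> \<mu> ..

lemma sets_\<mu>2: "sets (\<mu> \<Otimes>\<^sub>M \<mu>) = sets (borel :: (real \<times> real) measure)"
  using sets_pair_measure_cong[OF sets_\<mu> sets_\<mu>] by (simp only: borel_prod)

lemma finite_\<mu>2: "finite_measure (\<mu> \<Otimes>\<^sub>M \<mu>)"
  by (rule finite_measure_pair_measure) (auto intro: finite_measure_axioms)

lemma integral_\<mu>2:
  assumes "bm (\<lambda>p. f (fst p) (snd p))"
  shows "(LINT p|(\<mu> \<Otimes>\<^sub>M \<mu>). f (fst p) (snd p)) = LI (\<lambda>x. LI (f x))"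
  using pair.integral_fst'[of "\<lambda>p. f (fst p) (snd p)"] integral_bm[OF finite_\<mu>2 sets_\<mu>2 assms] by simp

lemma LI_swap:
  assumes "bm (\<lambda>p. f (fst p) (snd p))"
  shows "LI (\<lambda>x. LI (\<lambda>y. f x y)) = LI (\<lambda>y. LI (\<lambda>x. f x y))"
  using pair.Fubini_integral[of f] integral_bm[OF finite_\<mu>2 sets_\<mu>2 assms] by (simp add: split_def)

end

section \<open>The closed span of a system and completeness\<close>

locale bm_system = interval +
  fixes \<psi> :: "nat \<Rightarrow> real \<Rightarrow> real"
  assumes bm_\<psi>: "bm (\<psi> j)"
begin

text \<open>Membership in the L2 closure of the linear span of the system.\<close>

definition apx :: "(real \<Rightarrow> real) \<Rightarrow> bool" where
  "apx f \<longleftrightarrow> (\<forall>\<epsilon>>0. \<exists>p c. LI (\<lambda>x. (f x - (\<Sum>j\<le>p. c j * \<psi> j x))\<^sup>2) < \<epsilon>)"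

lemma LI_square_add_le:
  assumes "bm f" "bm g"
  shows "LI (\<lambda>x. (f x + g x)\<^sup>2) \<le> 2 * LI (\<lambda>x. (f x)\<^sup>2) + 2 * LI (\<lambda>x. (g x)\<^sup>2)"
proof -
  have "LI (\<lambda>x. (f x + g x)\<^sup>2) \<le> LI (\<lambda>x. 2 * (f x)\<^sup>2 + 2 * (g x)\<^sup>2)"
  proof (intro integral_mono integrable_\<mu> bm_intros assms)
    show "(f x + g x)\<^sup>2 \<le> 2 * (f x)\<^sup>2 + 2 * (g x)\<^sup>2" for x
      using sum_squares_bound[of "f x" "g x"] by (simp add: power2_sum)
  qed
  also have "\<dots> = LI (\<lambda>x. 2 * (f x)\<^sup>2) + LI (\<lambda>x. 2 * (g x)\<^sup>2)"
    by (intro Bochner_Integration.integral_add integrable_\<mu> bm_intros assms)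
  finally show ?thesis by simp
qed

lemma apx_close:
  assumes f: "bm f" and g: "\<And>\<epsilon>. \<epsilon> > 0 \<Longrightarrow> \<exists>g. bm g \<and> apx g \<and> LI (\<lambda>x. (f x - g x)\<^sup>2) < \<epsilon>"
  shows "apx f"
  unfolding apx_def
proof (intro allI impI)
  fix \<epsilon> :: real assume "\<epsilon> > 0"
  then obtain g where g: "bm g" "apx g" "LI (\<lambda>x. (f x - g x)\<^sup>2) < \<epsilon> / 4" using g[of "\<epsilon> / 4"] by auto
  have "\<epsilon> / 4 > 0" using \<open>\<epsilon> > 0\<close> by simp
  then obtain p c where pc: "LI (\<lambda>x. (g x - (\<Sum>j\<le>p. c j * \<psi> j x))\<^sup>2) < \<epsilon> / 4"
    using g(2) unfolding apx_def by blast
  have "LI (\<lambda>x. ((f x - g x) + (g x - (\<Sum>j\<le>p. c j * \<psi> j x)))\<^sup>2) \<le>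
     2 * LI (\<lambda>x. (f x - g x)\<^sup>2) + 2 * LI (\<lambda>x. (g x - (\<Sum>j\<le>p. c j * \<psi> j x))\<^sup>2)"
    by (intro LI_square_add_le bm_intros f g bm_\<psi>)
  also have "\<dots> < \<epsilon>" using g(3) pc by simp
  finally show "\<exists>p c. LI (\<lambda>x. (f x - (\<Sum>j\<le>p. c j * \<psi> j x))\<^sup>2) < \<epsilon>" by auto
qed

lemma apx_cmult: assumes "bm f" "apx f" shows "apx (\<lambda>x. a * f x)"
  unfolding apx_def
proof (intro allI impI)
  fix \<epsilon> :: real assume "\<epsilon> > 0"
  \<comment> \<open>The summand 1 avoids a separate case for \<open>a = 0\<close>.\<close>
  define \<eta> where "\<eta> = \<epsilon> / (a\<^sup>2 + 1)"
  have s: "a\<^sup>2 + 1 > 0" by (rule add_nonneg_pos) auto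
  then have "\<eta> > 0" using \<open>\<epsilon> > 0\<close> by (simp add: \<eta>_def)
  then obtain p c where pc: "LI (\<lambda>x. (f x - (\<Sum>j\<le>p. c j * \<psi> j x))\<^sup>2) < \<eta>"
    using assms(2) unfolding apx_def by blast
  have nn: "0 \<le> LI (\<lambda>x. (f x - (\<Sum>j\<le>p. c j * \<psi> j x))\<^sup>2)" by (intro Bochner_Integration.integral_nonneg) auto
  have e: "(a * f x - (\<Sum>j\<le>p. (a * c j) * \<psi> j x))\<^sup>2 = a\<^sup>2 * (f x - (\<Sum>j\<le>p. c j * \<psi> j x))\<^sup>2" for x
    by (simp add: power_mult_distrib[symmetric] right_diff_distrib sum_distrib_left mult.assoc)
  have "LI (\<lambda>x. (a * f x - (\<Sum>j\<le>p. (a * c j) * \<psi> j x))\<^sup>2) = a\<^sup>2 * LI (\<lambda>x. (f x - (\<Sum>j\<le>p. c j * \<psi> j x))\<^sup>2)"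
    unfolding e by simp
  also have "\<dots> \<le> (a\<^sup>2 + 1) * LI (\<lambda>x. (f x - (\<Sum>j\<le>p. c j * \<psi> j x))\<^sup>2)"
    using nn by (intro mult_right_mono) auto
  also have "\<dots> < (a\<^sup>2 + 1) * \<eta>" using pc s by (rule mult_strict_left_mono)
  also have "\<dots> = \<epsilon>" using s by (simp add: \<eta>_def)
  finally show "\<exists>p c. LI (\<lambda>x. (a * f x - (\<Sum>j\<le>p. c j * \<psi> j x))\<^sup>2) < \<epsilon>"
    by (intro exI[of _ p] exI[of _ "\<lambda>j. a * c j"])
qed

lemma apx_add: assumes f: "bm f" "apx f" and g: "bm g" "apx g" shows "apx (\<lambda>x. f x + g x)"
  unfolding apx_def
proof (intro allI impI)
  fix \<epsilon> :: real assume "\<epsilon> > 0"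
  then have e4: "\<epsilon> / 4 > 0" by simp
  obtain p c where pc: "LI (\<lambda>x. (f x - (\<Sum>j\<le>p. c j * \<psi> j x))\<^sup>2) < \<epsilon> / 4"
    using f(2) e4 unfolding apx_def by blast
  obtain q d where qd: "LI (\<lambda>x. (g x - (\<Sum>j\<le>q. d j * \<psi> j x))\<^sup>2) < \<epsilon> / 4"
    using g(2) e4 unfolding apx_def by blast
  define c' where "c' j = (if j \<le> p then c j else 0)" for j
  define d' where "d' j = (if j \<le> q then d j else 0)" for j
  have c': "(\<Sum>j\<le>p. c j * \<psi> j x) = (\<Sum>j\<le>max p q. c' j * \<psi> j x)" for x
    by (rule sum.mono_neutral_cong_left) (auto simp: c'_def)
  have d': "(\<Sum>j\<le>q. d j * \<psi> j x) = (\<Sum>j\<le>max p q. d' j * \<psi> j x)" for x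
    by (rule sum.mono_neutral_cong_left) (auto simp: d'_def)
  have "LI (\<lambda>x. ((f x + g x) - (\<Sum>j\<le>max p q. (c' j + d' j) * \<psi> j x))\<^sup>2) =
      LI (\<lambda>x. ((f x - (\<Sum>j\<le>p. c j * \<psi> j x)) + (g x - (\<Sum>j\<le>q. d j * \<psi> j x)))\<^sup>2)"
    unfolding c' d' by (simp add: distrib_right sum.distrib algebra_simps)
  also have "\<dots> \<le> 2 * LI (\<lambda>x. (f x - (\<Sum>j\<le>p. c j * \<psi> j x))\<^sup>2) + 2 * LI (\<lambda>x. (g x - (\<Sum>j\<le>q. d j * \<psi> j x))\<^sup>2)"
    by (intro LI_square_add_le bm_intros f g bm_\<psi>)
  also have "\<dots> < \<epsilon>" using pc qd by simp
  finally show "\<exists>p c. LI (\<lambda>x. (f x + g x - (\<Sum>j\<le>p. c j * \<psi> j x))\<^sup>2) < \<epsilon>"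
    by (intro exI[of _ "max p q"] exI[of _ "\<lambda>j. c' j + d' j"])
qed

text \<open>Dominated convergence turns bounded almost everywhere limits into L2 limits, under which
  the closed span is stable.\<close>

lemma apx_limit:
  assumes f: "bm f" and g: "\<And>n. bm (g n)" "\<And>n. apx (g n)" "\<And>n x. \<bar>g n x\<bar> \<le> B" "AE x in \<mu>. (\<lambda>n. g n x) \<longlonglongrightarrow> f x"
  shows "apx f"
proof (rule apx_close[OF f])
  fix \<epsilon> :: real assume "\<epsilon> > 0"
  obtain C where C: "\<And>x. \<bar>f x\<bar> \<le> C" using f unfolding bm_def by blast
  have "(\<lambda>n. LI (\<lambda>x. (f x - g n x)\<^sup>2)) \<longlonglongrightarrow> LI (\<lambda>x. 0)"
  proof (rule integral_dominated_convergence[where w = "\<lambda>_. (C + B)\<^sup>2"])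
    show "(\<lambda>x. (f x - g n x)\<^sup>2) \<in> borel_measurable \<mu>" for n
      using bm_measurable[OF bm_power[OF bm_diff[OF f g(1)[of n]], of 2]] by simp
    show "AE x in \<mu>. norm ((f x - g n x)\<^sup>2) \<le> (C + B)\<^sup>2" for n
    proof (intro always_eventually allI)
    fix x
    have "\<bar>f x - g n x\<bar> \<le> C + B" using C[of x] g(3)[of n x] by linarith
    from power_mono[OF this abs_ge_zero, of 2] show "norm ((f x - g n x)\<^sup>2) \<le> (C + B)\<^sup>2" by simp
    qed
    show "AE x in \<mu>. (\<lambda>n. (f x - g n x)\<^sup>2) \<longlonglongrightarrow> 0"
      using g(4)
    proof eventually_elim
      case (elim x)
      show ?case using tendsto_power[OF tendsto_diff[OF tendsto_const elim], of "f x" 2] by simp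
    qed
  qed auto
  then have "\<forall>\<^sub>F n in sequentially. LI (\<lambda>x. (f x - g n x)\<^sup>2) < \<epsilon>"
    using \<open>\<epsilon> > 0\<close> by (intro order_tendstoD) auto
  then obtain n where "LI (\<lambda>x. (f x - g n x)\<^sup>2) < \<epsilon>"
    by (meson eventually_happens trivial_limit_sequentially)
  then show "\<exists>g. bm g \<and> apx g \<and> LI (\<lambda>x. (f x - g x)\<^sup>2) < \<epsilon>" using g by blast
qed

lemma apx_uniform:
  assumes f: "bm f" and u: "\<And>e. 0 < e \<Longrightarrow> \<exists>p c. \<forall>x\<in>{t..<T}. \<bar>f x - (\<Sum>j\<le>p. c j * \<psi> j x)\<bar> \<le> e"
  shows "apx f"
  unfolding apx_def
proof (intro allI impI)
  fix \<epsilon> :: real assume "\<epsilon> > 0"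
  \<comment> \<open>Chosen so that the length of the interval times \<open>e\<^sup>2\<close> is half
    of \<open>\<epsilon>\<close>.\<close>
  define e where "e = sqrt (\<epsilon> / (2 * (T - t)))"
  have "0 < \<epsilon> / (2 * (T - t))" using \<open>\<epsilon> > 0\<close> t_less_T by simp
  then have e: "0 < e" "e\<^sup>2 = \<epsilon> / (2 * (T - t))" by (simp_all add: e_def)
  from u[OF e(1)] obtain p c where pc: "\<And>x. x \<in> {t..<T} \<Longrightarrow> \<bar>f x - (\<Sum>j\<le>p. c j * \<psi> j x)\<bar> \<le> e" by blast
  have b: "bm (\<lambda>x. (f x - (\<Sum>j\<le>p. c j * \<psi> j x))\<^sup>2)" by (intro bm_intros f bm_\<psi>)
  have "LI (\<lambda>x. (f x - (\<Sum>j\<le>p. c j * \<psi> j x))\<^sup>2) \<le> LI (\<lambda>x. e\<^sup>2)"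
  proof (intro integral_mono_AE integrable_\<mu> b bm_const)
    show "AE x in \<mu>. (f x - (\<Sum>j\<le>p. c j * \<psi> j x))\<^sup>2 \<le> e\<^sup>2"
      using AE_\<mu>
    proof eventually_elim
      case (elim x)
      from power_mono[OF pc[OF elim] abs_ge_zero, of 2] show ?case by simp
    qed
  qed
  also have "\<dots> = (T - t) * (\<epsilon> / (2 * (T - t)))" by (simp only: lebesgue_integral_const e(2) measure_\<mu>_UNIV space_\<mu> real_scaleR_def)
  also have "\<dots> = \<epsilon> / 2" using t_less_T by (simp add: field_simps)
  also have "\<dots> < \<epsilon>" using \<open>\<epsilon> > 0\<close> by simp
  finally show "\<exists>p c. LI (\<lambda>x. (f x - (\<Sum>j\<le>p. c j * \<psi> j x))\<^sup>2) < \<epsilon>" by blast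
qed

end

text \<open>Completeness is asked for bounded continuous functions only, because this is what
  Weierstrass approximation delivers for the two concrete systems; \<open>apx_bm\<close> extends it
  to all bounded Borel functions.\<close>

locale onb = bm_system +
  assumes orthonormal: "LI (\<lambda>x. \<psi> i x * \<psi> j x) = (if i = j then 1 else 0)"
    and dense: "continuous_on UNIV g \<Longrightarrow> bm g \<Longrightarrow> apx g"
begin

lemmas apx_continuous = dense

lemma apx_sum: "finite I \<Longrightarrow> (\<And>i. i \<in> I \<Longrightarrow> bm (f i)) \<Longrightarrow> (\<And>i. i \<in> I \<Longrightarrow> apx (f i)) \<Longrightarrow> apx (\<lambda>x. \<Sum>i\<in>I. f i x)"
proof (induction I rule: finite_induct)
  case empty
  then show ?case by (simp add: apx_continuous bm_const)
next
  case (insert i I)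
  then show ?case by (simp add: apx_add bm_sum)
qed

text \<open>Dynkin's argument: half-lines form an intersection-stable generator and are limits of
  continuous functions; complements and disjoint unions are handled by linearity and bounded
  limits.\<close>

lemma apx_indicator:
  assumes "A \<in> sets borel"
  shows "apx (indicator A)"
proof -
  have "Int_stable (range (\<lambda>a::real. {..a}))"
    by (auto simp: Int_stable_def)
  moreover have "range (\<lambda>a::real. {..a}) \<subseteq> Pow UNIV" by simp
  moreover have b: "sets borel = sigma_sets UNIV (range (\<lambda>a::real. {..a}))"
    by (subst borel_eq_atMost) simp
  then have "A \<in> sigma_sets UNIV (range (\<lambda>a. {..a}))" using assms by simp
  ultimately show ?thesis
  proof (induction rule: sigma_sets_induct_disjoint)
    case (basic A)
    then obtain a where A: "A = {..a}" by auto
    \<comment> \<open>Continuous ramps: equal to 1 up to \<open>a\<close>, then falling to 0 with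
      slope \<open>n\<close>.\<close>
    define g where "g n x = max 0 (min 1 (1 - real n * (x - a)))" for n x
    have c: "continuous_on UNIV (g n)" for n unfolding g_def by (intro continuous_intros)
    have gb: "\<bar>g n x\<bar> \<le> 1" for n x by (simp add: g_def)
    have bmg: "bm (g n)" for n
      using c gb by (intro bmI[of _ 1] borel_measurable_continuous_onI)
    show ?case
    proof (rule apx_limit[OF bm_indicator bmg apx_continuous[OF c bmg] gb always_eventually])
      show "A \<in> sets borel" using A by simp
      show "\<forall>x. (\<lambda>n. g n x) \<longlonglongrightarrow> indicator A x"
      proof
      fix x
      show "(\<lambda>n. g n x) \<longlonglongrightarrow> indicator A x"
      proof (cases "x \<le> a")
        case True
        then have "g n x = 1" for n using mult_nonneg_nonpos[of "real n" "x - a"] by (simp add: g_def)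
        then show ?thesis using True A by simp
      next
        case False
        then obtain N where N: "1 < real N * (x - a)" using reals_Archimedean3[of "x - a"] by auto
        have "g n x = 0" if "n \<ge> N" for n
        proof -
          have "real N * (x - a) \<le> real n * (x - a)" using that False by (intro mult_right_mono) auto
          then show ?thesis using N by (simp add: g_def)
        qed
        then have "\<forall>\<^sub>F n in sequentially. g n x = 0" by (auto simp: eventually_sequentially)
        then show ?thesis using False A by (simp add: tendsto_eventually)
      qed
      qed
    qed
  next
    case empty
    then show ?case using apx_continuous[of "\<lambda>_. 0"] by (simp add: bm_const)
  next
    case (compl A)
    have "indicator (UNIV - A) = (\<lambda>x. (1::real) + (-1) * indicator A x)" by (auto simp: indicator_def)
    moreover have "apx (\<lambda>x. (1::real) + (-1) * indicator A x)"
    proof (rule apx_add[OF bm_const apx_continuous[OF _ bm_const] bm_mult[OF bm_const] apx_cmult])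
      show "bm (indicator A)" using compl(1) b by (intro bm_indicator) simp
      then show "bm (indicator A)" .
      show "apx (indicator A)" by (rule compl)
    qed simp
    ultimately show ?case by simp
  next
    case (union A)
    have m: "A i \<in> sets borel" for i using union(2) b by auto
    show ?case
    proof (rule apx_limit[where g = "\<lambda>n x. \<Sum>i<n. indicator (A i) x" and B = 1])
      show "bm (indicator (\<Union> (range A)))" using m by (intro bm_indicator) auto
      show "bm (\<lambda>x. \<Sum>i<n. indicator (A i) x)" for n using m by (intro bm_sum bm_indicator)
      show "apx (\<lambda>x. \<Sum>i<n. indicator (A i) x)" for n using m union by (intro apx_sum bm_indicator) auto
      have e: "(\<Sum>i<n. indicator (A i) x) = indicator (\<Union>i<n. A i) x" for n and x
        using union(1) by (subst indicator_UN_disjoint) (auto intro: disjoint_family_on_mono)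
      show "\<bar>\<Sum>i<n. indicator (A i) x\<bar> \<le> (1::real)" for n x
        unfolding e by (simp add: indicator_def)
      show "AE x in \<mu>. (\<lambda>n. \<Sum>i<n. indicator (A i) x) \<longlonglongrightarrow> (indicator (\<Union> (range A)) x :: real)"
        unfolding e by (intro always_eventually allI LIMSEQ_indicator_UN)
    qed
  qed
qed

text \<open>Simple functions converge pointwise to \<open>f\<close> and are bounded by twice its
  bound, so \<open>apx_limit\<close> applies.\<close>

lemma apx_bm:
  assumes f: "bm f"
  shows "apx f"
proof -
  obtain B where B: "B \<ge> 0" "\<And>x. \<bar>f x\<bar> \<le> B" using bm_bounded[OF f] by blast
  obtain s where s: "\<And>i. simple_function borel (s i)" "\<And>x. (\<lambda>i. s i x) \<longlonglongrightarrow> f x"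
    "\<And>i x. norm (s i x) \<le> 2 * norm (f x)"
    using borel_measurable_implies_sequence_metric[OF bm_measurable[OF f], of 0] by auto
  have fin: "finite (range (s i))" for i using simple_functionD(1)[OF s(1)[of i]] by simp
  have lv: "s i -` {y} \<in> sets borel" for i y using simple_functionD(2)[OF s(1), of i "{y}"] by simp
  have e: "s i = (\<lambda>x. \<Sum>y\<in>range (s i). y * indicator (s i -` {y}) x)" for i
  proof
    fix x
    have "(\<Sum>y\<in>range (s i). y * indicator (s i -` {y}) x) = (\<Sum>y\<in>range (s i). if s i x = y then y else 0)"
      by (intro sum.cong) (auto simp: indicator_def)
    then show "s i x = (\<Sum>y\<in>range (s i). y * indicator (s i -` {y}) x)" using fin by simp
  qed
  have bms: "bm (s i)" and aps: "apx (s i)" for i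
    by (subst e, intro bm_intros bm_indicator lv)
      (subst e, intro apx_sum apx_cmult apx_indicator bm_intros bm_indicator lv fin)
  show ?thesis
  proof (rule apx_limit[OF f bms aps])
    show "\<bar>s i x\<bar> \<le> 2 * B" for i x using s(3)[of i x] B(2)[of x] by simp
    show "AE x in \<mu>. (\<lambda>i. s i x) \<longlonglongrightarrow> f x" using s(2) by simp
  qed
qed

abbreviation cf :: "(real \<Rightarrow> real) \<Rightarrow> nat \<Rightarrow> real" where "cf f j \<equiv> LI (\<lambda>x. f x * \<psi> j x)"

lemma bessel1:
  assumes "bm f"
  shows "(\<Sum>j\<le>p. (cf f j)\<^sup>2) \<le> LI (\<lambda>x. (f x)\<^sup>2)"
  by (rule bessel(2)[OF finite_measure_axioms sets_\<mu> _ assms bm_\<psi>]) (auto simp: orthonormal)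

text \<open>One good approximation of degree \<open>p\<close> bounds the defect of the Fourier sum
  at \<open>p\<close> by best approximation; the defect only decreases afterwards.\<close>

lemma parseval1:
  assumes "bm f"
  shows "(\<lambda>p. \<Sum>j\<le>p. (cf f j)\<^sup>2) \<longlonglongrightarrow> LI (\<lambda>x. (f x)\<^sup>2)"
proof (rule LIMSEQ_I)
  fix r :: real assume "r > 0"
  then obtain p c where pc: "LI (\<lambda>x. (f x - (\<Sum>j\<le>p. c j * \<psi> j x))\<^sup>2) < r"
    using apx_bm[OF assms] unfolding apx_def by blast
  have "LI (\<lambda>x. (f x)\<^sup>2) - (\<Sum>j\<le>p. (cf f j)\<^sup>2) \<le> LI (\<lambda>x. (f x - (\<Sum>j\<le>p. c j * \<psi> j x))\<^sup>2)"
    by (rule bessel(3)[OF finite_measure_axioms sets_\<mu> _ assms bm_\<psi>]) (auto simp: orthonormal)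
  then have 1: "LI (\<lambda>x. (f x)\<^sup>2) - (\<Sum>j\<le>p. (cf f j)\<^sup>2) < r" using pc by simp
  have "norm ((\<Sum>j\<le>n. (cf f j)\<^sup>2) - LI (\<lambda>x. (f x)\<^sup>2)) < r" if "n \<ge> p" for n
  proof -
    have "(\<Sum>j\<le>p. (cf f j)\<^sup>2) \<le> (\<Sum>j\<le>n. (cf f j)\<^sup>2)" using that by (intro sum_mono2) auto
    then show ?thesis using 1 bessel1[OF assms, of n] by simp
  qed
  then show "\<exists>no. \<forall>n\<ge>no. norm ((\<Sum>j\<le>n. (cf f j)\<^sup>2) - LI (\<lambda>x. (f x)\<^sup>2)) < r" by blast
qed

end

section \<open>Tensor products of orthonormal bases\<close>

lemma bm_Pair2:
  assumes "bm F" "f \<in> borel_measurable borel" "g \<in> borel_measurable borel"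
  shows "bm (\<lambda>p. F (f p :: 'b::second_countable_topology, g p :: 'c::second_countable_topology))"
  using bm_compose[OF assms(1) borel_measurable_Pair[OF assms(2,3)]] .

text \<open>Monotone convergence along the diagonal of a double sequence: the limits
  \<open>r j\<close> bound from above, finitely many rows suffice from below. It merges Parseval's
  identities in two groups of variables into one over a common truncation.\<close>

lemma tendsto_diagonal_sum:
  fixes s :: "nat \<Rightarrow> nat \<Rightarrow> real"
  assumes lim: "\<And>j. (\<lambda>p. s j p) \<longlonglongrightarrow> r j" and mono: "\<And>j. mono (s j)" and nonneg: "\<And>j p. 0 \<le> s j p"
    and sum: "(\<lambda>p. \<Sum>j\<le>p. r j) \<longlonglongrightarrow> S"
  shows "(\<lambda>p. \<Sum>j\<le>p. s j p) \<longlonglongrightarrow> S"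
proof (rule LIMSEQ_I)
  have le: "s j p \<le> r j" for j p
    using mono lim by (intro incseq_le[of "s j"]) auto
  have r: "0 \<le> r j" for j using nonneg[of j 0] le[of j 0] by linarith
  have up: "(\<Sum>j\<le>p. s j p) \<le> S" for p
  proof -
    have "(\<Sum>j\<le>p. s j p) \<le> (\<Sum>j\<le>p. r j)" by (intro sum_mono le)
    also have "\<dots> \<le> S"
      using r by (intro incseq_le[OF _ sum]) (auto simp: incseq_def intro: sum_mono2)
    finally show ?thesis .
  qed
  fix e :: real assume "e > 0"
  then have "\<forall>\<^sub>F q in sequentially. S - e < (\<Sum>j\<le>q. r j)"
    using sum by (intro order_tendstoD(1)) auto
  then obtain q where q: "S - e < (\<Sum>j\<le>q. r j)"
    by (meson eventually_happens trivial_limit_sequentially)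
  have "(\<lambda>p. \<Sum>j\<le>q. s j p) \<longlonglongrightarrow> (\<Sum>j\<le>q. r j)" by (intro tendsto_sum lim)
  then have "\<forall>\<^sub>F p in sequentially. S - e < (\<Sum>j\<le>q. s j p)" using q by (intro order_tendstoD(1))
  then obtain N where N: "\<And>p. p \<ge> N \<Longrightarrow> S - e < (\<Sum>j\<le>q. s j p)" by (auto simp: eventually_sequentially)
  have "norm ((\<Sum>j\<le>p. s j p) - S) < e" if "p \<ge> max N q" for p
  proof -
    have "(\<Sum>j\<le>q. s j p) \<le> (\<Sum>j\<le>p. s j p)" using that nonneg by (intro sum_mono2) auto
    then show ?thesis using N[of p] up[of p] that by simp
  qed
  then show "\<exists>no. \<forall>p\<ge>no. norm ((\<Sum>j\<le>p. s j p) - S) < e" by blast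
qed

context interval
begin

lemma sets_pair_\<mu>:
  fixes \<nu> :: "'b::second_countable_topology measure"
  assumes "sets \<nu> = sets borel"
  shows "sets (\<nu> \<Otimes>\<^sub>M \<mu>) = sets (borel :: ('b \<times> real) measure)"
  using sets_pair_measure_cong[OF assms sets_\<mu>] by (simp only: borel_prod)

lemma finite_pair_\<mu>: "finite_measure \<nu> \<Longrightarrow> finite_measure (\<nu> \<Otimes>\<^sub>M \<mu>)"
  by (rule finite_measure_pair_measure) (auto intro: finite_measure_axioms)

lemma integral_pair_\<mu>:
  fixes \<nu> :: "'b::second_countable_topology measure"
  assumes \<nu>: "finite_measure \<nu>" "sets \<nu> = sets borel" and f: "bm f"
  shows "(LINT p|(\<nu> \<Otimes>\<^sub>M \<mu>). f p) = (LINT x|\<nu>. LI (\<lambda>y. f (x, y)))"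
proof -
  interpret \<nu>: finite_measure \<nu> by fact
  interpret P: pair_sigma_finite \<nu> \<mu> ..
  show ?thesis
    using P.integral_fst'[of f] integral_bm[OF finite_pair_\<mu>[OF \<nu>(1)] sets_pair_\<mu>[OF \<nu>(2)] f] by simp
qed

lemma bm_LI_pair:
  fixes f :: "'b::second_countable_topology \<times> real \<Rightarrow> real"
  shows "bm f \<Longrightarrow> bm (\<lambda>x. LI (\<lambda>y. f (x, y)))"
  by (rule bm_LI) simp

lemma bm_Pair_section:
  fixes f :: "'b::second_countable_topology \<times> 'c::second_countable_topology \<Rightarrow> real"
  shows "bm f \<Longrightarrow> bm (\<lambda>y. f (x, y))"
  by (rule bm_Pair2) auto

end

context onb
begin

text \<open>An orthonormal basis together with the finite index sets along which sums are truncated;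
  completeness is encoded as Parseval's identity for bounded Borel functions.\<close>

definition basis_of :: "'b::second_countable_topology measure \<Rightarrow> ('s \<Rightarrow> 'b \<Rightarrow> real) \<Rightarrow> (nat \<Rightarrow> 's set) \<Rightarrow> bool" where
  "basis_of \<nu> e S \<longleftrightarrow> finite_measure \<nu> \<and> sets \<nu> = sets borel \<and> (\<forall>s. bm (e s)) \<and>
    (\<forall>s r. (LINT x|\<nu>. e s x * e r x) = (if s = r then 1 else 0)) \<and> (\<forall>p. finite (S p)) \<and> incseq S \<and>
    (\<forall>F. bm F \<longrightarrow> (\<lambda>p. \<Sum>s\<in>S p. (LINT x|\<nu>. F x * e s x)\<^sup>2) \<longlonglongrightarrow> (LINT x|\<nu>. (F x)\<^sup>2))"

lemma basis_of_\<mu>: "basis_of \<mu> \<psi> atMost"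
  unfolding basis_of_def using finite_measure_axioms bm_\<psi> orthonormal parseval1
  by (auto simp: incseq_def)

text \<open>Coefficients are taken in two stages: \<open>G j\<close> is the coefficient in the last
  variable. Parseval in that variable holds for each \<open>x\<close> and is integrated by dominated
  convergence; Parseval in the remaining variables applies to every \<open>G j\<close>;
  \<open>tendsto_diagonal_sum\<close> joins the two.\<close>

lemma basis_of_pair:
  fixes \<nu> :: "'b::second_countable_topology measure" and e :: "'s \<Rightarrow> 'b \<Rightarrow> real"
  assumes B: "basis_of \<nu> e S"
  shows "basis_of (\<nu> \<Otimes>\<^sub>M \<mu>) (\<lambda>s p. e (fst s) (fst p) * \<psi> (snd s) (snd p)) (\<lambda>p. S p \<times> {..p})"
proof -
  have fm: "finite_measure \<nu>" and sb: "sets \<nu> = sets borel" and bme: "\<And>s. bm (e s)"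
    and ort: "\<And>s r. (LINT x|\<nu>. e s x * e r x) = (if s = r then 1 else 0)" and fin: "\<And>p. finite (S p)"
    and inc: "incseq S"
    and par: "\<And>F. bm F \<Longrightarrow> (\<lambda>p. \<Sum>s\<in>S p. (LINT x|\<nu>. F x * e s x)\<^sup>2) \<longlonglongrightarrow> (LINT x|\<nu>. (F x)\<^sup>2)"
    using B unfolding basis_of_def by blast+
  interpret \<nu>: finite_measure \<nu> by fact
  have fst_m: "fst \<in> borel_measurable (borel :: ('b \<times> real) measure)"
    and snd_m: "snd \<in> borel_measurable (borel :: ('b \<times> real) measure)"
    using borel_measurable_fst_raw[OF measurable_ident] borel_measurable_snd_raw[OF measurable_ident] by (auto simp: id_def)
  have bme': "bm (\<lambda>p. e (fst s) (fst p) * \<psi> (snd s) (snd p))" for s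
    by (intro bm_mult bm_compose[OF bme] bm_compose[OF bm_\<psi>] fst_m snd_m)
  note int = integral_pair_\<mu>[OF fm sb]
  have co: "(LINT p|(\<nu> \<Otimes>\<^sub>M \<mu>). F p * (e (fst s) (fst p) * \<psi> (snd s) (snd p))) =
      (LINT x|\<nu>. LI (\<lambda>y. F (x, y) * \<psi> (snd s) y) * e (fst s) x)" if F: "bm F" for F s
  proof -
    have "(LINT p|(\<nu> \<Otimes>\<^sub>M \<mu>). F p * (e (fst s) (fst p) * \<psi> (snd s) (snd p))) =
        (LINT x|\<nu>. LI (\<lambda>y. F (x, y) * (e (fst s) x * \<psi> (snd s) y)))"
      by (subst int) (auto intro: bm_mult F bme')
    also have "(\<lambda>x. LI (\<lambda>y. F (x, y) * (e (fst s) x * \<psi> (snd s) y))) =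
        (\<lambda>x. LI (\<lambda>y. F (x, y) * \<psi> (snd s) y) * e (fst s) x)"
    proof
      fix x
      have "LI (\<lambda>y. F (x, y) * (e (fst s) x * \<psi> (snd s) y)) = LI (\<lambda>y. (F (x, y) * \<psi> (snd s) y) * e (fst s) x)"
        by (simp only: mult_ac)
      then show "LI (\<lambda>y. F (x, y) * (e (fst s) x * \<psi> (snd s) y)) = LI (\<lambda>y. F (x, y) * \<psi> (snd s) y) * e (fst s) x"
        by (simp only: integral_mult_left_zero)
    qed
    finally show ?thesis .
  qed
  have "(LINT p|(\<nu> \<Otimes>\<^sub>M \<mu>). (e (fst s) (fst p) * \<psi> (snd s) (snd p)) * (e (fst r) (fst p) * \<psi> (snd r) (snd p))) =
      (if s = r then 1 else 0)" for s r
  proof -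
    have "(LINT p|(\<nu> \<Otimes>\<^sub>M \<mu>). (e (fst s) (fst p) * \<psi> (snd s) (snd p)) * (e (fst r) (fst p) * \<psi> (snd r) (snd p))) =
       (LINT x|\<nu>. LI (\<lambda>y. e (fst s) x * \<psi> (snd s) y * \<psi> (snd r) y) * e (fst r) x)"
      by (subst co[OF bme']) simp
    also have "\<dots> = (LINT x|\<nu>. (if snd s = snd r then 1 else 0) * (e (fst s) x * e (fst r) x))"
      by (simp add: mult.assoc orthonormal)
    also have "\<dots> = (if s = r then 1 else 0)"
      by (auto simp: ort prod_eq_iff)
    finally show ?thesis .
  qed
  moreover have "(\<lambda>p. \<Sum>s\<in>S p \<times> {..p}. (LINT x|(\<nu> \<Otimes>\<^sub>M \<mu>). F x * (e (fst s) (fst x) * \<psi> (snd s) (snd x)))\<^sup>2)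
      \<longlonglongrightarrow> (LINT x|(\<nu> \<Otimes>\<^sub>M \<mu>). (F x)\<^sup>2)" if F: "bm F" for F
  proof -
    define G where "G j x = LI (\<lambda>y. F (x, y) * \<psi> j y)" for j x
    have G: "bm (G j)" for j
      unfolding G_def
      using bm_LI_pair[of "\<lambda>p. F p * \<psi> j (snd p)"] bm_mult[OF F bm_compose[OF bm_\<psi> snd_m]] by simp
    have Fs: "bm (\<lambda>y. F (x, y))" for x by (rule bm_Pair_section[OF F])
    obtain C where C: "C \<ge> 0" "\<And>p. \<bar>F p\<bar> \<le> C" using bm_bounded[OF F] by blast
    have sq: "bm (\<lambda>p. (F p)\<^sup>2)" by (intro bm_power F)
    have "(\<lambda>p. \<Sum>j\<le>p. \<Sum>s\<in>S p. (LINT x|\<nu>. G j x * e s x)\<^sup>2) \<longlonglongrightarrow> (LINT x|\<nu>. LI (\<lambda>y. (F (x, y))\<^sup>2))"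
    proof (rule tendsto_diagonal_sum)
      show "(\<lambda>p. \<Sum>s\<in>S p. (LINT x|\<nu>. G j x * e s x)\<^sup>2) \<longlonglongrightarrow> (LINT x|\<nu>. (G j x)\<^sup>2)" for j
        by (rule par[OF G])
      show "mono (\<lambda>p. \<Sum>s\<in>S p. (LINT x|\<nu>. G j x * e s x)\<^sup>2)" for j
        using inc fin by (intro monoI sum_mono2) (auto simp: incseq_def)
      show "0 \<le> (\<Sum>s\<in>S p. (LINT x|\<nu>. G j x * e s x)\<^sup>2)" for j p by (intro sum_nonneg) auto
      have "(\<lambda>p. LINT x|\<nu>. (\<Sum>j\<le>p. (G j x)\<^sup>2)) \<longlonglongrightarrow> (LINT x|\<nu>. LI (\<lambda>y. (F (x, y))\<^sup>2))"
      proof (rule integral_dominated_convergence[where w = "\<lambda>_. C\<^sup>2 * (T - t)"])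
        show "(\<lambda>x. LI (\<lambda>y. (F (x, y))\<^sup>2)) \<in> borel_measurable \<nu>"
          using bm_measurable[OF bm_LI_pair[OF sq]] by (simp cong: measurable_cong_sets[OF sb refl])
        show "(\<lambda>x. \<Sum>j\<le>p. (G j x)\<^sup>2) \<in> borel_measurable \<nu>" for p
        proof -
          have "bm (\<lambda>x. \<Sum>j\<le>p. (G j x)\<^sup>2)" by (intro bm_intros G)
          from bm_measurable[OF this] show ?thesis by (simp cong: measurable_cong_sets[OF sb refl])
        qed
        show "AE x in \<nu>. (\<lambda>p. \<Sum>j\<le>p. (G j x)\<^sup>2) \<longlonglongrightarrow> LI (\<lambda>y. (F (x, y))\<^sup>2)"
          unfolding G_def by (intro always_eventually allI parseval1 Fs)
        show "AE x in \<nu>. norm (\<Sum>j\<le>p. (G j x)\<^sup>2) \<le> C\<^sup>2 * (T - t)" for p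
        proof (intro always_eventually allI)
          fix x
          have "norm (\<Sum>j\<le>p. (G j x)\<^sup>2) = (\<Sum>j\<le>p. (G j x)\<^sup>2)" by (simp add: sum_nonneg)
          also have "\<dots> \<le> LI (\<lambda>y. (F (x, y))\<^sup>2)"
            unfolding G_def by (rule bessel1[OF Fs])
          also have "\<dots> \<le> LI (\<lambda>y. C\<^sup>2)"
          proof (intro integral_mono integrable_\<mu> bm_power Fs bm_const)
            show "(F (x, y))\<^sup>2 \<le> C\<^sup>2" for y
              using C(1) C(2)[of "(x, y)"] by (simp add: abs_le_square_iff[symmetric])
          qed
          also have "\<dots> = C\<^sup>2 * (T - t)" by (simp add: measure_\<mu>_UNIV)
          finally show "norm (\<Sum>j\<le>p. (G j x)\<^sup>2) \<le> C\<^sup>2 * (T - t)" .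
        qed
      qed simp
      moreover have "(LINT x|\<nu>. (\<Sum>j\<le>p. (G j x)\<^sup>2)) = (\<Sum>j\<le>p. LINT x|\<nu>. (G j x)\<^sup>2)" for p
        by (intro Bochner_Integration.integral_sum integral_bm[OF fm sb] bm_power G)
      ultimately show "(\<lambda>p. \<Sum>j\<le>p. LINT x|\<nu>. (G j x)\<^sup>2) \<longlonglongrightarrow> (LINT x|\<nu>. LI (\<lambda>y. (F (x, y))\<^sup>2))" by simp
    qed
    moreover have "(\<Sum>s\<in>S p \<times> {..p}. (LINT x|(\<nu> \<Otimes>\<^sub>M \<mu>). F x * (e (fst s) (fst x) * \<psi> (snd s) (snd x)))\<^sup>2) =
        (\<Sum>j\<le>p. \<Sum>s\<in>S p. (LINT x|\<nu>. G j x * e s x)\<^sup>2)" for p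
      unfolding co[OF F] G_def
      by (subst sum.swap) (simp add: sum.cartesian_product split_def)
    moreover have "(LINT x|(\<nu> \<Otimes>\<^sub>M \<mu>). (F x)\<^sup>2) = (LINT x|\<nu>. LI (\<lambda>y. (F (x, y))\<^sup>2))"
      by (rule int[OF sq])
    ultimately show ?thesis by simp
  qed
  moreover have "incseq (\<lambda>p. S p \<times> {..p})"
    unfolding incseq_def
  proof (intro allI impI Sigma_mono)
    show "S m \<subseteq> S n" if "m \<le> n" for m n using inc that by (rule incseqD)
  qed auto
  ultimately show ?thesis
    unfolding basis_of_def using fin
    by (intro conjI allI impI finite_pair_\<mu>[OF fm] sets_pair_\<mu>[OF sb] bme') auto
qed

lemma basis_of_projection:
  assumes B: "basis_of \<nu> e S" and F: "bm F"
  shows "(\<lambda>p. LINT x|\<nu>. (F x - (\<Sum>s\<in>S p. (LINT x|\<nu>. F x * e s x) * e s x))\<^sup>2) \<longlonglongrightarrow> 0"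
proof -
  have fm: "finite_measure \<nu>" and sb: "sets \<nu> = sets borel" and bme: "\<And>s. bm (e s)"
    and ort: "\<And>s r. (LINT x|\<nu>. e s x * e r x) = (if s = r then 1 else 0)" and fin: "\<And>p. finite (S p)"
    and par: "(\<lambda>p. \<Sum>s\<in>S p. (LINT x|\<nu>. F x * e s x)\<^sup>2) \<longlonglongrightarrow> (LINT x|\<nu>. (F x)\<^sup>2)"
    using B F unfolding basis_of_def by blast+
  have "(LINT x|\<nu>. (F x - (\<Sum>s\<in>S p. (LINT x|\<nu>. F x * e s x) * e s x))\<^sup>2) =
      (LINT x|\<nu>. (F x)\<^sup>2) - (\<Sum>s\<in>S p. (LINT x|\<nu>. F x * e s x)\<^sup>2)" for p
    by (rule bessel(1)[OF fm sb fin F bme ort])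
  then show ?thesis using tendsto_diff[OF tendsto_const[of "LINT x|\<nu>. (F x)\<^sup>2"] par] by simp
qed

text \<open>Write the error as the projection error of \<open>F\<close> plus the projection of
  \<open>F - G p\<close>; the latter is no larger than \<open>F - G p\<close> by Bessel. This serves
  contractions, whose truncated series has coefficients that themselves depend on
  \<open>p\<close>.\<close>

lemma basis_of_projection_limit:
  assumes B: "basis_of \<nu> e S" and F: "bm F" and G: "\<And>p. bm (G p)"
    and lim: "(\<lambda>p. LINT x|\<nu>. (F x - G p x)\<^sup>2) \<longlonglongrightarrow> 0"
  shows "(\<lambda>p. LINT x|\<nu>. (F x - (\<Sum>s\<in>S p. (LINT x|\<nu>. G p x * e s x) * e s x))\<^sup>2) \<longlonglongrightarrow> 0"
proof (rule tendsto_sandwich[OF _ _ tendsto_const])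
  have fm: "finite_measure \<nu>" and sb: "sets \<nu> = sets borel" and bme: "\<And>s. bm (e s)"
    and ort: "\<And>s r. (LINT x|\<nu>. e s x * e r x) = (if s = r then 1 else 0)" and fin: "\<And>p. finite (S p)"
    using B F unfolding basis_of_def by blast+
  note i = integral_bm[OF fm sb]
  let ?u = "\<lambda>p x. F x - (\<Sum>s\<in>S p. (LINT x|\<nu>. F x * e s x) * e s x)"
  let ?v = "\<lambda>p x. \<Sum>s\<in>S p. (LINT x|\<nu>. (F x - G p x) * e s x) * e s x"
  have u: "bm (?u p)" and v: "bm (?v p)" for p by (intro bm_intros F bme)+
  show "\<forall>\<^sub>F p in sequentially. 0 \<le> (LINT x|\<nu>. (F x - (\<Sum>s\<in>S p. (LINT x|\<nu>. G p x * e s x) * e s x))\<^sup>2)"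
    by (intro always_eventually allI Bochner_Integration.integral_nonneg) auto
  show "(\<lambda>p. 2 * (LINT x|\<nu>. (?u p x)\<^sup>2) + 2 * (LINT x|\<nu>. (F x - G p x)\<^sup>2)) \<longlonglongrightarrow> 0"
    using tendsto_add[OF tendsto_mult_right_zero[OF basis_of_projection[OF B F], of 2] tendsto_mult_right_zero[OF lim, of 2]]
    by simp
  show "\<forall>\<^sub>F p in sequentially. (LINT x|\<nu>. (F x - (\<Sum>s\<in>S p. (LINT x|\<nu>. G p x * e s x) * e s x))\<^sup>2) \<le>
      2 * (LINT x|\<nu>. (?u p x)\<^sup>2) + 2 * (LINT x|\<nu>. (F x - G p x)\<^sup>2)"
  proof (intro always_eventually allI)
    fix p
    have c: "(LINT x|\<nu>. (F x - G p x) * e s x) = (LINT x|\<nu>. F x * e s x) - (LINT x|\<nu>. G p x * e s x)" for s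
    proof -
      have "(LINT x|\<nu>. (F x - G p x) * e s x) = (LINT x|\<nu>. F x * e s x - G p x * e s x)"
        by (simp only: left_diff_distrib)
      also have "\<dots> = (LINT x|\<nu>. F x * e s x) - (LINT x|\<nu>. G p x * e s x)"
        by (intro Bochner_Integration.integral_diff i bm_mult F G bme)
      finally show ?thesis .
    qed
    have e: "F x - (\<Sum>s\<in>S p. (LINT x|\<nu>. G p x * e s x) * e s x) = ?u p x + ?v p x" for x
      unfolding c by (simp add: left_diff_distrib sum_subtractf)
    have "?v p = (\<lambda>x. 0 - (\<Sum>s\<in>S p. (- (LINT x|\<nu>. (F x - G p x) * e s x)) * e s x))"
      by (simp add: sum_negf)
    \<comment> \<open>The norm of a finite expansion, read off from its distance to the zero
      function.\<close>
    have vv: "(LINT x|\<nu>. (?v p x)\<^sup>2) = (\<Sum>s\<in>S p. (LINT x|\<nu>. (F x - G p x) * e s x)\<^sup>2)"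
      using orthonormal_distance[OF fm sb fin bm_const[of 0] bme ort, where c = "\<lambda>s. LINT x|\<nu>. (F x - G p x) * e s x"]
      by simp
    also have "\<dots> \<le> (LINT x|\<nu>. (F x - G p x)\<^sup>2)"
      by (rule bessel(2)[OF fm sb fin bm_diff[OF F G] bme ort])
    finally have 2: "(LINT x|\<nu>. (?v p x)\<^sup>2) \<le> (LINT x|\<nu>. (F x - G p x)\<^sup>2)" .
    have "(LINT x|\<nu>. (?u p x + ?v p x)\<^sup>2) \<le> (LINT x|\<nu>. 2 * (?u p x)\<^sup>2 + 2 * (?v p x)\<^sup>2)"
    proof (intro integral_mono i bm_add bm_mult bm_const bm_power u v)
      show "(?u p x + ?v p x)\<^sup>2 \<le> 2 * (?u p x)\<^sup>2 + 2 * (?v p x)\<^sup>2" for x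
        using sum_squares_bound[of "?u p x" "?v p x"] by (simp only: power2_sum)
    qed
    also have "\<dots> = (LINT x|\<nu>. 2 * (?u p x)\<^sup>2) + (LINT x|\<nu>. 2 * (?v p x)\<^sup>2)"
      by (intro Bochner_Integration.integral_add i bm_mult bm_const bm_power u v)
    also have "\<dots> = 2 * (LINT x|\<nu>. (?u p x)\<^sup>2) + 2 * (LINT x|\<nu>. (?v p x)\<^sup>2)"
      by (simp only: integral_mult_right_zero)
    also have "\<dots> \<le> 2 * (LINT x|\<nu>. (?u p x)\<^sup>2) + 2 * (LINT x|\<nu>. (F x - G p x)\<^sup>2)"
      using 2 by simp
    finally show "(LINT x|\<nu>. (F x - (\<Sum>s\<in>S p. (LINT x|\<nu>. G p x * e s x) * e s x))\<^sup>2) \<le>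
      2 * (LINT x|\<nu>. (?u p x)\<^sup>2) + 2 * (LINT x|\<nu>. (F x - G p x)\<^sup>2)"
      unfolding e .
  qed
qed

end

section \<open>Kernels and their contractions\<close>

text \<open>With the value \<open>1/2\<close> on the diagonal, trapezoidal sums are exactly sums against this kernel.\<close>

definition heav :: "'b::linorder \<Rightarrow> 'b \<Rightarrow> real" where
  "heav x y = (if x < y then 1 else if x = y then 1 / 2 else 0)"

lemma heav_add: "heav x y + heav y x = 1" by (auto simp: heav_def)
lemma heav_same [simp]: "heav x x = 1 / 2" by (simp add: heav_def)
lemma heav_abs_le: "\<bar>heav x y\<bar> \<le> 1" by (auto simp: heav_def)

lemma bm_heav:
  assumes "f \<in> borel_measurable borel" "g \<in> borel_measurable borel"
  shows "bm (\<lambda>q. heav (f q) (g q :: real))"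
proof (rule bmI)
  note [measurable] = assms
  show "(\<lambda>q. heav (f q) (g q)) \<in> borel_measurable borel" unfolding heav_def by measurable
qed (rule heav_abs_le)

text \<open>Joint boundedness and measurability of curried kernels. In \<open>bm3\<close> and
  \<open>bm4\<close> the pairs nest to the left, as in the product measures built by
  \<open>basis_of_pair\<close>.\<close>

definition bm2 :: "(real \<Rightarrow> real \<Rightarrow> real) \<Rightarrow> bool" where
  "bm2 f \<longleftrightarrow> bm (\<lambda>p. f (fst p) (snd p))"

definition bm3 :: "(real \<Rightarrow> real \<Rightarrow> real \<Rightarrow> real) \<Rightarrow> bool" where
  "bm3 f \<longleftrightarrow> bm (\<lambda>p. f (fst (fst p)) (snd (fst p)) (snd p))"

definition bm4 :: "(real \<Rightarrow> real \<Rightarrow> real \<Rightarrow> real \<Rightarrow> real) \<Rightarrow> bool" where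
  "bm4 f \<longleftrightarrow> bm (\<lambda>p. f (fst (fst (fst p))) (snd (fst (fst p))) (snd (fst p)) (snd p))"

text \<open>The substituted functions may coincide, so restrictions to diagonals are
  covered.\<close>

lemma bm2_sub:
  assumes "bm2 f" "a \<in> borel_measurable borel" "b \<in> borel_measurable borel"
  shows "bm (\<lambda>q. f (a q) (b q))"
  using bm_compose[OF assms(1)[unfolded bm2_def] borel_measurable_Pair[OF assms(2,3)]] by simp

lemma bm3_sub:
  assumes "bm3 f" "a \<in> borel_measurable borel" "b \<in> borel_measurable borel" "c \<in> borel_measurable borel"
  shows "bm (\<lambda>q. f (a q) (b q) (c q))"
  using bm_compose[OF assms(1)[unfolded bm3_def] borel_measurable_Pair[OF borel_measurable_Pair[OF assms(2,3)] assms(4)]] by simp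

lemma bm4_sub:
  assumes "bm4 f" "a \<in> borel_measurable borel" "b \<in> borel_measurable borel" "c \<in> borel_measurable borel" "d \<in> borel_measurable borel"
  shows "bm (\<lambda>q. f (a q) (b q) (c q) (d q))"
  using bm_compose[OF assms(1)[unfolded bm4_def]
      borel_measurable_Pair[OF borel_measurable_Pair[OF borel_measurable_Pair[OF assms(2,3)] assms(4)] assms(5)]] by simp

lemma ident_measurable: "(\<lambda>x. x) \<in> borel_measurable borel" by simp
lemma const_measurable: "(\<lambda>_. c) \<in> borel_measurable borel" by simp

lemmas bmi = bm_intros bm_heav
  borel_measurable_fst_raw borel_measurable_snd_raw ident_measurable const_measurable

context interval
begin

lemma bm_LI_raw:
  fixes f :: "'b::second_countable_topology \<Rightarrow> real \<Rightarrow> real"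
  shows "bm (\<lambda>p. f (fst p) (snd p)) \<Longrightarrow> bm (\<lambda>x. LI (\<lambda>y. f x y))"
  by (rule bm_LI)

lemma LI_swap2: "bm2 f \<Longrightarrow> LI (\<lambda>x. LI (\<lambda>y. f x y)) = LI (\<lambda>y. LI (\<lambda>x. f x y))"
  unfolding bm2_def by (rule LI_swap)

lemma LI_perm3:
  assumes f: "bm3 f"
  shows "LI (\<lambda>a. LI (\<lambda>b. LI (\<lambda>c. f a b c))) = LI (\<lambda>a. LI (\<lambda>c. LI (\<lambda>b. f a b c)))"
    and "LI (\<lambda>a. LI (\<lambda>b. LI (\<lambda>c. f a b c))) = LI (\<lambda>b. LI (\<lambda>a. LI (\<lambda>c. f a b c)))"
    and "LI (\<lambda>a. LI (\<lambda>b. LI (\<lambda>c. f a b c))) = LI (\<lambda>b. LI (\<lambda>c. LI (\<lambda>a. f a b c)))"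
    and "LI (\<lambda>a. LI (\<lambda>b. LI (\<lambda>c. f a b c))) = LI (\<lambda>c. LI (\<lambda>a. LI (\<lambda>b. f a b c)))"
proof -
  have s1: "LI (\<lambda>b. LI (\<lambda>c. f a b c)) = LI (\<lambda>c. LI (\<lambda>b. f a b c))" for a
    by (rule LI_swap2) (unfold bm2_def, intro bm3_sub[OF f] bmi)
  show 1: "LI (\<lambda>a. LI (\<lambda>b. LI (\<lambda>c. f a b c))) = LI (\<lambda>a. LI (\<lambda>c. LI (\<lambda>b. f a b c)))"
    unfolding s1 ..
  show 2: "LI (\<lambda>a. LI (\<lambda>b. LI (\<lambda>c. f a b c))) = LI (\<lambda>b. LI (\<lambda>a. LI (\<lambda>c. f a b c)))"
    by (rule LI_swap2) (unfold bm2_def, intro bm_LI_raw bm3_sub[OF f] bmi)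
  have s2: "LI (\<lambda>a. LI (\<lambda>c. f a b c)) = LI (\<lambda>c. LI (\<lambda>a. f a b c))" for b
    by (rule LI_swap2) (unfold bm2_def, intro bm3_sub[OF f] bmi)
  show "LI (\<lambda>a. LI (\<lambda>b. LI (\<lambda>c. f a b c))) = LI (\<lambda>b. LI (\<lambda>c. LI (\<lambda>a. f a b c)))"
    unfolding 2 s2 ..
  show "LI (\<lambda>a. LI (\<lambda>b. LI (\<lambda>c. f a b c))) = LI (\<lambda>c. LI (\<lambda>a. LI (\<lambda>b. f a b c)))"
    unfolding 1 by (rule LI_swap2) (unfold bm2_def, intro bm_LI_raw bm3_sub[OF f] bmi)
qed

lemma LI_perm4:
  assumes f: "bm4 f"
  shows "LI (\<lambda>a. LI (\<lambda>b. LI (\<lambda>c. LI (\<lambda>d. f a b c d)))) = LI (\<lambda>a. LI (\<lambda>c. LI (\<lambda>b. LI (\<lambda>d. f a b c d))))"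
    and "LI (\<lambda>a. LI (\<lambda>b. LI (\<lambda>c. LI (\<lambda>d. f a b c d)))) = LI (\<lambda>a. LI (\<lambda>d. LI (\<lambda>b. LI (\<lambda>c. f a b c d))))"
    and "LI (\<lambda>a. LI (\<lambda>b. LI (\<lambda>c. LI (\<lambda>d. f a b c d)))) = LI (\<lambda>b. LI (\<lambda>c. LI (\<lambda>a. LI (\<lambda>d. f a b c d))))"
    and "LI (\<lambda>a. LI (\<lambda>b. LI (\<lambda>c. LI (\<lambda>d. f a b c d)))) = LI (\<lambda>b. LI (\<lambda>d. LI (\<lambda>a. LI (\<lambda>c. f a b c d))))"
    and "LI (\<lambda>a. LI (\<lambda>b. LI (\<lambda>c. LI (\<lambda>d. f a b c d)))) = LI (\<lambda>c. LI (\<lambda>d. LI (\<lambda>a. LI (\<lambda>b. f a b c d))))"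
proof -
  have b1: "bm3 (\<lambda>b c d. f a b c d)" for a unfolding bm3_def by (intro bm4_sub[OF f] bmi)
  have b2: "bm3 (\<lambda>a c d. f a b c d)" for b unfolding bm3_def by (intro bm4_sub[OF f] bmi)
  show "LI (\<lambda>a. LI (\<lambda>b. LI (\<lambda>c. LI (\<lambda>d. f a b c d)))) = LI (\<lambda>a. LI (\<lambda>c. LI (\<lambda>b. LI (\<lambda>d. f a b c d))))"
    by (simp only: LI_perm3(2)[OF b1])
  show "LI (\<lambda>a. LI (\<lambda>b. LI (\<lambda>c. LI (\<lambda>d. f a b c d)))) = LI (\<lambda>a. LI (\<lambda>d. LI (\<lambda>b. LI (\<lambda>c. f a b c d))))"
    by (simp only: LI_perm3(4)[OF b1])
  have s: "LI (\<lambda>a. LI (\<lambda>b. LI (\<lambda>c. LI (\<lambda>d. f a b c d)))) = LI (\<lambda>b. LI (\<lambda>a. LI (\<lambda>c. LI (\<lambda>d. f a b c d))))"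
    by (rule LI_swap2) (unfold bm2_def, intro bm_LI_raw bm4_sub[OF f] bmi)
  show "LI (\<lambda>a. LI (\<lambda>b. LI (\<lambda>c. LI (\<lambda>d. f a b c d)))) = LI (\<lambda>b. LI (\<lambda>c. LI (\<lambda>a. LI (\<lambda>d. f a b c d))))"
    unfolding s by (simp only: LI_perm3(2)[OF b2])
  show "LI (\<lambda>a. LI (\<lambda>b. LI (\<lambda>c. LI (\<lambda>d. f a b c d)))) = LI (\<lambda>b. LI (\<lambda>d. LI (\<lambda>a. LI (\<lambda>c. f a b c d))))"
    unfolding s by (simp only: LI_perm3(4)[OF b2])
  have r: "LI (\<lambda>b. LI (\<lambda>a. f a b c d)) = LI (\<lambda>a. LI (\<lambda>b. f a b c d))" for c d
    by (rule LI_swap2) (unfold bm2_def, intro bm4_sub[OF f] bmi)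
  have "LI (\<lambda>a. LI (\<lambda>b. LI (\<lambda>c. LI (\<lambda>d. f a b c d)))) = LI (\<lambda>b. LI (\<lambda>c. LI (\<lambda>d. LI (\<lambda>a. f a b c d))))"
    unfolding s by (simp only: LI_perm3(3)[OF b2])
  also have "\<dots> = LI (\<lambda>c. LI (\<lambda>d. LI (\<lambda>b. LI (\<lambda>a. f a b c d))))"
    by (rule LI_perm3(3)) (unfold bm3_def, intro bm_LI_raw bm4_sub[OF f] bmi)
  finally show "LI (\<lambda>a. LI (\<lambda>b. LI (\<lambda>c. LI (\<lambda>d. f a b c d)))) = LI (\<lambda>c. LI (\<lambda>d. LI (\<lambda>a. LI (\<lambda>b. f a b c d))))"
    unfolding r .
qed

lemma LI_sum: "(\<And>i. i \<in> I \<Longrightarrow> bm (f i)) \<Longrightarrow> LI (\<lambda>x. \<Sum>i\<in>I. f i x) = (\<Sum>i\<in>I. LI (f i))"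
  by (intro Bochner_Integration.integral_sum integrable_\<mu>)

lemma LI_add: "bm f \<Longrightarrow> bm g \<Longrightarrow> LI (\<lambda>x. f x + g x) = LI f + LI g"
  by (intro Bochner_Integration.integral_add integrable_\<mu>)

lemma LI_diff: "bm f \<Longrightarrow> bm g \<Longrightarrow> LI (\<lambda>x. f x - g x) = LI f - LI g"
  by (intro Bochner_Integration.integral_diff integrable_\<mu>)

lemma LI_AE_cong:
  assumes "bm f" "bm g" "AE x in \<mu>. f x = g x"
  shows "LI f = LI g"
  using assms by (intro integral_cong_AE) (auto dest: bm_measurable)

text \<open>The exceptional points \<open>c\<close> and \<open>d\<close> are the fixed arguments at
  which kernels have ties.\<close>

lemma LI_neq_cong:
  assumes "bm f" "bm g" "\<And>x. x \<in> {t..<T} \<Longrightarrow> x \<noteq> c \<Longrightarrow> x \<noteq> d \<Longrightarrow> f x = g x"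
  shows "LI f = LI g"
proof (rule LI_AE_cong[OF assms(1,2)])
  show "AE x in \<mu>. f x = g x"
    using AE_\<mu> AE_\<mu>_neq[of c] AE_\<mu>_neq[of d] by eventually_elim (auto intro: assms(3))
qed

lemma LI_mono: "bm f \<Longrightarrow> bm g \<Longrightarrow> (\<And>x. f x \<le> g x) \<Longrightarrow> LI f \<le> LI g"
  by (intro integral_mono integrable_\<mu>)

lemma LI_const: "LI (\<lambda>_. c) = (T - t) * c"
  by (simp add: measure_\<mu>_UNIV)

lemma LI_bound:
  assumes "\<And>x. \<bar>f x\<bar> \<le> B" "bm f"
  shows "\<bar>LI f\<bar> \<le> (T - t) * B"
proof -
  have "\<bar>LI f\<bar> \<le> LI (\<lambda>x. \<bar>f x\<bar>)" by (rule integral_abs_bound)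
  also have "\<dots> \<le> LI (\<lambda>_. B)"
    using assms by (intro integral_mono integrable_abs integrable_\<mu> bm_const) auto
  finally show ?thesis by (simp only: LI_const)
qed

lemma LI2_tendsto:
  assumes "\<And>n. bm2 (f n)" "bm2 g" "\<And>n x y. \<bar>f n x y\<bar> \<le> B"
    and "\<And>x y. x \<in> {t..<T} \<Longrightarrow> y \<in> {t..<T} \<Longrightarrow> (\<lambda>n. f n x y) \<longlonglongrightarrow> g x y"
  shows "(\<lambda>n. LI (\<lambda>x. LI (f n x))) \<longlonglongrightarrow> LI (\<lambda>x. LI (g x))"
proof (rule LI_tendsto)
  have s: "bm (h x)" if "bm2 h" for h x by (intro bm2_sub[OF that] bmi)
  show "(\<lambda>x. LI (f n x)) \<in> borel_measurable borel" for n
    by (intro bm_measurable bm_LI assms(1)[unfolded bm2_def])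
  show "(\<lambda>x. LI (g x)) \<in> borel_measurable borel"
    by (intro bm_measurable bm_LI assms(2)[unfolded bm2_def])
  show "\<bar>LI (f n x)\<bar> \<le> (T - t) * B" for n x by (intro LI_bound assms s)
  show "(\<lambda>n. LI (f n x)) \<longlonglongrightarrow> LI (g x)" if "x \<in> {t..<T}" for x
    using that by (intro LI_tendsto[where B = B] assms bm_measurable s)
qed

end

context onb
begin

definition coef4 :: "(real \<Rightarrow> real \<Rightarrow> real \<Rightarrow> real \<Rightarrow> real) \<Rightarrow> nat \<Rightarrow> nat \<Rightarrow> nat \<Rightarrow> nat \<Rightarrow> real" where
  "coef4 f j1 j2 j3 j4 = LI (\<lambda>a. LI (\<lambda>b. LI (\<lambda>c. LI (\<lambda>d. f a b c d * (\<psi> j1 a * \<psi> j2 b * \<psi> j3 c * \<psi> j4 d)))))"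

definition remainder :: "(real \<Rightarrow> real \<Rightarrow> real \<Rightarrow> real \<Rightarrow> real) \<Rightarrow> nat \<Rightarrow> real \<Rightarrow> real \<Rightarrow> real \<Rightarrow> real \<Rightarrow> real" where
  "remainder f p a b c d = f a b c d - (\<Sum>j1\<le>p. \<Sum>j2\<le>p. \<Sum>j3\<le>p. \<Sum>j4\<le>p. coef4 f j1 j2 j3 j4 * (\<psi> j1 a * \<psi> j2 b * \<psi> j3 c * \<psi> j4 d))"

lemmas bmj = bm_compose[OF bm_\<psi>] bmi

lemma coef4_perm:
  assumes f: "bm4 f"
  shows "coef4 f j1 j2 j3 j4 = coef4 (\<lambda>a c b d. f a b c d) j1 j3 j2 j4"
    and "coef4 f j1 j2 j3 j4 = coef4 (\<lambda>a d b c. f a b c d) j1 j4 j2 j3"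
    and "coef4 f j1 j2 j3 j4 = coef4 (\<lambda>b c a d. f a b c d) j2 j3 j1 j4"
    and "coef4 f j1 j2 j3 j4 = coef4 (\<lambda>b d a c. f a b c d) j2 j4 j1 j3"
    and "coef4 f j1 j2 j3 j4 = coef4 (\<lambda>c d a b. f a b c d) j3 j4 j1 j2"
proof -
  have g: "bm4 (\<lambda>a b c d. f a b c d * (\<psi> j1 a * \<psi> j2 b * \<psi> j3 c * \<psi> j4 d))"
    unfolding bm4_def by (intro bm4_sub[OF f] bmj)
  show "coef4 f j1 j2 j3 j4 = coef4 (\<lambda>a c b d. f a b c d) j1 j3 j2 j4"
    unfolding coef4_def by (subst LI_perm4(1)[OF g]) (simp only: mult_ac)
  show "coef4 f j1 j2 j3 j4 = coef4 (\<lambda>a d b c. f a b c d) j1 j4 j2 j3"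
    unfolding coef4_def by (subst LI_perm4(2)[OF g]) (simp only: mult_ac)
  show "coef4 f j1 j2 j3 j4 = coef4 (\<lambda>b c a d. f a b c d) j2 j3 j1 j4"
    unfolding coef4_def by (subst LI_perm4(3)[OF g]) (simp only: mult_ac)
  show "coef4 f j1 j2 j3 j4 = coef4 (\<lambda>b d a c. f a b c d) j2 j4 j1 j3"
    unfolding coef4_def by (subst LI_perm4(4)[OF g]) (simp only: mult_ac)
  show "coef4 f j1 j2 j3 j4 = coef4 (\<lambda>c d a b. f a b c d) j3 j4 j1 j2"
    unfolding coef4_def by (subst LI_perm4(5)[OF g]) (simp only: mult_ac)
qed

text \<open>Reduces the contraction of any pair of arguments to that of the first two, for the
  kernel with its arguments rearranged.\<close>

lemma remainder_perm:
  assumes f: "bm4 f"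
  shows "remainder f p a b c d = remainder (\<lambda>a c b d. f a b c d) p a c b d"
    and "remainder f p a b c d = remainder (\<lambda>a d b c. f a b c d) p a d b c"
    and "remainder f p a b c d = remainder (\<lambda>b c a d. f a b c d) p b c a d"
    and "remainder f p a b c d = remainder (\<lambda>b d a c. f a b c d) p b d a c"
    and "remainder f p a b c d = remainder (\<lambda>c d a b. f a b c d) p c d a b"
proof -
  show "remainder f p a b c d = remainder (\<lambda>a c b d. f a b c d) p a c b d"
    unfolding remainder_def lessThan_Suc_atMost[symmetric]
    by (subst sum_perm4(1)) (simp only: coef4_perm(1)[OF f] mult_ac)
  show "remainder f p a b c d = remainder (\<lambda>a d b c. f a b c d) p a d b c"
    unfolding remainder_def lessThan_Suc_atMost[symmetric]
    by (subst sum_perm4(2)) (simp only: coef4_perm(2)[OF f] mult_ac)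
  show "remainder f p a b c d = remainder (\<lambda>b c a d. f a b c d) p b c a d"
    unfolding remainder_def lessThan_Suc_atMost[symmetric]
    by (subst sum_perm4(3)) (simp only: coef4_perm(3)[OF f] mult_ac)
  show "remainder f p a b c d = remainder (\<lambda>b d a c. f a b c d) p b d a c"
    unfolding remainder_def lessThan_Suc_atMost[symmetric]
    by (subst sum_perm4(4)) (simp only: coef4_perm(4)[OF f] mult_ac)
  show "remainder f p a b c d = remainder (\<lambda>c d a b. f a b c d) p c d a b"
    unfolding remainder_def lessThan_Suc_atMost[symmetric]
    by (subst sum_perm4(5)) (simp only: coef4_perm(5)[OF f] mult_ac)
qed

lemma bm4_remainder: "bm4 f \<Longrightarrow> bm4 (remainder f p)"
  unfolding remainder_def bm4_def by (intro bmj) (simp_all add: bm4_def)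

text \<open>Orthonormality collapses the sums over the first two indices to their diagonal.\<close>

lemma LI_remainder_diagonal:
  assumes f: "bm4 f"
  shows "LI (\<lambda>x. remainder f p x x z w) = LI (\<lambda>x. f x x z w) - (\<Sum>j\<le>p. \<Sum>k\<le>p. (\<Sum>l\<le>p. coef4 f l l j k) * (\<psi> j z * \<psi> k w))"
proof -
  have "LI (\<lambda>x. remainder f p x x z w) = LI (\<lambda>x. f x x z w) -
      LI (\<lambda>x. \<Sum>j1\<le>p. \<Sum>j2\<le>p. \<Sum>j3\<le>p. \<Sum>j4\<le>p. coef4 f j1 j2 j3 j4 * (\<psi> j1 x * \<psi> j2 x * \<psi> j3 z * \<psi> j4 w))"
    unfolding remainder_def by (rule LI_diff) (intro bm4_sub[OF f] bmj)+
  also have "LI (\<lambda>x. \<Sum>j1\<le>p. \<Sum>j2\<le>p. \<Sum>j3\<le>p. \<Sum>j4\<le>p. coef4 f j1 j2 j3 j4 * (\<psi> j1 x * \<psi> j2 x * \<psi> j3 z * \<psi> j4 w)) =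
      (\<Sum>j1\<le>p. LI (\<lambda>x. \<Sum>j2\<le>p. \<Sum>j3\<le>p. \<Sum>j4\<le>p. coef4 f j1 j2 j3 j4 * (\<psi> j1 x * \<psi> j2 x * \<psi> j3 z * \<psi> j4 w)))"
    by (rule LI_sum) (intro bmj)
  also have "\<dots> = (\<Sum>j1\<le>p. \<Sum>j2\<le>p. LI (\<lambda>x. \<Sum>j3\<le>p. \<Sum>j4\<le>p. coef4 f j1 j2 j3 j4 * (\<psi> j1 x * \<psi> j2 x * \<psi> j3 z * \<psi> j4 w)))"
    by (intro sum.cong refl LI_sum) (intro bmj)
  also have "\<dots> = (\<Sum>j1\<le>p. \<Sum>j2\<le>p. \<Sum>j3\<le>p. LI (\<lambda>x. \<Sum>j4\<le>p. coef4 f j1 j2 j3 j4 * (\<psi> j1 x * \<psi> j2 x * \<psi> j3 z * \<psi> j4 w)))"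
    by (intro sum.cong refl LI_sum) (intro bmj)
  also have "\<dots> = (\<Sum>j1\<le>p. \<Sum>j2\<le>p. \<Sum>j3\<le>p. \<Sum>j4\<le>p. LI (\<lambda>x. coef4 f j1 j2 j3 j4 * (\<psi> j1 x * \<psi> j2 x * \<psi> j3 z * \<psi> j4 w)))"
    by (intro sum.cong refl LI_sum) (intro bmj)
  also have "\<dots> = (\<Sum>j1\<le>p. \<Sum>j2\<le>p. \<Sum>j3\<le>p. \<Sum>j4\<le>p. coef4 f j1 j2 j3 j4 * ((if j1 = j2 then 1 else 0) * (\<psi> j3 z * \<psi> j4 w)))"
  proof (intro sum.cong refl)
    fix j1 j2 j3 j4
    have "LI (\<lambda>x. coef4 f j1 j2 j3 j4 * (\<psi> j1 x * \<psi> j2 x * \<psi> j3 z * \<psi> j4 w)) =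
        coef4 f j1 j2 j3 j4 * (LI (\<lambda>x. \<psi> j1 x * \<psi> j2 x) * (\<psi> j3 z * \<psi> j4 w))"
      by (simp only: mult.assoc integral_mult_right_zero) (simp only: mult.assoc[symmetric] integral_mult_left_zero)
    then show "LI (\<lambda>x. coef4 f j1 j2 j3 j4 * (\<psi> j1 x * \<psi> j2 x * \<psi> j3 z * \<psi> j4 w)) =
        coef4 f j1 j2 j3 j4 * ((if j1 = j2 then 1 else 0) * (\<psi> j3 z * \<psi> j4 w))"
      unfolding orthonormal .
  qed
  also have "\<dots> = (\<Sum>j\<le>p. \<Sum>k\<le>p. (\<Sum>l\<le>p. coef4 f l l j k) * (\<psi> j z * \<psi> k w))"
    unfolding lessThan_Suc_atMost[symmetric] by (subst sum_delta_contract) simp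
  finally show ?thesis .
qed

lemma basis_of_\<mu>2: "basis_of (\<mu> \<Otimes>\<^sub>M \<mu>) (\<lambda>s p. \<psi> (fst s) (fst p) * \<psi> (snd s) (snd p)) (\<lambda>p. {..p} \<times> {..p})"
  using basis_of_pair[OF basis_of_\<mu>] .

lemma LINT_\<mu>2: "bm2 f \<Longrightarrow> (LINT p|(\<mu> \<Otimes>\<^sub>M \<mu>). f (fst p) (snd p)) = LI (\<lambda>x. LI (f x))"
  unfolding bm2_def by (rule integral_\<mu>2)

text \<open>The partial traces \<open>G p\<close>, taken at fixed \<open>z\<close> and
  \<open>w\<close>, converge boundedly to the contraction \<open>h\<close>, hence in L2. By Fubini
  their Fourier coefficients are those of the contracted series, so the contracted remainder is
  \<open>h\<close> minus the truncated expansion of \<open>G p\<close>, and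
  \<open>basis_of_projection_limit\<close> applies.\<close>

lemma trace_remainder_tendsto:
  assumes f: "bm4 f"
    and lim: "\<And>z w. z \<in> {t..<T} \<Longrightarrow> w \<in> {t..<T} \<Longrightarrow>
      (\<lambda>p. \<Sum>l\<le>p. LI (\<lambda>u. LI (\<lambda>v. f u v z w * (\<psi> l u * \<psi> l v)))) \<longlonglongrightarrow> LI (\<lambda>x. f x x z w)"
    and bound: "\<And>p z w. \<bar>\<Sum>l\<le>p. LI (\<lambda>u. LI (\<lambda>v. f u v z w * (\<psi> l u * \<psi> l v)))\<bar> \<le> B"
  shows "(\<lambda>p. LI (\<lambda>z. LI (\<lambda>w. (LI (\<lambda>x. remainder f p x x z w))\<^sup>2))) \<longlonglongrightarrow> 0"
proof -
  define g where "g l z w = LI (\<lambda>u. LI (\<lambda>v. f u v z w * (\<psi> l u * \<psi> l v)))" for l z w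
  define G where "G p q = (\<Sum>l\<le>p. g l (fst q) (snd q))" for p and q :: "real \<times> real"
  define h where "h q = LI (\<lambda>x. f x x (fst q) (snd q))" for q :: "real \<times> real"
  have bg: "bm2 (g l)" for l unfolding g_def bm2_def by (intro bm_LI_raw bm4_sub[OF f] bmj)
  have bG: "bm (G p)" for p unfolding G_def by (intro bm_sum bg[unfolded bm2_def])
  have bh: "bm h" unfolding h_def by (intro bm_LI_raw bm4_sub[OF f] bmj)
  have h2: "bm2 (\<lambda>z w. LI (\<lambda>x. f x x z w))" unfolding bm2_def by (intro bm_LI_raw bm4_sub[OF f] bmj)
  have "\<exists>C. \<forall>q. \<bar>h q\<bar> \<le> C" using bh unfolding bm_def by blast
  then obtain C where C: "\<And>q. \<bar>h q\<bar> \<le> C" by blast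
  have BG: "\<bar>G p q\<bar> \<le> B" for p q unfolding G_def g_def by (rule bound)
  have "(\<lambda>p. LI (\<lambda>z. LI (\<lambda>w. (h (z, w) - G p (z, w))\<^sup>2))) \<longlonglongrightarrow> LI (\<lambda>z. LI (\<lambda>w. 0))"
  proof (rule LI2_tendsto)
    show "bm2 (\<lambda>z w. (h (z, w) - G n (z, w))\<^sup>2)" for n
      unfolding bm2_def using bm_power[OF bm_diff[OF bh bG[of n]], of 2] by simp
    show "bm2 (\<lambda>x y. 0)" unfolding bm2_def by (rule bm_const)
    show "\<bar>(h (x, y) - G n (x, y))\<^sup>2\<bar> \<le> (C + B)\<^sup>2" for n x y
    proof -
      have "\<bar>h (x, y) - G n (x, y)\<bar> \<le> C + B" using C[of "(x, y)"] BG[of n "(x, y)"] by linarith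
      then show ?thesis by (metis abs_ge_zero abs_power2 power2_abs power_mono)
    qed
    show "(\<lambda>n. (h (x, y) - G n (x, y))\<^sup>2) \<longlonglongrightarrow> 0" if "x \<in> {t..<T}" "y \<in> {t..<T}" for x y
      using tendsto_power[OF tendsto_diff[OF tendsto_const lim[OF that]], of "h (x, y)" 2]
      by (simp add: h_def G_def g_def)
  qed
  moreover have "(LINT q|(\<mu> \<Otimes>\<^sub>M \<mu>). (h q - G p q)\<^sup>2) = LI (\<lambda>z. LI (\<lambda>w. (h (z, w) - G p (z, w))\<^sup>2))" for p
    using LINT_\<mu>2[of "\<lambda>z w. (h (z, w) - G p (z, w))\<^sup>2"] bm_power[OF bm_diff[OF bh bG[of p]], of 2] by (simp add: bm2_def)
  ultimately have "(\<lambda>p. LINT q|(\<mu> \<Otimes>\<^sub>M \<mu>). (h q - G p q)\<^sup>2) \<longlonglongrightarrow> 0" by simp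
  from basis_of_projection_limit[OF basis_of_\<mu>2 bh bG this]
  have L: "(\<lambda>p. LINT q|(\<mu> \<Otimes>\<^sub>M \<mu>). (h q - (\<Sum>s\<in>{..p} \<times> {..p}.
     (LINT r|(\<mu> \<Otimes>\<^sub>M \<mu>). G p r * (\<psi> (fst s) (fst r) * \<psi> (snd s) (snd r))) * (\<psi> (fst s) (fst q) * \<psi> (snd s) (snd q))))\<^sup>2) \<longlonglongrightarrow> 0" .
  have co: "(LINT r|(\<mu> \<Otimes>\<^sub>M \<mu>). G p r * (\<psi> j (fst r) * \<psi> k (snd r))) = (\<Sum>l\<le>p. coef4 f l l j k)" for p j k
  proof -
    have "(LINT r|(\<mu> \<Otimes>\<^sub>M \<mu>). G p r * (\<psi> j (fst r) * \<psi> k (snd r))) =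
        (LINT r|(\<mu> \<Otimes>\<^sub>M \<mu>). (\<Sum>l\<le>p. g l (fst r) (snd r) * (\<psi> j (fst r) * \<psi> k (snd r))))"
      by (simp only: G_def sum_distrib_right)
    also have "\<dots> = (\<Sum>l\<le>p. LINT r|(\<mu> \<Otimes>\<^sub>M \<mu>). g l (fst r) (snd r) * (\<psi> j (fst r) * \<psi> k (snd r)))"
      by (intro Bochner_Integration.integral_sum integral_bm[OF finite_\<mu>2 sets_\<mu>2]) (intro bm2_sub[OF bg] bmj)
    also have "\<dots> = (\<Sum>l\<le>p. coef4 f l l j k)"
    proof (rule sum.cong[OF refl])
      fix l
      have b: "bm2 (\<lambda>z w. g l z w * (\<psi> j z * \<psi> k w))" unfolding bm2_def by (intro bm2_sub[OF bg] bmj)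
      have "(LINT r|(\<mu> \<Otimes>\<^sub>M \<mu>). g l (fst r) (snd r) * (\<psi> j (fst r) * \<psi> k (snd r))) =
          LI (\<lambda>z. LI (\<lambda>w. g l z w * (\<psi> j z * \<psi> k w)))"
        by (rule LINT_\<mu>2[OF b])
      also have "\<dots> = LI (\<lambda>z. LI (\<lambda>w. LI (\<lambda>u. LI (\<lambda>v. f u v z w * (\<psi> l u * \<psi> l v * \<psi> j z * \<psi> k w)))))"
        unfolding g_def by (simp only: integral_mult_left_zero[symmetric] mult.assoc)
      also have "\<dots> = LI (\<lambda>u. LI (\<lambda>v. LI (\<lambda>z. LI (\<lambda>w. f u v z w * (\<psi> l u * \<psi> l v * \<psi> j z * \<psi> k w)))))"
        by (rule LI_perm4(5)) (unfold bm4_def, intro bm4_sub[OF f] bmj)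
      finally show "(LINT r|(\<mu> \<Otimes>\<^sub>M \<mu>). g l (fst r) (snd r) * (\<psi> j (fst r) * \<psi> k (snd r))) = coef4 f l l j k"
        unfolding coef4_def .
    qed
    finally show ?thesis .
  qed
  have tr: "h q - (\<Sum>s\<in>{..p} \<times> {..p}. (\<Sum>l\<le>p. coef4 f l l (fst s) (snd s)) * (\<psi> (fst s) (fst q) * \<psi> (snd s) (snd q))) =
      LI (\<lambda>x. remainder f p x x (fst q) (snd q))" for q p
    unfolding LI_remainder_diagonal[OF f] h_def by (simp add: sum.cartesian_product split_def)
  have b: "bm2 (\<lambda>z w. (LI (\<lambda>x. remainder f p x x z w))\<^sup>2)" for p
    unfolding bm2_def by (intro bm_power bm_LI_raw bm4_sub[OF bm4_remainder[OF f]] bmj)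
  show ?thesis
    using L unfolding co tr LINT_\<mu>2[OF b] .
qed

end

section \<open>The simplex kernel\<close>

definition simplex_kernel :: "'b::linorder \<Rightarrow> 'b \<Rightarrow> 'b \<Rightarrow> 'b \<Rightarrow> real" where
  "simplex_kernel a b c d = heav a b * heav b c * heav c d"

lemma bm4_simplex_kernel: "bm4 simplex_kernel"
  unfolding bm4_def simplex_kernel_def by (intro bmi)

section \<open>Iterated integrals and shuffle products\<close>

context interval
begin

text \<open>Exchanging the variables turns \<open>heav x y\<close> into \<open>heav y x\<close>, and
  the two sum to 1.\<close>

lemma LI_heav: "LI (\<lambda>x. LI (\<lambda>y. heav x y)) = (T - t)\<^sup>2 / 2"
proof -
  have b: "bm2 (\<lambda>x y. heav x y)" "bm2 (\<lambda>x y. heav y x)" unfolding bm2_def by (intro bmi)+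
  have "LI (\<lambda>x. LI (\<lambda>y. heav x y)) + LI (\<lambda>x. LI (\<lambda>y. heav y x)) = LI (\<lambda>x. LI (\<lambda>y. heav x y + heav y x))"
    by (subst LI_add[symmetric], intro bm_LI_raw bmi, intro bm_LI_raw bmi, subst LI_add[symmetric])
      (intro bmi, intro bmi, rule refl)
  also have "\<dots> = (T - t)\<^sup>2" by (simp add: heav_add LI_const measure_\<mu>_UNIV power2_eq_square)
  also have "LI (\<lambda>x. LI (\<lambda>y. heav y x)) = LI (\<lambda>x. LI (\<lambda>y. heav x y))"
    by (rule LI_swap2[OF b(2)])
  finally show ?thesis by simp
qed

lemma LI_heav_square: "LI (\<lambda>x. LI (\<lambda>y. (heav x y)\<^sup>2)) = (T - t)\<^sup>2 / 2"
proof -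
  have "LI (\<lambda>y. (heav x y)\<^sup>2) = LI (\<lambda>y. heav x y)" for x
  proof (rule LI_neq_cong[of _ _ x x])
    show "bm (\<lambda>y. (heav x y)\<^sup>2)" "bm (\<lambda>y. heav x y)" by (intro bmi)+
    show "(heav x y)\<^sup>2 = heav x y" if "y \<noteq> x" for y using that by (simp add: heav_def)
  qed
  then show ?thesis by (simp add: LI_heav)
qed

text \<open>The integral from \<open>t\<close> to \<open>x\<close>, for \<open>x\<close> in the
  interval, written over a fixed domain so that Fubini requires no change of limits.\<close>

definition J :: "(real \<Rightarrow> real) \<Rightarrow> real \<Rightarrow> real" where "J f x = LI (\<lambda>s. heav s x * f s)"

lemma bm_J: assumes "bm f" shows "bm (J f)"
  unfolding J_def by (intro bm_LI_raw bm_compose[OF assms] bmi)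

lemma J_add: "bm f \<Longrightarrow> bm g \<Longrightarrow> J (\<lambda>s. f s + g s) x = J f x + J g x"
  unfolding J_def distrib_left by (intro LI_add bm_mult bm_heav ident_measurable const_measurable)

text \<open>Integration by parts: the square of pairs below \<open>x\<close> is cut into two
  triangles by \<open>heav u s + heav s u = 1\<close>.\<close>

lemma J_mult:
  assumes f: "bm f" and g: "bm g"
  shows "J f x * J g x = J (\<lambda>s. g s * J f s) x + J (\<lambda>s. f s * J g s) x"
proof -
  have 1: "J (\<lambda>s. g s * J f s) x = LI (\<lambda>s. LI (\<lambda>u. (heav s x * g s) * (heav u x * f u) * heav u s))"
    if f: "bm f" and g: "bm g" for f g
  proof -
    \<comment> \<open>If \<open>s\<close> lies below \<open>x\<close>, then \<open>u\<close> below
      \<open>s\<close> is below \<open>x\<close> as well, so the factor \<open>heav u x\<close> is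
      absorbed off ties; if \<open>s\<close> lies above \<open>x\<close>, both sides vanish.\<close>
    have "LI (\<lambda>u. (heav s x * g s) * (heav u x * f u) * heav u s) = heav s x * (g s * LI (\<lambda>u. heav u s * f u))" if "s \<noteq> x" for s
    proof -
      have "LI (\<lambda>u. (heav s x * g s) * (heav u x * f u) * heav u s) = LI (\<lambda>u. heav s x * (g s * (heav u s * f u)))"
        using that by (intro LI_neq_cong[of _ _ s x] bm_compose[OF f] bmi) (auto simp: heav_def)
      then show ?thesis by simp
    qed
    then show ?thesis
      unfolding J_def
      by (intro LI_neq_cong[of _ _ x x] bm_LI_raw bm_compose[OF f] bm_compose[OF g] bmi) auto
  qed
  have 2: "J (\<lambda>s. f s * J g s) x = LI (\<lambda>s. LI (\<lambda>u. (heav s x * g s) * (heav u x * f u) * heav s u))"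
    unfolding 1[OF g f]
    by (subst LI_swap2, unfold bm2_def, intro bm_compose[OF f] bm_compose[OF g] bmi) (simp only: mult_ac)
  have "J (\<lambda>s. g s * J f s) x + J (\<lambda>s. f s * J g s) x =
      LI (\<lambda>s. LI (\<lambda>u. (heav s x * g s) * (heav u x * f u) * heav u s + (heav s x * g s) * (heav u x * f u) * heav s u))"
    unfolding 1[OF f g] 2
    by (subst LI_add[symmetric], (intro bm_LI_raw bm_compose[OF f] bm_compose[OF g] bmi)+, subst LI_add[symmetric])
      ((intro bm_compose[OF f] bm_compose[OF g] bmi)+, rule refl)
  also have "\<dots> = LI (\<lambda>s. LI (\<lambda>u. (heav s x * g s) * (heav u x * f u)))"
    by (simp only: distrib_left[symmetric] heav_add mult_1_right)
  also have "\<dots> = J g x * J f x"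
    unfolding J_def by simp
  finally show ?thesis by (simp add: mult.commute)
qed

text \<open>Iterated integrals as words, with the innermost integrand as first letter.\<close>

definition w2 where "w2 a b = J (\<lambda>s. b s * J a s)"
definition w3 where "w3 a b c = J (\<lambda>s. c s * w2 a b s)"
definition w4 where "w4 a b c d = J (\<lambda>s. d s * w3 a b c s)"

lemma bm_w2: "bm a \<Longrightarrow> bm b \<Longrightarrow> bm (w2 a b)"
  unfolding w2_def by (intro bm_J bm_mult)
lemma bm_w3: "bm a \<Longrightarrow> bm b \<Longrightarrow> bm c \<Longrightarrow> bm (w3 a b c)"
  unfolding w3_def by (intro bm_J bm_mult bm_w2)

lemma shuffle11: "bm a \<Longrightarrow> bm b \<Longrightarrow> J a x * J b x = w2 a b x + w2 b a x"
  unfolding w2_def by (rule J_mult)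

text \<open>Integration by parts removes the last letter of either factor; the shorter shuffle
  relation then applies under the integral. The next two lemmas follow the same scheme, and the
  words on the right are all interleavings.\<close>

lemma shuffle12:
  assumes "bm a" "bm b" "bm c"
  shows "J a x * w2 b c x = w3 a b c x + w3 b a c x + w3 b c a x"
proof -
  have "J a x * w2 b c x = J (\<lambda>s. (c s * J b s) * J a s) x + J (\<lambda>s. a s * w2 b c s) x"
    unfolding w2_def using assms by (intro J_mult bm_mult bm_J)
  also have "(\<lambda>s. (c s * J b s) * J a s) = (\<lambda>s. c s * w2 a b s + c s * w2 b a s)"
  proof
    fix s
    have "(c s * J b s) * J a s = c s * (J a s * J b s)" by (simp only: mult_ac)
    also have "\<dots> = c s * w2 a b s + c s * w2 b a s" by (simp only: shuffle11[OF assms(1,2)] distrib_left add.assoc)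
    finally show "(c s * J b s) * J a s = c s * w2 a b s + c s * w2 b a s" .
  qed
  finally show ?thesis
    unfolding w3_def using assms by (simp add: J_add bm_mult bm_w2)
qed

lemma shuffle13:
  assumes "bm a" "bm b" "bm c" "bm d"
  shows "J a x * w3 b c d x = w4 a b c d x + w4 b a c d x + w4 b c a d x + w4 b c d a x"
proof -
  have "J a x * w3 b c d x = J (\<lambda>s. (d s * w2 b c s) * J a s) x + J (\<lambda>s. a s * w3 b c d s) x"
    unfolding w3_def using assms by (intro J_mult bm_mult bm_w2)
  also have "(\<lambda>s. (d s * w2 b c s) * J a s) = (\<lambda>s. d s * w3 a b c s + (d s * w3 b a c s + d s * w3 b c a s))"
  proof
    fix s
    have "(d s * w2 b c s) * J a s = d s * (J a s * w2 b c s)" by (simp only: mult_ac)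
    also have "\<dots> = d s * w3 a b c s + (d s * w3 b a c s + d s * w3 b c a s)" by (simp only: shuffle12[OF assms(1,2,3)] distrib_left add.assoc)
    finally show "(d s * w2 b c s) * J a s = d s * w3 a b c s + (d s * w3 b a c s + d s * w3 b c a s)" .
  qed
  finally show ?thesis
    unfolding w4_def using assms by (simp add: J_add bm_mult bm_add bm_w3)
qed

lemma shuffle22:
  assumes "bm a" "bm b" "bm c" "bm d"
  shows "w2 a b x * w2 c d x = w4 c a b d x + w4 a c b d x + w4 a b c d x + w4 a c d b x + w4 c a d b x + w4 c d a b x"
proof -
  have "w2 a b x * w2 c d x = J (\<lambda>s. (d s * J c s) * w2 a b s) x + J (\<lambda>s. (b s * J a s) * w2 c d s) x"
    unfolding w2_def using assms by (intro J_mult bm_mult bm_J)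
  also have "(\<lambda>s. (d s * J c s) * w2 a b s) = (\<lambda>s. d s * w3 c a b s + (d s * w3 a c b s + d s * w3 a b c s))"
  proof
    fix s
    have "(d s * J c s) * w2 a b s = d s * (J c s * w2 a b s)" by (simp only: mult_ac)
    also have "\<dots> = d s * w3 c a b s + (d s * w3 a c b s + d s * w3 a b c s)" by (simp only: shuffle12[OF assms(3,1,2)] distrib_left add.assoc)
    finally show "(d s * J c s) * w2 a b s = d s * w3 c a b s + (d s * w3 a c b s + d s * w3 a b c s)" .
  qed
  also have "(\<lambda>s. (b s * J a s) * w2 c d s) = (\<lambda>s. b s * w3 a c d s + (b s * w3 c a d s + b s * w3 c d a s))"
  proof
    fix s
    have "(b s * J a s) * w2 c d s = b s * (J a s * w2 c d s)" by (simp only: mult_ac)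
    also have "\<dots> = b s * w3 a c d s + (b s * w3 c a d s + b s * w3 c d a s)" by (simp only: shuffle12[OF assms(1,3,4)] distrib_left add.assoc)
    finally show "(b s * J a s) * w2 c d s = b s * w3 a c d s + (b s * w3 c a d s + b s * w3 c d a s)" .
  qed
  finally show ?thesis
    unfolding w4_def using assms by (simp add: J_add bm_mult bm_add bm_w3)
qed

lemma J_T: "bm f \<Longrightarrow> J f T = LI f"
  unfolding J_def by (intro LI_cong bm_measurable bm_mult bm_heav ident_measurable const_measurable) (auto simp: heav_def)

end

section \<open>Single contractions by Parseval's identity\<close>

context onb
begin

lemma cf_add: "bm f \<Longrightarrow> bm g \<Longrightarrow> cf (\<lambda>x. f x + g x) j = cf f j + cf g j"
  unfolding distrib_right by (intro LI_add bm_mult bm_\<psi>)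

lemma cf_diff: "bm f \<Longrightarrow> bm g \<Longrightarrow> cf (\<lambda>x. f x - g x) j = cf f j - cf g j"
  unfolding left_diff_distrib by (intro LI_diff bm_mult bm_\<psi>)

text \<open>Polarisation of \<open>parseval1\<close>.\<close>

lemma parseval_inner:
  assumes f: "bm f" and g: "bm g"
  shows "(\<lambda>p. \<Sum>j\<le>p. cf f j * cf g j) \<longlonglongrightarrow> LI (\<lambda>x. f x * g x)"
proof -
  have "(\<lambda>p. ((\<Sum>j\<le>p. (cf (\<lambda>x. f x + g x) j)\<^sup>2) - (\<Sum>j\<le>p. (cf (\<lambda>x. f x - g x) j)\<^sup>2)) / 4) \<longlonglongrightarrow>
      (LI (\<lambda>x. (f x + g x)\<^sup>2) - LI (\<lambda>x. (f x - g x)\<^sup>2)) / 4"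
    by (intro tendsto_intros parseval1 bm_add bm_diff f g) simp
  also have "(LI (\<lambda>x. (f x + g x)\<^sup>2) - LI (\<lambda>x. (f x - g x)\<^sup>2)) / 4 = LI (\<lambda>x. f x * g x)"
  proof -
    have "LI (\<lambda>x. (f x + g x)\<^sup>2) - LI (\<lambda>x. (f x - g x)\<^sup>2) = LI (\<lambda>x. (f x + g x)\<^sup>2 - (f x - g x)\<^sup>2)"
      by (rule LI_diff[symmetric]) (intro bm_intros f g)+
    also have "(\<lambda>x. (f x + g x)\<^sup>2 - (f x - g x)\<^sup>2) = (\<lambda>x. 4 * (f x * g x))"
      by (simp add: power2_sum power2_diff)
    finally show ?thesis by simp
  qed
  also have "(\<lambda>p. ((\<Sum>j\<le>p. (cf (\<lambda>x. f x + g x) j)\<^sup>2) - (\<Sum>j\<le>p. (cf (\<lambda>x. f x - g x) j)\<^sup>2)) / 4) =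
      (\<lambda>p. \<Sum>j\<le>p. cf f j * cf g j)"
    unfolding cf_add[OF f g] cf_diff[OF f g]
    by (simp add: power2_sum power2_diff flip: sum_subtractf) (simp add: sum_divide_distrib)
  finally show ?thesis .
qed

lemma bessel_abs_le_1:
  assumes f: "bm f" and "\<And>x. \<bar>f x\<bar> \<le> 1"
  shows "(\<Sum>j\<le>p. (cf f j)\<^sup>2) \<le> T - t"
proof -
  have "(\<Sum>j\<le>p. (cf f j)\<^sup>2) \<le> LI (\<lambda>x. (f x)\<^sup>2)" by (rule bessel1[OF f])
  also have "\<dots> \<le> LI (\<lambda>x. 1)"
    using assms(2) by (intro LI_mono bm_power f bm_const) (simp add: abs_square_le_1)
  finally show ?thesis by (simp add: measure_\<mu>_UNIV)
qed

text \<open>For a product kernel the partial trace is a sum of products of Fourier coefficients, so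
  Parseval gives its limit. The bound, from Bessel, is independent of \<open>p\<close> and of the
  fixed arguments and provides the domination in \<open>trace_remainder_tendsto\<close>.\<close>

lemma split_kernel_trace:
  assumes h: "\<And>u v. h u v = q * (a u * b v)" and a: "bm a" "\<And>x. \<bar>a x\<bar> \<le> 1" and b: "bm b" "\<And>x. \<bar>b x\<bar> \<le> 1"
    and q: "\<bar>q\<bar> \<le> 1"
  shows "(\<lambda>p. \<Sum>l\<le>p. LI (\<lambda>u. LI (\<lambda>v. h u v * (\<psi> l u * \<psi> l v)))) \<longlonglongrightarrow> LI (\<lambda>x. h x x)"
    and "\<bar>\<Sum>l\<le>p. LI (\<lambda>u. LI (\<lambda>v. h u v * (\<psi> l u * \<psi> l v)))\<bar> \<le> T - t"
proof -
  have e: "LI (\<lambda>u. LI (\<lambda>v. h u v * (\<psi> l u * \<psi> l v))) = q * (cf a l * cf b l)" for l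
  proof -
    have "LI (\<lambda>v. h u v * (\<psi> l u * \<psi> l v)) = q * (a u * \<psi> l u * cf b l)" for u
    proof -
      have "LI (\<lambda>v. h u v * (\<psi> l u * \<psi> l v)) = LI (\<lambda>v. (q * (a u * \<psi> l u)) * (b v * \<psi> l v))"
        unfolding h by (simp only: mult_ac)
      then show ?thesis by simp
    qed
    then show ?thesis by simp
  qed
  have "LI (\<lambda>x. h x x) = q * LI (\<lambda>x. a x * b x)" unfolding h by simp
  then show "(\<lambda>p. \<Sum>l\<le>p. LI (\<lambda>u. LI (\<lambda>v. h u v * (\<psi> l u * \<psi> l v)))) \<longlonglongrightarrow> LI (\<lambda>x. h x x)"
    unfolding e using tendsto_mult_left[OF parseval_inner[OF a(1) b(1)], of q] by (simp add: sum_distrib_left)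
  have "\<bar>\<Sum>l\<le>p. q * (cf a l * cf b l)\<bar> \<le> (\<Sum>l\<le>p. (cf a l)\<^sup>2 / 2 + (cf b l)\<^sup>2 / 2)"
  proof (rule order_trans[OF sum_abs sum_mono])
    fix l
    have "\<bar>q * (cf a l * cf b l)\<bar> \<le> 1 * \<bar>cf a l * cf b l\<bar>"
      unfolding abs_mult[of q] using q by (intro mult_right_mono) auto
    also have "\<dots> \<le> (cf a l)\<^sup>2 / 2 + (cf b l)\<^sup>2 / 2"
      using sum_squares_bound[of "\<bar>cf a l\<bar>" "\<bar>cf b l\<bar>"] by (simp add: abs_mult)
    finally show "\<bar>q * (cf a l * cf b l)\<bar> \<le> (cf a l)\<^sup>2 / 2 + (cf b l)\<^sup>2 / 2" .
  qed
  also have "\<dots> = (\<Sum>l\<le>p. (cf a l)\<^sup>2) / 2 + (\<Sum>l\<le>p. (cf b l)\<^sup>2) / 2"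
    by (simp add: sum.distrib sum_divide_distrib)
  also have "\<dots> \<le> T - t" using bessel_abs_le_1[OF a, of p] bessel_abs_le_1[OF b, of p] by simp
  finally show "\<bar>\<Sum>l\<le>p. LI (\<lambda>u. LI (\<lambda>v. h u v * (\<psi> l u * \<psi> l v)))\<bar> \<le> T - t" unfolding e .
qed

text \<open>The weight \<open>a u * a v\<close> and the basis product are symmetric in
  \<open>u\<close> and \<open>v\<close>, so \<open>heav u v\<close> may be replaced by its
  symmetrisation 1/2. The hypothesis is needed only away from the points \<open>z\<close> and
  \<open>w\<close>, which are null.\<close>

lemma ordered_kernel_coefficient:
  assumes h: "\<And>u v. u \<noteq> z \<Longrightarrow> u \<noteq> w \<Longrightarrow> v \<noteq> z \<Longrightarrow> v \<noteq> w \<Longrightarrow> h u v = q * (heav u v * (a u * a v))" and bh: "bm2 h" and a: "bm a"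
  shows "LI (\<lambda>u. LI (\<lambda>v. h u v * (\<psi> l u * \<psi> l v))) = q * ((cf a l)\<^sup>2 / 2)"
proof -
  let ?g = "\<lambda>u v. heav u v * ((a u * \<psi> l u) * (a v * \<psi> l v))"
  have g: "bm2 ?g" "bm2 (\<lambda>u v. heav v u * ((a u * \<psi> l u) * (a v * \<psi> l v)))"
    unfolding bm2_def by (intro bm_compose[OF a] bmj)+
  have "LI (\<lambda>u. LI (\<lambda>v. ?g u v)) + LI (\<lambda>u. LI (\<lambda>v. heav v u * ((a u * \<psi> l u) * (a v * \<psi> l v)))) =
      LI (\<lambda>u. LI (\<lambda>v. ?g u v + heav v u * ((a u * \<psi> l u) * (a v * \<psi> l v))))"
    by (subst LI_add[symmetric], (intro bm_LI_raw bm_compose[OF a] bmj)+, subst LI_add[symmetric])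
      ((intro bm_compose[OF a] bmj)+, rule refl)
  also have "\<dots> = LI (\<lambda>u. LI (\<lambda>v. (a u * \<psi> l u) * (a v * \<psi> l v)))"
    by (simp only: distrib_right[symmetric] heav_add mult_1_left)
  also have "\<dots> = (cf a l)\<^sup>2" by (simp add: power2_eq_square)
  also have "LI (\<lambda>u. LI (\<lambda>v. heav v u * ((a u * \<psi> l u) * (a v * \<psi> l v)))) = LI (\<lambda>u. LI (\<lambda>v. ?g u v))"
    by (subst LI_swap2[OF g(2)]) (simp only: mult_ac)
  finally have 1: "LI (\<lambda>u. LI (\<lambda>v. ?g u v)) = (cf a l)\<^sup>2 / 2" by simp
  have "LI (\<lambda>u. LI (\<lambda>v. h u v * (\<psi> l u * \<psi> l v))) = LI (\<lambda>u. LI (\<lambda>v. q * ?g u v))"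
  proof (rule LI_neq_cong[of _ _ z w])
    show "bm (\<lambda>u. LI (\<lambda>v. h u v * (\<psi> l u * \<psi> l v)))" by (intro bm_LI_raw bm2_sub[OF bh] bmj)
    show "bm (\<lambda>u. LI (\<lambda>v. q * ?g u v))" by (intro bm_LI_raw bm_compose[OF a] bmj)
    fix u assume u: "u \<noteq> z" "u \<noteq> w"
    show "LI (\<lambda>v. h u v * (\<psi> l u * \<psi> l v)) = LI (\<lambda>v. q * ?g u v)"
    proof (rule LI_neq_cong[of _ _ z w])
      show "bm (\<lambda>v. h u v * (\<psi> l u * \<psi> l v))" by (intro bm2_sub[OF bh] bmj)
      show "bm (\<lambda>v. q * ?g u v)" by (intro bm_compose[OF a] bmj)
      show "h u v * (\<psi> l u * \<psi> l v) = q * ?g u v" if "v \<noteq> z" "v \<noteq> w" for v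
        using h[OF u that] by (simp add: mult_ac)
    qed
  qed
  also have "\<dots> = q * LI (\<lambda>u. LI (\<lambda>v. ?g u v))" by simp
  finally show ?thesis unfolding 1 .
qed

text \<open>Parseval yields half the integral of the square of \<open>a\<close>; the kernel has
  exactly this value on the diagonal because \<open>heav x x = 1 / 2\<close>. Here the convention on
  ties is decisive.\<close>

lemma ordered_kernel_trace:
  assumes h: "\<And>u v. u \<noteq> z \<Longrightarrow> u \<noteq> w \<Longrightarrow> v \<noteq> z \<Longrightarrow> v \<noteq> w \<Longrightarrow> h u v = q * (heav u v * (a u * a v))" and bh: "bm2 h"
    and a: "bm a" "\<And>x. \<bar>a x\<bar> \<le> 1" and q: "\<bar>q\<bar> \<le> 1"
  shows "(\<lambda>p. \<Sum>l\<le>p. LI (\<lambda>u. LI (\<lambda>v. h u v * (\<psi> l u * \<psi> l v)))) \<longlonglongrightarrow> LI (\<lambda>x. h x x)"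
    and "\<bar>\<Sum>l\<le>p. LI (\<lambda>u. LI (\<lambda>v. h u v * (\<psi> l u * \<psi> l v)))\<bar> \<le> T - t"
proof -
  have e: "LI (\<lambda>u. LI (\<lambda>v. h u v * (\<psi> l u * \<psi> l v))) = q * ((cf a l)\<^sup>2 / 2)" for l
    by (rule ordered_kernel_coefficient[OF h bh a(1)])
  have "LI (\<lambda>x. h x x) = LI (\<lambda>x. q / 2 * (a x)\<^sup>2)"
  proof (rule LI_neq_cong[of _ _ z w])
    show "bm (\<lambda>x. h x x)" by (intro bm2_sub[OF bh] bmi)
    show "bm (\<lambda>x. q / 2 * (a x)\<^sup>2)" by (intro bm_intros a)
    show "h x x = q / 2 * (a x)\<^sup>2" if "x \<noteq> z" "x \<noteq> w" for x
      using h[OF that that] by (simp add: power2_eq_square)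
  qed
  also have "\<dots> = q / 2 * LI (\<lambda>x. (a x)\<^sup>2)" by (rule integral_mult_right_zero)
  finally have d: "LI (\<lambda>x. h x x) = q / 2 * LI (\<lambda>x. (a x)\<^sup>2)" .
  have s: "(\<Sum>l\<le>p. q * ((cf a l)\<^sup>2 / 2)) = q / 2 * (\<Sum>l\<le>p. (cf a l)\<^sup>2)" for p
    by (simp add: sum_distrib_left)
  show "(\<lambda>p. \<Sum>l\<le>p. LI (\<lambda>u. LI (\<lambda>v. h u v * (\<psi> l u * \<psi> l v)))) \<longlonglongrightarrow> LI (\<lambda>x. h x x)"
    unfolding e d s by (intro tendsto_mult_left parseval1 a)
  have "\<bar>q / 2 * (\<Sum>l\<le>p. (cf a l)\<^sup>2)\<bar> \<le> 1 * (T - t)"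
    unfolding abs_mult using q bessel_abs_le_1[OF a, of p]
    by (intro mult_mono) (auto simp: sum_nonneg)
  then show "\<bar>\<Sum>l\<le>p. LI (\<lambda>u. LI (\<lambda>v. h u v * (\<psi> l u * \<psi> l v)))\<bar> \<le> T - t" unfolding e s by simp
qed

text \<open>As a function of the contracted pair, with the other two arguments fixed, the simplex kernel is up to a
  constant either a product or a product times \<open>heav\<close>; in both cases Parseval gives the trace.\<close>

lemma simplex_traces_tendsto:
  fixes D defines "D \<equiv> remainder simplex_kernel"
  shows "(\<lambda>p. LI (\<lambda>z. LI (\<lambda>w. (LI (\<lambda>x. D p x x z w))\<^sup>2))) \<longlonglongrightarrow> 0"
    and "(\<lambda>p. LI (\<lambda>z. LI (\<lambda>w. (LI (\<lambda>x. D p x z x w))\<^sup>2))) \<longlonglongrightarrow> 0"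
    and "(\<lambda>p. LI (\<lambda>z. LI (\<lambda>w. (LI (\<lambda>x. D p x z w x))\<^sup>2))) \<longlonglongrightarrow> 0"
    and "(\<lambda>p. LI (\<lambda>z. LI (\<lambda>w. (LI (\<lambda>x. D p z x x w))\<^sup>2))) \<longlonglongrightarrow> 0"
    and "(\<lambda>p. LI (\<lambda>z. LI (\<lambda>w. (LI (\<lambda>x. D p z x w x))\<^sup>2))) \<longlonglongrightarrow> 0"
    and "(\<lambda>p. LI (\<lambda>z. LI (\<lambda>w. (LI (\<lambda>x. D p z w x x))\<^sup>2))) \<longlonglongrightarrow> 0"
proof -
  note k = bm4_simplex_kernel
  note sk = simplex_kernel_def[abs_def]
  have ab: "\<bar>heav a b * heav c d\<bar> \<le> 1" for a b c d :: real
    unfolding abs_mult using heav_abs_le[of a b] heav_abs_le[of c d] by (simp add: mult_le_one)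
  have b4: "bm4 (\<lambda>a b c d. simplex_kernel (g1 a b c d) (g2 a b c d) (g3 a b c d) (g4 a b c d))"
    if "\<And>i. i \<in> {g1, g2, g3, g4} \<Longrightarrow> (\<lambda>p. i (fst (fst (fst p))) (snd (fst (fst p))) (snd (fst p)) (snd p)) \<in> borel_measurable borel"
    for g1 g2 g3 g4 :: "real \<Rightarrow> real \<Rightarrow> real \<Rightarrow> real \<Rightarrow> real"
    unfolding bm4_def by (intro bm4_sub[OF k] that) auto
  have b2: "bm2 (\<lambda>u v. simplex_kernel (g1 u v) (g2 u v) (g3 u v) (g4 u v))"
    if "\<And>i. i \<in> {g1, g2, g3, g4} \<Longrightarrow> (\<lambda>p. i (fst p) (snd p)) \<in> borel_measurable borel"
    for g1 g2 g3 g4 :: "real \<Rightarrow> real \<Rightarrow> real"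
    unfolding bm2_def by (intro bm4_sub[OF k] that) auto
  have m: "(\<lambda>p. fst p) \<in> borel_measurable (borel :: (real \<times> real) measure)"
    "(\<lambda>p. snd p) \<in> borel_measurable (borel :: (real \<times> real) measure)"
    by (intro bmi)+
  have m4: "(\<lambda>p. fst (fst (fst p))) \<in> borel_measurable (borel :: (((real \<times> real) \<times> real) \<times> real) measure)"
    "(\<lambda>p. snd (fst (fst p))) \<in> borel_measurable (borel :: (((real \<times> real) \<times> real) \<times> real) measure)"
    "(\<lambda>p. snd (fst p)) \<in> borel_measurable (borel :: (((real \<times> real) \<times> real) \<times> real) measure)"
    "(\<lambda>p. snd p) \<in> borel_measurable (borel :: (((real \<times> real) \<times> real) \<times> real) measure)"
    by (intro bmi)+
  show "(\<lambda>p. LI (\<lambda>z. LI (\<lambda>w. (LI (\<lambda>x. D p x x z w))\<^sup>2))) \<longlonglongrightarrow> 0"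
    unfolding D_def
  proof (rule trace_remainder_tendsto[where B = "T - t"])
    fix z w :: real
    \<comment> \<open>If \<open>u\<close> is below \<open>v\<close> and \<open>v\<close> below
      \<open>z\<close>, then \<open>u\<close> is below \<open>z\<close>: the factor
      \<open>heav u z\<close> can be inserted to make the weight symmetric.\<close>
    have h: "simplex_kernel u v z w = heav z w * (heav u v * (heav u z * heav v z))" if "u \<noteq> z" "v \<noteq> z" for u v
      using that by (auto simp: simplex_kernel_def heav_def)
    have b: "bm2 (\<lambda>u v. simplex_kernel u v z w)" by (rule b2) (auto intro: m)
    \<comment> \<open>The only tie to avoid is with \<open>z\<close>, so it serves as both
      exceptional points.\<close>
    note K = ordered_kernel_trace[where h = "\<lambda>u v. simplex_kernel u v z w" and z = z and w = z, OF h b _ heav_abs_le heav_abs_le]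
    show "(\<lambda>p. \<Sum>l\<le>p. LI (\<lambda>u. LI (\<lambda>v. simplex_kernel u v z w * (\<psi> l u * \<psi> l v)))) \<longlonglongrightarrow> LI (\<lambda>x. simplex_kernel x x z w)"
      by (rule K(1)) (assumption | intro bmi)+
    show "\<bar>\<Sum>l\<le>p. LI (\<lambda>u. LI (\<lambda>v. simplex_kernel u v z w * (\<psi> l u * \<psi> l v)))\<bar> \<le> T - t" for p
      by (rule K(2)) (assumption | intro bmi)+
  qed (rule k)
  show "(\<lambda>p. LI (\<lambda>z. LI (\<lambda>w. (LI (\<lambda>x. D p x z x w))\<^sup>2))) \<longlonglongrightarrow> 0"
    unfolding D_def remainder_perm(1)[OF k]
  proof (rule trace_remainder_tendsto[where B = "T - t"])
    fix z w :: real
    have h: "simplex_kernel u z v w = 1 * (heav u z * (heav z v * heav v w))" for u v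
      by (simp add: simplex_kernel_def)
    note K = split_kernel_trace[where h = "\<lambda>u v. simplex_kernel u z v w", OF h _ heav_abs_le _ ab]
    show "(\<lambda>p. \<Sum>l\<le>p. LI (\<lambda>u. LI (\<lambda>v. simplex_kernel u z v w * (\<psi> l u * \<psi> l v)))) \<longlonglongrightarrow> LI (\<lambda>x. simplex_kernel x z x w)"
      by (rule K(1)) (simp | intro bmi)+
    show "\<bar>\<Sum>l\<le>p. LI (\<lambda>u. LI (\<lambda>v. simplex_kernel u z v w * (\<psi> l u * \<psi> l v)))\<bar> \<le> T - t" for p
      by (rule K(2)) (simp | intro bmi)+
  qed (rule b4, auto intro: m4)
  show "(\<lambda>p. LI (\<lambda>z. LI (\<lambda>w. (LI (\<lambda>x. D p x z w x))\<^sup>2))) \<longlonglongrightarrow> 0"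
    unfolding D_def remainder_perm(2)[OF k]
  proof (rule trace_remainder_tendsto[where B = "T - t"])
    fix z w :: real
    have h: "simplex_kernel u z w v = heav z w * (heav u z * heav w v)" for u v
      by (simp add: simplex_kernel_def)
    note K = split_kernel_trace[where h = "\<lambda>u v. simplex_kernel u z w v", OF h _ heav_abs_le _ heav_abs_le heav_abs_le]
    show "(\<lambda>p. \<Sum>l\<le>p. LI (\<lambda>u. LI (\<lambda>v. simplex_kernel u z w v * (\<psi> l u * \<psi> l v)))) \<longlonglongrightarrow> LI (\<lambda>x. simplex_kernel x z w x)"
      by (rule K(1)) (intro bmi)+
    show "\<bar>\<Sum>l\<le>p. LI (\<lambda>u. LI (\<lambda>v. simplex_kernel u z w v * (\<psi> l u * \<psi> l v)))\<bar> \<le> T - t" for p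
      by (rule K(2)) (intro bmi)+
  qed (rule b4, auto intro: m4)
  show "(\<lambda>p. LI (\<lambda>z. LI (\<lambda>w. (LI (\<lambda>x. D p z x x w))\<^sup>2))) \<longlonglongrightarrow> 0"
    unfolding D_def remainder_perm(3)[OF k]
  proof (rule trace_remainder_tendsto[where B = "T - t"])
    fix z w :: real
    have h: "simplex_kernel z u v w = 1 * (heav u v * ((heav z u * heav u w) * (heav z v * heav v w)))"
      if "u \<noteq> z" "u \<noteq> w" "v \<noteq> z" "v \<noteq> w" for u v
      using that by (auto simp: simplex_kernel_def heav_def)
    have b: "bm2 (\<lambda>u v. simplex_kernel z u v w)" by (rule b2) (auto intro: m)
    note K = ordered_kernel_trace[where h = "\<lambda>u v. simplex_kernel z u v w" and z = z and w = w, OF h b _ ab]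
    show "(\<lambda>p. \<Sum>l\<le>p. LI (\<lambda>u. LI (\<lambda>v. simplex_kernel z u v w * (\<psi> l u * \<psi> l v)))) \<longlonglongrightarrow> LI (\<lambda>x. simplex_kernel z x x w)"
      by (rule K(1)) (assumption | simp | intro bmi)+
    show "\<bar>\<Sum>l\<le>p. LI (\<lambda>u. LI (\<lambda>v. simplex_kernel z u v w * (\<psi> l u * \<psi> l v)))\<bar> \<le> T - t" for p
      by (rule K(2)) (assumption | simp | intro bmi)+
  qed (rule b4, auto intro: m4)
  show "(\<lambda>p. LI (\<lambda>z. LI (\<lambda>w. (LI (\<lambda>x. D p z x w x))\<^sup>2))) \<longlonglongrightarrow> 0"
    unfolding D_def remainder_perm(4)[OF k]
  proof (rule trace_remainder_tendsto[where B = "T - t"])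
    fix z w :: real
    have h: "simplex_kernel z u w v = 1 * ((heav z u * heav u w) * heav w v)" for u v
      by (simp add: simplex_kernel_def)
    note K = split_kernel_trace[where h = "\<lambda>u v. simplex_kernel z u w v", OF h _ ab _ heav_abs_le]
    show "(\<lambda>p. \<Sum>l\<le>p. LI (\<lambda>u. LI (\<lambda>v. simplex_kernel z u w v * (\<psi> l u * \<psi> l v)))) \<longlonglongrightarrow> LI (\<lambda>x. simplex_kernel z x w x)"
      by (rule K(1)) (simp | intro bmi)+
    show "\<bar>\<Sum>l\<le>p. LI (\<lambda>u. LI (\<lambda>v. simplex_kernel z u w v * (\<psi> l u * \<psi> l v)))\<bar> \<le> T - t" for p
      by (rule K(2)) (simp | intro bmi)+
  qed (rule b4, auto intro: m4)
  show "(\<lambda>p. LI (\<lambda>z. LI (\<lambda>w. (LI (\<lambda>x. D p z w x x))\<^sup>2))) \<longlonglongrightarrow> 0"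
    unfolding D_def remainder_perm(5)[OF k]
  proof (rule trace_remainder_tendsto[where B = "T - t"])
    fix z w :: real
    have h: "simplex_kernel z w u v = heav z w * (heav u v * (heav w u * heav w v))" if "u \<noteq> w" "v \<noteq> w" for u v
      using that by (auto simp: simplex_kernel_def heav_def)
    have b: "bm2 (\<lambda>u v. simplex_kernel z w u v)" by (rule b2) (auto intro: m)
    note K = ordered_kernel_trace[where h = "\<lambda>u v. simplex_kernel z w u v" and z = w and w = w, OF h b _ heav_abs_le heav_abs_le]
    show "(\<lambda>p. \<Sum>l\<le>p. LI (\<lambda>u. LI (\<lambda>v. simplex_kernel z w u v * (\<psi> l u * \<psi> l v)))) \<longlonglongrightarrow> LI (\<lambda>x. simplex_kernel z w x x)"
      by (rule K(1)) (assumption | intro bmi)+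
    show "\<bar>\<Sum>l\<le>p. LI (\<lambda>u. LI (\<lambda>v. simplex_kernel z w u v * (\<psi> l u * \<psi> l v)))\<bar> \<le> T - t" for p
      by (rule K(2)) (assumption | intro bmi)+
  qed (rule b4, auto intro: m4)
qed

end

context interval
begin

text \<open>Continuous counterpart of \<open>trace_norm4\<close>; on functions of the cells the two
  are related by \<open>trace_norm_cell\<close>.\<close>

definition trace_norm :: "(real \<Rightarrow> real \<Rightarrow> real \<Rightarrow> real \<Rightarrow> real) \<Rightarrow> real" where
  "trace_norm D = LI (\<lambda>a. LI (\<lambda>b. LI (\<lambda>c. LI (\<lambda>d. (D a b c d)\<^sup>2))))
    + LI (\<lambda>z. LI (\<lambda>w. (LI (\<lambda>x. D x x z w))\<^sup>2)) + LI (\<lambda>z. LI (\<lambda>w. (LI (\<lambda>x. D x z x w))\<^sup>2))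
    + LI (\<lambda>z. LI (\<lambda>w. (LI (\<lambda>x. D x z w x))\<^sup>2)) + LI (\<lambda>z. LI (\<lambda>w. (LI (\<lambda>x. D z x x w))\<^sup>2))
    + LI (\<lambda>z. LI (\<lambda>w. (LI (\<lambda>x. D z x w x))\<^sup>2)) + LI (\<lambda>z. LI (\<lambda>w. (LI (\<lambda>x. D z w x x))\<^sup>2))
    + (LI (\<lambda>z. LI (\<lambda>x. D x x z z)))\<^sup>2 + (LI (\<lambda>z. LI (\<lambda>x. D x z x z)))\<^sup>2 + (LI (\<lambda>z. LI (\<lambda>x. D x z z x)))\<^sup>2"

lemma integral_\<mu>4:
  assumes f: "bm4 f"
  shows "(LINT p|(((\<mu> \<Otimes>\<^sub>M \<mu>) \<Otimes>\<^sub>M \<mu>) \<Otimes>\<^sub>M \<mu>). f (fst (fst (fst p))) (snd (fst (fst p))) (snd (fst p)) (snd p)) =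
    LI (\<lambda>a. LI (\<lambda>b. LI (\<lambda>c. LI (\<lambda>d. f a b c d))))"
proof -
  note f2 = finite_\<mu>2 and s2 = sets_\<mu>2
  note f3 = finite_pair_\<mu>[OF f2] and s3 = sets_pair_\<mu>[OF s2]
  have "(LINT p|(((\<mu> \<Otimes>\<^sub>M \<mu>) \<Otimes>\<^sub>M \<mu>) \<Otimes>\<^sub>M \<mu>). f (fst (fst (fst p))) (snd (fst (fst p))) (snd (fst p)) (snd p)) =
      (LINT p|((\<mu> \<Otimes>\<^sub>M \<mu>) \<Otimes>\<^sub>M \<mu>). LI (\<lambda>d. f (fst (fst p)) (snd (fst p)) (snd p) d))"
    using integral_pair_\<mu>[OF f3 s3 f[unfolded bm4_def]] by simp
  also have "\<dots> = (LINT p|(\<mu> \<Otimes>\<^sub>M \<mu>). LI (\<lambda>c. LI (\<lambda>d. f (fst p) (snd p) c d)))"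
    by (subst integral_pair_\<mu>[OF f2 s2]) (intro bm_LI_raw bm4_sub[OF f] bmi, simp)
  also have "\<dots> = LI (\<lambda>a. LI (\<lambda>b. LI (\<lambda>c. LI (\<lambda>d. f a b c d))))"
    by (subst integral_pair_\<mu>[OF finite_measure_axioms sets_\<mu>]) (intro bm_LI_raw bm4_sub[OF f] bmi, simp)
  finally show ?thesis .
qed

end

section \<open>Double contractions of the simplex kernel\<close>

locale onb_const = onb +
  assumes \<psi>_0: "x \<in> {t..<T} \<Longrightarrow> \<psi> 0 x = 1 / sqrt (T - t)"
begin

text \<open>Projection onto the fourfold tensor basis obtained by iterating
  \<open>basis_of_pair\<close>.\<close>

lemma norm_remainder_tendsto:
  assumes f: "bm4 f"
  shows "(\<lambda>p. LI (\<lambda>a. LI (\<lambda>b. LI (\<lambda>c. LI (\<lambda>d. (remainder f p a b c d)\<^sup>2))))) \<longlonglongrightarrow> 0"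
proof -
  note B4 = basis_of_pair[OF basis_of_pair[OF basis_of_\<mu>2]]
  let ?F = "\<lambda>p. f (fst (fst (fst p))) (snd (fst (fst p))) (snd (fst p)) (snd p)"
  let ?\<nu> = "((\<mu> \<Otimes>\<^sub>M \<mu>) \<Otimes>\<^sub>M \<mu>) \<Otimes>\<^sub>M \<mu>"
  let ?e = "\<lambda>s p. \<psi> (fst (fst (fst s))) (fst (fst (fst p))) * \<psi> (snd (fst (fst s))) (snd (fst (fst p))) *
    \<psi> (snd (fst s)) (snd (fst p)) * \<psi> (snd s) (snd p)"
  have L: "(\<lambda>p. LINT x|?\<nu>. (?F x - (\<Sum>s\<in>(({..p} \<times> {..p}) \<times> {..p}) \<times> {..p}. (LINT x|?\<nu>. ?F x * ?e s x) * ?e s x))\<^sup>2) \<longlonglongrightarrow> 0"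
    by (rule basis_of_projection[OF B4 f[unfolded bm4_def]])
  have co: "(LINT x|?\<nu>. ?F x * ?e s x) = coef4 f (fst (fst (fst s))) (snd (fst (fst s))) (snd (fst s)) (snd s)" for s
    unfolding coef4_def
    by (rule integral_\<mu>4[of "\<lambda>a b c d. f a b c d * (\<psi> (fst (fst (fst s))) a * \<psi> (snd (fst (fst s))) b * \<psi> (snd (fst s)) c * \<psi> (snd s) d)"])
      (unfold bm4_def, intro bm4_sub[OF f] bmj)
  have D: "?F x - (\<Sum>s\<in>(({..p} \<times> {..p}) \<times> {..p}) \<times> {..p}. coef4 f (fst (fst (fst s))) (snd (fst (fst s))) (snd (fst s)) (snd s) * ?e s x) =
      remainder f p (fst (fst (fst x))) (snd (fst (fst x))) (snd (fst x)) (snd x)" for p x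
    unfolding remainder_def sum.cartesian_product' by (simp add: split_def)
  have b: "bm4 (\<lambda>a b c d. (remainder f p a b c d)\<^sup>2)" for p
    unfolding bm4_def by (intro bm_power bm4_sub[OF bm4_remainder[OF f]] bmi)
  show ?thesis
    using L unfolding co D integral_\<mu>4[OF b] .
qed

lemma double_trace_remainder:
  assumes f: "bm4 f"
  shows "LI (\<lambda>z. LI (\<lambda>x. remainder f p x x z z)) = LI (\<lambda>z. LI (\<lambda>x. f x x z z)) - (\<Sum>j\<le>p. \<Sum>l\<le>p. coef4 f l l j j)"
proof -
  have "LI (\<lambda>z. LI (\<lambda>x. remainder f p x x z z)) = LI (\<lambda>z. LI (\<lambda>x. f x x z z)) -
      LI (\<lambda>z. \<Sum>j\<le>p. \<Sum>k\<le>p. (\<Sum>l\<le>p. coef4 f l l j k) * (\<psi> j z * \<psi> k z))"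
    unfolding LI_remainder_diagonal[OF f] by (rule LI_diff) (intro bm_LI_raw bm4_sub[OF f] bmj)+
  also have "LI (\<lambda>z. \<Sum>j\<le>p. \<Sum>k\<le>p. (\<Sum>l\<le>p. coef4 f l l j k) * (\<psi> j z * \<psi> k z)) =
      (\<Sum>j\<le>p. LI (\<lambda>z. \<Sum>k\<le>p. (\<Sum>l\<le>p. coef4 f l l j k) * (\<psi> j z * \<psi> k z)))"
    by (rule LI_sum) (intro bmj)
  also have "\<dots> = (\<Sum>j\<le>p. \<Sum>k\<le>p. LI (\<lambda>z. (\<Sum>l\<le>p. coef4 f l l j k) * (\<psi> j z * \<psi> k z)))"
    by (intro sum.cong refl LI_sum) (intro bmj)
  also have "\<dots> = (\<Sum>j\<le>p. \<Sum>k\<le>p. (\<Sum>l\<le>p. coef4 f l l j k) * (if j = k then 1 else 0))"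
    by (simp only: integral_mult_right_zero orthonormal)
  also have "\<dots> = (\<Sum>j\<le>p. \<Sum>l\<le>p. coef4 f l l j j)"
    unfolding lessThan_Suc_atMost[symmetric] by (subst sum_delta_contract2) simp
  finally show ?thesis .
qed

abbreviation "K \<equiv> coef4 simplex_kernel"

text \<open>The three \<open>heav\<close> factors chain neighbouring variables, so Fubini can
  integrate from \<open>a\<close> outwards to \<open>d\<close>.\<close>

lemma K_eq_w4: "K j1 j2 j3 j4 = w4 (\<psi> j1) (\<psi> j2) (\<psi> j3) (\<psi> j4) T"
proof -
  let ?f = "\<lambda>a b c d. simplex_kernel a b c d * (\<psi> j1 a * \<psi> j2 b * \<psi> j3 c * \<psi> j4 d)"
  have f: "bm4 ?f" unfolding bm4_def by (intro bm4_sub[OF bm4_simplex_kernel] bmj)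
  have "K j1 j2 j3 j4 = LI (\<lambda>c. LI (\<lambda>d. LI (\<lambda>a. LI (\<lambda>b. ?f a b c d))))"
    unfolding coef4_def by (rule LI_perm4(5)[OF f])
  also have "\<dots> = LI (\<lambda>d. LI (\<lambda>c. LI (\<lambda>a. LI (\<lambda>b. ?f a b c d))))"
    by (rule LI_swap2) (unfold bm2_def, intro bm_LI_raw bm4_sub[OF f] bmi)
  also have "\<dots> = LI (\<lambda>d. LI (\<lambda>c. LI (\<lambda>b. LI (\<lambda>a. ?f a b c d))))"
  proof -
    have "LI (\<lambda>a. LI (\<lambda>b. ?f a b c d)) = LI (\<lambda>b. LI (\<lambda>a. ?f a b c d))" for c d
      by (rule LI_swap2) (unfold bm2_def, intro bm4_sub[OF f] bmi)
    then show ?thesis by simp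
  qed
  also have "\<dots> = LI (\<lambda>d. \<psi> j4 d * LI (\<lambda>c. heav c d * (\<psi> j3 c * LI (\<lambda>b. heav b c * (\<psi> j2 b * LI (\<lambda>a. heav a b * \<psi> j1 a))))))"
  proof -
    have "LI (\<lambda>a. ?f a b c d) = (heav c d * \<psi> j4 d * \<psi> j3 c) * (heav b c * \<psi> j2 b * LI (\<lambda>a. heav a b * \<psi> j1 a))" for b c d
    proof -
      have "LI (\<lambda>a. ?f a b c d) = LI (\<lambda>a. ((heav c d * \<psi> j4 d * \<psi> j3 c) * (heav b c * \<psi> j2 b)) * (heav a b * \<psi> j1 a))"
        unfolding simplex_kernel_def by (simp only: mult_ac)
      then show ?thesis by (simp only: integral_mult_right_zero mult.assoc)
    qed
    then have "LI (\<lambda>b. LI (\<lambda>a. ?f a b c d)) = (heav c d * \<psi> j4 d * \<psi> j3 c) * LI (\<lambda>b. heav b c * \<psi> j2 b * LI (\<lambda>a. heav a b * \<psi> j1 a))" for c d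
      by (simp only: integral_mult_right_zero)
    then have "LI (\<lambda>b. LI (\<lambda>a. ?f a b c d)) = \<psi> j4 d * (heav c d * (\<psi> j3 c * LI (\<lambda>b. heav b c * (\<psi> j2 b * LI (\<lambda>a. heav a b * \<psi> j1 a)))))" for c d
      by (simp only: mult_ac)
    then show ?thesis by (simp only: integral_mult_right_zero)
  qed
  also have "\<dots> = LI (\<lambda>d. \<psi> j4 d * w3 (\<psi> j1) (\<psi> j2) (\<psi> j3) d)"
    unfolding w3_def w2_def J_def ..
  also have "\<dots> = w4 (\<psi> j1) (\<psi> j2) (\<psi> j3) (\<psi> j4) T"
    unfolding w4_def by (rule J_T[symmetric]) (intro bm_mult bm_\<psi> bm_w3)
  finally show ?thesis .
qed

text \<open>Integrating \<open>\<psi> j\<close> is pairing it with a multiple of the constant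
  \<open>\<psi> 0\<close>.\<close>

lemma J_\<psi>_T: "J (\<psi> j) T = (if j = 0 then sqrt (T - t) else 0)"
proof -
  have s: "sqrt (T - t) * (1 / sqrt (T - t)) = 1" using t_less_T by simp
  have "J (\<psi> j) T = LI (\<psi> j)" by (rule J_T[OF bm_\<psi>])
  also have "\<dots> = LI (\<lambda>x. sqrt (T - t) * (\<psi> 0 x * \<psi> j x))"
  proof (rule LI_cong)
    show "\<psi> j x = sqrt (T - t) * (\<psi> 0 x * \<psi> j x)" if "x \<in> {t..<T}" for x
      using s by (simp only: \<psi>_0[OF that] mult.assoc[symmetric] mult_1_left)
  qed (rule bm_measurable, intro bmj)+
  also have "\<dots> = sqrt (T - t) * LI (\<lambda>x. \<psi> 0 x * \<psi> j x)" by (rule integral_mult_right_zero)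
  finally show ?thesis by (simp add: orthonormal)
qed

text \<open>The double contractions of the truncated series; their limits are determined by three linear relations.\<close>

definition tA where "tA p = (\<Sum>j\<le>p. \<Sum>l\<le>p. K l l j j)"
definition tB where "tB p = (\<Sum>j\<le>p. \<Sum>l\<le>p. K l j l j)"
definition tC where "tC p = (\<Sum>j\<le>p. \<Sum>l\<le>p. K l j j l)"

text \<open>With equal letters the shuffle relation says that twice the iterated integral is the
  square of the simple one.\<close>

lemma w2_same_T: "w2 (\<psi> j) (\<psi> j) T = (if j = 0 then (T - t) / 2 else 0)"
  using shuffle11[OF bm_\<psi> bm_\<psi>, of j T j] t_less_T by (auto simp: J_\<psi>_T split: if_splits)

lemma sum_swap_K: "(\<Sum>j\<le>p. \<Sum>l\<le>p. K j j l l) = tA p" "(\<Sum>j\<le>p. \<Sum>l\<le>p. K j l j l) = tB p" "(\<Sum>j\<le>p. \<Sum>l\<le>p. K j l l j) = tC p"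
  unfolding tA_def tB_def tC_def by (rule sum.swap)+

text \<open>Shuffling the words \<open>j j\<close> and \<open>l l\<close> gives each of the three
  pairing patterns twice. The left side factorises, and only the index 0 contributes, so the
  relation is exact for every \<open>p\<close>.\<close>

lemma trace_relation1: "2 * (tA p + tB p + tC p) = ((T - t) / 2)\<^sup>2"
proof -
  have "(\<Sum>j\<le>p. \<Sum>l\<le>p. w2 (\<psi> j) (\<psi> j) T * w2 (\<psi> l) (\<psi> l) T) = 2 * (tA p + tB p + tC p)"
    unfolding shuffle22[OF bm_\<psi> bm_\<psi> bm_\<psi> bm_\<psi>] K_eq_w4[symmetric] sum.distrib sum_swap_K
    by (simp add: tA_def tB_def tC_def)
  moreover have "(\<Sum>j\<le>p. \<Sum>l\<le>p. w2 (\<psi> j) (\<psi> j) T * w2 (\<psi> l) (\<psi> l) T) = ((T - t) / 2)\<^sup>2"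
  proof -
    have "(\<Sum>j\<le>p. w2 (\<psi> j) (\<psi> j) T) = (T - t) / 2" by (simp add: w2_same_T)
    then show ?thesis by (simp only: power2_eq_square sum_product[symmetric])
  qed
  ultimately show ?thesis by simp
qed

text \<open>Shuffling the word \<open>j l\<close> with itself gives \<open>j j l l\<close> four
  times and \<open>j l j l\<close> twice.\<close>

lemma trace_relation2: "2 * tB p + 4 * tA p = (\<Sum>j\<le>p. \<Sum>l\<le>p. (w2 (\<psi> j) (\<psi> l) T)\<^sup>2)"
  unfolding power2_eq_square shuffle22[OF bm_\<psi> bm_\<psi> bm_\<psi> bm_\<psi>] K_eq_w4[symmetric] sum.distrib sum_swap_K
  by simp

text \<open>Shuffling the letter \<open>j\<close> into \<open>j l l\<close> gives
  \<open>j j l l\<close> twice and the other two patterns once. The sum over \<open>j\<close>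
  reduces to \<open>j = 0\<close> by \<open>J_\<psi>_T\<close>.\<close>

lemma trace_relation3: "tC p + tB p + 2 * tA p = (\<Sum>l\<le>p. sqrt (T - t) * w3 (\<psi> 0) (\<psi> l) (\<psi> l) T)"
proof -
  have "(\<Sum>j\<le>p. \<Sum>l\<le>p. J (\<psi> j) T * w3 (\<psi> j) (\<psi> l) (\<psi> l) T) = tC p + tB p + 2 * tA p"
    unfolding shuffle13[OF bm_\<psi> bm_\<psi> bm_\<psi> bm_\<psi>] K_eq_w4[symmetric] sum.distrib sum_swap_K by simp
  moreover have "(\<Sum>j\<le>p. \<Sum>l\<le>p. J (\<psi> j) T * w3 (\<psi> j) (\<psi> l) (\<psi> l) T) = (\<Sum>l\<le>p. sqrt (T - t) * w3 (\<psi> 0) (\<psi> l) (\<psi> l) T)"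
  proof -
    have "(\<Sum>l\<le>p. J (\<psi> j) T * w3 (\<psi> j) (\<psi> l) (\<psi> l) T) = (if j = 0 then \<Sum>l\<le>p. sqrt (T - t) * w3 (\<psi> 0) (\<psi> l) (\<psi> l) T else 0)" for j
      by (simp add: J_\<psi>_T)
    then show ?thesis by simp
  qed
  ultimately show ?thesis by simp
qed

text \<open>The scaled innermost function is the constant 1, so its variable \<open>s\<close> can be
  integrated last. For fixed \<open>s\<close> what remains is an ordered integral with a symmetric
  weight, and \<open>ordered_kernel_coefficient\<close> makes it half a squared Fourier
  coefficient.\<close>

lemma w3_const: "sqrt (T - t) * w3 (\<psi> 0) (\<psi> l) (\<psi> l) T = LI (\<lambda>s. (cf (\<lambda>u. heav s u) l)\<^sup>2 / 2)"
proof -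
  have s: "sqrt (T - t) * (1 / sqrt (T - t)) = 1" using t_less_T by simp
  let ?f = "\<lambda>v u s. heav u v * (heav s u * (\<psi> l u * \<psi> l v))"
  have f: "bm3 ?f" unfolding bm3_def by (intro bmj)
  have "w3 (\<psi> 0) (\<psi> l) (\<psi> l) T = LI (\<lambda>v. \<psi> l v * LI (\<lambda>u. heav u v * (\<psi> l u * LI (\<lambda>s. heav s u * \<psi> 0 s))))"
    unfolding w3_def by (subst J_T) (intro bm_mult bm_\<psi> bm_w2, unfold w2_def J_def, rule refl)
  also have "\<dots> = LI (\<lambda>v. \<psi> l v * LI (\<lambda>u. heav u v * (\<psi> l u * LI (\<lambda>s. 1 / sqrt (T - t) * heav s u))))"
  proof -
    have "LI (\<lambda>s. heav s u * \<psi> 0 s) = LI (\<lambda>s. 1 / sqrt (T - t) * heav s u)" for u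
      by (rule LI_cong) (simp add: \<psi>_0, (rule bm_measurable, intro bmj)+)
    then show ?thesis by simp
  qed
  also have "\<dots> = 1 / sqrt (T - t) * LI (\<lambda>v. \<psi> l v * LI (\<lambda>u. heav u v * (\<psi> l u * LI (\<lambda>s. heav s u))))"
    by simp
  finally have "sqrt (T - t) * w3 (\<psi> 0) (\<psi> l) (\<psi> l) T =
      (sqrt (T - t) * (1 / sqrt (T - t))) * LI (\<lambda>v. \<psi> l v * LI (\<lambda>u. heav u v * (\<psi> l u * LI (\<lambda>s. heav s u))))"
    by (simp only: mult.assoc)
  also have "\<dots> = LI (\<lambda>v. LI (\<lambda>u. LI (\<lambda>s. ?f v u s)))"
    unfolding s mult_1_left by (simp only: integral_mult_right_zero[symmetric] mult_ac)
  also have "\<dots> = LI (\<lambda>s. LI (\<lambda>v. LI (\<lambda>u. ?f v u s)))"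
    by (rule LI_perm3(4)[OF f])
  also have "\<dots> = LI (\<lambda>s. LI (\<lambda>u. LI (\<lambda>v. ?f v u s)))"
  proof -
    have "LI (\<lambda>v. LI (\<lambda>u. ?f v u s)) = LI (\<lambda>u. LI (\<lambda>v. ?f v u s))" for s
      by (rule LI_swap2) (unfold bm2_def, intro bm3_sub[OF f] bmi)
    then show ?thesis by simp
  qed
  also have "\<dots> = LI (\<lambda>s. (cf (\<lambda>u. heav s u) l)\<^sup>2 / 2)"
  proof -
    have "LI (\<lambda>u. LI (\<lambda>v. (heav u v * heav s u) * (\<psi> l u * \<psi> l v))) = 1 * ((cf (\<lambda>u. heav s u) l)\<^sup>2 / 2)" for s
    proof (rule ordered_kernel_coefficient[of s s])
      \<comment> \<open>If \<open>s\<close> is below \<open>u\<close> and \<open>u\<close> below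
        \<open>v\<close>, then \<open>s\<close> is below \<open>v\<close>; inserting that factor
        makes the weight symmetric.\<close>
      show "heav u v * heav s u = 1 * (heav u v * (heav s u * heav s v))" if "u \<noteq> s" "u \<noteq> s" "v \<noteq> s" "v \<noteq> s" for u v
        using that by (auto simp: heav_def)
      show "bm2 (\<lambda>u v. heav u v * heav s u)" unfolding bm2_def by (intro bmi)
      show "bm (\<lambda>u. heav s u)" by (intro bmi)
    qed
    then show ?thesis by (simp only: mult.assoc mult_1_left)
  qed
  finally show ?thesis .
qed

text \<open>Parseval for \<open>heav s\<close> at each \<open>s\<close>, then dominated convergence
  in \<open>s\<close>; the limit is half the integral of the squared \<open>heav\<close> over the
  square.\<close>

lemma tendsto_trace_relation3: "(\<lambda>p. tC p + tB p + 2 * tA p) \<longlonglongrightarrow> (T - t)\<^sup>2 / 4"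
proof -
  have bt: "bm (\<lambda>u. heav s u)" for s :: real by (intro bmi)
  have bc: "bm (\<lambda>s. (cf (\<lambda>u. heav s u) l)\<^sup>2 / 2)" for l
  proof -
    have "bm (\<lambda>s. 1 / 2 * (cf (\<lambda>u. heav s u) l)\<^sup>2)" by (intro bm_mult bm_const bm_power bm_LI_raw bmj)
    then show ?thesis by simp
  qed
  have bs: "bm (\<lambda>s. LI (\<lambda>u. (heav s u)\<^sup>2) / 2)"
  proof -
    have "bm (\<lambda>s. 1 / 2 * LI (\<lambda>u. (heav s u)\<^sup>2))" by (intro bm_mult bm_const bm_power bm_LI_raw bmi)
    then show ?thesis by simp
  qed
  have "(\<lambda>p. LI (\<lambda>s. \<Sum>l\<le>p. (cf (\<lambda>u. heav s u) l)\<^sup>2 / 2)) \<longlonglongrightarrow> LI (\<lambda>s. LI (\<lambda>u. (heav s u)\<^sup>2) / 2)"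
  proof (rule LI_tendsto)
    show "(\<lambda>s. \<Sum>l\<le>p. (cf (\<lambda>u. heav s u) l)\<^sup>2 / 2) \<in> borel_measurable borel" for p
      by (rule bm_measurable, intro bm_sum bc)
    show "(\<lambda>s. LI (\<lambda>u. (heav s u)\<^sup>2) / 2) \<in> borel_measurable borel" by (rule bm_measurable[OF bs])
    show "\<bar>\<Sum>l\<le>p. (cf (\<lambda>u. heav s u) l)\<^sup>2 / 2\<bar> \<le> T - t" for p s
      using bessel_abs_le_1[OF bt heav_abs_le, of s p] sum_nonneg[of "{..p}" "\<lambda>l. (cf (\<lambda>u. heav s u) l)\<^sup>2"]
      by (simp add: sum_divide_distrib[symmetric])
    show "(\<lambda>p. \<Sum>l\<le>p. (cf (\<lambda>u. heav s u) l)\<^sup>2 / 2) \<longlonglongrightarrow> LI (\<lambda>u. (heav s u)\<^sup>2) / 2" for s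
      using tendsto_divide[OF parseval1[OF bt[of s]] tendsto_const[of 2]] by (simp add: sum_divide_distrib)
  qed
  also have "LI (\<lambda>s. LI (\<lambda>u. (heav s u)\<^sup>2) / 2) = (T - t)\<^sup>2 / 4"
    using LI_heav_square by simp
  also have "(\<lambda>p. LI (\<lambda>s. \<Sum>l\<le>p. (cf (\<lambda>u. heav s u) l)\<^sup>2 / 2)) = (\<lambda>p. tC p + tB p + 2 * tA p)"
    unfolding trace_relation3 w3_const by (rule ext, rule LI_sum, rule bc)
  finally show ?thesis .
qed

text \<open>The numbers \<open>w2 (\<psi> j) (\<psi> l) T\<close> are the Fourier coefficients of
  \<open>heav\<close> on the square, so Parseval in two variables applies.\<close>

lemma tendsto_trace_relation2: "(\<lambda>p. 2 * tB p + 4 * tA p) \<longlonglongrightarrow> (T - t)\<^sup>2 / 2"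
proof -
  have b: "bm2 (\<lambda>x y. (heav x y)\<^sup>2)" "bm (\<lambda>q::real\<times>real. heav (fst q) (snd q))" unfolding bm2_def by (intro bmi)+
  have "(\<lambda>p. \<Sum>s\<in>{..p} \<times> {..p}. (LINT q|(\<mu> \<Otimes>\<^sub>M \<mu>). heav (fst q) (snd q) * (\<psi> (fst s) (fst q) * \<psi> (snd s) (snd q)))\<^sup>2)
      \<longlonglongrightarrow> (LINT q|(\<mu> \<Otimes>\<^sub>M \<mu>). (heav (fst q) (snd q))\<^sup>2)"
    using basis_of_\<mu>2 b(2) unfolding basis_of_def by blast
  also have "(LINT q|(\<mu> \<Otimes>\<^sub>M \<mu>). (heav (fst q) (snd q))\<^sup>2) = (T - t)\<^sup>2 / 2"
    unfolding LINT_\<mu>2[OF b(1)] by (rule LI_heav_square)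
  also have "(\<lambda>p. \<Sum>s\<in>{..p} \<times> {..p}. (LINT q|(\<mu> \<Otimes>\<^sub>M \<mu>). heav (fst q) (snd q) * (\<psi> (fst s) (fst q) * \<psi> (snd s) (snd q)))\<^sup>2) =
      (\<lambda>p. 2 * tB p + 4 * tA p)"
  proof
    fix p
    have "(LINT q|(\<mu> \<Otimes>\<^sub>M \<mu>). heav (fst q) (snd q) * (\<psi> j (fst q) * \<psi> l (snd q))) = w2 (\<psi> j) (\<psi> l) T" for j l
    proof -
      have b: "bm2 (\<lambda>x y. heav x y * (\<psi> j x * \<psi> l y))" unfolding bm2_def by (intro bmj)
      have "(LINT q|(\<mu> \<Otimes>\<^sub>M \<mu>). heav (fst q) (snd q) * (\<psi> j (fst q) * \<psi> l (snd q))) = LI (\<lambda>x. LI (\<lambda>y. heav x y * (\<psi> j x * \<psi> l y)))"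
        by (rule LINT_\<mu>2[OF b])
      also have "\<dots> = LI (\<lambda>y. LI (\<lambda>x. heav x y * (\<psi> j x * \<psi> l y)))" by (rule LI_swap2[OF b])
      also have "\<dots> = LI (\<lambda>y. LI (\<lambda>x. \<psi> l y * (heav x y * \<psi> j x)))" by (simp only: mult_ac)
      also have "\<dots> = LI (\<lambda>y. \<psi> l y * J (\<psi> j) y)" unfolding J_def by simp
      also have "\<dots> = w2 (\<psi> j) (\<psi> l) T" unfolding w2_def by (rule J_T[symmetric]) (intro bm_mult bm_\<psi> bm_J)
      finally show ?thesis .
    qed
    then show "(\<Sum>s\<in>{..p} \<times> {..p}. (LINT q|(\<mu> \<Otimes>\<^sub>M \<mu>). heav (fst q) (snd q) * (\<psi> (fst s) (fst q) * \<psi> (snd s) (snd q)))\<^sup>2) =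
      2 * tB p + 4 * tA p"
      unfolding trace_relation2 by (simp add: sum.cartesian_product split_def)
  qed
  finally show ?thesis .
qed

text \<open>Half of the exact first relation, subtracted from the third, isolates \<open>tA\<close>;
  the second relation then gives \<open>tB\<close>, and the first one \<open>tC\<close>.\<close>

lemma double_traces_tendsto:
  shows "tA \<longlonglongrightarrow> (T - t)\<^sup>2 / 8" "tB \<longlonglongrightarrow> 0" "tC \<longlonglongrightarrow> 0"
proof -
  have s: "tA p + tB p + tC p = (T - t)\<^sup>2 / 8" for p
    using trace_relation1[of p] by (simp add: power_divide)
  have "tA = (\<lambda>p. (tC p + tB p + 2 * tA p) - (T - t)\<^sup>2 / 8)"
  proof
    show "tA p = (tC p + tB p + 2 * tA p) - (T - t)\<^sup>2 / 8" for p using s[of p] by linarith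
  qed
  then show A: "tA \<longlonglongrightarrow> (T - t)\<^sup>2 / 8"
    using tendsto_diff[OF tendsto_trace_relation3 tendsto_const[of "(T - t)\<^sup>2 / 8"]] by simp
  have "(\<lambda>p. ((2 * tB p + 4 * tA p) - 4 * tA p) / 2) \<longlonglongrightarrow> ((T - t)\<^sup>2 / 2 - 4 * ((T - t)\<^sup>2 / 8)) / 2"
    by (intro tendsto_intros tendsto_trace_relation2 A) simp
  then show B: "tB \<longlonglongrightarrow> 0" by simp
  have "tC = (\<lambda>p. (T - t)\<^sup>2 / 8 - tA p - tB p)"
  proof
    show "tC p = (T - t)\<^sup>2 / 8 - tA p - tB p" for p using s[of p] by linarith
  qed
  then show "tC \<longlonglongrightarrow> 0"
    using tendsto_diff[OF tendsto_diff[OF tendsto_const[of "(T - t)\<^sup>2 / 8"] A] B] by simp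
qed

text \<open>On arguments \<open>x x z z\<close> the kernel is a quarter of \<open>heav x z\<close>,
  with integral \<open>(T - t)\<^sup>2 / 8\<close>, the limit of \<open>tA\<close>. The other two
  pairings would require both \<open>x\<close> below \<open>z\<close> and \<open>z\<close> below
  \<open>x\<close>, so off the diagonal the kernel vanishes, in agreement with the limits 0.\<close>

lemma simplex_double_traces_tendsto:
  shows "(\<lambda>p. LI (\<lambda>z. LI (\<lambda>x. remainder simplex_kernel p x x z z))) \<longlonglongrightarrow> 0"
    and "(\<lambda>p. LI (\<lambda>z. LI (\<lambda>x. remainder simplex_kernel p x z x z))) \<longlonglongrightarrow> 0"
    and "(\<lambda>p. LI (\<lambda>z. LI (\<lambda>x. remainder simplex_kernel p x z z x))) \<longlonglongrightarrow> 0"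
proof -
  note k = bm4_simplex_kernel
  have f1: "bm4 (\<lambda>a c b d. simplex_kernel a b c d)" and f2: "bm4 (\<lambda>a d b c. simplex_kernel a b c d)"
    unfolding bm4_def by (intro bm4_sub[OF k] bmi)+
  have z: "LI (\<lambda>z. LI (\<lambda>x. g x z)) = 0" if "bm2 g" "\<And>x z. x \<noteq> z \<Longrightarrow> g x z = 0" for g
  proof -
    have "LI (\<lambda>x. g x z) = LI (\<lambda>x. 0)" for z
      by (rule LI_neq_cong[of _ _ z z]) (intro bm2_sub[OF that(1)] bmi, rule bm_const, rule that(2))
    then show ?thesis by simp
  qed
  have "LI (\<lambda>z. LI (\<lambda>x. simplex_kernel x x z z :: real)) = LI (\<lambda>z. LI (\<lambda>x. heav x z)) / 4"
    by (simp add: simplex_kernel_def)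
  also have "LI (\<lambda>z. LI (\<lambda>x. heav x z)) = LI (\<lambda>x. LI (\<lambda>z. heav x z))"
    by (rule LI_swap2) (unfold bm2_def, intro bmi)
  finally have v: "LI (\<lambda>z. LI (\<lambda>x. simplex_kernel x x z z :: real)) = (T - t)\<^sup>2 / 8"
    by (simp add: LI_heav)
  show "(\<lambda>p. LI (\<lambda>z. LI (\<lambda>x. remainder simplex_kernel p x x z z))) \<longlonglongrightarrow> 0"
    unfolding double_trace_remainder[OF k] v tA_def[symmetric]
    using tendsto_diff[OF tendsto_const double_traces_tendsto(1), of "(T - t)\<^sup>2 / 8"] by simp
  have v1: "LI (\<lambda>z. LI (\<lambda>x. simplex_kernel x z x z :: real)) = 0"
    by (rule z) (unfold bm2_def, intro bm4_sub[OF k] bmi, auto simp: simplex_kernel_def heav_def)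
  show "(\<lambda>p. LI (\<lambda>z. LI (\<lambda>x. remainder simplex_kernel p x z x z))) \<longlonglongrightarrow> 0"
    unfolding remainder_perm(1)[OF k] double_trace_remainder[OF f1] v1 coef4_perm(1)[OF k, symmetric] tB_def[symmetric]
    using tendsto_minus[OF double_traces_tendsto(2)] by simp
  have v2: "LI (\<lambda>z. LI (\<lambda>x. simplex_kernel x z z x :: real)) = 0"
    by (rule z) (unfold bm2_def, intro bm4_sub[OF k] bmi, auto simp: simplex_kernel_def heav_def)
  show "(\<lambda>p. LI (\<lambda>z. LI (\<lambda>x. remainder simplex_kernel p x z z x))) \<longlonglongrightarrow> 0"
    unfolding remainder_perm(2)[OF k] double_trace_remainder[OF f2] v2 coef4_perm(2)[OF k, symmetric] tC_def[symmetric]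
    using tendsto_minus[OF double_traces_tendsto(3)] by simp
qed

theorem trace_norm_remainder_tendsto: "(\<lambda>p. trace_norm (remainder simplex_kernel p)) \<longlonglongrightarrow> 0"
proof -
  have "(\<lambda>p. trace_norm (remainder simplex_kernel p)) \<longlonglongrightarrow> 0 + 0 + 0 + 0 + 0 + 0 + 0 + 0\<^sup>2 + 0\<^sup>2 + 0\<^sup>2"
    unfolding trace_norm_def
    by (intro tendsto_add tendsto_power norm_remainder_tendsto simplex_traces_tendsto simplex_double_traces_tendsto bm4_simplex_kernel)
  then show ?thesis by simp
qed

end

section \<open>The Legendre and the trigonometric system\<close>

context interval
begin

text \<open>Cutting off at the ends of the interval makes the basis functions bounded on the whole line.\<close>

definition restr :: "(real \<Rightarrow> real) \<Rightarrow> real \<Rightarrow> real" where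
  "restr f x = indicator {t..<T} x * f x"

lemma restr_eq: "x \<in> {t..<T} \<Longrightarrow> restr f x = f x"
  by (simp add: restr_def)

lemma bm_restr:
  assumes "continuous_on {t..T} f"
  shows "bm (restr f)"
proof -
  have "bounded (f ` {t..T})"
    by (intro compact_imp_bounded compact_continuous_image assms) simp
  then obtain B where "\<forall>y\<in>f ` {t..T}. \<bar>y\<bar> \<le> B"
    unfolding bounded_real by blast
  then have B: "\<bar>f x\<bar> \<le> B" if "x \<in> {t..T}" for x using that by blast
  have "0 \<le> B" using B[of t] t_less_T by (auto intro: order_trans[OF abs_ge_zero])
  have m: "(\<lambda>x. indicator {t..<T} x *\<^sub>R f x) \<in> borel_measurable borel"
    by (intro borel_measurable_continuous_on_indicator continuous_on_subset[OF assms]) auto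
  show ?thesis
  proof (rule bmI)
    show "restr f \<in> borel_measurable borel" using m by (simp add: restr_def[abs_def])
    show "\<bar>restr f x\<bar> \<le> B" for x
      using B[of x] \<open>0 \<le> B\<close> by (auto simp: restr_def indicator_def)
  qed
qed

text \<open>Links the gauge integrals of \<open>coefC\<close> with integrals against
  \<open>\<mu>\<close>; the two integrands can differ only at \<open>x\<close> and
  \<open>T\<close>.\<close>

lemma integral_eq_J:
  assumes f: "continuous_on {t..T} f" and g: "bm g" "\<And>s. s \<in> {t..<T} \<Longrightarrow> g s = f s" and x: "x \<in> {t..T}"
  shows "integral {t..x} f = J g x"
proof -
  have cf: "continuous_on {t..x} f" using f x by (auto intro: continuous_on_subset)
  have si: "set_integrable lborel {t..x} f" by (rule borel_integrable_atLeastAtMost'[OF cf])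
  have bth: "bm (\<lambda>s. heav s x * g s)" by (intro bm_mult bm_heav g ident_measurable const_measurable)
  have m: "(\<lambda>s. indicator {t..<T} s * (heav s x * g s)) \<in> borel_measurable borel"
    by (rule bm_measurable) (intro bm_mult bm_indicator bth, simp)
  have "J g x = (LINT s|lborel. indicator {t..<T} s * (heav s x * g s))"
    unfolding J_def by (rule LI_eq) (rule bm_measurable[OF bth])
  also have "\<dots> = (LINT s|lborel. indicator {t..x} s *\<^sub>R f s)"
  proof (rule integral_cong_AE)
    show "(\<lambda>s. indicator {t..<T} s * (heav s x * g s)) \<in> borel_measurable lborel" using m by simp
    show "(\<lambda>s. indicator {t..x} s *\<^sub>R f s) \<in> borel_measurable lborel"
      using si by (simp add: set_integrable_def borel_measurable_integrable)
    show "AE s in lborel. indicator {t..<T} s * (heav s x * g s) = indicator {t..x} s *\<^sub>R f s"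
      using AE_lborel_singleton[of x] AE_lborel_singleton[of T]
    proof eventually_elim
      case (elim s)
      then show ?case using x g(2)[of s] by (auto simp: indicator_def heav_def)
    qed
  qed
  also have "\<dots> = integral {t..x} f"
    using set_borel_integral_eq_integral(2)[OF si] by (simp add: set_lebesgue_integral_def)
  finally show ?thesis ..
qed

lemma continuous_integral:
  fixes f :: "real \<Rightarrow> real"
  shows "continuous_on {t..T} f \<Longrightarrow> continuous_on {t..T} (\<lambda>x. integral {t..x} f)"
  by (rule indefinite_integral_continuous_1[OF integrable_continuous_interval])

text \<open>\<open>coefC\<close> takes the outermost index first, \<open>w4\<close> the innermost
  function. Continuity of every inner integral is carried along because \<open>integral_eq_J\<close>
  asks for a continuous integrand.\<close>

lemma coefC_eq_w4:
  assumes \<phi>: "\<And>j. continuous_on {t..T} (\<phi> j)"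
  shows "coefC \<phi> t T j4 j3 j2 j1 = w4 (restr (\<phi> j1)) (restr (\<phi> j2)) (restr (\<phi> j3)) (restr (\<phi> j4)) T"
proof -
  note b = bm_restr[OF \<phi>]
  have T: "T \<in> {t..T}" using t_less_T by simp
  have 1: "integral {t..x} (\<phi> j1) = J (restr (\<phi> j1)) x" if "x \<in> {t..T}" for x
    by (rule integral_eq_J[OF \<phi> b restr_eq that])
  have c1: "continuous_on {t..T} (\<lambda>s. \<phi> j2 s * integral {t..s} (\<phi> j1))"
    by (intro continuous_on_mult continuous_integral \<phi>)
  have 2: "integral {t..x} (\<lambda>s. \<phi> j2 s * integral {t..s} (\<phi> j1)) = w2 (restr (\<phi> j1)) (restr (\<phi> j2)) x" if "x \<in> {t..T}" for x
    unfolding w2_def by (rule integral_eq_J[OF c1 _ _ that]) (auto intro!: bm_mult bm_J b simp: 1 restr_eq)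
  have c2: "continuous_on {t..T} (\<lambda>s. \<phi> j3 s * integral {t..s} (\<lambda>s. \<phi> j2 s * integral {t..s} (\<phi> j1)))"
    by (intro continuous_on_mult continuous_integral \<phi>)
  have 3: "integral {t..x} (\<lambda>s. \<phi> j3 s * integral {t..s} (\<lambda>s. \<phi> j2 s * integral {t..s} (\<phi> j1))) =
      w3 (restr (\<phi> j1)) (restr (\<phi> j2)) (restr (\<phi> j3)) x" if "x \<in> {t..T}" for x
    unfolding w3_def by (rule integral_eq_J[OF c2 _ _ that]) (auto intro!: bm_mult bm_w2 b simp: 2 restr_eq)
  have c3: "continuous_on {t..T} (\<lambda>s. \<phi> j4 s * integral {t..s} (\<lambda>s. \<phi> j3 s * integral {t..s} (\<lambda>s. \<phi> j2 s * integral {t..s} (\<phi> j1))))"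
    by (intro continuous_on_mult continuous_integral \<phi>)
  show ?thesis
    unfolding coefC_def w4_def
    by (rule integral_eq_J[OF c3 _ _ T]) (auto intro!: bm_mult bm_w3 b simp: 3 restr_eq)
qed

lemma LI_restr:
  assumes f: "continuous_on {t..T} f" and g: "bm g" "\<And>s. s \<in> {t..<T} \<Longrightarrow> g s = f s"
  shows "LI g = integral {t..T} f"
  using integral_eq_J[OF f g, of T] J_T[OF g(1)] t_less_T by simp

end

section \<open>Legendre polynomials\<close>

fun legendreP' :: "nat \<Rightarrow> real \<Rightarrow> real" where
  "legendreP' 0 x = 0"
| "legendreP' (Suc 0) x = 1"
| "legendreP' (Suc (Suc n)) x =
     ((2 * real n + 3) * (legendreP (Suc n) x + x * legendreP' (Suc n) x) - (real n + 1) * legendreP' n x) / (real n + 2)"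

text \<open>\<open>legendreP'\<close> is the recursion of \<open>legendreP\<close> differentiated
  term by term, so the induction follows the recursion.\<close>

lemma legendreP_deriv: "(legendreP n has_real_derivative legendreP' n x) (at x)"
proof (induction n rule: induct_nat_012)
  case 0
  have "legendreP 0 = (\<lambda>_. 1)" by auto
  then show ?case by simp
next
  case 1
  have "legendreP (Suc 0) = (\<lambda>x. x)" by auto
  then show ?case by simp
next
  case (ge2 n)
  have "legendreP (Suc (Suc n)) = (\<lambda>x. ((2 * real n + 3) * x * legendreP (Suc n) x - (real n + 1) * legendreP n x) / (real n + 2))"
    by auto
  moreover have "((\<lambda>x. ((2 * real n + 3) * x * legendreP (Suc n) x - (real n + 1) * legendreP n x) / (real n + 2))
      has_real_derivative legendreP' (Suc (Suc n)) x) (at x)"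
    unfolding legendreP'.simps(3)
  proof (rule DERIV_cdivide, rule DERIV_diff)
    show "((\<lambda>x. (2 * real n + 3) * x * legendreP (Suc n) x) has_real_derivative
        (2 * real n + 3) * (legendreP (Suc n) x + x * legendreP' (Suc n) x)) (at x)"
      using ge2 by (auto intro!: derivative_eq_intros simp: algebra_simps)
    show "((\<lambda>x. (real n + 1) * legendreP n x) has_real_derivative (real n + 1) * legendreP' n x) (at x)"
      using ge2 by (intro DERIV_cmult)
  qed
  ultimately show ?case by simp
qed

lemma continuous_legendreP: "continuous_on S (legendreP n)"
  using legendreP_deriv DERIV_isCont by (blast intro: continuous_at_imp_continuous_on)

lemma legendreP_rec: "(real n + 2) * legendreP (Suc (Suc n)) x = (2 * real n + 3) * x * legendreP (Suc n) x - (real n + 1) * legendreP n x"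
  by simp

lemma legendreP'_rec: "(real n + 2) * legendreP' (Suc (Suc n)) x =
    (2 * real n + 3) * (legendreP (Suc n) x + x * legendreP' (Suc n) x) - (real n + 1) * legendreP' n x"
  by simp

declare legendreP.simps(3) [simp del] legendreP'.simps(3) [simp del]

lemma legendreP'_diff_aux:
  assumes "x * legendreP' (Suc n) x = legendreP' n x + (real n + 1) * legendreP (Suc n) x"
  shows "legendreP' (Suc (Suc n)) x = legendreP' n x + (2 * real n + 3) * legendreP (Suc n) x"
proof -
  have "(real n + 2) * legendreP' (Suc (Suc n)) x = (real n + 2) * (legendreP' n x + (2 * real n + 3) * legendreP (Suc n) x)"
    unfolding legendreP'_rec assms by (simp add: algebra_simps)
  then show ?thesis by (simp add: mult_left_cancel[of "real n + 2"] add_nonneg_eq_0_iff)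
qed

text \<open>The two classical derivative relations are proved together: the step for the first uses
  both.\<close>

lemma legendreP'_relations:
  "x * legendreP' (Suc n) x = legendreP' n x + (real n + 1) * legendreP (Suc n) x \<and>
   legendreP' (Suc n) x = x * legendreP' n x + (real n + 1) * legendreP n x"
proof (induction n)
  case 0
  then show ?case by simp
next
  case (Suc n)
  then have B: "x * legendreP' (Suc n) x = legendreP' n x + (real n + 1) * legendreP (Suc n) x"
    and C: "legendreP' (Suc n) x = x * legendreP' n x + (real n + 1) * legendreP n x" by auto
  note A = legendreP'_diff_aux[OF B]
  have "x * legendreP' (Suc (Suc n)) x = x * legendreP' n x + (2 * real n + 3) * x * legendreP (Suc n) x"
    unfolding A by (simp add: algebra_simps)
  also have "(2 * real n + 3) * x * legendreP (Suc n) x = (real n + 2) * legendreP (Suc (Suc n)) x + (real n + 1) * legendreP n x"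
    unfolding legendreP_rec by simp
  also have "x * legendreP' n x = legendreP' (Suc n) x - (real n + 1) * legendreP n x" using C by simp
  finally have "x * legendreP' (Suc (Suc n)) x = legendreP' (Suc n) x + (real (Suc n) + 1) * legendreP (Suc (Suc n)) x"
    by simp
  moreover have "legendreP' (Suc (Suc n)) x = x * legendreP' (Suc n) x + (real (Suc n) + 1) * legendreP (Suc n) x"
    unfolding A B by (simp add: algebra_simps)
  ultimately show ?case by blast
qed

text \<open>Supplies an antiderivative of a Legendre polynomial in terms of its two
  neighbours.\<close>

lemma legendreP'_diff: "legendreP' (Suc (Suc n)) x = legendreP' n x + (2 * real n + 3) * legendreP (Suc n) x"
  using legendreP'_relations by (intro legendreP'_diff_aux) blast

lemma legendreP_1: "legendreP n 1 = 1"
proof (induction n rule: induct_nat_012)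
  case (ge2 n)
  have "(real n + 2) * legendreP (Suc (Suc n)) 1 = (real n + 2) * 1"
    unfolding legendreP_rec using ge2 by simp
  then show ?case by (simp add: add_nonneg_eq_0_iff)
qed auto

lemma legendreP_minus_1: "legendreP n (-1) = (-1) ^ n"
proof (induction n rule: induct_nat_012)
  case (ge2 n)
  have "(real n + 2) * legendreP (Suc (Suc n)) (-1) = (real n + 2) * (-1) ^ (Suc (Suc n))"
    unfolding legendreP_rec using ge2 by (simp add: algebra_simps)
  then show ?case by (simp add: add_nonneg_eq_0_iff)
qed auto

definition basis_span :: "(nat \<Rightarrow> real \<Rightarrow> real) \<Rightarrow> (real \<Rightarrow> real) \<Rightarrow> bool" where
  "basis_span b f \<longleftrightarrow> (\<exists>p c. \<forall>x. f x = (\<Sum>j\<le>p. c j * b j x))"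

lemma basis_span_add: "basis_span b f \<Longrightarrow> basis_span b g \<Longrightarrow> basis_span b (\<lambda>x. f x + g x)"
proof -
  assume "basis_span b f" "basis_span b g"
  then obtain p c q d where f: "\<And>x. f x = (\<Sum>j\<le>p. c j * b j x)" and g: "\<And>x. g x = (\<Sum>j\<le>q. d j * b j x)"
    unfolding basis_span_def by blast
  have "f x = (\<Sum>j\<le>max p q. (if j \<le> p then c j else 0) * b j x)" for x
    unfolding f by (rule sum.mono_neutral_cong_left) auto
  moreover have "g x = (\<Sum>j\<le>max p q. (if j \<le> q then d j else 0) * b j x)" for x
    unfolding g by (rule sum.mono_neutral_cong_left) auto
  ultimately show ?thesis
    unfolding basis_span_def
    by (intro exI[of _ "max p q"] exI[of _ "\<lambda>j. (if j \<le> p then c j else 0) + (if j \<le> q then d j else 0)"])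
      (simp add: distrib_right sum.distrib)
qed

lemma basis_span_cmult: "basis_span b f \<Longrightarrow> basis_span b (\<lambda>x. a * f x)"
  unfolding basis_span_def
proof (elim exE)
  fix p c assume "\<forall>x. f x = (\<Sum>j\<le>p. c j * b j x)"
  then show "\<exists>p c. \<forall>x. a * f x = (\<Sum>j\<le>p. c j * b j x)"
    by (intro exI[of _ p] exI[of _ "\<lambda>j. a * c j"]) (simp add: sum_distrib_left mult.assoc)
qed

lemma basis_span_basis: "basis_span b (b n)"
  unfolding basis_span_def
  by (intro exI[of _ n] exI[of _ "\<lambda>j. if j = n then 1 else 0"]) (simp add: if_distrib[of "\<lambda>c. c * _"] cong: if_cong)

lemma basis_span_sum: "(\<And>i. i \<le> (n::nat) \<Longrightarrow> basis_span b (f i)) \<Longrightarrow> basis_span b (\<lambda>x. \<Sum>i\<le>n. f i x)"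
  by (induction n) (auto intro: basis_span_add)

text \<open>Bonnet's recursion read as the action of multiplication by \<open>x\<close>. It yields
  both the density of the span and the orthogonality. At \<open>n = 0\<close> the truncated
  predecessor has the factor 0.\<close>

lemma mult_legendreP:
  "x * legendreP n x = (real n + 1) / (2 * real n + 1) * legendreP (Suc n) x + real n / (2 * real n + 1) * legendreP (n - 1) x"
proof (cases n)
  case 0
  then show ?thesis by simp
next
  case (Suc k)
  have "(2 * real k + 3) * (x * legendreP (Suc k) x) = (real k + 2) * legendreP (Suc (Suc k)) x + (real k + 1) * legendreP k x"
    using legendreP_rec[of k x] by (simp add: mult.assoc)
  moreover have "2 * real k + 3 \<noteq> 0" by linarith
  ultimately have "x * legendreP (Suc k) x = ((real k + 2) * legendreP (Suc (Suc k)) x + (real k + 1) * legendreP k x) / (2 * real k + 3)"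
    by (metis nonzero_mult_div_cancel_left)
  then show ?thesis using Suc by (simp add: add_divide_distrib algebra_simps)
qed

lemma legendre_span_mult_x: "basis_span legendreP f \<Longrightarrow> basis_span legendreP (\<lambda>x. x * f x)"
proof -
  assume "basis_span legendreP f"
  then obtain p c where f: "\<And>x. f x = (\<Sum>j\<le>p. c j * legendreP j x)" unfolding basis_span_def by blast
  have "x * f x = (\<Sum>j\<le>p. c j * ((real j + 1) / (2 * real j + 1) * legendreP (Suc j) x + real j / (2 * real j + 1) * legendreP (j - 1) x))" for x
    unfolding f sum_distrib_left mult_legendreP[symmetric] by (simp only: mult_ac)
  moreover have "basis_span legendreP (\<lambda>x. \<Sum>j\<le>p. c j * ((real j + 1) / (2 * real j + 1) * legendreP (Suc j) x + real j / (2 * real j + 1) * legendreP (j - 1) x))"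
    by (intro basis_span_sum basis_span_cmult basis_span_add basis_span_basis)
  ultimately show ?thesis by simp
qed

lemma legendre_span_power: "basis_span legendreP (\<lambda>x. x ^ n)"
proof (induction n)
  case 0
  have "legendreP 0 = (\<lambda>x. x ^ 0)" by auto
  then show ?case using basis_span_basis[of legendreP 0] by simp
next
  case (Suc n)
  then show ?case using legendre_span_mult_x by simp
qed

lemma legendre_span_polynomial: "real_polynomial_function f \<Longrightarrow> basis_span legendreP f"
proof -
  assume "real_polynomial_function f"
  then obtain a n where "f = (\<lambda>x. \<Sum>i\<le>n. a i * x ^ i)"
    by (auto simp: real_polynomial_function_iff_sum)
  then show ?thesis by (simp add: basis_span_sum basis_span_cmult legendre_span_power)
qed

context interval
begin

definition legendre_arg :: "real \<Rightarrow> real" where "legendre_arg x = (x - (T + t) / 2) * (2 / (T - t))"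

lemma legendre_arg_t: "legendre_arg t = -1" and legendre_arg_T: "legendre_arg T = 1"
  using t_less_T by (auto simp: legendre_arg_def field_simps)

lemma continuous_legendre_arg: "continuous_on S legendre_arg"
  unfolding legendre_arg_def[abs_def] by (intro continuous_intros)

lemma continuous_legendreP_legendre_arg: "continuous_on S (\<lambda>x. legendreP n (legendre_arg x))"
  by (rule continuous_on_compose2[OF continuous_legendreP[of UNIV] continuous_legendre_arg]) auto

text \<open>For positive degree the antiderivative from \<open>legendreP'_diff\<close> vanishes at
  both ends, since the two polynomials in it have degrees of equal parity and hence equal end
  values.\<close>

lemma integral_legendreP:
  "integral {t..T} (\<lambda>x. legendreP n (legendre_arg x)) = (if n = 0 then T - t else 0)"
proof (cases n)
  case 0
  then show ?thesis using t_less_T by simp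
next
  case (Suc k)
  let ?A = "\<lambda>x. (legendreP (Suc (Suc k)) (legendre_arg x) - legendreP k (legendre_arg x)) * ((T - t) / 2 / (2 * real k + 3))"
  have "((\<lambda>x. legendreP (Suc k) (legendre_arg x)) has_integral (?A T - ?A t)) {t..T}"
  proof (rule fundamental_theorem_of_calculus)
    show "t \<le> T" using t_less_T by simp
    fix x
    have "((\<lambda>x. (x - c) * k) has_real_derivative k) (at x)" for c k :: real
      by (auto intro!: derivative_eq_intros)
    then have y: "(legendre_arg has_real_derivative 2 / (T - t)) (at x)"
      unfolding legendre_arg_def[abs_def] .
    have "(?A has_real_derivative
        (legendreP' (Suc (Suc k)) (legendre_arg x) * (2 / (T - t)) - legendreP' k (legendre_arg x) * (2 / (T - t))) * ((T - t) / 2 / (2 * real k + 3))) (at x)"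
      by (intro DERIV_cmult_right DERIV_diff DERIV_chain2[OF legendreP_deriv y])
    also have "(legendreP' (Suc (Suc k)) (legendre_arg x) * (2 / (T - t)) - legendreP' k (legendre_arg x) * (2 / (T - t))) * ((T - t) / 2 / (2 * real k + 3)) =
        legendreP (Suc k) (legendre_arg x)"
    proof -
      have "(legendreP' (Suc (Suc k)) (legendre_arg x) * (2 / (T - t)) - legendreP' k (legendre_arg x) * (2 / (T - t))) * ((T - t) / 2 / (2 * real k + 3)) =
          ((2 * real k + 3) * legendreP (Suc k) (legendre_arg x)) * ((2 / (T - t)) * ((T - t) / 2)) / (2 * real k + 3)"
      proof -
        have "((b + c * P) * h - b * h) * (k / c) = (c * P) * (h * k) / c" for b c P h k :: real
          by (simp add: distrib_right)
        then show ?thesis unfolding legendreP'_diff .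
      qed
      also have "(2 / (T - t)) * ((T - t) / 2) = 1" using t_less_T by simp
      finally show ?thesis
      proof -
        have "0 < 2 * real k + 3" by simp
        then have nz: "2 * real k + 3 \<noteq> 0" by (rule less_imp_neq[symmetric])
        assume "(legendreP' (Suc (Suc k)) (legendre_arg x) * (2 / (T - t)) - legendreP' k (legendre_arg x) * (2 / (T - t))) * ((T - t) / 2 / (2 * real k + 3)) =
          ((2 * real k + 3) * legendreP (Suc k) (legendre_arg x)) * 1 / (2 * real k + 3)"
        also have "\<dots> = legendreP (Suc k) (legendre_arg x)"
          unfolding mult_1_right by (rule nonzero_mult_div_cancel_left[OF nz])
        finally show ?thesis .
      qed
    qed
    finally show "(?A has_vector_derivative legendreP (Suc k) (legendre_arg x)) (at x within {t..T})"
      unfolding has_real_derivative_iff_has_vector_derivative by (rule has_vector_derivative_at_within)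
  qed
  moreover have "?A T - ?A t = 0" by (simp add: legendre_arg_t legendre_arg_T legendreP_1 legendreP_minus_1)
  ultimately show ?thesis using Suc by (simp add: integral_unique)
qed

definition legendre_inner :: "nat \<Rightarrow> nat \<Rightarrow> real" where "legendre_inner n k = integral {t..T} (\<lambda>x. legendreP n (legendre_arg x) * legendreP k (legendre_arg x))"

text \<open>Multiplication by the argument can be moved from one factor to the other;
  \<open>mult_legendreP\<close> expands both versions.\<close>

lemma legendre_inner_rec:
  "(real n + 1) / (2 * real n + 1) * legendre_inner (Suc n) k + real n / (2 * real n + 1) * legendre_inner (n - 1) k =
   (real k + 1) / (2 * real k + 1) * legendre_inner n (Suc k) + real k / (2 * real k + 1) * legendre_inner n (k - 1)"
proof -
  have i: "(\<lambda>x. a * (legendreP p (legendre_arg x) * legendreP q (legendre_arg x))) integrable_on {t..T}" for a p q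
    by (intro integrable_continuous_interval continuous_intros continuous_legendreP_legendre_arg)
  have lin: "a * legendre_inner p q + b * legendre_inner r s = integral {t..T} (\<lambda>x. a * (legendreP p (legendre_arg x) * legendreP q (legendre_arg x)) + b * (legendreP r (legendre_arg x) * legendreP s (legendre_arg x)))" for a b p q r s
    unfolding legendre_inner_def by (subst Henstock_Kurzweil_Integration.integral_add[OF i i]) simp
  have "(real n + 1) / (2 * real n + 1) * (legendreP (Suc n) y * legendreP k y) + real n / (2 * real n + 1) * (legendreP (n - 1) y * legendreP k y) =
      (real k + 1) / (2 * real k + 1) * (legendreP n y * legendreP (Suc k) y) + real k / (2 * real k + 1) * (legendreP n y * legendreP (k - 1) y)" for y
  proof -
    have "(real n + 1) / (2 * real n + 1) * (legendreP (Suc n) y * legendreP k y) + real n / (2 * real n + 1) * (legendreP (n - 1) y * legendreP k y) =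
        (y * legendreP n y) * legendreP k y"
      unfolding mult_legendreP by (simp only: distrib_right mult.assoc)
    also have "\<dots> = legendreP n y * (y * legendreP k y)" by (simp only: mult_ac)
    also have "\<dots> = (real k + 1) / (2 * real k + 1) * (legendreP n y * legendreP (Suc k) y) + real k / (2 * real k + 1) * (legendreP n y * legendreP (k - 1) y)"
      unfolding mult_legendreP[of y k] by (simp only: distrib_left mult.left_commute)
    finally show ?thesis .
  qed
  then show ?thesis unfolding lin by simp
qed

text \<open>Degree 0 is \<open>integral_legendreP\<close>. For higher degree the recursion expresses
  the pairing through pairings whose first index is smaller and still below the second.\<close>

lemma legendre_inner_less: "n < k \<Longrightarrow> legendre_inner n k = 0"
proof (induction n arbitrary: k rule: less_induct)
  case (less n)
  show ?case
  proof (cases n)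
    case 0
    then show ?thesis using integral_legendreP[of k] less.prems by (simp add: legendre_inner_def)
  next
    case (Suc j)
    \<comment> \<open>At \<open>j = 0\<close> the corresponding term of the recursion has the factor
      0.\<close>
    have "legendre_inner (j - 1) k = 0 \<or> j = 0" using less.IH[of "j - 1" k] less.prems Suc by (cases j) auto
    moreover have "legendre_inner j (Suc k) = 0" "legendre_inner j (k - 1) = 0" using less.IH less.prems Suc by auto
    ultimately have "(real j + 1) / (2 * real j + 1) * legendre_inner (Suc j) k = 0" using legendre_inner_rec[of j k] by auto
    then show ?thesis using Suc by (simp add: add_nonneg_eq_0_iff)
  qed
qed

text \<open>The recursion at the indices \<open>n\<close> and \<open>Suc n\<close> compares
  consecutive norms, its other terms being zero by orthogonality.\<close>

lemma legendre_inner_diag: "legendre_inner n n = (T - t) / (2 * real n + 1)"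
proof (induction n)
  case 0
  then show ?case using t_less_T by (simp add: legendre_inner_def)
next
  case (Suc n)
  have "(real n + 1) / (2 * real n + 1) * legendre_inner (Suc n) (Suc n) = (real n + 1) / (2 * real n + 3) * legendre_inner n n"
    using legendre_inner_rec[of n "Suc n"] legendre_inner_less[of "n - 1" "Suc n"] legendre_inner_less[of n "Suc (Suc n)"] by (simp add: algebra_simps)
  also have "\<dots> = (real n + 1) / (2 * real n + 1) * ((T - t) / (2 * real n + 3))"
    unfolding Suc.IH by (simp only: times_divide_times_eq mult.commute)
  finally have "legendre_inner (Suc n) (Suc n) = (T - t) / (2 * real n + 3)"
    by (subst (asm) mult_left_cancel) (simp_all add: add_nonneg_eq_0_iff)
  moreover have "2 * real (Suc n) + 1 = 2 * real n + 3" by simp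
  ultimately show ?case by (simp only:)
qed

lemma legendre_inner_eq: "legendre_inner n k = (if n = k then (T - t) / (2 * real n + 1) else 0)"
proof -
  have "legendre_inner n k = legendre_inner k n" by (simp add: legendre_inner_def mult.commute)
  then show ?thesis using legendre_inner_less[of n k] legendre_inner_less[of k n] legendre_inner_diag by (cases n k rule: linorder_cases) auto
qed

lemma legendre_sys_legendre_arg: "legendre_sys t T j x = sqrt ((2 * real j + 1) / (T - t)) * legendreP j (legendre_arg x)"
  by (simp add: legendre_sys_def legendre_arg_def)

lemma continuous_legendre_sys: "continuous_on S (legendre_sys t T j)"
  unfolding legendre_sys_legendre_arg[abs_def] by (intro continuous_intros continuous_legendreP_legendre_arg)

lemma onb_const_legendre: "onb_const t T (\<lambda>j. restr (legendre_sys t T j))"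
proof -
  interpret bm_system t T "\<lambda>j. restr (legendre_sys t T j)"
    by unfold_locales (intro bm_restr continuous_legendre_sys)
  show ?thesis
  proof (unfold_locales)
    fix i j
    have "LI (\<lambda>x. restr (legendre_sys t T i) x * restr (legendre_sys t T j) x) = integral {t..T} (\<lambda>x. legendre_sys t T i x * legendre_sys t T j x)"
      by (intro LI_restr continuous_intros continuous_legendre_sys bm_mult bm_\<psi>) (simp add: restr_eq)
    also have "\<dots> = sqrt ((2 * real i + 1) / (T - t)) * sqrt ((2 * real j + 1) / (T - t)) * legendre_inner i j"
      unfolding legendre_inner_def legendre_sys_legendre_arg by (subst integral_mult_right[symmetric]) (simp only: mult_ac)
    also have "\<dots> = (if i = j then 1 else 0)"
      using t_less_T by (simp add: legendre_inner_eq)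
    finally show "LI (\<lambda>x. restr (legendre_sys t T i) x * restr (legendre_sys t T j) x) = (if i = j then 1 else 0)" .
  next
    fix g :: "real \<Rightarrow> real" assume g: "continuous_on UNIV g" "bm g"
    show "apx g"
    proof (rule apx_uniform[OF g(2)])
      fix e :: real assume e: "0 < e"
      \<comment> \<open>The inverse of \<open>legendre_arg\<close>, carrying \<open>g\<close> to the
        standard interval.\<close>
      let ?x = "\<lambda>y. (T + t) / 2 + y * ((T - t) / 2)"
      have "continuous_on {-1..1} (\<lambda>y. g (?x y))"
        by (intro continuous_on_compose2[OF g(1)] continuous_intros) auto
      from Stone_Weierstrass_real_polynomial_function[OF _ this e] obtain q where
        q: "real_polynomial_function q" "\<And>y. y \<in> {-1..1} \<Longrightarrow> \<bar>g (?x y) - q y\<bar> < e" by (auto simp: abs_minus_commute)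
      obtain p c where c: "\<And>y. q y = (\<Sum>j\<le>p. c j * legendreP j y)"
        using legendre_span_polynomial[OF q(1)] unfolding basis_span_def by blast
      \<comment> \<open>The normalising factors of \<open>legendre_sys\<close>; the coefficients of
        the polynomial are divided by them.\<close>
      let ?s = "\<lambda>j. sqrt ((2 * real j + 1) / (T - t))"
      have s: "?s j \<noteq> 0" for j using t_less_T by (simp add: add_nonneg_eq_0_iff)
      have "\<bar>g x - (\<Sum>j\<le>p. (c j / ?s j) * restr (legendre_sys t T j) x)\<bar> \<le> e" if x: "x \<in> {t..<T}" for x
      proof -
        have y: "legendre_arg x \<in> {-1..1}" using x t_less_T by (auto simp: legendre_arg_def field_simps)
        have xy: "?x (legendre_arg x) = x"
        proof -
          have "?x (legendre_arg x) = (T + t) / 2 + (x - (T + t) / 2) * ((2 / (T - t)) * ((T - t) / 2))"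
            by (simp only: legendre_arg_def mult.assoc)
          also have "(2 / (T - t)) * ((T - t) / 2) = 1" using t_less_T by simp
          finally show ?thesis by simp
        qed
        have "(\<Sum>j\<le>p. (c j / ?s j) * restr (legendre_sys t T j) x) = q (legendre_arg x)"
          unfolding c restr_eq[OF x] legendre_sys_legendre_arg
          by (intro sum.cong refl) (simp only: mult.assoc[symmetric] nonzero_eq_divide_eq[OF s, THEN iffD1, OF refl])
        then show ?thesis using q(2)[OF y] xy by simp
      qed
      then show "\<exists>p c. \<forall>x\<in>{t..<T}. \<bar>g x - (\<Sum>j\<le>p. c j * restr (legendre_sys t T j) x)\<bar> \<le> e"
        by (intro exI[of _ p] exI[of _ "\<lambda>j. c j / ?s j"] ballI)
    qed
  next
    show "restr (legendre_sys t T 0) x = 1 / sqrt (T - t)" if "x \<in> {t..<T}" for x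
      using that by (simp add: restr_eq legendre_sys_def real_sqrt_divide)
  qed
qed

section \<open>The trigonometric system\<close>

definition ang :: "real \<Rightarrow> real" where "ang x = 2 * pi * (x - t) / (T - t)"

lemma continuous_ang: "continuous_on S ang"
  unfolding ang_def[abs_def] by (intro continuous_intros) (use t_less_T in auto)

definition trig_coeff :: "nat \<Rightarrow> real" where
  "trig_coeff j = (if j = 0 then 1 / sqrt (T - t) else sqrt (2 / (T - t)))"

text \<open>One frequency formula for both parities: for even \<open>j\<close> adding 1 does not
  change the quotient, and frequency 0 gives the constant. Frequencies are integers because products
  of basis functions involve their differences.\<close>

lemma trig_sys_ang:
  "trig_sys t T j x = trig_coeff j *
    (if odd j then sin (of_int (int ((j + 1) div 2)) * ang x) else cos (of_int (int ((j + 1) div 2)) * ang x))"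
proof -
  have k: "(2 * pi * real k * (x - t) / (T - t)) = of_int (int k) * ang x" for k by (simp add: ang_def)
  show ?thesis
  proof (cases "odd j")
    case True
    then have "j \<noteq> 0" using odd_pos by auto
    then show ?thesis unfolding trig_sys_def trig_coeff_def k by (simp only: True if_True if_False not_False_eq_True)
  next
    case False
    then have "(j + 1) div 2 = j div 2" by auto
    then show ?thesis unfolding trig_sys_def trig_coeff_def k using False by (cases "j = 0") simp_all
  qed
qed

lemma continuous_trig_sys: "continuous_on S (trig_sys t T j)"
  unfolding trig_sys_ang[abs_def] by (cases "odd j") (auto intro!: continuous_intros continuous_ang)

lemma trig_coeff_neq_0: "trig_coeff j \<noteq> 0"
  using t_less_T by (simp add: trig_coeff_def)

abbreviation "trig_span \<equiv> basis_span (trig_sys t T)"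

lemma trig_span_of_nat:
  "trig_span (\<lambda>x. cos (of_int (int n) * ang x))" "trig_span (\<lambda>x. sin (of_int (int n) * ang x))"
proof -
  have "trig_span (\<lambda>x. inverse (trig_coeff (2 * n)) * trig_sys t T (2 * n) x)"
    by (intro basis_span_cmult basis_span_basis)
  then show "trig_span (\<lambda>x. cos (of_int (int n) * ang x))"
    using trig_coeff_neq_0[of "2 * n"] by (simp add: trig_sys_ang mult.assoc[symmetric])
  show "trig_span (\<lambda>x. sin (of_int (int n) * ang x))"
  \<comment> \<open>At 0 the index \<open>2 * n - 1\<close> would be truncated to 0, which is the
    constant function; the sine is zero there anyway.\<close>
  proof (cases "n = 0")
    case True
    then show ?thesis using basis_span_cmult[OF basis_span_basis, of "trig_sys t T" 0 0] by simp
  next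
    case False
    have "trig_span (\<lambda>x. inverse (trig_coeff (2 * n - 1)) * trig_sys t T (2 * n - 1) x)"
      by (intro basis_span_cmult basis_span_basis)
    moreover have "odd (2 * n - 1)" "(2 * n - 1 + 1) div 2 = n" using False by auto
    ultimately show ?thesis
      using trig_coeff_neq_0[of "2 * n - 1"] by (simp add: trig_sys_ang mult.assoc[symmetric])
  qed
qed

lemma trig_span_of_int:
  fixes k :: int
  shows "trig_span (\<lambda>x. cos (of_int k * ang x))" "trig_span (\<lambda>x. sin (of_int k * ang x))"
proof -
  obtain n where n: "k = int n \<or> k = - int n" by (cases k rule: int_cases2) auto
  then show "trig_span (\<lambda>x. cos (of_int k * ang x))" using trig_span_of_nat(1)[of n] by auto
  show "trig_span (\<lambda>x. sin (of_int k * ang x))"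
    using n trig_span_of_nat(2)[of n] basis_span_cmult[OF trig_span_of_nat(2)[of n], of "-1"] by auto
qed

text \<open>Product-to-sum formulas. They make the span an algebra, which is what lets polynomials
  on the circle be rewritten in the basis.\<close>

lemma trig_span_mult_basis: "trig_span (\<lambda>x. trig_sys t T i x * trig_sys t T j x)"
proof -
  let ?a = "\<lambda>i x. of_int (int ((i + 1) div 2)) * ang x"
  have s: "?a i x - ?a j x = of_int (int ((i + 1) div 2) - int ((j + 1) div 2)) * ang x"
    "?a i x + ?a j x = of_int (int ((i + 1) div 2) + int ((j + 1) div 2)) * ang x" for x
    by (simp_all only: of_int_diff of_int_add left_diff_distrib distrib_right)
  have scale: "trig_span (\<lambda>x. (trig_coeff i * f x) * (trig_coeff j * g x))" if "trig_span (\<lambda>x. f x * g x)" for f g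
    using basis_span_cmult[OF that, of "trig_coeff i * trig_coeff j"] by (simp add: mult_ac)
  have half: "trig_span (\<lambda>x. (f x + g x) / 2)" "trig_span (\<lambda>x. (f x - g x) / 2)" if "trig_span f" "trig_span g" for f g
    using basis_span_cmult[OF basis_span_add[OF that], of "1/2"]
      basis_span_cmult[OF basis_span_add[OF that(1) basis_span_cmult[OF that(2), of "-1"]], of "1/2"] by simp_all
  have "trig_span (\<lambda>x. sin (?a i x) * sin (?a j x))" "trig_span (\<lambda>x. cos (?a i x) * cos (?a j x))"
    "trig_span (\<lambda>x. sin (?a i x) * cos (?a j x))" "trig_span (\<lambda>x. cos (?a i x) * sin (?a j x))"
    unfolding sin_times_sin cos_times_cos sin_times_cos cos_times_sin s by (intro half trig_span_of_int)+
  note this[THEN scale]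
  then show ?thesis unfolding trig_sys_ang by (cases "odd i"; cases "odd j") (simp_all only: if_True if_False not_False_eq_True not_True_eq_False)
qed

lemma trig_span_mult:
  assumes "trig_span f" "trig_span g"
  shows "trig_span (\<lambda>x. f x * g x)"
proof -
  from assms obtain p c q d where f: "\<And>x. f x = (\<Sum>j\<le>p. c j * trig_sys t T j x)" and g: "\<And>x. g x = (\<Sum>j\<le>q. d j * trig_sys t T j x)"
    unfolding basis_span_def by blast
  have "f x * g x = (\<Sum>i\<le>p. \<Sum>j\<le>q. (c i * d j) * (trig_sys t T i x * trig_sys t T j x))" for x
    unfolding f g sum_product by (simp only: mult_ac)
  moreover have "trig_span (\<lambda>x. \<Sum>i\<le>p. \<Sum>j\<le>q. (c i * d j) * (trig_sys t T i x * trig_sys t T j x))"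
    by (intro basis_span_sum basis_span_cmult trig_span_mult_basis)
  ultimately show ?thesis by simp
qed

text \<open>Polynomial functions on the plane are generated by constants and linear functionals, and
  a linear functional of a point of the circle is a combination of cosine and sine of the
  angle.\<close>

lemma trig_span_polynomial:
  fixes q :: "complex \<Rightarrow> real"
  assumes "real_polynomial_function q"
  shows "trig_span (\<lambda>x. q (cis (ang x)))"
  using assms
proof induction
  case (linear f)
  interpret bounded_linear f by fact
  have e: "f (cis (ang x)) = f 1 * cos (of_int 1 * ang x) + f \<i> * sin (of_int 1 * ang x)" for x
  proof -
    have "cis (ang x) = cos (ang x) *\<^sub>R 1 + sin (ang x) *\<^sub>R \<i>" by (simp add: complex_eq_iff)
    then show ?thesis by (simp only: add scale) simp
  qed
  show ?case unfolding e by (intro basis_span_add basis_span_cmult trig_span_of_int)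
next
  case (const c)
  then show ?case using basis_span_cmult[OF trig_span_of_int(1)[of 0], of c] by simp
qed (intro basis_span_add trig_span_mult; assumption)+

text \<open>The angle goes around the circle once, so the only coincidence is that of the two end
  points.\<close>

lemma cis_ang_eq:
  assumes "x \<in> {t..T}" "y \<in> {t..T}" "cis (ang x) = cis (ang y)"
  shows "x = y \<or> x = t \<and> y = T \<or> x = T \<and> y = t"
proof -
  have "sin (ang x) = sin (ang y) \<and> cos (ang x) = cos (ang y)"
    using assms(3) by (simp add: complex_eq_iff)
  then obtain n :: int where "ang x = ang y + 2 * pi * n" unfolding sin_cos_eq_iff by blast
  then have "2 * pi * ((x - t) / (T - t)) = 2 * pi * ((y - t) / (T - t) + of_int n)"
    by (simp add: ang_def distrib_left)
  then have "(x - t) / (T - t) = (y - t) / (T - t) + of_int n" by (simp only: mult_cancel_left) simp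
  then have n: "x - y = of_int n * (T - t)" using t_less_T by (simp add: field_simps)
  have le: "\<bar>x - y\<bar> \<le> T - t" using assms by auto
  then have "\<bar>of_int n :: real\<bar> * (T - t) \<le> 1 * (T - t)" using t_less_T unfolding n by (simp add: abs_mult)
  then have "\<bar>of_int n :: real\<bar> \<le> 1" using t_less_T by (subst (asm) mult_le_cancel_right_pos) simp_all
  then have "n = 0 \<or> n = 1 \<or> n = -1" by linarith
  then show ?thesis using n assms by auto
qed

text \<open>A function with equal end values descends to the circle, where it is continuous because its graph is
  compact; there polynomials in \<open>Re\<close> and \<open>Im\<close> are dense.\<close>

lemma periodic_trig_approximation:
  assumes g: "continuous_on {t..T} g" "g t = g T" and e: "0 < e"
  shows "\<exists>f. trig_span f \<and> (\<forall>x\<in>{t..T}. \<bar>g x - f x\<bar> < e)"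
proof -
  let ?e = "\<lambda>x. cis (ang x)"
  define h where "h z = g (SOME x. x \<in> {t..T} \<and> ?e x = z)" for z
  have h: "h (?e x) = g x" if "x \<in> {t..T}" for x
  proof -
    let ?y = "SOME y. y \<in> {t..T} \<and> ?e y = ?e x"
    have "?y \<in> {t..T} \<and> ?e ?y = ?e x" by (rule someI[of _ x]) (use that in auto)
    then show ?thesis using cis_ang_eq[of ?y x] that g(2) unfolding h_def by auto
  qed
  have ce: "continuous_on {t..T} ?e"
    unfolding cis_conv_exp by (intro continuous_intros continuous_ang)
  have "continuous_on (?e ` {t..T}) h"
  proof (rule continuous_from_closed_graph)
    show "compact (g ` {t..T})" by (intro compact_continuous_image g) simp
    show "h \<in> ?e ` {t..T} \<rightarrow> g ` {t..T}" using h by auto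
    have "(\<lambda>z. (z, h z)) ` ?e ` {t..T} = (\<lambda>x. (?e x, g x)) ` {t..T}"
      using h by (auto simp: image_image)
    moreover have "compact ((\<lambda>x. (?e x, g x)) ` {t..T})"
      by (intro compact_continuous_image continuous_on_Pair ce g) simp
    ultimately show "closed ((\<lambda>z. (z, h z)) ` ?e ` {t..T})" by (simp only: compact_imp_closed)
  qed
  then obtain q where q: "real_polynomial_function q" "\<And>z. z \<in> ?e ` {t..T} \<Longrightarrow> \<bar>h z - q z\<bar> < e"
    using Stone_Weierstrass_real_polynomial_function[of "?e ` {t..T}" h e] e compact_continuous_image[OF ce] by auto
  then show ?thesis
    using h trig_span_polynomial[OF q(1)] by (intro exI[of _ "\<lambda>x. q (?e x)"]) force
qed

lemma integral_cos_sin_ang: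
  assumes "k \<noteq> 0"
  shows "integral {t..T} (\<lambda>x. cos (of_int k * ang x)) = 0" "integral {t..T} (\<lambda>x. sin (of_int k * ang x)) = 0"
proof -
  let ?c = "of_int k * (2 * pi / (T - t))"
  have c: "?c \<noteq> 0" using assms t_less_T by simp
  have a: "((\<lambda>x. of_int k * ang x) has_real_derivative ?c) (at x)" for x
    unfolding ang_def[abs_def] using t_less_T by (auto intro!: derivative_eq_intros)
  have per: "of_int k * ang T = 2 * pi * of_int k" "of_int k * ang t = 0"
    using t_less_T by (simp_all add: ang_def)
  have "((\<lambda>x. cos (of_int k * ang x)) has_integral (sin (of_int k * ang T) / ?c - sin (of_int k * ang t) / ?c)) {t..T}"
  proof (rule fundamental_theorem_of_calculus)
    fix x
    have "((\<lambda>x. sin (of_int k * ang x) / ?c) has_real_derivative (cos (of_int k * ang x) * ?c) / ?c) (at x)"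
      by (intro DERIV_cdivide DERIV_chain2[OF DERIV_sin a])
    then show "((\<lambda>x. sin (of_int k * ang x) / ?c) has_vector_derivative cos (of_int k * ang x)) (at x within {t..T})"
      unfolding nonzero_mult_div_cancel_right[OF c] has_real_derivative_iff_has_vector_derivative
      by (rule has_vector_derivative_at_within)
  qed (use t_less_T in simp)
  then show "integral {t..T} (\<lambda>x. cos (of_int k * ang x)) = 0"
    unfolding per by (simp add: integral_unique sin_int_2pin)
  have "((\<lambda>x. sin (of_int k * ang x)) has_integral (cos (of_int k * ang T) / (- ?c) - cos (of_int k * ang t) / (- ?c))) {t..T}"
  proof (rule fundamental_theorem_of_calculus)
    fix x
    have "((\<lambda>x. cos (of_int k * ang x) / (- ?c)) has_real_derivative (- sin (of_int k * ang x) * ?c) / (- ?c)) (at x)"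
      by (intro DERIV_cdivide DERIV_chain2[OF DERIV_cos a])
    moreover have "(- sin (of_int k * ang x) * ?c) / (- ?c) = sin (of_int k * ang x)"
      using nonzero_mult_div_cancel_right[OF c] by (simp only: mult_minus_left minus_divide_left[symmetric] minus_divide_right[symmetric] minus_minus)
    ultimately show "((\<lambda>x. cos (of_int k * ang x) / (- ?c)) has_vector_derivative sin (of_int k * ang x)) (at x within {t..T})"
      unfolding has_real_derivative_iff_has_vector_derivative by (metis has_vector_derivative_at_within)
  qed (use t_less_T in simp)
  then show "integral {t..T} (\<lambda>x. sin (of_int k * ang x)) = 0"
    unfolding per by (simp add: integral_unique cos_int_2pin)
qed

lemma integral_cos_ang: "integral {t..T} (\<lambda>x. cos (of_int k * ang x)) = (if k = 0 then T - t else 0)"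
  using t_less_T by (simp add: integral_cos_sin_ang)

lemma integral_sin_ang: "integral {t..T} (\<lambda>x. sin (of_int k * ang x)) = 0"
  by (cases "k = 0") (simp_all add: integral_cos_sin_ang)

text \<open>Product-to-sum formulas leave integrals of single frequencies, which vanish unless the
  frequency is 0.\<close>

lemma integral_trig_mult:
  "integral {t..T} (\<lambda>x. trig_sys t T i x * trig_sys t T j x) = (if i = j then 1 else 0)"
proof -
  define m where "m i = int ((i + 1) div 2)" for i :: nat
  let ?a = "\<lambda>i x. of_int (m i) * ang x"
  have s: "?a i x - ?a j x = of_int (m i - m j) * ang x" "?a i x + ?a j x = of_int (m i + m j) * ang x" for x
    by (simp_all only: of_int_diff of_int_add left_diff_distrib distrib_right)
  have ic: "(\<lambda>x. cos (of_int k * ang x)) integrable_on {t..T}" "(\<lambda>x. sin (of_int k * ang x)) integrable_on {t..T}" for k :: int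
    by (intro integrable_continuous_interval continuous_intros continuous_ang)+
  note int = Henstock_Kurzweil_Integration.integral_add Henstock_Kurzweil_Integration.integral_diff ic
    integral_cos_ang integral_sin_ang integral_divide
  have L: "T - t \<noteq> 0" using t_less_T by simp
  have L2: "(2 * T - 2 * t) / (T - t) = 2" "2 * (T - t) / (T - t) = 2" using L by (simp_all add: divide_eq_eq)
  have cc: "trig_coeff k * trig_coeff k = (if k = 0 then 1 / (T - t) else 2 / (T - t))" for k
    using t_less_T by (simp add: trig_coeff_def)
  have "integral {t..T} (\<lambda>x. trig_sys t T i x * trig_sys t T j x) = trig_coeff i * trig_coeff j *
      integral {t..T} (\<lambda>x. (if odd i then sin (?a i x) else cos (?a i x)) * (if odd j then sin (?a j x) else cos (?a j x)))"
    unfolding trig_sys_ang m_def[symmetric] by (subst integral_mult_right[symmetric]) (simp only: mult_ac)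
  also have "\<dots> = (if i = j then 1 else 0)"
  proof (cases "odd i \<longleftrightarrow> odd j")
    case False
    then show ?thesis
      by (cases "odd i") (auto simp: sin_times_cos cos_times_sin s int simp del: of_int_diff of_int_add)
  next
    case True
    \<comment> \<open>Within one parity the frequency determines the index.\<close>
    have eq: "m i = m j \<longleftrightarrow> i = j" using True unfolding m_def by presburger
    show ?thesis
    proof (cases "odd i")
      case odd: True
      then have "m i + m j \<noteq> 0" "i \<noteq> 0" unfolding m_def by (auto elim!: oddE)
      then show ?thesis using True odd eq L by (auto simp: sin_times_sin s int cc L2 simp del: of_int_diff of_int_add)
    next
      case even: False
      have "m i + m j = 0 \<longleftrightarrow> i = 0 \<and> j = 0" using even True unfolding m_def by auto
      then show ?thesis using True even eq L by (auto simp: cos_times_cos s int cc L2 simp del: of_int_diff of_int_add)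
    qed
  qed
  finally show ?thesis .
qed

lemma onb_const_trig: "onb_const t T (\<lambda>j. restr (trig_sys t T j))"
proof -
  interpret bm_system t T "\<lambda>j. restr (trig_sys t T j)"
    by unfold_locales (intro bm_restr continuous_trig_sys)
  show ?thesis
  proof (unfold_locales)
    fix i j
    have "LI (\<lambda>x. restr (trig_sys t T i) x * restr (trig_sys t T j) x) = integral {t..T} (\<lambda>x. trig_sys t T i x * trig_sys t T j x)"
      by (intro LI_restr continuous_intros continuous_trig_sys bm_mult bm_\<psi>) (simp add: restr_eq)
    then show "LI (\<lambda>x. restr (trig_sys t T i) x * restr (trig_sys t T j) x) = (if i = j then 1 else 0)"
      unfolding integral_trig_mult .
  next
    fix g :: "real \<Rightarrow> real" assume g: "continuous_on UNIV g" "bm g"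
    obtain B where B: "\<And>x. \<bar>g x\<bar> \<le> B" using bm_bounded[OF g(2)] by blast
    \<comment> \<open>Periodic approximation asks for equal end values, which \<open>g\<close> need
      not have. The cutoffs vanish at both ends and tend to 1 inside the interval.\<close>
    let ?w = "\<lambda>n x. max 0 (min 1 (real n * min (x - t) (T - x)))"
    have w: "0 \<le> ?w n x" "?w n x \<le> 1" for n x by auto
    have cw: "continuous_on S (?w n)" for S n by (intro continuous_intros)
    have bw: "bm (?w n)" for n
    proof (rule bmI)
      show "?w n \<in> borel_measurable borel" by (rule borel_measurable_continuous_onI[OF cw])
      show "\<bar>?w n x\<bar> \<le> 1" for x using w[of n x] by linarith
    qed
    show "apx g"
    proof (rule apx_limit[OF g(2), where g = "\<lambda>n x. g x * ?w n x" and B = B])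
      show "bm (\<lambda>x. g x * ?w n x)" for n by (intro bm_mult g bw)
      show "\<bar>g x * ?w n x\<bar> \<le> B" for n x
      proof -
        have "\<bar>g x * ?w n x\<bar> \<le> \<bar>g x\<bar> * 1" unfolding abs_mult by (intro mult_left_mono) (use w[of n x] in auto)
        then show ?thesis using B[of x] by simp
      qed
      show "AE x in \<mu>. (\<lambda>n. g x * ?w n x) \<longlonglongrightarrow> g x"
        using AE_\<mu> AE_\<mu>_neq[of t]
      proof eventually_elim
        case (elim x)
        then have d: "0 < min (x - t) (T - x)" by auto
        from reals_Archimedean3[OF this] obtain n0 where n0: "1 < real n0 * min (x - t) (T - x)" by blast
        have "?w n x = 1" if "n \<ge> n0" for n
        proof -
          have "real n0 * min (x - t) (T - x) \<le> real n * min (x - t) (T - x)"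
            using that d by (intro mult_right_mono) auto
          then show ?thesis using n0 by simp
        qed
        then have "eventually (\<lambda>n. g x * ?w n x = g x) sequentially"
          unfolding eventually_sequentially by (intro exI[of _ n0]) simp
        then show ?case by (rule tendsto_eventually)
      qed
      show "apx (\<lambda>x. g x * ?w n x)" for n
      proof (rule apx_uniform)
        show "bm (\<lambda>x. g x * ?w n x)" by (intro bm_mult g bw)
        fix e :: real assume e: "0 < e"
        have c: "continuous_on {t..T} (\<lambda>x. g x * ?w n x)"
          by (intro continuous_on_mult cw continuous_on_subset[OF g(1)]) simp
        have p: "g t * ?w n t = g T * ?w n T" using t_less_T by (simp add: min_def)
        obtain f where f: "trig_span f" "\<And>x. x \<in> {t..T} \<Longrightarrow> \<bar>g x * ?w n x - f x\<bar> < e"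
          using periodic_trig_approximation[OF c p e] by blast
        obtain p c where "\<And>x. f x = (\<Sum>j\<le>p. c j * trig_sys t T j x)" using f(1) unfolding basis_span_def by blast
        then have "\<bar>g x * ?w n x - (\<Sum>j\<le>p. c j * restr (trig_sys t T j) x)\<bar> \<le> e" if "x \<in> {t..<T}" for x
          using f(2)[of x] that by (simp add: restr_eq less_imp_le)
        then show "\<exists>p c. \<forall>x\<in>{t..<T}. \<bar>g x * ?w n x - (\<Sum>j\<le>p. c j * restr (trig_sys t T j) x)\<bar> \<le> e" by blast
      qed
    qed
  next
    show "restr (trig_sys t T 0) x = 1 / sqrt (T - t)" if "x \<in> {t..<T}" for x
      using that by (simp add: restr_eq trig_sys_def)
  qed
qed

end

section \<open>Trapezoidal sums\<close>

text \<open>The mean of two consecutive partial sums counts earlier coarse cells fully and the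
  current one by half, which is \<open>heav\<close> of the coarse cell numbers. \<open>r\<close> is
  the refinement factor; a common range \<open>M\<close> for the inner sum makes it independent of
  \<open>d\<close>.\<close>

lemma trapezoid_sum_kernel:
  fixes x y :: "nat \<Rightarrow> real"
  assumes r: "0 < r" and M: "K * r \<le> M"
    and X: "\<And>k. k \<le> K \<Longrightarrow> X k = (\<Sum>c<k * r. x c)"
    and Y: "\<And>k. k < K \<Longrightarrow> Y k = (\<Sum>d = k * r..<k * r + r. y d)"
  shows "(\<Sum>k<K. (X k + X (Suc k)) / 2 * Y k) = (\<Sum>d<K * r. y d * (\<Sum>c<M. heav (c div r) (d div r) * x c))"
proof -
  have X2: "(X k + X (Suc k)) / 2 = (\<Sum>c<M. heav (c div r) k * x c)" if "k < K" for k
  proof -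
    have le: "Suc k * r \<le> M" "k * r \<le> M"
      using that M mult_le_mono1[of "Suc k" K r] mult_le_mono1[of k K r] by linarith+
    have "X k = (\<Sum>c<M. if c div r < k then x c else 0)"
      using that le r by (subst X, simp, intro sum.mono_neutral_cong_left) (auto simp: div_less_iff_less_mult)
    moreover have "X (Suc k) = (\<Sum>c<M. if c div r < Suc k then x c else 0)"
      using that le r by (subst X, simp, intro sum.mono_neutral_cong_left) (auto simp: div_less_iff_less_mult simp del: mult_Suc)
    ultimately have "X k + X (Suc k) = (\<Sum>c<M. (if c div r < k then x c else 0) + (if c div r < Suc k then x c else 0))"
      by (simp add: sum.distrib)
    also have "\<dots> = (\<Sum>c<M. 2 * (heav (c div r) k * x c))"
      by (intro sum.cong refl) (auto simp: heav_def)
    finally show ?thesis by (simp add: sum_distrib_left[symmetric])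
  qed
  have "(\<Sum>k<K. (X k + X (Suc k)) / 2 * Y k) =
      (\<Sum>k<K. \<Sum>d = k * r..<k * r + r. y d * (\<Sum>c<M. heav (c div r) (d div r) * x c))"
  proof (rule sum.cong[OF refl])
    fix k assume "k \<in> {..<K}"
    then have k: "k < K" by simp
    have "d div r = k" if "d \<in> {k * r..<k * r + r}" for d
      using that r by (intro div_nat_eqI) (auto simp: algebra_simps)
    then show "(X k + X (Suc k)) / 2 * Y k = (\<Sum>d = k * r..<k * r + r. y d * (\<Sum>c<M. heav (c div r) (d div r) * x c))"
      unfolding X2[OF k] Y[OF k] by (simp add: sum_distrib_left[symmetric] sum_distrib_right[symmetric] mult.commute)
  qed
  also have "\<dots> = (\<Sum>d<K * r. y d * (\<Sum>c<M. heav (c div r) (d div r) * x c))"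
    by (rule sum.nat_group)
  finally show ?thesis .
qed

section \<open>Uniform grids and step functions\<close>

context interval
begin

definition grid :: "nat \<Rightarrow> nat \<Rightarrow> real" where "grid n k = t + real k * ((T - t) / real n)"

definition cell :: "nat \<Rightarrow> real \<Rightarrow> nat" where "cell n x = nat \<lfloor>(x - t) / ((T - t) / real n)\<rfloor>"

lemma grid_0 [simp]: "grid n 0 = t" by (simp add: grid_def)

lemma grid_n: "0 < n \<Longrightarrow> grid n n = T" by (simp add: grid_def)

lemma grid_mult: "0 < r \<Longrightarrow> grid (n * r) (k * r) = grid n k"
  by (cases "n = 0") (auto simp: grid_def)

lemma step_pos: "0 < n \<Longrightarrow> 0 < (T - t) / real n" using t_less_T by simp

lemma grid_less: "0 < n \<Longrightarrow> k < l \<Longrightarrow> grid n k < grid n l"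
  unfolding grid_def using step_pos[of n] by (simp del: times_divide_eq_right)

lemma grid_Suc: "grid n (Suc k) = grid n k + (T - t) / real n"
  unfolding grid_def by (simp add: distrib_right del: times_divide_eq_right)

lemma grid_range: "0 < n \<Longrightarrow> k \<le> n \<Longrightarrow> grid n k \<in> {t..T}"
proof -
  assume n: "0 < n" and k: "k \<le> n"
  have "real k * ((T - t) / real n) \<le> real n * ((T - t) / real n)"
    using k step_pos[OF n] by (intro mult_right_mono) auto
  also have "\<dots> = T - t" using n by simp
  finally have "real k * ((T - t) / real n) \<le> T - t" .
  moreover have "0 \<le> real k * ((T - t) / real n)"
    using step_pos[OF n] by (intro mult_nonneg_nonneg) auto
  ultimately show ?thesis by (simp add: grid_def del: times_divide_eq_right)
qed

lemma grid_range_less: "0 < n \<Longrightarrow> k < n \<Longrightarrow> grid n k \<in> {t..<T}"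
  using grid_range[of n k] grid_less[of n k n] grid_n[of n] by auto

lemma cell_eq_iff: "0 < n \<Longrightarrow> t \<le> x \<Longrightarrow> cell n x = a \<longleftrightarrow> grid n a \<le> x \<and> x < grid n (Suc a)"
proof -
  assume n: "0 < n" and x: "t \<le> x"
  note s = step_pos[OF n]
  define y where "y = (x - t) / ((T - t) / real n)"
  have y: "0 \<le> y" unfolding y_def using x s by (intro divide_nonneg_pos) auto
  have "cell n x = a \<longleftrightarrow> real a \<le> y \<and> y < real (Suc a)"
    unfolding cell_def y_def[symmetric] using y by (auto simp: nat_eq_iff floor_eq_iff)
  also have "real a \<le> y \<longleftrightarrow> grid n a \<le> x"
    unfolding y_def using s by (subst pos_le_divide_eq[OF s]) (auto simp: grid_def)
  also have "y < real (Suc a) \<longleftrightarrow> x < grid n (Suc a)"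
    unfolding y_def using s by (subst pos_divide_less_eq[OF s]) (auto simp: grid_def)
  finally show ?thesis .
qed

lemma cell_bounds: "0 < n \<Longrightarrow> t \<le> x \<Longrightarrow> grid n (cell n x) \<le> x \<and> x < grid n (Suc (cell n x))"
  using cell_eq_iff[of n x "cell n x"] by simp

lemma cell_less: "0 < n \<Longrightarrow> x \<in> {t..<T} \<Longrightarrow> cell n x < n"
  using cell_bounds[of n x] grid_n[of n] grid_less[of n n "cell n x"] by (cases "cell n x" n rule: linorder_cases) auto

lemma cell_measurable [measurable]: "cell n \<in> borel \<rightarrow>\<^sub>M count_space UNIV"
  unfolding cell_def[abs_def] by measurable

text \<open>Lets a cell number be compared at a coarser resolution, as happens between two levels of
  discretisation.\<close>

lemma cell_div:
  assumes "0 < n" "0 < r" "t \<le> x"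
  shows "cell (n * r) x div r = cell n x"
proof -
  let ?c = "cell (n * r) x"
  have b: "grid (n * r) ?c \<le> x" "x < grid (n * r) (Suc ?c)" using cell_bounds[of "n * r" x] assms by auto
  have d: "?c div r * r \<le> ?c" "Suc ?c \<le> Suc (?c div r) * r"
    using assms(2) by (auto simp: div_times_less_eq_dividend Suc_le_eq dividend_less_div_times)
  have mono: "grid (n * r) k \<le> grid (n * r) l" if "k \<le> l" for k l
    using that grid_less[of "n * r" k l] assms by (cases "k = l") auto
  have "grid n (?c div r) \<le> x"
    using mono[OF d(1)] b grid_mult[OF assms(2), of n "?c div r"] by simp
  moreover have "x < grid n (Suc (?c div r))"
    using mono[OF d(2)] b grid_mult[OF assms(2), of n "Suc (?c div r)"] by simp
  ultimately show ?thesis using cell_eq_iff[OF assms(1,3), of "?c div r"] by simp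
qed

lemma LI_cell:
  assumes n: "0 < n"
  shows "LI (\<lambda>x. g (cell n x)) = (T - t) / real n * (\<Sum>a<n. g a)"
proof -
  let ?I = "\<lambda>a. {grid n a..<grid n (Suc a)}"
  have "LI (\<lambda>x. g (cell n x)) = LI (\<lambda>x. \<Sum>a<n. g a * indicator (?I a) x)"
  proof (rule LI_cong)
    fix x assume x: "x \<in> {t..<T}"
    have "(\<Sum>a<n. g a * indicator (?I a) x) = (\<Sum>a<n. if cell n x = a then g a else 0)"
      using x n by (intro sum.cong refl) (auto simp: indicator_def cell_eq_iff)
    then show "g (cell n x) = (\<Sum>a<n. g a * indicator (?I a) x)" using cell_less[OF n x] by simp
  next
    show "(\<lambda>x. g (cell n x)) \<in> borel_measurable borel"
      by (rule measurable_compose[OF cell_measurable]) simp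
    show "(\<lambda>x. \<Sum>a<n. g a * indicator (?I a) x) \<in> borel_measurable borel"
      by (intro bm_measurable bm_sum bm_mult bm_const bm_indicator) auto
  qed
  also have "\<dots> = (\<Sum>a<n. LI (\<lambda>x. g a * indicator (?I a) x))"
    by (intro LI_sum bm_mult bm_const bm_indicator) auto
  also have "\<dots> = (\<Sum>a<n. g a * ((T - t) / real n))"
  proof (rule sum.cong[OF refl])
    fix a assume "a \<in> {..<n}"
    then have a: "a < n" by simp
    have le: "grid n a < grid n (Suc a)" by (rule grid_less[OF n]) simp
    have "?I a \<inter> {t..<T} = ?I a"
      using grid_range[OF n, of a] grid_range[OF n, of "Suc a"] a by auto
    then have "emeasure \<mu> (?I a) = ennreal (grid n (Suc a) - grid n a)"
      using le by (simp add: emeasure_\<mu>)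
    moreover have "grid n (Suc a) - grid n a = (T - t) / real n" by (simp add: grid_Suc)
    ultimately have "measure \<mu> (?I a) = (T - t) / real n" using step_pos[OF n] by (simp add: measure_def)
    then show "LI (\<lambda>x. g a * indicator (?I a) x) = g a * ((T - t) / real n)" by simp
  qed
  finally show ?thesis by (simp only: sum_distrib_right[symmetric] mult.commute)
qed

lemma LI_cell2:
  assumes n: "0 < n"
  shows "LI (\<lambda>x. LI (\<lambda>y. g (cell n x) (cell n y))) = ((T - t) / real n)\<^sup>2 * (\<Sum>a<n. \<Sum>b<n. g a b)"
  unfolding LI_cell[OF n, of "g (cell n _)"] LI_cell[OF n, of "\<lambda>a. (T - t) / real n * (\<Sum>b<n. g a b)"]
  by (simp add: power2_eq_square sum_distrib_left mult.assoc)

lemma LI_cell4: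
  assumes n: "0 < n"
  shows "LI (\<lambda>x. LI (\<lambda>y. LI (\<lambda>z. LI (\<lambda>w. g (cell n x) (cell n y) (cell n z) (cell n w))))) =
    ((T - t) / real n)^4 * (\<Sum>a<n. \<Sum>b<n. \<Sum>c<n. \<Sum>d<n. g a b c d)"
proof -
  have "LI (\<lambda>z. LI (\<lambda>w. g a b (cell n z) (cell n w))) = ((T - t) / real n)\<^sup>2 * (\<Sum>c<n. \<Sum>d<n. g a b c d)" for a b
    by (rule LI_cell2[OF n])
  then show ?thesis
    using LI_cell2[OF n, of "\<lambda>a b. ((T - t) / real n)\<^sup>2 * (\<Sum>c<n. \<Sum>d<n. g a b c d)"]
    by (simp add: sum_distrib_left power2_eq_square power4_eq_xxxx mult.assoc)
qed

text \<open>With \<open>h\<close> the mesh, the fourfold integral carries \<open>h\<close> to the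
  fourth power, each single contraction \<open>h\<^sup>2\<close> from outside and
  \<open>h\<^sup>2\<close> from the squared inner integral, each double contraction
  \<open>h\<^sup>2\<close> inside the square. All ten terms are thus matched by scaling
  \<open>D\<close> with \<open>h\<^sup>2\<close>, the factor that four increments also
  produce.\<close>

lemma trace_norm_cell:
  assumes n: "0 < n"
  shows "trace_norm (\<lambda>a b c d. D (cell n a) (cell n b) (cell n c) (cell n d)) =
    trace_norm4 n (\<lambda>a b c d. ((T - t) / real n)\<^sup>2 * D a b c d)"
proof -
  let ?h = "(T - t) / real n"
  have 2: "LI (\<lambda>z. LI (\<lambda>w. (LI (\<lambda>x. g (cell n x) (cell n z) (cell n w)))\<^sup>2)) =
      (\<Sum>z<n. \<Sum>w<n. (\<Sum>x<n. ?h\<^sup>2 * g x z w)\<^sup>2)" for g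
  proof -
    have "LI (\<lambda>x. g (cell n x) z w) = ?h * (\<Sum>x<n. g x z w)" for z w by (rule LI_cell[OF n])
    then have "LI (\<lambda>z. LI (\<lambda>w. (LI (\<lambda>x. g (cell n x) (cell n z) (cell n w)))\<^sup>2)) =
        ?h\<^sup>2 * (\<Sum>z<n. \<Sum>w<n. (?h * (\<Sum>x<n. g x z w))\<^sup>2)"
      using LI_cell2[OF n, of "\<lambda>z w. (?h * (\<Sum>x<n. g x z w))\<^sup>2"] by simp
    also have "\<dots> = (\<Sum>z<n. \<Sum>w<n. (\<Sum>x<n. ?h\<^sup>2 * g x z w)\<^sup>2)"
    proof -
      have "(\<Sum>x<n. ?h\<^sup>2 * g x z w)\<^sup>2 = ?h\<^sup>2 * (?h * (\<Sum>x<n. g x z w))\<^sup>2" for z w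
        unfolding sum_distrib_left[symmetric] by (simp only: power_mult_distrib power2_eq_square mult_ac)
      then show ?thesis by (simp add: sum_distrib_left)
    qed
    finally show ?thesis .
  qed
  have 0: "(LI (\<lambda>z. LI (\<lambda>x. g (cell n x) (cell n z))))\<^sup>2 = (\<Sum>z<n. \<Sum>x<n. ?h\<^sup>2 * g x z)\<^sup>2" for g
    using LI_cell2[OF n, of "\<lambda>z x. g x z"] by (simp add: sum_distrib_left)
  have 4: "LI (\<lambda>a. LI (\<lambda>b. LI (\<lambda>c. LI (\<lambda>d. (D (cell n a) (cell n b) (cell n c) (cell n d))\<^sup>2)))) =
      (\<Sum>a<n. \<Sum>b<n. \<Sum>c<n. \<Sum>d<n. (?h\<^sup>2 * D a b c d)\<^sup>2)"
    using LI_cell4[OF n, of "\<lambda>a b c d. (D a b c d)\<^sup>2"] by (simp add: sum_distrib_left power_mult_distrib)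
  show ?thesis
    unfolding trace_norm_def trace_norm4_def 4
      2[of "\<lambda>x z w. D x x z w"] 2[of "\<lambda>x z w. D x z x w"] 2[of "\<lambda>x z w. D x z w x"] 2[of "\<lambda>x z w. D z x x w"]
      2[of "\<lambda>x z w. D z x w x"] 2[of "\<lambda>x z w. D z w x x"]
      0[of "\<lambda>x z. D x x z z"] 0[of "\<lambda>x z. D x z x z"] 0[of "\<lambda>x z. D x z z x"] ..
qed

lemma LI_tendsto_bm:
  assumes "\<And>n. bm (f n)" "bm g" "\<And>n x. \<bar>f n x\<bar> \<le> B" "\<And>x. x \<in> {t..<T} \<Longrightarrow> (\<lambda>n. f n x) \<longlonglongrightarrow> g x"
  shows "(\<lambda>n. LI (f n)) \<longlonglongrightarrow> LI g"
  using assms by (intro LI_tendsto[where B = B] bm_measurable)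

text \<open>Bounded convergence in every term. Pointwise convergence is demanded at all points
  rather than almost everywhere, since contractions evaluate the kernel on diagonals.\<close>

lemma trace_norm_tendsto:
  assumes f: "\<And>n. bm4 (f n)" and g: "bm4 g" and B: "\<And>n a b c d. \<bar>f n a b c d\<bar> \<le> B"
    and lim: "\<And>a b c d. a \<in> {t..<T} \<Longrightarrow> b \<in> {t..<T} \<Longrightarrow> c \<in> {t..<T} \<Longrightarrow> d \<in> {t..<T} \<Longrightarrow>
      (\<lambda>n. f n a b c d) \<longlonglongrightarrow> g a b c d"
  shows "(\<lambda>n. trace_norm (f n)) \<longlonglongrightarrow> trace_norm g"
proof -
  have B2: "\<bar>(f n a b c d)\<^sup>2\<bar> \<le> B\<^sup>2" for n a b c d
    using power_mono[OF B[of n a b c d] abs_ge_zero, of 2] by simp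
  have L: "\<bar>LI h\<bar> \<le> (T - t) * C" if "\<And>x. \<bar>h x\<bar> \<le> C" "bm h" for h C by (rule LI_bound[OF that])
  have 4: "(\<lambda>n. LI (\<lambda>a. LI (\<lambda>b. LI (\<lambda>c. LI (\<lambda>d. (f n a b c d)\<^sup>2))))) \<longlonglongrightarrow> LI (\<lambda>a. LI (\<lambda>b. LI (\<lambda>c. LI (\<lambda>d. (g a b c d)\<^sup>2))))"
    apply (rule LI_tendsto_bm, (intro bm_LI_raw bm_power bm4_sub[OF f] bm4_sub[OF g] bmi)+)
     apply (rule L, rule L, rule L, rule B2, (intro bm_LI_raw bm_power bm4_sub[OF f] bmi)+)
    apply (rule LI_tendsto_bm, (intro bm_LI_raw bm_power bm4_sub[OF f] bm4_sub[OF g] bmi)+)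
     apply (rule L, rule L, rule B2, (intro bm_LI_raw bm_power bm4_sub[OF f] bmi)+)
    apply (rule LI_tendsto_bm, (intro bm_LI_raw bm_power bm4_sub[OF f] bm4_sub[OF g] bmi)+)
     apply (rule L, rule B2, (intro bm_LI_raw bm_power bm4_sub[OF f] bmi)+)
    apply (rule LI_tendsto_bm, (intro bm_LI_raw bm_power bm4_sub[OF f] bm4_sub[OF g] bmi)+)
     apply (rule B2)
    apply (intro tendsto_power lim; assumption)
    done
  have 2: "(\<lambda>n. LI (\<lambda>z. LI (\<lambda>w. (LI (\<lambda>x. p n x z w))\<^sup>2))) \<longlonglongrightarrow> LI (\<lambda>z. LI (\<lambda>w. (LI (\<lambda>x. q x z w))\<^sup>2))"
    if p: "\<And>n. bm3 (p n)" and q: "bm3 q" and Bp: "\<And>n x z w. \<bar>p n x z w\<bar> \<le> B"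
      and l: "\<And>x z w. x \<in> {t..<T} \<Longrightarrow> z \<in> {t..<T} \<Longrightarrow> w \<in> {t..<T} \<Longrightarrow> (\<lambda>n. p n x z w) \<longlonglongrightarrow> q x z w" for p q
  proof (rule LI2_tendsto[where B = "((T - t) * B)\<^sup>2"])
    show "bm2 (\<lambda>z w. (LI (\<lambda>x. p n x z w))\<^sup>2)" for n unfolding bm2_def by (intro bm_power bm_LI_raw bm3_sub[OF p] bmi)
    show "bm2 (\<lambda>z w. (LI (\<lambda>x. q x z w))\<^sup>2)" unfolding bm2_def by (intro bm_power bm_LI_raw bm3_sub[OF q] bmi)
    show "\<bar>(LI (\<lambda>x. p n x z w))\<^sup>2\<bar> \<le> ((T - t) * B)\<^sup>2" for n z w
    proof -
      have "\<bar>LI (\<lambda>x. p n x z w)\<bar> \<le> (T - t) * B" by (rule L[OF Bp]) (intro bm3_sub[OF p] bmi)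
      from power_mono[OF this abs_ge_zero, of 2] show ?thesis by simp
    qed
    show "(\<lambda>n. (LI (\<lambda>x. p n x z w))\<^sup>2) \<longlonglongrightarrow> (LI (\<lambda>x. q x z w))\<^sup>2" if "z \<in> {t..<T}" "w \<in> {t..<T}" for z w
      by (intro tendsto_power LI_tendsto_bm[where B = B] Bp l that bm3_sub[OF p] bm3_sub[OF q] bmi)
  qed
  have 0: "(\<lambda>n. (LI (\<lambda>z. LI (\<lambda>x. p n x z)))\<^sup>2) \<longlonglongrightarrow> (LI (\<lambda>z. LI (\<lambda>x. q x z)))\<^sup>2"
    if p: "\<And>n. bm2 (p n)" and q: "bm2 q" and Bp: "\<And>n x z. \<bar>p n x z\<bar> \<le> B"
      and l: "\<And>x z. x \<in> {t..<T} \<Longrightarrow> z \<in> {t..<T} \<Longrightarrow> (\<lambda>n. p n x z) \<longlonglongrightarrow> q x z" for p q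
    by (intro tendsto_power LI2_tendsto[where B = B] Bp l) (unfold bm2_def, (intro bm2_sub[OF p] bm2_sub[OF q] bmi)+)
  have b3: "bm3 (\<lambda>x z w. h x x z w)" "bm3 (\<lambda>x z w. h x z x w)" "bm3 (\<lambda>x z w. h x z w x)" "bm3 (\<lambda>x z w. h z x x w)"
    "bm3 (\<lambda>x z w. h z x w x)" "bm3 (\<lambda>x z w. h z w x x)" if "bm4 h" for h
    unfolding bm3_def by (intro bm4_sub[OF that] bmi)+
  have b2: "bm2 (\<lambda>x z. h x x z z)" "bm2 (\<lambda>x z. h x z x z)" "bm2 (\<lambda>x z. h x z z x)" if "bm4 h" for h
    unfolding bm2_def by (intro bm4_sub[OF that] bmi)+
  show ?thesis
    unfolding trace_norm_def
    by (intro tendsto_add 4 2[OF b3(1)[OF f] b3(1)[OF g]] 2[OF b3(2)[OF f] b3(2)[OF g]] 2[OF b3(3)[OF f] b3(3)[OF g]]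
        2[OF b3(4)[OF f] b3(4)[OF g]] 2[OF b3(5)[OF f] b3(5)[OF g]] 2[OF b3(6)[OF f] b3(6)[OF g]]
        0[OF b2(1)[OF f] b2(1)[OF g]] 0[OF b2(2)[OF f] b2(2)[OF g]] 0[OF b2(3)[OF f] b2(3)[OF g]] B lim)
qed

text \<open>Distinct points lie in different cells once the mesh is below their distance; equal
  points share a cell on every grid, where both sides are 1/2. So the convergence includes the
  diagonal.\<close>

lemma heav_cell_tendsto:
  assumes N: "filterlim N at_top sequentially" "\<And>q. 0 < N q" and xy: "x \<in> {t..<T}" "y \<in> {t..<T}"
  shows "(\<lambda>q. heav (cell (N q) x) (cell (N q) y)) \<longlonglongrightarrow> heav x y"
proof -
  have sep: "\<forall>\<^sub>F q in sequentially. cell (N q) x < cell (N q) y" if xy: "x \<in> {t..<T}" "y \<in> {t..<T}" "x < y" for x y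
  proof -
    \<comment> \<open>With at least \<open>m\<close> cells the mesh is smaller than
      \<open>y - x\<close>.\<close>
    obtain m where m: "(T - t) / (y - x) < real m" using reals_Archimedean2 by blast
    have "\<forall>\<^sub>F q in sequentially. m \<le> N q" using N(1) by (simp add: filterlim_at_top)
    then show ?thesis
    proof eventually_elim
      case (elim q)
      let ?h = "(T - t) / real (N q)"
      have h: "?h < y - x"
      proof -
        have "(T - t) / (y - x) < real (N q)" using m elim by simp
        then show ?thesis using xy(3) N(2)[of q] by (simp add: field_simps)
      qed
      have "grid (N q) (cell (N q) x) \<le> x" "y < grid (N q) (Suc (cell (N q) y))"
        using cell_bounds[OF N(2), of x q] cell_bounds[OF N(2), of y q] xy by auto
      then have "grid (N q) (Suc (cell (N q) x)) < grid (N q) (Suc (cell (N q) y))"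
        using h xy(3) by (simp add: grid_Suc)
      then show ?case
        using grid_less[OF N(2), of "Suc (cell (N q) y)" "Suc (cell (N q) x)" q]
        by (cases "cell (N q) x" "cell (N q) y" rule: linorder_cases) auto
    qed
  qed
  consider "x < y" | "x = y" | "y < x" by linarith
  then show ?thesis
  proof cases
    case 1
    show ?thesis using sep[OF xy 1] by (intro tendsto_eventually) (auto simp: heav_def 1 elim: eventually_mono)
  next
    case 2
    then show ?thesis by simp
  next
    case 3
    show ?thesis using sep[OF xy(2,1) 3] 3 by (intro tendsto_eventually) (auto simp: heav_def elim!: eventually_mono)
  qed
qed

lemma grid_cell_tendsto:
  assumes N: "filterlim N at_top sequentially" "\<And>q. 0 < N q" and x: "x \<in> {t..<T}"
  shows "(\<lambda>q. grid (N q) (cell (N q) x)) \<longlonglongrightarrow> x"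
proof (rule tendsto_sandwich)
  have b: "grid (N q) (cell (N q) x) \<le> x \<and> x < grid (N q) (Suc (cell (N q) x))" for q
    using cell_bounds[OF N(2), of x q] x by auto
  show "\<forall>\<^sub>F q in sequentially. grid (N q) (cell (N q) x) \<le> x" using b by simp
  show "\<forall>\<^sub>F q in sequentially. x - (T - t) / real (N q) \<le> grid (N q) (cell (N q) x)"
    using b by (intro always_eventually allI) (simp add: grid_Suc algebra_simps less_imp_le)
  have "(\<lambda>q. (T - t) / real (N q)) \<longlonglongrightarrow> 0"
    by (rule tendsto_divide_0[OF tendsto_const filterlim_at_top_imp_at_infinity])
      (rule filterlim_compose[OF filterlim_real_sequentially N(1)])
  from tendsto_diff[OF tendsto_const this] show "(\<lambda>q. x - (T - t) / real (N q)) \<longlonglongrightarrow> x" by simp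
qed simp

text \<open>Refining a grid by the factors \<open>Suc q\<close> keeps \<open>grid n k\<close> as a
  grid point, so initial segments are admissible partitions for the integral up to that
  point.\<close>

lemma partition_seq_grid:
  assumes "0 < n" "0 < k"
  shows "partition_seq t (grid n k) (\<lambda>q. k * Suc q) (\<lambda>q l. grid (n * Suc q) l)"
  unfolding partition_seq_def
proof (intro conjI allI impI)
  fix q
  show "0 < k * Suc q" using assms by simp
  show "grid (n * Suc q) 0 = t" by simp
  show "grid (n * Suc q) (k * Suc q) = grid n k" by (rule grid_mult) simp
  show "grid (n * Suc q) l < grid (n * Suc q) (Suc l)" for l using assms by (intro grid_less) auto
next
  have "Max ((\<lambda>l. grid (n * Suc q) (Suc l) - grid (n * Suc q) l) ` {..<k * Suc q}) = (T - t) / real n * inverse (real (Suc q))" for q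
  proof -
    have "grid (n * Suc q) (Suc l) - grid (n * Suc q) l = (T - t) / real n * inverse (real (Suc q))" for l
      by (simp add: grid_Suc divide_inverse mult.assoc del: of_nat_Suc mult_Suc_right)
    moreover have "{..<k * Suc q} \<noteq> {}" using assms(2) by auto
    ultimately show ?thesis by (simp del: mult_Suc_right of_nat_Suc)
  qed
  then show "(\<lambda>q. Max ((\<lambda>l. grid (n * Suc q) (Suc l) - grid (n * Suc q) l) ` {..<k * Suc q})) \<longlonglongrightarrow> 0"
    using tendsto_mult_right_zero[OF LIMSEQ_inverse_real_of_nat, of "(T - t) / real n"] by simp
qed

end

section \<open>Almost sure subsequences and Fatou's lemma\<close>

context prob_space
begin

text \<open>The summed squared errors tend to 0 in L1, so a single subsequence serves all members of
  the finite family at once.\<close>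

lemma ms_lim_AE_subseq:
  assumes A: "finite A" and lim: "\<And>a. a \<in> A \<Longrightarrow> ms_lim M (X a) (Y a)"
  shows "\<exists>r. strict_mono r \<and> (AE \<omega> in M. \<forall>a\<in>A. (\<lambda>q. X a (r q) \<omega>) \<longlonglongrightarrow> Y a \<omega>)"
proof -
  define Z where "Z q \<omega> = (\<Sum>a\<in>A. (X a q \<omega> - Y a \<omega>)\<^sup>2)" for q \<omega>
  have int: "integrable M (\<lambda>\<omega>. (X a q \<omega> - Y a \<omega>)\<^sup>2)" if "a \<in> A" for a q
    using lim[OF that] by (simp add: ms_lim_def)
  have Z: "integrable M (Z q)" for q
    unfolding Z_def by (intro Bochner_Integration.integrable_sum int)
  have nn: "0 \<le> Z q \<omega>" for q \<omega> unfolding Z_def by (intro sum_nonneg) auto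
  have "(\<lambda>q. \<Sum>a\<in>A. LINT \<omega>|M. (X a q \<omega> - Y a \<omega>)\<^sup>2) \<longlonglongrightarrow> (\<Sum>a\<in>A. 0)"
    by (intro tendsto_sum) (use lim in \<open>simp add: ms_lim_def\<close>)
  also have "(\<lambda>q. \<Sum>a\<in>A. LINT \<omega>|M. (X a q \<omega> - Y a \<omega>)\<^sup>2) = (\<lambda>q. LINT \<omega>|M. norm (Z q \<omega>))"
  proof
    fix q
    have "(LINT \<omega>|M. norm (Z q \<omega>)) = (LINT \<omega>|M. Z q \<omega>)" using nn by simp
    also have "\<dots> = (\<Sum>a\<in>A. LINT \<omega>|M. (X a q \<omega> - Y a \<omega>)\<^sup>2)"
      unfolding Z_def by (intro Bochner_Integration.integral_sum int)
    finally show "(\<Sum>a\<in>A. LINT \<omega>|M. (X a q \<omega> - Y a \<omega>)\<^sup>2) = (LINT \<omega>|M. norm (Z q \<omega>))" by simp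
  qed
  finally have lim0: "(\<lambda>q. LINT \<omega>|M. norm (Z q \<omega>)) \<longlonglongrightarrow> 0" by simp
  obtain r where r: "strict_mono r" "AE \<omega> in M. (\<lambda>q. Z (r q) \<omega>) \<longlonglongrightarrow> 0"
    using tendsto_L1_AE_subseq[OF Z lim0] by blast
  have "AE \<omega> in M. \<forall>a\<in>A. (\<lambda>q. X a (r q) \<omega>) \<longlonglongrightarrow> Y a \<omega>"
    using r(2)
  proof eventually_elim
    case (elim \<omega>)
    show ?case
    proof
      fix a assume a: "a \<in> A"
      have "(\<lambda>q. (X a (r q) \<omega> - Y a \<omega>)\<^sup>2) \<longlonglongrightarrow> 0"
      proof (rule tendsto_sandwich[OF _ _ tendsto_const elim])
        show "\<forall>\<^sub>F q in sequentially. (X a (r q) \<omega> - Y a \<omega>)\<^sup>2 \<le> Z (r q) \<omega>"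
          unfolding Z_def using a A by (intro always_eventually allI member_le_sum) auto
      qed simp
      from tendsto_real_sqrt[OF this] have "(\<lambda>q. X a (r q) \<omega> - Y a \<omega>) \<longlonglongrightarrow> 0"
        by (simp add: tendsto_rabs_zero_iff)
      then show "(\<lambda>q. X a (r q) \<omega>) \<longlonglongrightarrow> Y a \<omega>" by (rule LIM_zero_cancel)
    qed
  qed
  with r(1) show ?thesis by blast
qed

text \<open>Mean-square convergence is not preserved by products, but almost sure convergence is.
  Along a subsequence with the latter, a bound on second moments survives in the limit.\<close>

lemma fatou_second_moment:
  assumes X: "\<And>q. ms_le (X q) (c q)" and c: "c \<longlonglongrightarrow> d" and r: "strict_mono r"
    and lim: "AE \<omega> in M. (\<lambda>q. X (r q) \<omega>) \<longlonglongrightarrow> Y \<omega>" and Y: "Y \<in> borel_measurable M"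
  shows "ms_le Y d"
  unfolding ms_le_def
proof
  have "(\<integral>\<^sup>+\<omega>. ennreal ((Y \<omega>)\<^sup>2) \<partial>M) = (\<integral>\<^sup>+\<omega>. liminf (\<lambda>q. ennreal ((X (r q) \<omega>)\<^sup>2)) \<partial>M)"
    using lim
  proof (intro nn_integral_cong_AE, eventually_elim)
    case (elim \<omega>)
    have "(\<lambda>q. ennreal ((X (r q) \<omega>)\<^sup>2)) \<longlonglongrightarrow> ennreal ((Y \<omega>)\<^sup>2)"
      by (intro tendsto_ennrealI tendsto_power elim)
    then show ?case by (intro lim_imp_Liminf[symmetric]) auto
  qed
  also have "\<dots> \<le> liminf (\<lambda>q. \<integral>\<^sup>+\<omega>. ennreal ((X (r q) \<omega>)\<^sup>2) \<partial>M)"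
  proof (rule nn_integral_liminf)
    show "(\<lambda>\<omega>. ennreal ((X (r q) \<omega>)\<^sup>2)) \<in> borel_measurable M" for q
    proof -
      have [measurable]: "X (r q) \<in> borel_measurable M" using X[of "r q"] by (simp add: ms_le_def)
      show ?thesis by measurable
    qed
  qed
  also have "\<dots> \<le> liminf (\<lambda>q. ennreal (c (r q)))"
    using X by (intro Liminf_mono always_eventually) (auto simp: ms_le_def)
  also have "\<dots> = ennreal d"
    using LIMSEQ_subseq_LIMSEQ[OF c r] by (intro lim_imp_Liminf) (auto intro!: tendsto_ennrealI simp: o_def)
  finally show "(\<integral>\<^sup>+\<omega>. ennreal ((Y \<omega>)\<^sup>2) \<partial>M) \<le> ennreal d" .
qed (rule Y)

lemma ms_lim_cong_AE:
  assumes lim: "ms_lim M X Y" and AE: "\<And>q. AE \<omega> in M. X q \<omega> = X' q \<omega>" and X': "\<And>q. X' q \<in> borel_measurable M"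
  shows "ms_lim M X' Y"
proof -
  have Y[measurable]: "Y \<in> borel_measurable M" and int: "\<And>q. integrable M (\<lambda>\<omega>. (X q \<omega> - Y \<omega>)\<^sup>2)"
    and l: "(\<lambda>q. LINT \<omega>|M. (X q \<omega> - Y \<omega>)\<^sup>2) \<longlonglongrightarrow> 0"
    using lim by (auto simp: ms_lim_def)
  note [measurable] = X'
  have m: "(\<lambda>\<omega>. (X' q \<omega> - Y \<omega>)\<^sup>2) \<in> borel_measurable M" for q by measurable
  have ae: "AE \<omega> in M. (X q \<omega> - Y \<omega>)\<^sup>2 = (X' q \<omega> - Y \<omega>)\<^sup>2" for q
    using AE[of q] by eventually_elim simp
  have "integrable M (\<lambda>\<omega>. (X' q \<omega> - Y \<omega>)\<^sup>2)" for q
    by (rule integrable_cong_AE_imp[OF int m]) (use ae[of q] in \<open>auto elim: eventually_mono\<close>)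
  moreover have "(LINT \<omega>|M. (X q \<omega> - Y \<omega>)\<^sup>2) = (LINT \<omega>|M. (X' q \<omega> - Y \<omega>)\<^sup>2)" for q
    by (rule integral_cong_AE[OF borel_measurable_integrable[OF int] m ae])
  ultimately show ?thesis using l Y by (simp add: ms_lim_def)
qed

lemma ms_lim_const_AE:
  assumes lim: "ms_lim M (\<lambda>_. X) Y"
  shows "AE \<omega> in M. X \<omega> = Y \<omega>"
proof -
  obtain r where "AE \<omega> in M. \<forall>a\<in>{()}. (\<lambda>q::nat. X \<omega>) \<longlonglongrightarrow> Y \<omega>"
    using ms_lim_AE_subseq[of "{()}" "\<lambda>_ _. X" "\<lambda>_. Y"] lim by auto
  then show ?thesis by eventually_elim (simp add: LIMSEQ_const_iff)
qed

end

section \<open>The mean-square error\<close>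

text \<open>\<open>\<phi>\<close> is the continuous basis of the hypotheses, \<open>\<psi>\<close> a
  bounded version agreeing with it on the half-open interval. The array \<open>C\<close> is
  arbitrary: the second moment bound holds for any finite kernel of this form and is specialised in
  \<open>ms_lim_expansion\<close>.\<close>

locale strat_expansion = interval t T + prob_space M for t T and M :: "'a measure" +
  fixes F m W and i1 i2 i3 i4 :: nat and \<phi> \<psi> :: "nat \<Rightarrow> real \<Rightarrow> real"
    and \<zeta> :: "nat \<Rightarrow> nat \<Rightarrow> 'a \<Rightarrow> real" and J1 J2 J3 :: "real \<Rightarrow> 'a \<Rightarrow> real" and I :: "'a \<Rightarrow> real"
    and C :: "nat \<Rightarrow> nat \<Rightarrow> nat \<Rightarrow> nat \<Rightarrow> real"
  assumes wiener: "std_wiener M F m W" and t0: "0 \<le> t"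
    and idx: "i1 \<le> m" "i2 \<le> m" "i3 \<le> m" "i4 \<le> m"
    and zeta: "\<And>i j. i \<le> m \<Longrightarrow> ito_int M (\<lambda>s \<omega>. \<phi> j s) (wproc W i) t T (\<zeta> i j)"
    and J1: "\<And>s. s \<in> {t..T} \<Longrightarrow> strat_int M (\<lambda>_ _. 1) (wproc W i1) t s (J1 s)"
    and J2: "\<And>s. s \<in> {t..T} \<Longrightarrow> strat_int M J1 (wproc W i2) t s (J2 s)"
    and J3: "\<And>s. s \<in> {t..T} \<Longrightarrow> strat_int M J2 (wproc W i3) t s (J3 s)"
    and I: "strat_int M J3 (wproc W i4) t T I"
    and cont: "continuous_on UNIV (\<phi> j)"
    and \<psi>: "bm (\<psi> j)" "x \<in> {t..<T} \<Longrightarrow> \<psi> j x = \<phi> j x"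
begin

abbreviation "w \<equiv> wproc W"

lemma w_measurable: "i \<le> m \<Longrightarrow> 0 \<le> s \<Longrightarrow> w i s \<in> borel_measurable M"
proof (cases "i = 0")
  case True
  then show ?thesis by (simp add: wproc_def)
next
  case False
  assume "i \<le> m" "0 \<le> s"
  with False have "i \<in> {1..m}" by simp
  then have "W i s \<in> borel_measurable (F s)"
    using \<open>0 \<le> s\<close> wiener unfolding std_wiener_def by blast
  moreover have "subalgebra M (F s)"
    using wiener unfolding std_wiener_def by blast
  ultimately have "W i s \<in> borel_measurable M" by (rule measurable_from_subalg[rotated])
  then show ?thesis using False by (simp add: wproc_def)
qed

definition inc :: "nat \<Rightarrow> nat \<Rightarrow> nat \<Rightarrow> 'a \<Rightarrow> real" where
  "inc n i a \<omega> = w i (grid n (Suc a)) \<omega> - w i (grid n a) \<omega>"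

lemma grid_nonneg: "0 \<le> grid n a"
  unfolding grid_def using t0 t_less_T by (intro add_nonneg_nonneg mult_nonneg_nonneg divide_nonneg_nonneg) auto

lemma inc_measurable: "i \<le> m \<Longrightarrow> inc n i a \<in> borel_measurable M"
  unfolding inc_def[abs_def] by (intro borel_measurable_diff w_measurable grid_nonneg)

lemma sum_inc: "k \<le> l \<Longrightarrow> (\<Sum>a = k..<l. inc n i a \<omega>) = w i (grid n l) \<omega> - w i (grid n k) \<omega>"
  unfolding inc_def by (rule sum_Suc_diff')

lemma coarse_inc: "0 < r \<Longrightarrow> inc n i k \<omega> = (\<Sum>a = k * r..<k * r + r. inc (n * r) i a \<omega>)"
  by (subst sum_inc) (auto simp: inc_def grid_mult[of r n "Suc k", symmetric] grid_mult[of r n k, symmetric] add.commute)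

text \<open>Every increment, that of time included, is \<open>sqrt\<close> of the mesh times
  \<open>std_inc\<close>, so four of them give the squared mesh, as in
  \<open>trace_norm_cell\<close>. The value \<open>1 + (T - t)\<close> for \<open>K\<close>
  dominates both 1 and the length of the interval.\<close>

lemma ms_le_inc_form:
  assumes n: "0 < n"
  shows "ms_le (\<lambda>\<omega>. \<Sum>a<n. \<Sum>b<n. \<Sum>c<n. \<Sum>d<n. D a b c d * inc n i1 a \<omega> * inc n i2 b \<omega> * inc n i3 c \<omega> * inc n i4 d \<omega>)
    (10000 * (1 + (T - t))^4 * trace_norm (\<lambda>a b c d. D (cell n a) (cell n b) (cell n c) (cell n d)))"
proof -
  let ?\<delta> = "(T - t) / real n"
  have \<delta>: "0 < ?\<delta>" by (rule step_pos[OF n])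
  interpret g: wiener_grid M F m W t ?\<delta>
    using wiener t0 \<delta> by unfold_locales
  have sq: "sqrt ?\<delta> * sqrt ?\<delta> = ?\<delta>" by (rule real_sqrt_mult_self[THEN trans], rule abs_of_pos[OF \<delta>])
  have inc: "inc n i a \<omega> = sqrt ?\<delta> * g.std_inc i a \<omega>" for i a \<omega>
  proof (cases "i = 0")
    case True
    have "inc n i a \<omega> = ?\<delta>" using True by (simp add: inc_def wproc_def grid_Suc)
    also have "\<dots> = sqrt ?\<delta> * sqrt ?\<delta>" by (simp only: sq)
    also have "\<dots> = sqrt ?\<delta> * g.std_inc i a \<omega>" using True by (simp add: g.std_inc_0)
    finally show ?thesis .
  next
    case False
    have s0: "sqrt ?\<delta> \<noteq> 0" using real_sqrt_gt_zero[OF \<delta>] by linarith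
    have "inc n i a \<omega> = W i (t + real (Suc a) * ?\<delta>) \<omega> - W i (t + real a * ?\<delta>) \<omega>"
      using False by (simp only: inc_def wproc_def grid_def if_False)
    also have "\<dots> = sqrt ?\<delta> * ((W i (t + real (Suc a) * ?\<delta>) \<omega> - W i (t + real a * ?\<delta>) \<omega>) / sqrt ?\<delta>)"
      by (simp only: times_divide_eq_right nonzero_mult_div_cancel_left[OF s0])
    also have "\<dots> = sqrt ?\<delta> * g.std_inc i a \<omega>"
      using False by (simp only: g.std_inc_def g.\<xi>_def if_False)
    finally show ?thesis .
  qed
  have e: "D a b c d * inc n i1 a \<omega> * inc n i2 b \<omega> * inc n i3 c \<omega> * inc n i4 d \<omega> =
      (?\<delta>\<^sup>2 * D a b c d) * g.std_inc i1 a \<omega> * g.std_inc i2 b \<omega> * g.std_inc i3 c \<omega> * g.std_inc i4 d \<omega>" for a b c d \<omega>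
  proof -
    have "D a b c d * inc n i1 a \<omega> * inc n i2 b \<omega> * inc n i3 c \<omega> * inc n i4 d \<omega> =
      ((sqrt ?\<delta> * sqrt ?\<delta>) * (sqrt ?\<delta> * sqrt ?\<delta>) * D a b c d) * g.std_inc i1 a \<omega> * g.std_inc i2 b \<omega> * g.std_inc i3 c \<omega> * g.std_inc i4 d \<omega>"
      unfolding inc by (simp only: mult_ac)
    then show ?thesis unfolding sq by (simp only: power2_eq_square)
  qed
  show ?thesis
    unfolding e trace_norm_cell[OF n]
    by (rule g.ms_le_form4) (use t_less_T n idx in auto)
qed

text \<open>For \<open>k = 0\<close> the sums are empty and the degenerate clause of
  \<open>strat_int\<close> applies; otherwise refined grids are admissible partitions.\<close>

lemma strat_grid_lim:
  assumes S: "strat_int M X w' t (grid n k) Y" and n: "0 < n"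
  shows "ms_lim M (\<lambda>q \<omega>. \<Sum>l<k * Suc q. (X (grid (n * Suc q) l) \<omega> + X (grid (n * Suc q) (Suc l)) \<omega>) / 2 *
    (w' (grid (n * Suc q) (Suc l)) \<omega> - w' (grid (n * Suc q) l) \<omega>)) Y"
proof (cases "k = 0")
  case True
  then have Y: "Y \<in> borel_measurable M" "AE \<omega> in M. Y \<omega> = 0" using S by (auto simp: strat_int_def)
  have ae: "AE \<omega> in M. (0 - Y \<omega>)\<^sup>2 = 0" using Y(2) by eventually_elim simp
  have m: "(\<lambda>\<omega>. (0 - Y \<omega>)\<^sup>2) \<in> borel_measurable M" using Y(1) by simp
  have "integrable M (\<lambda>\<omega>. (0 - Y \<omega>)\<^sup>2)"
    by (rule integrable_cong_AE_imp[OF integrable_zero m]) (use ae in \<open>auto elim: eventually_mono\<close>)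
  moreover have "(LINT \<omega>|M. (0 - Y \<omega>)\<^sup>2) = 0"
    using integral_cong_AE[OF m _ ae] by simp
  ultimately show ?thesis using True Y by (simp add: ms_lim_def)
next
  case False
  then have less: "t < grid n k" using grid_less[OF n, of 0 k] by simp
  then have "partition_seq t (grid n k) N \<tau> \<Longrightarrow> ms_lim M (\<lambda>q \<omega>. \<Sum>l<N q. (X (\<tau> q l) \<omega> + X (\<tau> q (Suc l)) \<omega>) / 2
                                * (w' (\<tau> q (Suc l)) \<omega> - w' (\<tau> q l) \<omega>)) Y" for N \<tau>
    using S by (auto simp: strat_int_def)
  from this[OF partition_seq_grid[OF n]] False show ?thesis by blast
qed

text \<open>For the integrand 1 the sums telescope to a value that does not depend on the
  refinement.\<close>

lemma J1_eq:
  assumes "k \<le> n" "0 < n"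
  shows "AE \<omega> in M. J1 (grid n k) \<omega> = w i1 (grid n k) \<omega> - w i1 t \<omega>"
proof -
  have tel: "(\<Sum>l<k * Suc q. w i1 (grid (n * Suc q) (Suc l)) \<omega> - w i1 (grid (n * Suc q) l) \<omega>) = w i1 (grid n k) \<omega> - w i1 t \<omega>" for q \<omega>
    using sum_lessThan_telescope[of "\<lambda>l. w i1 (grid (n * Suc q) l) \<omega>" "k * Suc q"] grid_mult[of "Suc q" n k] by simp
  have "ms_lim M (\<lambda>q \<omega>. w i1 (grid n k) \<omega> - w i1 t \<omega>) (J1 (grid n k))"
    using strat_grid_lim[OF J1[OF grid_range[OF assms(2,1)]] assms(2)] by (simp add: tel del: mult_Suc_right)
  from ms_lim_const_AE[OF this] show ?thesis by eventually_elim simp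
qed

text \<open>Each sum involves \<open>J1\<close> at finitely many points only, so the exceptional
  null sets of \<open>J1_eq\<close> can be collected.\<close>

lemma J2_lim:
  assumes "k \<le> n" "0 < n"
  shows "ms_lim M (\<lambda>q \<omega>. \<Sum>l<k * Suc q. ((w i1 (grid (n * Suc q) l) \<omega> - w i1 t \<omega>) + (w i1 (grid (n * Suc q) (Suc l)) \<omega> - w i1 t \<omega>)) / 2 *
    inc (n * Suc q) i2 l \<omega>) (J2 (grid n k))"
proof (rule ms_lim_cong_AE)
  show "ms_lim M (\<lambda>q \<omega>. \<Sum>l<k * Suc q. (J1 (grid (n * Suc q) l) \<omega> + J1 (grid (n * Suc q) (Suc l)) \<omega>) / 2 *
    (w i2 (grid (n * Suc q) (Suc l)) \<omega> - w i2 (grid (n * Suc q) l) \<omega>)) (J2 (grid n k))"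
    by (rule strat_grid_lim[OF J2[OF grid_range[OF assms(2,1)]] assms(2)])
  fix q
  have le: "k * Suc q \<le> n * Suc q" using assms(1) by (rule mult_le_mono1)
  have "AE \<omega> in M. \<forall>l\<in>{..k * Suc q}. J1 (grid (n * Suc q) l) \<omega> = w i1 (grid (n * Suc q) l) \<omega> - w i1 t \<omega>"
    by (intro AE_finite_allI J1_eq) (use le assms in auto)
  then show "AE \<omega> in M. (\<Sum>l<k * Suc q. (J1 (grid (n * Suc q) l) \<omega> + J1 (grid (n * Suc q) (Suc l)) \<omega>) / 2 *
    (w i2 (grid (n * Suc q) (Suc l)) \<omega> - w i2 (grid (n * Suc q) l) \<omega>)) =
    (\<Sum>l<k * Suc q. ((w i1 (grid (n * Suc q) l) \<omega> - w i1 t \<omega>) + (w i1 (grid (n * Suc q) (Suc l)) \<omega> - w i1 t \<omega>)) / 2 *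
    inc (n * Suc q) i2 l \<omega>)"
    by eventually_elim (intro sum.cong refl, simp add: inc_def Suc_le_eq del: mult_Suc_right)
  show "(\<lambda>\<omega>. \<Sum>l<k * Suc q. ((w i1 (grid (n * Suc q) l) \<omega> - w i1 t \<omega>) + (w i1 (grid (n * Suc q) (Suc l)) \<omega> - w i1 t \<omega>)) / 2 *
    inc (n * Suc q) i2 l \<omega>) \<in> borel_measurable M"
    by (intro borel_measurable_sum borel_measurable_times borel_measurable_divide borel_measurable_add borel_measurable_diff
        borel_measurable_const w_measurable inc_measurable grid_nonneg idx t0)
qed

lemma J3_lim:
  assumes "k \<le> n" "0 < n"
  shows "ms_lim M (\<lambda>q \<omega>. \<Sum>l<k * Suc q. (J2 (grid (n * Suc q) l) \<omega> + J2 (grid (n * Suc q) (Suc l)) \<omega>) / 2 *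
    inc (n * Suc q) i3 l \<omega>) (J3 (grid n k))"
  unfolding inc_def by (rule strat_grid_lim[OF J3[OF grid_range[OF assms(2,1)]] assms(2)])

lemma I_lim:
  "ms_lim M (\<lambda>q \<omega>. \<Sum>l<Suc q. (J3 (grid (Suc q) l) \<omega> + J3 (grid (Suc q) (Suc l)) \<omega>) / 2 * inc (Suc q) i4 l \<omega>) I"
  unfolding inc_def using strat_grid_lim[of J3 "w i4" 1 1 I] I grid_n[of 1] by (simp only: mult_1 zero_less_one)

lemma zeta_lim:
  assumes "i \<le> m" "0 < n"
  shows "ms_lim M (\<lambda>q \<omega>. \<Sum>a<n * Suc q. \<psi> j (grid (n * Suc q) a) * inc (n * Suc q) i a \<omega>) (\<zeta> i j)"
proof -
  have "ms_lim M (\<lambda>q \<omega>. \<Sum>a<n * Suc q. \<phi> j (grid (n * Suc q) a) * (w i (grid (n * Suc q) (Suc a)) \<omega> - w i (grid (n * Suc q) a) \<omega>)) (\<zeta> i j)"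
  proof -
    have "partition_seq t T N \<tau> \<Longrightarrow> ms_lim M (\<lambda>q \<omega>. \<Sum>a<N q. \<phi> j (\<tau> q a) * (w i (\<tau> q (Suc a)) \<omega> - w i (\<tau> q a) \<omega>)) (\<zeta> i j)" for N \<tau>
      using zeta[OF assms(1), of j] unfolding ito_int_def by blast
    from this[OF partition_seq_grid[OF assms(2,2), unfolded grid_n[OF assms(2)]]] show ?thesis .
  qed
  moreover have "(\<Sum>a<n * Suc q. \<psi> j (grid (n * Suc q) a) * inc (n * Suc q) i a \<omega>) =
      (\<Sum>a<n * Suc q. \<phi> j (grid (n * Suc q) a) * (w i (grid (n * Suc q) (Suc a)) \<omega> - w i (grid (n * Suc q) a) \<omega>))" for q \<omega>
    using assms(2) by (intro sum.cong refl) (subst \<psi>(2)[OF grid_range_less], auto simp: inc_def simp del: mult_Suc_right)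
  ultimately show ?thesis by (simp del: mult_Suc_right)
qed

end

lemma prod4_sums:
  fixes A :: "nat \<Rightarrow> real"
  shows "(\<Sum>a<n. A a) * (\<Sum>b<n. B b) * (\<Sum>c<n. E c) * (\<Sum>d<n. G d) = (\<Sum>a<n. \<Sum>b<n. \<Sum>c<n. \<Sum>d<n. A a * B b * E c * G d)"
proof -
  have 2: "(\<Sum>c<n. E c) * (\<Sum>d<n. G d) = (\<Sum>c<n. \<Sum>d<n. E c * G d)" by (rule sum_product)
  have 3: "(\<Sum>b<n. B b) * (\<Sum>c<n. \<Sum>d<n. E c * G d) = (\<Sum>b<n. \<Sum>c<n. \<Sum>d<n. B b * (E c * G d))"
    by (subst sum_distrib_right) (simp only: sum_distrib_left)
  have "(\<Sum>a<n. A a) * (\<Sum>b<n. \<Sum>c<n. \<Sum>d<n. B b * (E c * G d)) = (\<Sum>a<n. \<Sum>b<n. \<Sum>c<n. \<Sum>d<n. A a * (B b * (E c * G d)))"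
    by (subst sum_distrib_right) (simp only: sum_distrib_left)
  then show ?thesis by (simp only: mult.assoc 2 3)
qed

lemma filterlim_mult_Suc: "0 < k \<Longrightarrow> filterlim (\<lambda>q. k * Suc q) at_top sequentially"
proof (rule filterlim_at_top_mono[OF filterlim_Suc])
  assume "0 < k"
  then have "Suc q \<le> k * Suc q" for q by (cases k) auto
  then show "\<forall>\<^sub>F q in sequentially. Suc q \<le> k * Suc q" by simp
qed

lemma sum_reverse4:
  fixes f :: "nat \<Rightarrow> nat \<Rightarrow> nat \<Rightarrow> nat \<Rightarrow> real"
  shows "(\<Sum>d<n. \<Sum>c<n. \<Sum>b<n. \<Sum>a<n. f a b c d) = (\<Sum>a<n. \<Sum>b<n. \<Sum>c<n. \<Sum>d<n. f a b c d)"
proof -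
  have "(\<Sum>d<n. \<Sum>c<n. \<Sum>b<n. \<Sum>a<n. f a b c d) = (\<Sum>b<n. \<Sum>a<n. \<Sum>d<n. \<Sum>c<n. f a b c d)"
    by (rule sum_perm4(5))
  also have "\<dots> = (\<Sum>a<n. \<Sum>b<n. \<Sum>d<n. \<Sum>c<n. f a b c d)" by (rule sum.swap)
  also have "\<dots> = (\<Sum>a<n. \<Sum>b<n. \<Sum>c<n. \<Sum>d<n. f a b c d)" by (intro sum.cong refl sum.swap)
  finally show ?thesis .
qed

context interval
begin

lemma bm_cell2:
  assumes f: "f \<in> borel_measurable borel" and g: "g \<in> borel_measurable borel" and h: "\<And>a b. \<bar>h a b\<bar> \<le> B"
  shows "bm (\<lambda>q. h (cell n (f q)) (cell k (g q)) :: real)"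
proof (rule bmI[OF _ h])
  show "(\<lambda>q. h (cell n (f q)) (cell k (g q))) \<in> borel_measurable borel"
  proof (rule measurable_compose_countable[where g = "\<lambda>q. cell n (f q)" and f = "\<lambda>a q. h a (cell k (g q))"])
    show "(\<lambda>q. h a (cell k (g q))) \<in> borel_measurable borel" for a
      by (rule measurable_compose[OF measurable_compose[OF g cell_measurable]]) simp
    show "(\<lambda>q. cell n (f q)) \<in> borel \<rightarrow>\<^sub>M count_space UNIV"
      by (rule measurable_compose[OF f cell_measurable])
  qed
qed

lemma grid_cell_measurable:
  "f \<in> borel_measurable borel \<Longrightarrow> (\<lambda>q. grid n (cell n (f q))) \<in> borel_measurable borel"
  by (rule measurable_compose[OF measurable_compose[OF _ cell_measurable]]) simp_all

end

section \<open>Passing to the limit in the nested discretisations\<close>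

context strat_expansion
begin

definition sum_kernel :: "nat \<Rightarrow> real \<Rightarrow> real \<Rightarrow> real \<Rightarrow> real \<Rightarrow> real" where
  "sum_kernel p a b c d = (\<Sum>j1\<le>p. \<Sum>j2\<le>p. \<Sum>j3\<le>p. \<Sum>j4\<le>p. C j1 j2 j3 j4 * (\<psi> j1 a * \<psi> j2 b * \<psi> j3 c * \<psi> j4 d))"

definition quad_sum :: "nat \<Rightarrow> (nat \<Rightarrow> real) \<Rightarrow> (nat \<Rightarrow> real) \<Rightarrow> (nat \<Rightarrow> real) \<Rightarrow> (nat \<Rightarrow> real) \<Rightarrow> real" where
  "quad_sum p z1 z2 z3 z4 = (\<Sum>j1\<le>p. \<Sum>j2\<le>p. \<Sum>j3\<le>p. \<Sum>j4\<le>p. C j1 j2 j3 j4 * z1 j1 * z2 j2 * z3 j3 * z4 j4)"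

lemma bm4_sum_kernel: "bm4 (sum_kernel p)"
  unfolding sum_kernel_def bm4_def by (intro bm_compose[OF \<psi>(1)] bmi)

text \<open>With Riemann sums in place of the Gaussian variables the partial sum becomes a quadruple
  form on the same grid as the discretised integral, so that their difference is a single
  form.\<close>

lemma quad_sum_sums:
  fixes g :: "nat \<Rightarrow> real" and n :: nat
  shows "quad_sum p (\<lambda>j. \<Sum>a<n. \<psi> j (g a) * y1 a) (\<lambda>j. \<Sum>a<n. \<psi> j (g a) * y2 a) (\<lambda>j. \<Sum>a<n. \<psi> j (g a) * y3 a) (\<lambda>j. \<Sum>a<n. \<psi> j (g a) * y4 a) =
    (\<Sum>a<n. \<Sum>b<n. \<Sum>c<n. \<Sum>d<n. sum_kernel p (g a) (g b) (g c) (g d) * y1 a * y2 b * y3 c * y4 d)"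
proof -
  have 1: "C j1 j2 j3 j4 * (\<Sum>a<n. \<psi> j1 (g a) * y1 a) * (\<Sum>a<n. \<psi> j2 (g a) * y2 a) * (\<Sum>a<n. \<psi> j3 (g a) * y3 a) * (\<Sum>a<n. \<psi> j4 (g a) * y4 a) =
    (\<Sum>a<n. \<Sum>b<n. \<Sum>c<n. \<Sum>d<n. C j1 j2 j3 j4 * (\<psi> j1 (g a) * \<psi> j2 (g b) * \<psi> j3 (g c) * \<psi> j4 (g d)) * y1 a * y2 b * y3 c * y4 d)" for j1 j2 j3 j4
  proof -
    have "C j1 j2 j3 j4 * (\<Sum>a<n. \<psi> j1 (g a) * y1 a) * (\<Sum>a<n. \<psi> j2 (g a) * y2 a) * (\<Sum>a<n. \<psi> j3 (g a) * y3 a) * (\<Sum>a<n. \<psi> j4 (g a) * y4 a) =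
      C j1 j2 j3 j4 * ((\<Sum>a<n. \<psi> j1 (g a) * y1 a) * (\<Sum>a<n. \<psi> j2 (g a) * y2 a) * (\<Sum>a<n. \<psi> j3 (g a) * y3 a) * (\<Sum>a<n. \<psi> j4 (g a) * y4 a))"
      by (simp only: mult.assoc)
    then show ?thesis by (simp only: prod4_sums) (simp only: sum_distrib_left mult_ac)
  qed
  have s: "(\<Sum>j\<le>p. \<Sum>a<n. g j a) = (\<Sum>a<n. \<Sum>j\<le>p. g j a)" for g :: "nat \<Rightarrow> nat \<Rightarrow> real"
    by (rule sum.swap)
  have "quad_sum p (\<lambda>j. \<Sum>a<n. \<psi> j (g a) * y1 a) (\<lambda>j. \<Sum>a<n. \<psi> j (g a) * y2 a) (\<lambda>j. \<Sum>a<n. \<psi> j (g a) * y3 a) (\<lambda>j. \<Sum>a<n. \<psi> j (g a) * y4 a) =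
    (\<Sum>j1\<le>p. \<Sum>j2\<le>p. \<Sum>j3\<le>p. \<Sum>j4\<le>p. \<Sum>a<n. \<Sum>b<n. \<Sum>c<n. \<Sum>d<n.
      C j1 j2 j3 j4 * (\<psi> j1 (g a) * \<psi> j2 (g b) * \<psi> j3 (g c) * \<psi> j4 (g d)) * y1 a * y2 b * y3 c * y4 d)"
    unfolding quad_sum_def by (intro sum.cong refl 1)
  also have "\<dots> = (\<Sum>a<n. \<Sum>b<n. \<Sum>c<n. \<Sum>d<n. \<Sum>j1\<le>p. \<Sum>j2\<le>p. \<Sum>j3\<le>p. \<Sum>j4\<le>p.
      C j1 j2 j3 j4 * (\<psi> j1 (g a) * \<psi> j2 (g b) * \<psi> j3 (g c) * \<psi> j4 (g d)) * y1 a * y2 b * y3 c * y4 d)"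
    by (simp only: s)
  also have "\<dots> = (\<Sum>a<n. \<Sum>b<n. \<Sum>c<n. \<Sum>d<n. sum_kernel p (g a) (g b) (g c) (g d) * y1 a * y2 b * y3 c * y4 d)"
    unfolding sum_kernel_def by (simp only: sum_distrib_right)
  finally show ?thesis .
qed

lemma quad_sum_tendsto:
  assumes "\<And>j. j \<le> p \<Longrightarrow> (\<lambda>q. z1 q j) \<longlonglongrightarrow> x1 j" "\<And>j. j \<le> p \<Longrightarrow> (\<lambda>q. z2 q j) \<longlonglongrightarrow> x2 j"
    "\<And>j. j \<le> p \<Longrightarrow> (\<lambda>q. z3 q j) \<longlonglongrightarrow> x3 j" "\<And>j. j \<le> p \<Longrightarrow> (\<lambda>q. z4 q j) \<longlonglongrightarrow> x4 j"
  shows "(\<lambda>q. quad_sum p (z1 q) (z2 q) (z3 q) (z4 q)) \<longlonglongrightarrow> quad_sum p x1 x2 x3 x4"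
  unfolding quad_sum_def by (intro tendsto_sum tendsto_mult tendsto_const assms) auto

definition partial_sum :: "nat \<Rightarrow> 'a \<Rightarrow> real" where
  "partial_sum p \<omega> = quad_sum p (\<lambda>j. \<zeta> i1 j \<omega>) (\<lambda>j. \<zeta> i2 j \<omega>) (\<lambda>j. \<zeta> i3 j \<omega>) (\<lambda>j. \<zeta> i4 j \<omega>)"

lemma zeta_measurable: "i \<le> m \<Longrightarrow> \<zeta> i j \<in> borel_measurable M"
  using zeta_lim[of i 1 j] by (simp add: ms_lim_def)

lemma partial_sum_measurable: "partial_sum p \<in> borel_measurable M"
  unfolding partial_sum_def[abs_def] quad_sum_def
  by (intro borel_measurable_sum borel_measurable_times borel_measurable_const zeta_measurable idx)

lemma J2_measurable: "k \<le> n \<Longrightarrow> 0 < n \<Longrightarrow> J2 (grid n k) \<in> borel_measurable M"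
  using J2_lim[of k n] by (simp add: ms_lim_def)

lemma J3_measurable: "k \<le> n \<Longrightarrow> 0 < n \<Longrightarrow> J3 (grid n k) \<in> borel_measurable M"
  using J3_lim[of k n] by (simp add: ms_lim_def)

text \<open>The trapezoidal sum on a grid of \<open>n\<close> cells up to its point
  \<open>k * r\<close>; here \<open>r\<close> is the factor by which this grid refines the one on
  which \<open>k\<close> counts.\<close>

definition trap :: "nat \<Rightarrow> nat \<Rightarrow> (nat \<Rightarrow> real) \<Rightarrow> nat \<Rightarrow> 'a \<Rightarrow> nat \<Rightarrow> real" where
  "trap n i X k \<omega> r = (\<Sum>l<k * r. (X l + X (Suc l)) / 2 * inc n i l \<omega>)"

text \<open>The inner integrals are discretised on successively finer grids, so the indices are compared at different
  resolutions.\<close>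

lemma discrete_form:
  assumes n: "0 < n" "0 < r" "0 < s" and N: "N = n * r * s"
  shows "(\<Sum>k<n. (trap (n * r) i3 (\<lambda>l. trap N i2 (\<lambda>a. w i1 (grid N a) \<omega> - w i1 t \<omega>) l \<omega> s) k \<omega> r +
        trap (n * r) i3 (\<lambda>l. trap N i2 (\<lambda>a. w i1 (grid N a) \<omega> - w i1 t \<omega>) l \<omega> s) (Suc k) \<omega> r) / 2 * inc n i4 k \<omega>) =
    (\<Sum>a<N. \<Sum>b<N. \<Sum>c<N. \<Sum>d<N. heav a b * heav (b div s) (c div s) * heav (c div (r * s)) (d div (r * s)) *
      inc N i1 a \<omega> * inc N i2 b \<omega> * inc N i3 c \<omega> * inc N i4 d \<omega>)"
proof -
  \<comment> \<open>The trivial division shows the innermost level as the case of refinement factor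
    1 in \<open>trapezoid_sum_kernel\<close>.\<close>
  let ?x2 = "\<lambda>b. inc N i2 b \<omega> * (\<Sum>a<N. heav (a div 1) (b div 1) * inc N i1 a \<omega>)"
  let ?x3 = "\<lambda>c. inc N i3 c \<omega> * (\<Sum>b<N. heav (b div s) (c div s) * ?x2 b)"
  have 1: "trap N i2 (\<lambda>a. w i1 (grid N a) \<omega> - w i1 t \<omega>) l \<omega> s = (\<Sum>b<l * s. ?x2 b)" if l: "l \<le> n * r" for l
  proof -
    have "l * s \<le> N" unfolding N using l by (rule mult_le_mono1)
    moreover have "w i1 (grid N k) \<omega> - w i1 t \<omega> = (\<Sum>c<k * 1. inc N i1 c \<omega>)" for k
      using sum_inc[of 0 k N i1 \<omega>] by (simp add: lessThan_atLeast0)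
    ultimately show ?thesis
      unfolding trap_def
      using trapezoid_sum_kernel[of 1 "l * s" N "\<lambda>a. w i1 (grid N a) \<omega> - w i1 t \<omega>" "\<lambda>c. inc N i1 c \<omega>" "\<lambda>b. inc N i2 b \<omega>" "\<lambda>b. inc N i2 b \<omega>"]
      by simp
  qed
  have 2: "trap (n * r) i3 (\<lambda>l. trap N i2 (\<lambda>a. w i1 (grid N a) \<omega> - w i1 t \<omega>) l \<omega> s) k \<omega> r = (\<Sum>c<k * (r * s). ?x3 c)"
    if k: "k \<le> n" for k
  proof -
    have kr: "k * r \<le> n * r" using k by (rule mult_le_mono1)
    have "(\<Sum>l<k * r. (trap N i2 (\<lambda>a. w i1 (grid N a) \<omega> - w i1 t \<omega>) l \<omega> s + trap N i2 (\<lambda>a. w i1 (grid N a) \<omega> - w i1 t \<omega>) (Suc l) \<omega> s) / 2 * inc (n * r) i3 l \<omega>) =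
        (\<Sum>d<k * r * s. ?x3 d)"
    proof (rule trapezoid_sum_kernel[OF n(3)])
      show "k * r * s \<le> N" unfolding N using kr by (rule mult_le_mono1)
      show "trap N i2 (\<lambda>a. w i1 (grid N a) \<omega> - w i1 t \<omega>) l \<omega> s = (\<Sum>b<l * s. ?x2 b)" if "l \<le> k * r" for l
        by (rule 1) (use that kr in linarith)
      show "inc (n * r) i3 l \<omega> = (\<Sum>d = l * s..<l * s + s. inc N i3 d \<omega>)" for l
        unfolding N by (rule coarse_inc[OF n(3)])
    qed
    then show ?thesis unfolding trap_def by (simp only: mult.assoc)
  qed
  have "(\<Sum>k<n. (trap (n * r) i3 (\<lambda>l. trap N i2 (\<lambda>a. w i1 (grid N a) \<omega> - w i1 t \<omega>) l \<omega> s) k \<omega> r +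
        trap (n * r) i3 (\<lambda>l. trap N i2 (\<lambda>a. w i1 (grid N a) \<omega> - w i1 t \<omega>) l \<omega> s) (Suc k) \<omega> r) / 2 * inc n i4 k \<omega>) =
      (\<Sum>d<n * (r * s). inc N i4 d \<omega> * (\<Sum>c<N. heav (c div (r * s)) (d div (r * s)) * ?x3 c))"
  proof (rule trapezoid_sum_kernel)
    show "0 < r * s" using n by simp
    show "n * (r * s) \<le> N" by (simp add: N)
    show "inc n i4 k \<omega> = (\<Sum>d = k * (r * s)..<k * (r * s) + r * s. inc N i4 d \<omega>)" for k
      using coarse_inc[of "r * s" n i4 k \<omega>] n by (simp add: N mult.assoc)
  qed (rule 2)
  also have "n * (r * s) = N" by (simp add: N)
  also have "(\<Sum>d<N. inc N i4 d \<omega> * (\<Sum>c<N. heav (c div (r * s)) (d div (r * s)) * ?x3 c)) =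
    (\<Sum>d<N. \<Sum>c<N. \<Sum>b<N. \<Sum>a<N. heav a b * heav (b div s) (c div s) * heav (c div (r * s)) (d div (r * s)) *
      inc N i1 a \<omega> * inc N i2 b \<omega> * inc N i3 c \<omega> * inc N i4 d \<omega>)"
    unfolding sum_distrib_left div_by_1 by (simp only: mult_ac)
  also have "\<dots> = (\<Sum>a<N. \<Sum>b<N. \<Sum>c<N. \<Sum>d<N. heav a b * heav (b div s) (c div s) * heav (c div (r * s)) (d div (r * s)) *
      inc N i1 a \<omega> * inc N i2 b \<omega> * inc N i3 c \<omega> * inc N i4 d \<omega>)"
    by (rule sum_reverse4)
  finally show ?thesis .
qed

abbreviation (input) "c0 \<equiv> 10000 * (1 + (T - t))^4"

lemma th3_abs_le: "\<bar>heav a b * heav c d * heav e f\<bar> \<le> 1" for a b :: "'x::linorder" and c d :: "'y::linorder" and e f :: "'z::linorder"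
  unfolding abs_mult using heav_abs_le[of a b] heav_abs_le[of c d] heav_abs_le[of e f]
  by (intro mult_le_one mult_nonneg_nonneg) auto

lemma sum_kernel_bounded: "\<exists>B. \<forall>a b c d. \<bar>sum_kernel p a b c d\<bar> \<le> B"
proof -
  have "\<exists>B. \<forall>x. \<bar>sum_kernel p (fst (fst (fst x))) (snd (fst (fst x))) (snd (fst x)) (snd x)\<bar> \<le> B"
    using bm4_sum_kernel[of p] unfolding bm4_def bm_def by blast
  then obtain B where "\<And>x. \<bar>sum_kernel p (fst (fst (fst x))) (snd (fst (fst x))) (snd (fst x)) (snd x)\<bar> \<le> B" by blast
  from this[of "(((_, _), _), _)"] show ?thesis by auto
qed

text \<open>\<open>\<psi>\<close> is not assumed continuous, but the grid points of these cells stay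
  in the interval where it agrees with the continuous \<open>\<phi>\<close>.\<close>

lemma \<psi>_grid_tendsto:
  assumes "filterlim N at_top sequentially" "\<And>q. 0 < N q" and x: "x \<in> {t..<T}"
  shows "(\<lambda>q. \<psi> j (grid (N q) (cell (N q) x))) \<longlonglongrightarrow> \<psi> j x"
proof -
  have "(\<lambda>q. \<phi> j (grid (N q) (cell (N q) x))) \<longlonglongrightarrow> \<phi> j x"
    using cont grid_cell_tendsto[OF assms] by (auto simp: continuous_on_eq_continuous_at intro: isCont_tendsto_compose)
  moreover have "\<psi> j (grid (N q) (cell (N q) x)) = \<phi> j (grid (N q) (cell (N q) x))" for q
    by (intro \<psi>(2) grid_range_less assms(2) cell_less x)
  ultimately show ?thesis using \<psi>(2)[OF x] by simp
qed

lemma sum_kernel_grid_tendsto: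
  assumes "filterlim N at_top sequentially" "\<And>q. 0 < N q"
    and "a \<in> {t..<T}" "b \<in> {t..<T}" "c \<in> {t..<T}" "d \<in> {t..<T}"
  shows "(\<lambda>q. sum_kernel p (grid (N q) (cell (N q) a)) (grid (N q) (cell (N q) b)) (grid (N q) (cell (N q) c)) (grid (N q) (cell (N q) d))) \<longlonglongrightarrow> sum_kernel p a b c d"
  unfolding sum_kernel_def by (intro tendsto_intros \<psi>_grid_tendsto assms)

text \<open>The innermost mesh tends to zero with the two outer grids fixed. This turns the inner
  sums into \<open>J2\<close> and the Riemann sums into the Gaussian variables, while in the kernel
  only the comparison of \<open>a\<close> and \<open>b\<close> becomes exact.\<close>

lemma second_moment_level3:
  assumes n: "0 < n" "0 < r"
  shows "ms_le (\<lambda>\<omega>. (\<Sum>k<n. (trap (n * r) i3 (\<lambda>l. J2 (grid (n * r) l) \<omega>) k \<omega> r + trap (n * r) i3 (\<lambda>l. J2 (grid (n * r) l) \<omega>) (Suc k) \<omega> r) / 2 *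
      inc n i4 k \<omega>) - partial_sum p \<omega>)
    (c0 * trace_norm (\<lambda>a b c d. heav a b * heav (cell (n * r) b) (cell (n * r) c) * heav (cell n c) (cell n d) - sum_kernel p a b c d))"
proof -
  let ?N = "\<lambda>q. n * r * Suc q"
  have Npos: "0 < ?N q" for q using n by simp
  have Nlim: "filterlim ?N at_top sequentially"
    by (rule filterlim_mult_Suc) (use n in simp)
  let ?J2 = "\<lambda>q \<omega> l. trap (?N q) i2 (\<lambda>a. w i1 (grid (?N q) a) \<omega> - w i1 t \<omega>) l \<omega> (Suc q)"
  let ?z = "\<lambda>q \<omega> i j. \<Sum>a<?N q. \<psi> j (grid (?N q) a) * inc (?N q) i a \<omega>"
  define X where "X q \<omega> = (\<Sum>k<n. (trap (n * r) i3 (?J2 q \<omega>) k \<omega> r + trap (n * r) i3 (?J2 q \<omega>) (Suc k) \<omega> r) / 2 * inc n i4 k \<omega>) -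
      quad_sum p (?z q \<omega> i1) (?z q \<omega> i2) (?z q \<omega> i3) (?z q \<omega> i4)" for q \<omega>
  let ?D = "\<lambda>q a b c d. heav a b * heav (b div Suc q) (c div Suc q) * heav (c div (r * Suc q)) (d div (r * Suc q)) -
      sum_kernel p (grid (?N q) a) (grid (?N q) b) (grid (?N q) c) (grid (?N q) d)"
  have X: "X q \<omega> = (\<Sum>a<?N q. \<Sum>b<?N q. \<Sum>c<?N q. \<Sum>d<?N q. ?D q a b c d *
      inc (?N q) i1 a \<omega> * inc (?N q) i2 b \<omega> * inc (?N q) i3 c \<omega> * inc (?N q) i4 d \<omega>)" for q \<omega>
    unfolding X_def quad_sum_sums discrete_form[OF n zero_less_Suc refl]
    by (simp only: left_diff_distrib sum_subtractf)
  have bound: "ms_le (X q) (c0 * trace_norm (\<lambda>a b c d. ?D q (cell (?N q) a) (cell (?N q) b) (cell (?N q) c) (cell (?N q) d)))" for q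
    unfolding X[abs_def] by (rule ms_le_inc_form[OF Npos])
  obtain B where B: "\<And>a b c d. \<bar>sum_kernel p a b c d\<bar> \<le> B" using sum_kernel_bounded by blast
  have lim: "(\<lambda>q. trace_norm (\<lambda>a b c d. ?D q (cell (?N q) a) (cell (?N q) b) (cell (?N q) c) (cell (?N q) d))) \<longlonglongrightarrow>
      trace_norm (\<lambda>a b c d. heav a b * heav (cell (n * r) b) (cell (n * r) c) * heav (cell n c) (cell n d) - sum_kernel p a b c d)"
  proof (rule trace_norm_tendsto[where B = "1 + B"])
    show "bm4 (\<lambda>a b c d. ?D q (cell (?N q) a) (cell (?N q) b) (cell (?N q) c) (cell (?N q) d))" for q
      unfolding bm4_def
      by (intro bm_diff bm_mult bm4_sub[OF bm4_sum_kernel] grid_cell_measurable bm_heav borel_measurable_fst_raw borel_measurable_snd_raw ident_measurable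
          bm_cell2[where h = heav, OF _ _ heav_abs_le] bm_cell2[where h = "\<lambda>a b. heav (a div Suc q) (b div Suc q)", OF _ _ heav_abs_le]
          bm_cell2[where h = "\<lambda>a b. heav (a div (r * Suc q)) (b div (r * Suc q))", OF _ _ heav_abs_le])
    show "bm4 (\<lambda>a b c d. heav a b * heav (cell (n * r) b) (cell (n * r) c) * heav (cell n c) (cell n d) - sum_kernel p a b c d)"
      unfolding bm4_def by (intro bm_diff bm_mult bm4_sub[OF bm4_sum_kernel] bm_cell2[where h = heav, OF _ _ heav_abs_le]
        bm_heav borel_measurable_fst_raw borel_measurable_snd_raw ident_measurable)
    show "\<bar>?D q (cell (?N q) a) (cell (?N q) b) (cell (?N q) c) (cell (?N q) d)\<bar> \<le> 1 + B" for q a b c d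
      by (rule order_trans[OF abs_triangle_ineq4 add_mono[OF th3_abs_le B]])
    fix a b c d assume x: "a \<in> {t..<T}" "b \<in> {t..<T}" "c \<in> {t..<T}" "d \<in> {t..<T}"
    \<comment> \<open>At the coarser resolutions the cell numbers do not depend on \<open>q\<close>,
      so the last two factors of the kernel are constant along the limit.\<close>
    have d1: "cell (?N q) y div Suc q = cell (n * r) y" if "y \<in> {t..<T}" for q y
      by (rule cell_div) (use n that in auto)
    have d2: "cell (?N q) y div (r * Suc q) = cell n y" if "y \<in> {t..<T}" for q y
      using cell_div[of n "r * Suc q" y] n that by (simp add: mult.assoc del: mult_Suc_right)
    show "(\<lambda>q. ?D q (cell (?N q) a) (cell (?N q) b) (cell (?N q) c) (cell (?N q) d)) \<longlonglongrightarrow>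
        heav a b * heav (cell (n * r) b) (cell (n * r) c) * heav (cell n c) (cell n d) - sum_kernel p a b c d"
      unfolding d1[OF x(2)] d1[OF x(3)] d2[OF x(3)] d2[OF x(4)]
      by (intro tendsto_diff tendsto_mult tendsto_const heav_cell_tendsto[OF Nlim Npos] sum_kernel_grid_tendsto[OF Nlim Npos] x)
  qed
  \<comment> \<open>One index set for everything that must converge along the same subsequence:
    \<open>Inl\<close> for the values of \<open>J2\<close> at the grid points, \<open>Inr\<close>
    for the Gaussian variables.\<close>
  define A where "A = Inl ` {..n * r} \<union> Inr ` ({i1, i2, i3, i4} \<times> {..p})"
  have "finite A" by (simp add: A_def)
  moreover have "ms_lim M (\<lambda>q \<omega>. case s of Inl l \<Rightarrow> ?J2 q \<omega> l | Inr ij \<Rightarrow> ?z q \<omega> (fst ij) (snd ij))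
      (\<lambda>\<omega>. case s of Inl l \<Rightarrow> J2 (grid (n * r) l) \<omega> | Inr ij \<Rightarrow> \<zeta> (fst ij) (snd ij) \<omega>)" if "s \<in> A" for s
    using that
  proof (cases s)
    case (Inl l)
    with that have "l \<le> n * r" by (auto simp: A_def)
    from J2_lim[OF this] n Inl show ?thesis unfolding trap_def by simp
  next
    case (Inr ij)
    with that have "fst ij \<le> m" using idx by (auto simp: A_def)
    from zeta_lim[OF this, of "n * r"] n Inr show ?thesis by simp
  qed
  ultimately obtain f where f: "strict_mono f" and ae: "AE \<omega> in M. \<forall>s\<in>A.
      (\<lambda>q. case s of Inl l \<Rightarrow> ?J2 (f q) \<omega> l | Inr ij \<Rightarrow> ?z (f q) \<omega> (fst ij) (snd ij)) \<longlonglongrightarrow>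
      (case s of Inl l \<Rightarrow> J2 (grid (n * r) l) \<omega> | Inr ij \<Rightarrow> \<zeta> (fst ij) (snd ij) \<omega>)"
    using ms_lim_AE_subseq[of A "\<lambda>s q \<omega>. case s of Inl l \<Rightarrow> ?J2 q \<omega> l | Inr ij \<Rightarrow> ?z q \<omega> (fst ij) (snd ij)"
        "\<lambda>s \<omega>. case s of Inl l \<Rightarrow> J2 (grid (n * r) l) \<omega> | Inr ij \<Rightarrow> \<zeta> (fst ij) (snd ij) \<omega>"] by auto
  show ?thesis
  proof (rule fatou_second_moment[OF bound tendsto_mult_left[OF lim] f])
    show "AE \<omega> in M. (\<lambda>q. X (f q) \<omega>) \<longlonglongrightarrow> (\<Sum>k<n. (trap (n * r) i3 (\<lambda>l. J2 (grid (n * r) l) \<omega>) k \<omega> r +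
        trap (n * r) i3 (\<lambda>l. J2 (grid (n * r) l) \<omega>) (Suc k) \<omega> r) / 2 * inc n i4 k \<omega>) - partial_sum p \<omega>"
      using ae
    proof eventually_elim
      case (elim \<omega>)
      have J: "(\<lambda>q. ?J2 (f q) \<omega> l) \<longlonglongrightarrow> J2 (grid (n * r) l) \<omega>" if "l \<le> n * r" for l
        using bspec[OF elim, of "Inl l"] that by (simp add: A_def)
      have Z: "(\<lambda>q. ?z (f q) \<omega> i j) \<longlonglongrightarrow> \<zeta> i j \<omega>" if "i \<in> {i1, i2, i3, i4}" "j \<le> p" for i j
        using bspec[OF elim, of "Inr (i, j)"] that by (simp add: A_def)
      have T: "(\<lambda>q. trap (n * r) i3 (?J2 (f q) \<omega>) k \<omega> r) \<longlonglongrightarrow> trap (n * r) i3 (\<lambda>l. J2 (grid (n * r) l) \<omega>) k \<omega> r" if "k \<le> n" for k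
      proof -
        have le: "k * r \<le> n * r" using that by (rule mult_le_mono1)
        have l: "l \<le> n * r" "Suc l \<le> n * r" if "l < k * r" for l
          using that le by linarith+
        show ?thesis unfolding trap_def[of "n * r"] by (intro tendsto_intros J) (auto intro!: l)
      qed
      show ?case
        unfolding X_def partial_sum_def
        by (intro tendsto_diff tendsto_sum tendsto_mult tendsto_divide tendsto_add tendsto_const T quad_sum_tendsto Z) auto
    qed
    show "(\<lambda>\<omega>. (\<Sum>k<n. (trap (n * r) i3 (\<lambda>l. J2 (grid (n * r) l) \<omega>) k \<omega> r + trap (n * r) i3 (\<lambda>l. J2 (grid (n * r) l) \<omega>) (Suc k) \<omega> r) / 2 *
      inc n i4 k \<omega>) - partial_sum p \<omega>) \<in> borel_measurable M"
    proof -
      have "(\<lambda>\<omega>. trap (n * r) i3 (\<lambda>l. J2 (grid (n * r) l) \<omega>) k \<omega> r) \<in> borel_measurable M" if "k \<le> n" for k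
      proof -
        have le: "k * r \<le> n * r" using that by (rule mult_le_mono1)
        have l: "l \<le> n * r" "Suc l \<le> n * r" if "l < k * r" for l
          using that le by linarith+
        show ?thesis unfolding trap_def
          by (intro borel_measurable_sum borel_measurable_times borel_measurable_divide borel_measurable_add
              borel_measurable_const J2_measurable inc_measurable idx) (use n in \<open>auto intro!: l\<close>)
      qed
      then show ?thesis
        by (intro borel_measurable_diff partial_sum_measurable borel_measurable_sum borel_measurable_times borel_measurable_divide
            borel_measurable_add borel_measurable_const inc_measurable idx) auto
    qed
  qed
qed

text \<open>Now the middle mesh tends to zero with the outer grid fixed: sums of \<open>J2\<close>
  become \<open>J3\<close>, and the comparison of \<open>b\<close> and \<open>c\<close> becomes
  exact.\<close>

lemma second_moment_level2:
  assumes n: "0 < n"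
  shows "ms_le (\<lambda>\<omega>. (\<Sum>k<n. (J3 (grid n k) \<omega> + J3 (grid n (Suc k)) \<omega>) / 2 * inc n i4 k \<omega>) - partial_sum p \<omega>)
    (c0 * trace_norm (\<lambda>a b c d. heav a b * heav b c * heav (cell n c) (cell n d) - sum_kernel p a b c d))"
proof -
  let ?N = "\<lambda>q. n * Suc q"
  have Npos: "0 < ?N q" for q using n by simp
  have Nlim: "filterlim ?N at_top sequentially"
    by (rule filterlim_mult_Suc[OF n])
  let ?J3 = "\<lambda>q \<omega> k. trap (?N q) i3 (\<lambda>l. J2 (grid (?N q) l) \<omega>) k \<omega> (Suc q)"
  obtain B where B: "\<And>a b c d. \<bar>sum_kernel p a b c d\<bar> \<le> B" using sum_kernel_bounded by blast
  have lim: "(\<lambda>q. trace_norm (\<lambda>a b c d. heav a b * heav (cell (?N q) b) (cell (?N q) c) * heav (cell n c) (cell n d) - sum_kernel p a b c d)) \<longlonglongrightarrow>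
      trace_norm (\<lambda>a b c d. heav a b * heav b c * heav (cell n c) (cell n d) - sum_kernel p a b c d)"
  proof (rule trace_norm_tendsto[where B = "1 + B"])
    show "bm4 (\<lambda>a b c d. heav a b * heav (cell (?N q) b) (cell (?N q) c) * heav (cell n c) (cell n d) - sum_kernel p a b c d)" for q
      unfolding bm4_def by (intro bm_diff bm_mult bm4_sub[OF bm4_sum_kernel] bm_cell2[where h = heav, OF _ _ heav_abs_le]
        bm_heav borel_measurable_fst_raw borel_measurable_snd_raw ident_measurable)
    show "bm4 (\<lambda>a b c d. heav a b * heav b c * heav (cell n c) (cell n d) - sum_kernel p a b c d)"
      unfolding bm4_def by (intro bm_diff bm_mult bm4_sub[OF bm4_sum_kernel] bm_cell2[where h = heav, OF _ _ heav_abs_le]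
        bm_heav borel_measurable_fst_raw borel_measurable_snd_raw ident_measurable)
    show "\<bar>heav a b * heav (cell (?N q) b) (cell (?N q) c) * heav (cell n c) (cell n d) - sum_kernel p a b c d\<bar> \<le> 1 + B" for q a b c d
      by (rule order_trans[OF abs_triangle_ineq4 add_mono[OF th3_abs_le B]])
    show "(\<lambda>q. heav a b * heav (cell (?N q) b) (cell (?N q) c) * heav (cell n c) (cell n d) - sum_kernel p a b c d) \<longlonglongrightarrow>
        heav a b * heav b c * heav (cell n c) (cell n d) - sum_kernel p a b c d"
      if "a \<in> {t..<T}" "b \<in> {t..<T}" "c \<in> {t..<T}" "d \<in> {t..<T}" for a b c d
      by (intro tendsto_diff tendsto_mult tendsto_const heav_cell_tendsto[OF Nlim Npos] that)
  qed
  have "ms_lim M (\<lambda>q \<omega>. ?J3 q \<omega> k) (J3 (grid n k))" if "k \<in> {..n}" for k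
    unfolding trap_def by (rule J3_lim) (use that n in auto)
  then obtain f where f: "strict_mono f" and ae: "AE \<omega> in M. \<forall>k\<in>{..n}. (\<lambda>q. ?J3 (f q) \<omega> k) \<longlonglongrightarrow> J3 (grid n k) \<omega>"
    using ms_lim_AE_subseq[of "{..n}" "\<lambda>k q \<omega>. ?J3 q \<omega> k" "\<lambda>k. J3 (grid n k)"] by auto
  show ?thesis
  proof (rule fatou_second_moment[OF second_moment_level3[OF n zero_less_Suc] tendsto_mult_left[OF lim] f])
    show "AE \<omega> in M. (\<lambda>q. (\<Sum>k<n. (?J3 (f q) \<omega> k + ?J3 (f q) \<omega> (Suc k)) / 2 * inc n i4 k \<omega>) - partial_sum p \<omega>) \<longlonglongrightarrow>
        (\<Sum>k<n. (J3 (grid n k) \<omega> + J3 (grid n (Suc k)) \<omega>) / 2 * inc n i4 k \<omega>) - partial_sum p \<omega>"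
      using ae
    proof eventually_elim
      case (elim \<omega>)
      show ?case
        by (intro tendsto_diff tendsto_sum tendsto_mult tendsto_divide tendsto_add tendsto_const bspec[OF elim]) auto
    qed
    show "(\<lambda>\<omega>. (\<Sum>k<n. (J3 (grid n k) \<omega> + J3 (grid n (Suc k)) \<omega>) / 2 * inc n i4 k \<omega>) - partial_sum p \<omega>) \<in> borel_measurable M"
      by (intro borel_measurable_diff partial_sum_measurable borel_measurable_sum borel_measurable_times borel_measurable_divide
          borel_measurable_add borel_measurable_const inc_measurable idx J3_measurable) (use n in auto)
  qed
qed

text \<open>Last limit, in the outer mesh: the error of the expansion at fixed \<open>p\<close> is
  bounded by the trace norm of the error of the kernel, with no discretisation left.\<close>

theorem second_moment_bound:
  "ms_le (\<lambda>\<omega>. I \<omega> - partial_sum p \<omega>) (c0 * trace_norm (\<lambda>a b c d. simplex_kernel a b c d - sum_kernel p a b c d))"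
proof -
  obtain B where B: "\<And>a b c d. \<bar>sum_kernel p a b c d\<bar> \<le> B" using sum_kernel_bounded by blast
  have lim: "(\<lambda>q. trace_norm (\<lambda>a b c d. heav a b * heav b c * heav (cell (Suc q) c) (cell (Suc q) d) - sum_kernel p a b c d)) \<longlonglongrightarrow>
      trace_norm (\<lambda>a b c d. simplex_kernel a b c d - sum_kernel p a b c d)"
    unfolding simplex_kernel_def
  proof (rule trace_norm_tendsto[where B = "1 + B"])
    show "bm4 (\<lambda>a b c d. heav a b * heav b c * heav (cell (Suc q) c) (cell (Suc q) d) - sum_kernel p a b c d)" for q
      unfolding bm4_def by (intro bm_diff bm_mult bm4_sub[OF bm4_sum_kernel] bm_cell2[where h = heav, OF _ _ heav_abs_le]
        bm_heav borel_measurable_fst_raw borel_measurable_snd_raw ident_measurable)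
    show "bm4 (\<lambda>a b c d. heav a b * heav b c * heav c d - sum_kernel p a b c d)"
      unfolding bm4_def by (intro bm_diff bm_mult bm4_sub[OF bm4_sum_kernel] bmi)
    show "\<bar>heav a b * heav b c * heav (cell (Suc q) c) (cell (Suc q) d) - sum_kernel p a b c d\<bar> \<le> 1 + B" for q a b c d
      by (rule order_trans[OF abs_triangle_ineq4 add_mono[OF th3_abs_le B]])
    show "(\<lambda>q. heav a b * heav b c * heav (cell (Suc q) c) (cell (Suc q) d) - sum_kernel p a b c d) \<longlonglongrightarrow> heav a b * heav b c * heav c d - sum_kernel p a b c d"
      if "a \<in> {t..<T}" "b \<in> {t..<T}" "c \<in> {t..<T}" "d \<in> {t..<T}" for a b c d
      by (intro tendsto_diff tendsto_mult tendsto_const heav_cell_tendsto[OF filterlim_Suc] that) simp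
  qed
  obtain f where f: "strict_mono f" and ae: "AE \<omega> in M. \<forall>k\<in>{()}.
      (\<lambda>q. \<Sum>l<Suc (f q). (J3 (grid (Suc (f q)) l) \<omega> + J3 (grid (Suc (f q)) (Suc l)) \<omega>) / 2 * inc (Suc (f q)) i4 l \<omega>) \<longlonglongrightarrow> I \<omega>"
    using ms_lim_AE_subseq[of "{()}" "\<lambda>_ q \<omega>. \<Sum>l<Suc q. (J3 (grid (Suc q) l) \<omega> + J3 (grid (Suc q) (Suc l)) \<omega>) / 2 * inc (Suc q) i4 l \<omega>" "\<lambda>_. I"]
      I_lim by auto
  show ?thesis
  proof (rule fatou_second_moment[OF second_moment_level2[OF zero_less_Suc] tendsto_mult_left[OF lim] f])
    show "AE \<omega> in M. (\<lambda>q. (\<Sum>k<Suc (f q). (J3 (grid (Suc (f q)) k) \<omega> + J3 (grid (Suc (f q)) (Suc k)) \<omega>) / 2 * inc (Suc (f q)) i4 k \<omega>) - partial_sum p \<omega>)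
        \<longlonglongrightarrow> I \<omega> - partial_sum p \<omega>"
      using ae by eventually_elim (intro tendsto_diff tendsto_const, simp)
    show "(\<lambda>\<omega>. I \<omega> - partial_sum p \<omega>) \<in> borel_measurable M"
      using I_lim partial_sum_measurable[of p] by (auto simp: ms_lim_def)
  qed
qed

text \<open>For the Fourier coefficients of the simplex kernel the error kernel is its
  \<open>remainder\<close>, so the probabilistic bound meets the deterministic limit
  \<open>trace_norm_remainder_tendsto\<close>.\<close>

lemma ms_lim_expansion:
  assumes C: "\<And>j1 j2 j3 j4. C j1 j2 j3 j4 = w4 (\<psi> j1) (\<psi> j2) (\<psi> j3) (\<psi> j4) T"
    and onb: "onb_const t T \<psi>"
  shows "ms_lim M partial_sum I"
  unfolding ms_lim_def
proof (intro conjI allI)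
  interpret B: onb_const t T \<psi> by (rule onb)
  have sum_kernel: "simplex_kernel a b c d - sum_kernel p a b c d = B.remainder simplex_kernel p a b c d" for p a b c d
    unfolding B.remainder_def sum_kernel_def C B.K_eq_w4 ..
  define e where "e p = c0 * trace_norm (B.remainder simplex_kernel p)" for p
  have e: "e \<longlonglongrightarrow> c0 * 0"
    unfolding e_def[abs_def] by (intro tendsto_mult tendsto_const B.trace_norm_remainder_tendsto)
  have b: "ms_le (\<lambda>\<omega>. I \<omega> - partial_sum p \<omega>) (e p)" for p
    using second_moment_bound[of p] unfolding sum_kernel e_def .
  show "I \<in> borel_measurable M" using I_lim by (simp add: ms_lim_def)
  then have m: "(\<lambda>\<omega>. (partial_sum p \<omega> - I \<omega>)\<^sup>2) \<in> borel_measurable M" for p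
    using partial_sum_measurable[of p] by measurable
  have n: "(\<integral>\<^sup>+\<omega>. ennreal ((partial_sum p \<omega> - I \<omega>)\<^sup>2) \<partial>M) \<le> ennreal (e p)" for p
    using b[of p] by (simp add: ms_le_def power2_commute)
  show int: "integrable M (\<lambda>\<omega>. (partial_sum p \<omega> - I \<omega>)\<^sup>2)" for p
    using n[of p] by (intro integrableI_nonneg m) (auto simp: top.not_eq_extremum intro: order.strict_trans1)
  \<comment> \<open>\<open>ennreal\<close> truncates negative numbers to 0, hence the
    maximum.\<close>
  have le: "(LINT \<omega>|M. (partial_sum p \<omega> - I \<omega>)\<^sup>2) \<le> max 0 (e p)" for p
  proof -
    have "ennreal (LINT \<omega>|M. (partial_sum p \<omega> - I \<omega>)\<^sup>2) \<le> ennreal (e p)"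
      using n[of p] by (subst nn_integral_eq_integral[symmetric]) (auto intro: int)
    then show ?thesis by (cases "0 \<le> e p") (auto simp: ennreal_le_iff ennreal_neg max_def)
  qed
  show "(\<lambda>p. LINT \<omega>|M. (partial_sum p \<omega> - I \<omega>)\<^sup>2) \<longlonglongrightarrow> 0"
  proof (rule tendsto_sandwich[OF _ _ tendsto_const])
    show "(\<lambda>p. max 0 (e p)) \<longlonglongrightarrow> 0" using tendsto_max[OF tendsto_const e, of 0] by simp
  qed (use le in \<open>auto intro!: always_eventually\<close>)
qed

end

theorem theorem4:
  fixes M :: "'a measure" and F :: "real \<Rightarrow> 'a measure" and m :: nat
    and W :: "nat \<Rightarrow> real \<Rightarrow> 'a \<Rightarrow> real"
    and t T :: real and \<phi> :: "nat \<Rightarrow> real \<Rightarrow> real"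
    and i1 i2 i3 i4 :: nat
    and \<zeta> :: "nat \<Rightarrow> nat \<Rightarrow> 'a \<Rightarrow> real"
    and J1 J2 J3 :: "real \<Rightarrow> 'a \<Rightarrow> real" and I :: "'a \<Rightarrow> real"
  assumes wiener: "std_wiener M F m W"
    and tT: "0 \<le> t" "t < T"
    and basis: "\<phi> = legendre_sys t T \<or> \<phi> = trig_sys t T"
    and idx: "i1 \<le> m" "i2 \<le> m" "i3 \<le> m" "i4 \<le> m"
    and zeta: "\<And>i j. i \<le> m \<Longrightarrow> ito_int M (\<lambda>s \<omega>. \<phi> j s) (wproc W i) t T (\<zeta> i j)"
    and J1: "\<And>s. s \<in> {t..T} \<Longrightarrow> strat_int M (\<lambda>_ _. 1) (wproc W i1) t s (J1 s)"
    and J2: "\<And>s. s \<in> {t..T} \<Longrightarrow> strat_int M J1 (wproc W i2) t s (J2 s)"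
    and J3: "\<And>s. s \<in> {t..T} \<Longrightarrow> strat_int M J2 (wproc W i3) t s (J3 s)"
    and I: "strat_int M J3 (wproc W i4) t T I"
  shows "ms_lim M
     (\<lambda>p \<omega>. \<Sum>j1\<le>p. \<Sum>j2\<le>p. \<Sum>j3\<le>p. \<Sum>j4\<le>p.
        coefC \<phi> t T j4 j3 j2 j1 * \<zeta> i1 j1 \<omega> * \<zeta> i2 j2 \<omega> * \<zeta> i3 j3 \<omega> * \<zeta> i4 j4 \<omega>) I"
proof -
  interpret interval t T by unfold_locales (rule tT)
  interpret prob_space M using wiener unfolding std_wiener_def by blast
  have c: "continuous_on A (\<phi> j)" for A j
    using basis by (auto simp: continuous_legendre_sys continuous_trig_sys)
  have onb: "onb_const t T (\<lambda>j. restr (\<phi> j))"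
    using basis onb_const_legendre onb_const_trig by auto
  \<comment> \<open>\<open>coefC\<close> lists indices from the outermost integral inwards, the
    array \<open>C\<close> from the innermost outwards.\<close>
  interpret strat_expansion t T M F m W i1 i2 i3 i4 \<phi> "\<lambda>j. restr (\<phi> j)" \<zeta> J1 J2 J3 I "\<lambda>j1 j2 j3 j4. coefC \<phi> t T j4 j3 j2 j1"
    by unfold_locales (use wiener tT idx zeta J1 J2 J3 I c in \<open>simp_all add: bm_restr restr_eq\<close>)
  show ?thesis
    using ms_lim_expansion[OF coefC_eq_w4[OF c] onb] unfolding partial_sum_def[abs_def] quad_sum_def .
qed

end
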